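(* Suppose that $\psi_1$ is a positive and strictly increasing solution of the integro-differential equation $$g(x)\varphi'(x)-(\lambda+\delta)\varphi(x)+\lambda\int_0^x\varphi(x-y)\,\alpha e^{-\alpha y}\,\mathrm{d}y=0,\qquad x>0,$$ that $\psi_1'(x)$ achieves its minimum value at $b>0$, and that $\psi_1'(x)$ is nondecreasing on $(b,\infty)$. Then: (a) A solution to the quasi-variational inequality $$\max\{(\mathcal A-\delta)\varphi(x),\,1-\varphi'(x)\}=0,\qquad x>0,$$ is given by $$\Phi(x)=\begin{cases}\dfrac{\psi_1(x)}{\psi_1'(b)}, & \text{if } 0\le x\le b,\\[2ex] x-b+\dfrac{\psi_1(b)}{\psi_1'(b)}, & \text{if } x>b,\end{cases}$$ (with $\Phi(x)=0$ for $x<0$). (b) The barrier strategy $D^*$ with $D^*(0-)=0$, with continuous part given by $\mathrm{d}D^*(t)=g(b)I_{\{X^*(t)=b\}}\,\mathrm{d}t$ and singular part given by $\Delta D^*(t)=X^*(t-)-b$ if $X^*(t-)>b$, where $X^*$ is the corresponding controlled surplus process with $X^*(0-)=x$, is an optimal control that corresponds to $\Phi$; that is, $V(x)=\Phi(x)=J(x,D^* )$ for all $x\ge0$.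
   Context: Model. Let $(\Omega,\mathcal F,\{\mathcal F_t\}_{t\ge0},\mathrm P)$ be a filtered probability space satisfying the usual conditions. $N=\{N(t),t\ge0\}$ is a Poisson process with rate $\lambda>0$, and $Y_1,Y_2,\dots$ are i.i.d. random variables, independent of $N$, with exponential distribution function $Q(y)=1-e^{-\alpha y}$, $y\ge0$, for some $\alpha>0$; $\sum_{i=1}^{N(t)}Y_i$ is a compound Poisson process relative to $\{\mathcal F_t\}$. The function $g$ (on $[0,\infty)$) takes values in $(0,\infty)$, is Lipschitz continuous and satisfies the linear growth condition. $\delta>0$ is a constant. Unrestricted dividend schemes. An admissible control is a càdlàg, nondecreasing, $\mathcal F_t$-adapted process $D=\{D(t),t\ge0\}$ with $D(0-)=0$ and $\Delta D(t):=D(t)-D(t-)\le X^D(t-)$ for all $t$ up to ruin; $\Pi$ is the set of all admissible controls. Here, for initial surplus $X^D(0-)=x\ge0$, the controlled surplus (considered up to ruin) is $$X^D(t)=x+\int_0^t g(X^D(s))\,\mathrm{d}s-\sum_{i=1}^{N(t)}Y_i-D(t),$$ the ruin time is $\tau=\inf\{t\ge0:X^D(t)<0\}$, and $$J(x,D)=\mathrm E_x\int_0^\tau e^{-\delta t}\,\mathrm{d}D(t),\qquad V(x)=\sup_{D\in\Pi}J(x,D),$$ where the integral is taken over $[0,\tau)$ (dividends up to ruin, including a lump payment $D(0)$ at time $0$). Standing assumption: $V(x)<\infty$ for all $x\ge0$. The generator is $\mathcal A\varphi(x)=g(x)\varphi'(x)-\lambda\varphi(x)+\lambda\int_0^\infty\varphi(x-y)\,\mathrm{d}Q(y)$,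 $x\ge0$, for functions $\varphi$ on $\mathbb R$ with $\varphi(y)=0$ for $y<0$. Solutions of the integro-differential equation are real-valued continuously differentiable functions on $[0,\infty)$ satisfying the equation for $x>0$. $I_A$ denotes the indicator of $A$. *)

theory Defs
  imports "HOL-Probability.Probability"
begin

section \<open>The surplus model\<close>

text \<open>
  All processes are indexed by the reals; values at negative times encode the
  state just before time 0, so that the left limit of a path at 0 is its value at
  \<open>0-\<close>, and a jump at time 0 is an ordinary jump.
\<close>

definition cadlag :: "(real \<Rightarrow> real) \<Rightarrow> bool" where
  "cadlag f \<longleftrightarrow> (\<forall>t. continuous (at_right t) f \<and> (\<exists>l. (f \<longlongrightarrow> l) (at_left t)))"

definition left_limit :: "(real \<Rightarrow> real) \<Rightarrow> real \<Rightarrow> real" where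
  "left_limit f t = Lim (at_left t) f"

definition jump :: "(real \<Rightarrow> real) \<Rightarrow> real \<Rightarrow> real" where
  "jump f t = f t - left_limit f t"

text \<open>\<open>Y i\<close> is the size of the claim number \<open>i + 1\<close>.\<close>

definition claims :: "(real \<Rightarrow> 'a \<Rightarrow> nat) \<Rightarrow> (nat \<Rightarrow> 'a \<Rightarrow> real) \<Rightarrow> real \<Rightarrow> 'a \<Rightarrow> real" where
  "claims N Y t \<omega> = (\<Sum>i<N t \<omega>. Y i \<omega>)"

text \<open>
  The filtration is used for times \<open>t \<ge> 0\<close> only.
  Completeness of \<open>M\<close>, \<open>F_null\<close> and \<open>F_right_cont\<close> are the usual
  conditions. The assumption
  \<open>claims_indep\<close> together with \<open>claims_adapted\<close> says that the
  aggregate claims form a compound Poisson process relative to the filtration.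
\<close>

locale dividend_model = prob_space M + complete_measure M + filtration "space M" F
  for M :: "'a measure" and F :: "real \<Rightarrow> 'a measure" +
  fixes N :: "real \<Rightarrow> 'a \<Rightarrow> nat" and Y :: "nat \<Rightarrow> 'a \<Rightarrow> real"
    and g :: "real \<Rightarrow> real" and lam alpha :: real
  assumes F_subalgebra: "\<And>t. t \<ge> 0 \<Longrightarrow> subalgebra M (F t)"
    and F_null: "null_sets M \<subseteq> sets (F 0)"
    and F_right_cont: "\<And>t. t \<ge> 0 \<Longrightarrow> sets (F t) = (\<Inter>s\<in>{t<..}. sets (F s))"
    and lam_pos: "lam > 0"
    and alpha_pos: "alpha > 0"
    \<comment> \<open>\<open>N\<close> is a Poisson process with rate \<open>lam\<close>\<close>
    and N_measurable: "\<And>t. t \<ge> 0 \<Longrightarrow> N t \<in> measurable M (count_space UNIV)"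
    and N_paths: "AE \<omega> in M. N 0 \<omega> = 0 \<and> mono_on {0..} (\<lambda>t. N t \<omega>) \<and>
                    (\<forall>t\<ge>0. continuous (at_right t) (\<lambda>t. real (N t \<omega>)))"
    and N_indep_increments: "\<And>t :: nat \<Rightarrow> real. 0 \<le> t 0 \<Longrightarrow> mono t \<Longrightarrow>
          indep_vars (\<lambda>_. borel) (\<lambda>i \<omega>. real (N (t (Suc i)) \<omega>) - real (N (t i) \<omega>)) UNIV"
    and N_increments: "\<And>s t. 0 \<le> s \<Longrightarrow> s < t \<Longrightarrow>
          distr M borel (\<lambda>\<omega>. real (N t \<omega>) - real (N s \<omega>)) =
          distr (measure_pmf (poisson_pmf (lam * (t - s)))) borel real"
    \<comment> \<open>i.i.d. exponential claim sizes, independent of \<open>N\<close>\<close>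
    and Y_indep: "indep_vars (\<lambda>_. borel) Y UNIV"
    and Y_exponential: "\<And>i. distributed M lborel (Y i) (exponential_density alpha)"
    and Y_N_indep: "indep_var (PiM UNIV (\<lambda>_. borel)) (\<lambda>\<omega> i. Y i \<omega>)
                      (PiM {0..} (\<lambda>_. count_space UNIV)) (\<lambda>\<omega>. \<lambda>t\<in>{0..}. N t \<omega>)"
    and claims_adapted: "\<And>t. t \<ge> 0 \<Longrightarrow> claims N Y t \<in> borel_measurable (F t)"
    and claims_indep: "\<And>s t. 0 \<le> s \<Longrightarrow> s \<le> t \<Longrightarrow>
          indep_set (sets (F s))
            {(\<lambda>\<omega>. claims N Y t \<omega> - claims N Y s \<omega>) -` A \<inter> space M | A. A \<in> sets borel}"
    \<comment> \<open>premium rate, a function on the half-line\<close>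
    and g_pos: "\<And>x. x \<ge> 0 \<Longrightarrow> g x > 0"
    and g_lipschitz: "\<exists>L. L-lipschitz_on {0..} g"
    and g_linear_growth: "\<exists>K. \<forall>x\<ge>0. \<bar>g x\<bar> \<le> K * (1 + x)"

section \<open>Controlled surplus, ruin and dividends\<close>

text \<open>
  The surplus path for initial surplus \<open>x\<close>, claim path \<open>c\<close> and
  dividend path \<open>d\<close>. Since \<open>g\<close> is only given on the half-line, it
  is continued by the constant \<open>g 0\<close>, so that the path exists for all times
  and is unique. The choice of the continuation affects neither the ruin time nor
  the path before ruin.
\<close>

definition is_surplus_path ::
  "(real \<Rightarrow> real) \<Rightarrow> real \<Rightarrow> (real \<Rightarrow> real) \<Rightarrow> (real \<Rightarrow> real) \<Rightarrow> (real \<Rightarrow> real) \<Rightarrow> bool" where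
  "is_surplus_path g x c d X \<longleftrightarrow>
     (\<forall>t<0. X t = x) \<and>
     (\<forall>t\<ge>0. set_integrable lborel {0..t} (\<lambda>s. g (max 0 (X s))) \<and>
             X t = x + (LBINT s:{0..t}. g (max 0 (X s))) - c t - d t)"

definition surplus_path ::
  "(real \<Rightarrow> real) \<Rightarrow> real \<Rightarrow> (real \<Rightarrow> real) \<Rightarrow> (real \<Rightarrow> real) \<Rightarrow> real \<Rightarrow> real" where
  "surplus_path g x c d = (THE X. is_surplus_path g x c d X)"

definition surplus ::
  "(real \<Rightarrow> real) \<Rightarrow> (real \<Rightarrow> 'a \<Rightarrow> nat) \<Rightarrow> (nat \<Rightarrow> 'a \<Rightarrow> real) \<Rightarrow> real \<Rightarrow>
     (real \<Rightarrow> 'a \<Rightarrow> real) \<Rightarrow> 'a \<Rightarrow> real \<Rightarrow> real" where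
  "surplus g N Y x D \<omega> = surplus_path g x (\<lambda>t. claims N Y t \<omega>) (\<lambda>t. D t \<omega>)"

definition ruin_time :: "(real \<Rightarrow> real) \<Rightarrow> ereal" where
  "ruin_time X = Inf (ereal ` {t. t \<ge> 0 \<and> X t < 0})"

definition control_path :: "(real \<Rightarrow> real) \<Rightarrow> bool" where
  "control_path d \<longleftrightarrow> (\<forall>t<0. d t = 0) \<and> cadlag d \<and> mono d"

text \<open>Path properties of processes are understood almost surely.\<close>

definition admissible ::
  "'a measure \<Rightarrow> (real \<Rightarrow> 'a measure) \<Rightarrow> (real \<Rightarrow> 'a \<Rightarrow> nat) \<Rightarrow> (nat \<Rightarrow> 'a \<Rightarrow> real) \<Rightarrow>
     (real \<Rightarrow> real) \<Rightarrow> real \<Rightarrow> (real \<Rightarrow> 'a \<Rightarrow> real) set" where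
  "admissible M F N Y g x = {D.
     (\<forall>t\<ge>0. D t \<in> borel_measurable (F t)) \<and>
     (AE \<omega> in M. control_path (\<lambda>t. D t \<omega>) \<and>
        (\<forall>t\<ge>0. ereal t \<le> ruin_time (surplus g N Y x D \<omega>) \<longrightarrow>
           jump (\<lambda>t. D t \<omega>) t \<le> left_limit (surplus g N Y x D \<omega>) t))}"

text \<open>
  The inner integral is the Lebesgue--Stieltjes integral over \<open>[0, \<tau>)\<close>. As
  \<open>D\<close> vanishes at negative times, it includes the payment \<open>D 0\<close> at time 0.
\<close>

definition dividend_value ::
  "'a measure \<Rightarrow> (real \<Rightarrow> 'a \<Rightarrow> nat) \<Rightarrow> (nat \<Rightarrow> 'a \<Rightarrow> real) \<Rightarrow> (real \<Rightarrow> real) \<Rightarrow> real \<Rightarrow>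
     real \<Rightarrow> (real \<Rightarrow> 'a \<Rightarrow> real) \<Rightarrow> ennreal" where
  "dividend_value M N Y g delta x D =
     (\<integral>\<^sup>+\<omega>. (\<integral>\<^sup>+t\<in>{t. t \<ge> 0 \<and> ereal t < ruin_time (surplus g N Y x D \<omega>)}.
                ennreal (exp (- delta * t)) \<partial>interval_measure (\<lambda>t. D t \<omega>)) \<partial>M)"

definition optimal_value ::
  "'a measure \<Rightarrow> (real \<Rightarrow> 'a measure) \<Rightarrow> (real \<Rightarrow> 'a \<Rightarrow> nat) \<Rightarrow> (nat \<Rightarrow> 'a \<Rightarrow> real) \<Rightarrow>
     (real \<Rightarrow> real) \<Rightarrow> real \<Rightarrow> real \<Rightarrow> ennreal" where
  "optimal_value M F N Y g delta x =
     (SUP D\<in>admissible M F N Y g x. dividend_value M N Y g delta x D)"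

text \<open>
  The barrier strategy is specified by its feedback equations: the jumps of \<open>D\<close>
  are prescribed, and \<open>D\<close> minus the sum of its jumps has the prescribed rate.
\<close>

definition is_barrier_strategy ::
  "'a measure \<Rightarrow> (real \<Rightarrow> 'a \<Rightarrow> nat) \<Rightarrow> (nat \<Rightarrow> 'a \<Rightarrow> real) \<Rightarrow> (real \<Rightarrow> real) \<Rightarrow> real \<Rightarrow>
     real \<Rightarrow> (real \<Rightarrow> 'a \<Rightarrow> real) \<Rightarrow> bool" where
  "is_barrier_strategy M N Y g b x D \<longleftrightarrow>
     (AE \<omega> in M. let X = surplus g N Y x D \<omega>; d = (\<lambda>t. D t \<omega>) in
        control_path d \<and>
        (\<forall>t\<ge>0. jump d t = (if left_limit X t > b then left_limit X t - b else 0)) \<and>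
        (\<forall>t\<ge>0. (jump d has_sum (d t - (LBINT s:{0..t}. g b * indicator {s. X s = b} s))) {0..t}))"

section \<open>Integro-differential equation and quasi-variational inequality\<close>

definition C1_halfline :: "(real \<Rightarrow> real) \<Rightarrow> bool" where
  "C1_halfline \<phi> \<longleftrightarrow> (\<exists>\<phi>'. continuous_on {0..} \<phi>' \<and>
     (\<forall>x\<ge>0. (\<phi> has_real_derivative \<phi>' x) (at x within {0..})))"

text \<open>The derivative on the half-line, one-sided at 0.\<close>

definition hderiv :: "(real \<Rightarrow> real) \<Rightarrow> real \<Rightarrow> real" where
  "hderiv \<phi> x = vector_derivative \<phi> (at x within {0..})"

definition ide_solution ::
  "(real \<Rightarrow> real) \<Rightarrow> real \<Rightarrow> real \<Rightarrow> real \<Rightarrow> (real \<Rightarrow> real) \<Rightarrow> bool" where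
  "ide_solution g lam alpha delta \<phi> \<longleftrightarrow> C1_halfline \<phi> \<and>
     (\<forall>x>0. g x * hderiv \<phi> x - (lam + delta) * \<phi> x
        + lam * (LBINT y:{0..x}. \<phi> (x - y) * (alpha * exp (- alpha * y))) = 0)"

definition generator ::
  "(real \<Rightarrow> real) \<Rightarrow> real \<Rightarrow> real \<Rightarrow> (real \<Rightarrow> real) \<Rightarrow> real \<Rightarrow> real" where
  "generator g lam alpha \<phi> x = g x * hderiv \<phi> x - lam * \<phi> x
     + lam * (\<integral>y. \<phi> (x - y) \<partial>density lborel (exponential_density alpha))"

definition qvi_solution ::
  "(real \<Rightarrow> real) \<Rightarrow> real \<Rightarrow> real \<Rightarrow> real \<Rightarrow> (real \<Rightarrow> real) \<Rightarrow> bool" where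
  "qvi_solution g lam alpha delta \<phi> \<longleftrightarrow> C1_halfline \<phi> \<and> (\<forall>y<0. \<phi> y = 0) \<and>
     (\<forall>x>0. max (generator g lam alpha \<phi> x - delta * \<phi> x) (1 - hderiv \<phi> x) = 0)"

definition barrier_function :: "(real \<Rightarrow> real) \<Rightarrow> real \<Rightarrow> real \<Rightarrow> real" where
  "barrier_function \<psi> b x =
     (if x < 0 then 0
      else if x \<le> b then \<psi> x / hderiv \<psi> b
      else x - b + \<psi> b / hderiv \<psi> b)"

end

theory Submission
  imports Defs
begin

text \<open>
  The variational inequality makes \<open>exp (- delta * t) * \<Phi> (X t)\<close> plus the dividends
  discounted up to time \<open>t\<close> a supermartingale for every admissible control, and a
  martingale for the barrier strategy. Stochastic calculus is avoided by working on a grid of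
  mesh \<open>1 / n\<close>: over one cell the surplus is compared with one Euler step driven by the
  increments of claims and dividends, and since the increment of the claims is independent of
  the past, the expectation of \<open>\<Phi>\<close> after such a step can be expanded to first order in the
  mesh, with the generator as coefficient. The errors add up to a quantity that vanishes as
  \<open>n\<close> grows, because the local errors are controlled by the total increments of claims and
  dividends. Fatou's lemma, first in \<open>n\<close> and then in the time horizon, gives the upper
  bound for every control, and its reverse form the lower bound for a barrier strategy.
  A barrier strategy exists because flows stopped at \<open>b\<close> can be pasted together from
  one claim to the next.
\<close>

section \<open>Integral equations with a Lipschitz rate\<close>

text \<open>Two obstacles shape the proof. The law of a short increment of the aggregate claims is
  not given: claim sizes are known to be independent of the counts at integer times only, and the
  link with the past is \<open>claims_indep\<close>. What must be recovered is that the size of the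
  first claim after an integer time says nothing about when it occurs. The defect is a Lipschitz
  function on a unit interval; its increments, weighted by the Poisson probabilities of further
  claims before the interval ends, sum to O(1/n) because they assemble an event about integer times,
  and a moment argument shows that the function is zero. The second obstacle is that \<Phi> jumps at
  0 and is only once continuously differentiable beyond. Uniform continuity gives errors o(h) per
  step; the jump matters only when a claim brings the surplus within O(h) of 0, which has
  probability O(h^2) because the exponential density is bounded. Finally, a barrier strategy is
  given by feedback equations alone, so its adaptedness has to be derived: its surplus is the limit
  of Euler schemes capped at \<open>b\<close> and driven by the claims.\<close>

lemma gronwall_integral:
  fixes u :: "real \<Rightarrow> real"
  assumes cont: "continuous_on {0..T} u" and L: "0 \<le> L"
    and le: "\<And>t. t \<in> {0..T} \<Longrightarrow> u t \<le> a + L * integral {0..t} u"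
    and t: "t \<in> {0..T}"
  shows "u t \<le> a * exp (L * t)"
proof -
  define B where "B t = a + L * integral {0..t} u" for t
  \<comment> \<open>Up to sign this is the product with the integrating factor; its derivative is
    nonnegative exactly because of \<open>le\<close>.\<close>
  define v where "v t = - (B t * exp (- L * t))" for t
  have dB: "(B has_real_derivative L * u s) (at s within {0..T})" if "s \<in> {0..T}" for s
    unfolding B_def using integral_has_real_derivative[OF cont that]
    by (auto intro!: derivative_eq_intros)
  have dv: "(v has_real_derivative L * (B s - u s) * exp (- L * s)) (at s within {0..T})"
    if "s \<in> {0..T}" for s
    unfolding v_def by (auto intro!: derivative_eq_intros dB[OF that] simp: algebra_simps)
  have cv: "continuous_on {0..T} v"
    by (rule DERIV_continuous_on[OF dv])
  have "v 0 \<le> v t"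
  proof (rule DERIV_nonneg_imp_increasing_open[where f=v])
    show "0 \<le> t" using t by auto
    show "continuous_on {0..t} v" by (rule continuous_on_subset[OF cv]) (use t in auto)
    fix s assume s: "0 < s" "s < t"
    then have "at s within {0..T} = at s" using t by (intro at_within_Icc_at) auto
    moreover have "0 \<le> L * (B s - u s) * exp (- L * s)"
      using le[of s] L s t by (auto simp: B_def)
    ultimately show "\<exists>y. (v has_real_derivative y) (at s) \<and> 0 \<le> y"
      using dv[of s] s t by auto
  qed
  then have "B t * exp (- (L * t)) \<le> a" by (simp add: v_def B_def)
  then have "B t \<le> a * exp (L * t)" by (simp add: exp_minus field_simps)
  then show ?thesis using le[OF t] by (simp add: B_def)
qed

lemma bounded_measurable_set_integrable:
  fixes f :: "real \<Rightarrow> real"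
  assumes "f \<in> borel_measurable borel" "\<And>s. s \<in> {a..b} \<Longrightarrow> \<bar>f s\<bar> \<le> B"
  shows "set_integrable lborel {a..b} f"
  unfolding set_integrable_def
  by (rule integrableI_bounded_set_indicator[where B=B]) (use assms in \<open>auto simp: emeasure_lborel_Icc_eq\<close>)

lemma bounded_measurable_integrable_on:
  fixes f :: "real \<Rightarrow> real"
  assumes "f \<in> borel_measurable borel" "\<And>s. s \<in> {a..b} \<Longrightarrow> \<bar>f s\<bar> \<le> B"
  shows "f integrable_on {a..b}"
  using set_borel_integral_eq_integral(1)[OF bounded_measurable_set_integrable[OF assms]] .

lemma integral_diff_interval:
  fixes f :: "real \<Rightarrow> real"
  assumes "f integrable_on {0..t}" "0 \<le> s" "s \<le> t"
  shows "integral {s..t} f = integral {0..t} f - integral {0..s} f"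
  using Henstock_Kurzweil_Integration.integral_combine[OF assms(2,3,1)] by simp

lemma integrable_on_interval_mono:
  fixes f :: "real \<Rightarrow> real"
  assumes "f integrable_on {0..t}" "0 \<le> s" "u \<le> t"
  shows "f integrable_on {s..u}"
  by (rule integrable_on_subinterval[OF assms(1)]) (use assms in auto)

text \<open>\<open>f\<close> is the driving path, in general discontinuous: initial surplus minus
  claims minus dividends, or a constant between two claims. Only the integral part of
  \<open>X\<close> is continuous.\<close>

definition flow_equation :: "(real \<Rightarrow> real) \<Rightarrow> (real \<Rightarrow> real) \<Rightarrow> (real \<Rightarrow> real) \<Rightarrow> bool" where
  "flow_equation G f X \<longleftrightarrow>
     (\<forall>t\<ge>0. (\<lambda>s. G (X s)) integrable_on {0..t} \<and> X t = f t + integral {0..t} (\<lambda>s. G (X s)))"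

lemma flow_equationD:
  assumes "flow_equation G f X" "0 \<le> t"
  shows "(\<lambda>s. G (X s)) integrable_on {0..t}" "X t = f t + integral {0..t} (\<lambda>s. G (X s))"
  using assms by (auto simp: flow_equation_def)

locale lipschitz_rate =
  fixes G :: "real \<Rightarrow> real" and L :: real
  assumes L_pos: "0 < L" and lipschitz: "\<And>u v. \<bar>G u - G v\<bar> \<le> L * \<bar>u - v\<bar>"
begin

lemma continuous_rate: "continuous_on S G"
proof -
  have "L-lipschitz_on UNIV G"
    using L_pos lipschitz by (auto simp: lipschitz_on_def dist_real_def)
  then show ?thesis by (metis lipschitz_on_continuous_on continuous_on_subset subset_UNIV)
qed

lemma measurable_rate [measurable]: "G \<in> borel_measurable borel"
  by (rule borel_measurable_continuous_onI[OF continuous_rate])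

text \<open>The solutions may jump, but their difference is a difference of integrals. Hence
  \<open>u\<close> is continuous, equals the distance of the solutions, and satisfies Gronwall's
  hypothesis with constant term 0.\<close>

lemma flow_unique_until:
  fixes X X' f :: "real \<Rightarrow> real"
  assumes X: "\<And>t. t \<in> {0..T} \<Longrightarrow> (\<lambda>s. G (X s)) integrable_on {0..t} \<and> X t = f t + integral {0..t} (\<lambda>s. G (X s))"
    and X': "\<And>t. t \<in> {0..T} \<Longrightarrow> (\<lambda>s. G (X' s)) integrable_on {0..t} \<and> X' t = f t + integral {0..t} (\<lambda>s. G (X' s))"
    and t: "t \<in> {0..T}"
  shows "X t = X' t"
proof -
  have T: "0 \<le> T" using t by auto
  define u where "u t = \<bar>integral {0..t} (\<lambda>s. G (X s)) - integral {0..t} (\<lambda>s. G (X' s))\<bar>" for t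
  have XX': "u s = \<bar>X s - X' s\<bar>" if "s \<in> {0..T}" for s
    using X[OF that] X'[OF that] by (simp add: u_def)
  have cont: "continuous_on {0..T} u"
    unfolding u_def using X[of T] X'[of T] T
    by (intro continuous_intros indefinite_integral_continuous_1) auto
  have "u s \<le> 0 + L * integral {0..s} u" if s: "s \<in> {0..T}" for s
  proof -
    have iu: "u integrable_on {0..s}"
      by (rule integrable_continuous_real, rule continuous_on_subset[OF cont]) (use s in auto)
    have "integral {0..s} (\<lambda>r. G (X r)) - integral {0..s} (\<lambda>r. G (X' r))
      = integral {0..s} (\<lambda>r. G (X r) - G (X' r))"
      using X[OF s] X'[OF s] by (simp add: Henstock_Kurzweil_Integration.integral_diff)
    also have "norm \<dots> \<le> integral {0..s} (\<lambda>r. L * u r)"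
    proof (rule integral_norm_bound_integral)
      show "(\<lambda>r. G (X r) - G (X' r)) integrable_on {0..s}"
        using X[OF s] X'[OF s] by (auto intro: integrable_diff)
      show "(\<lambda>r. L * u r) integrable_on {0..s}" by (rule integrable_on_mult_right[OF iu])
      show "norm (G (X r) - G (X' r)) \<le> L * u r" if "r \<in> {0..s}" for r
        using lipschitz[of "X r" "X' r"] XX'[of r] that s by auto
    qed
    finally show ?thesis by (simp add: u_def[abs_def])
  qed
  from gronwall_integral[OF cont _ this t] L_pos have "u t \<le> 0" by auto
  then show ?thesis using XX'[OF t] by auto
qed

lemma flow_unique:
  assumes "flow_equation G f X" "flow_equation G f X'" "0 \<le> t"
  shows "X t = X' t"
  by (rule flow_unique_until[where T=t and f=f]) (use assms in \<open>auto simp: flow_equation_def\<close>)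

text \<open>Picard iteration is a contraction in the norm weighted by \<open>exp (- 2 * L * t)\<close>.\<close>

lemma flow_exists_until:
  fixes f :: "real \<Rightarrow> real"
  assumes f [measurable]: "f \<in> borel_measurable borel" and bdd: "\<And>s. s \<in> {0..T} \<Longrightarrow> \<bar>f s\<bar> \<le> B" and T: "0 \<le> T"
  obtains Z where "continuous_on UNIV Z"
    "\<And>t. t \<in> {0..T} \<Longrightarrow> (\<lambda>s. G (f s + Z s)) integrable_on {0..t} \<and> Z t = integral {0..t} (\<lambda>s. G (f s + Z s))"
proof -
  \<comment> \<open>Clamping time to \<open>[0, T]\<close> lets the iteration act on bounded
    continuous functions on the whole line, a complete space.\<close>
  define cl where "cl t = max 0 (min T t)" for t
  \<comment> \<open>The unknown \<open>W\<close> is the integral part of the solution divided by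
    \<open>exp (2 * L * s)\<close>, so that the supremum norm of \<open>W\<close> is the weighted
    norm of that part.\<close>
  define h where "h W s = G (f s + exp (2 * L * s) * W s)" for W :: "real \<Rightarrow> real" and s :: real
  define Op where "Op W t = exp (- (2 * L * cl t)) * integral {0..cl t} (h W)" for W :: "real \<Rightarrow> real" and t
  have cl: "cl t \<in> {0..T}" for t using T by (auto simp: cl_def)
  have ccl: "continuous_on UNIV cl" unfolding cl_def by (intro continuous_intros)
  have int_h: "h (apply_bcontfun W) integrable_on {0..T}" for W :: "real \<Rightarrow>\<^sub>C real"
  proof -
    have [measurable]: "apply_bcontfun W \<in> borel_measurable borel"
      by (rule borel_measurable_continuous_onI) simp
    have m: "h (apply_bcontfun W) \<in> borel_measurable borel" unfolding h_def by measurable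
    have "\<bar>h (apply_bcontfun W) s\<bar> \<le> \<bar>G 0\<bar> + L * (B + exp (2 * L * T) * norm W)" if s: "s \<in> {0..T}" for s
    proof -
      have "\<bar>exp (2 * L * s) * apply_bcontfun W s\<bar> \<le> exp (2 * L * T) * norm W"
        unfolding abs_mult using s L_pos norm_bounded[of W s] by (intro mult_mono) auto
      then have "\<bar>f s + exp (2 * L * s) * apply_bcontfun W s\<bar> \<le> B + exp (2 * L * T) * norm W"
        using bdd[OF s] by linarith
      then have "L * \<bar>f s + exp (2 * L * s) * apply_bcontfun W s - 0\<bar> \<le> L * (B + exp (2 * L * T) * norm W)"
        using L_pos by simp
      then show ?thesis
        using lipschitz[of "f s + exp (2 * L * s) * apply_bcontfun W s" 0] unfolding h_def by linarith
    qed
    from bounded_measurable_integrable_on[OF m this] show ?thesis .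
  qed
  have Op_cont: "continuous_on UNIV (Op (apply_bcontfun W))" for W :: "real \<Rightarrow>\<^sub>C real"
  proof -
    have "continuous_on {0..T} (\<lambda>t. integral {0..t} (h (apply_bcontfun W)))"
      by (rule indefinite_integral_continuous_1[OF int_h])
    then have "continuous_on UNIV (\<lambda>t. integral {0..cl t} (h (apply_bcontfun W)))"
      by (rule continuous_on_compose2[OF _ ccl]) (use cl in auto)
    then show ?thesis unfolding Op_def by (intro continuous_intros ccl)
  qed
  have Op_in: "Op (apply_bcontfun W) \<in> bcontfun" for W :: "real \<Rightarrow>\<^sub>C real"
  proof -
    have "compact (Op (apply_bcontfun W) ` {0..T})"
      by (rule compact_continuous_image[OF continuous_on_subset[OF Op_cont]]) simp_all
    then have "bounded (Op (apply_bcontfun W) ` {0..T})" by (rule compact_imp_bounded)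
    then obtain C where "\<forall>x\<in>Op (apply_bcontfun W) ` {0..T}. norm x \<le> C"
      unfolding bounded_iff by (rule exE)
    then have C: "norm (Op (apply_bcontfun W) t) \<le> C" if "t \<in> {0..T}" for t
      using that by (rule bspec[OF _ imageI])
    have "norm (Op (apply_bcontfun W) t) \<le> C" for t
    proof -
      have "cl (cl t) = cl t" using T by (auto simp: cl_def)
      then have "Op (apply_bcontfun W) t = Op (apply_bcontfun W) (cl t)" by (simp add: Op_def)
      then show ?thesis using C[OF cl[of t]] by simp
    qed
    then show ?thesis by (rule bcontfun_normI[OF Op_cont])
  qed
  define F where "F W = Bcontfun (Op (apply_bcontfun W))" for W :: "real \<Rightarrow>\<^sub>C real"
  have F: "apply_bcontfun (F W) = Op (apply_bcontfun W)" for W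
    unfolding F_def by (rule Bcontfun_inverse[OF Op_in])
  have "dist (F W) (F W') \<le> 1 / 2 * dist W W'" for W W'
  proof (rule dist_bound)
    fix t
    let ?D = "dist W W'" and ?\<tau> = "cl t"
    have ii: "h (apply_bcontfun W) integrable_on {0..?\<tau>}" for W :: "real \<Rightarrow>\<^sub>C real"
      by (rule integrable_on_interval_mono[OF int_h]) (use cl[of t] in auto)
    have "((\<lambda>s. exp (2 * L * s)) has_integral (exp (2 * L * ?\<tau>) / (2 * L) - exp (2 * L * 0) / (2 * L))) {0..?\<tau>}"
      by (rule fundamental_theorem_of_calculus)
         (use cl[of t] L_pos in \<open>auto intro!: derivative_eq_intros simp: has_real_derivative_iff_has_vector_derivative[symmetric]\<close>)
    then have ex: "((\<lambda>s. L * ?D * exp (2 * L * s)) has_integral (L * ?D * ((exp (2 * L * ?\<tau>) - 1) / (2 * L)))) {0..?\<tau>}"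
      using has_integral_mult_right[of _ _ _ "L * ?D"] by (simp add: diff_divide_distrib)
    have "norm (integral {0..?\<tau>} (\<lambda>s. h (apply_bcontfun W) s - h (apply_bcontfun W') s))
        \<le> integral {0..?\<tau>} (\<lambda>s. L * ?D * exp (2 * L * s))"
    proof (rule integral_norm_bound_integral)
      show "(\<lambda>s. h (apply_bcontfun W) s - h (apply_bcontfun W') s) integrable_on {0..?\<tau>}"
        by (rule integrable_diff[OF ii ii])
      show "(\<lambda>s. L * ?D * exp (2 * L * s)) integrable_on {0..?\<tau>}" using ex by blast
      fix s assume "s \<in> {0..?\<tau>}"
      have "norm (h (apply_bcontfun W) s - h (apply_bcontfun W') s)
        \<le> L * \<bar>exp (2 * L * s) * (apply_bcontfun W s - apply_bcontfun W' s)\<bar>"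
        unfolding h_def using lipschitz[of "f s + exp (2 * L * s) * apply_bcontfun W s" "f s + exp (2 * L * s) * apply_bcontfun W' s"]
        by (simp add: algebra_simps)
      also have "\<dots> \<le> L * (exp (2 * L * s) * ?D)"
        using dist_bounded[of W s W'] L_pos unfolding abs_mult dist_real_def
        by (intro mult_left_mono) auto
      finally show "norm (h (apply_bcontfun W) s - h (apply_bcontfun W') s) \<le> L * ?D * exp (2 * L * s)"
        by (simp add: algebra_simps)
    qed
    also have "\<dots> = L * ?D * ((exp (2 * L * ?\<tau>) - 1) / (2 * L))" using ex by blast
    \<comment> \<open>Integrating the weight gains \<open>1 / (2 * L)\<close> against the Lipschitz
      constant \<open>L\<close>; this is where the contraction factor 1/2 comes from.\<close>
    also have "\<dots> = ?D * (exp (2 * L * ?\<tau>) - 1) / 2" using L_pos by simp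
    also have "\<dots> \<le> ?D * exp (2 * L * ?\<tau>) / 2" by (simp add: algebra_simps)
    finally have le: "\<bar>integral {0..?\<tau>} (h (apply_bcontfun W)) - integral {0..?\<tau>} (h (apply_bcontfun W'))\<bar> \<le> ?D * exp (2 * L * ?\<tau>) / 2"
      using Henstock_Kurzweil_Integration.integral_diff[OF ii ii] by simp
    have "dist (apply_bcontfun (F W) t) (apply_bcontfun (F W') t)
       = exp (- (2 * L * ?\<tau>)) * \<bar>integral {0..?\<tau>} (h (apply_bcontfun W)) - integral {0..?\<tau>} (h (apply_bcontfun W'))\<bar>"
      unfolding F Op_def dist_real_def by (simp add: abs_mult flip: right_diff_distrib)
    also have "\<dots> \<le> exp (- (2 * L * ?\<tau>)) * (?D * exp (2 * L * ?\<tau>) / 2)"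
      by (rule mult_left_mono[OF le]) simp
    also have "\<dots> = 1 / 2 * ?D" by (simp add: exp_minus)
    finally show "dist (apply_bcontfun (F W) t) (apply_bcontfun (F W') t) \<le> 1 / 2 * ?D" .
  qed
  then obtain W where W: "F W = W" using banach_fix_type[of "1/2" F] by auto
  define Z where "Z t = exp (2 * L * t) * apply_bcontfun W t" for t
  have hW: "h (apply_bcontfun W) = (\<lambda>s. G (f s + Z s))" by (auto simp: h_def Z_def)
  show thesis
  proof
    show "continuous_on UNIV Z" unfolding Z_def by (intro continuous_intros continuous_on_apply_bcontfun)
    fix t assume t: "t \<in> {0..T}"
    then have clt: "cl t = t" by (auto simp: cl_def)
    have "apply_bcontfun W t = Op (apply_bcontfun W) t" using F[of W] W by simp
    then have "Z t = integral {0..t} (\<lambda>s. G (f s + Z s))"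
      unfolding Z_def[of t] Op_def clt hW by (simp add: exp_minus)
    then show "(\<lambda>s. G (f s + Z s)) integrable_on {0..t} \<and> Z t = integral {0..t} (\<lambda>s. G (f s + Z s))"
      using integrable_on_interval_mono[OF int_h[of W], of 0 t] t unfolding hW by auto
  qed
qed

text \<open>Solutions on \<open>[0, m]\<close> agree wherever both are defined, by uniqueness, so
  the one with \<open>m\<close> the ceiling of \<open>t\<close> may be read off at time
  \<open>t\<close>. Only countably many solutions are involved, which keeps the result
  measurable.\<close>

lemma flow_exists:
  assumes f [measurable]: "f \<in> borel_measurable borel"
    and bdd: "\<And>T. \<exists>B. \<forall>s\<in>{0..T}. \<bar>f s\<bar> \<le> B"
  obtains X where "flow_equation G f X" "X \<in> borel_measurable borel"
proof -
  have "\<exists>Z. continuous_on UNIV Z \<and> (\<forall>t\<in>{0..real m}. (\<lambda>s. G (f s + Z s)) integrable_on {0..t} \<and> Z t = integral {0..t} (\<lambda>s. G (f s + Z s)))" for m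
  proof -
    obtain B where "\<And>s. s \<in> {0..real m} \<Longrightarrow> \<bar>f s\<bar> \<le> B" using bdd[of "real m"] by blast
    from flow_exists_until[OF f this, of "real m"] show ?thesis by (metis of_nat_0_le_iff)
  qed
  then obtain Z where cZ: "\<And>m::nat. continuous_on UNIV (Z m)" and
    Z: "\<And>m t. t \<in> {0..real m} \<Longrightarrow> (\<lambda>s. G (f s + Z m s)) integrable_on {0..t} \<and> Z m t = integral {0..t} (\<lambda>s. G (f s + Z m s))"
    by metis
  have agree: "Z m t = Z k t" if "t \<in> {0..real m}" "t \<in> {0..real k}" for m k t
  proof -
    have "f t + Z m t = f t + Z k t"
      by (rule flow_unique_until[where T=t and f=f]) (use that Z[of _ m] Z[of _ k] in auto)
    then show ?thesis by simp
  qed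
  define X where "X t = f t + Z (nat \<lceil>t\<rceil>) t" for t
  have X: "X t = f t + Z m t" if "t \<in> {0..real m}" for t m
    unfolding X_def using agree[OF that, of "nat \<lceil>t\<rceil>"] that by (simp add: real_nat_ceiling_ge)
  show thesis
  proof
    show "flow_equation G f X" unfolding flow_equation_def
    proof (intro allI impI)
      fix t :: real assume t: "0 \<le> t"
      let ?m = "nat \<lceil>t\<rceil>"
      have tm: "t \<in> {0..real ?m}" using t by (simp add: real_nat_ceiling_ge)
      have eq: "G (X s) = G (f s + Z ?m s)" if "s \<in> {0..t}" for s
      proof -
        have "s \<in> {0..real ?m}" using that tm unfolding atLeastAtMost_iff by linarith
        from X[OF this] show ?thesis by simp
      qed
      have "(\<lambda>s. G (X s)) integrable_on {0..t}"
        using Z[OF tm] by (auto intro: integrable_eq[where f="\<lambda>s. G (f s + Z ?m s)"] simp: eq)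
      moreover have "integral {0..t} (\<lambda>s. G (X s)) = integral {0..t} (\<lambda>s. G (f s + Z ?m s))"
        by (rule integral_cong) (simp add: eq)
      ultimately show "(\<lambda>s. G (X s)) integrable_on {0..t} \<and> X t = f t + integral {0..t} (\<lambda>s. G (X s))"
        using Z[OF tm] X[OF tm] by simp
    qed
    have [measurable]: "Z m \<in> borel_measurable borel" for m
      by (rule borel_measurable_continuous_onI[OF cZ])
    have "(\<lambda>t. Z (nat \<lceil>t\<rceil>) t) \<in> borel_measurable borel"
      by (rule measurable_compose_countable[where f="\<lambda>m t. Z m t"]) measurable
    then show "X \<in> borel_measurable borel" unfolding X_def by measurable
  qed
qed

end

section \<open>Euler approximation of flows\<close>

text \<open>\<open>S\<close> is the one-step map and the increments of \<open>f\<close> are added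
  exactly. Two maps occur: the free step \<open>z + h * G z\<close>, and the same step capped at
  \<open>b\<close>.\<close>

primrec euler :: "(real \<Rightarrow> real) \<Rightarrow> (real \<Rightarrow> real) \<Rightarrow> real \<Rightarrow> nat \<Rightarrow> real" where
  "euler S f h 0 = f 0"
| "euler S f h (Suc i) = S (euler S f h i) + f (real (Suc i) * h) - f (real i * h)"

lemma tendsto_if_error_le_inverse:
  fixes S :: "nat \<Rightarrow> real"
  assumes "\<And>n. 0 < n \<Longrightarrow> \<bar>S n - l\<bar> \<le> C / real n"
  shows "S \<longlonglongrightarrow> l"
proof (rule metric_tendsto_imp_tendsto)
  show "(\<lambda>n. C / real n) \<longlonglongrightarrow> 0" by (rule lim_const_over_n)
  show "\<forall>\<^sub>F n in sequentially. dist (S n) l \<le> dist (C / real n) 0"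
  proof (rule eventually_sequentiallyI)
    fix n :: nat assume "1 \<le> n"
    then have "\<bar>S n - l\<bar> \<le> C / real n" using assms by simp
    then show "dist (S n) l \<le> dist (C / real n) 0" unfolding dist_real_def by linarith
  qed
qed

lemma discrete_gronwall:
  fixes e r :: "nat \<Rightarrow> real"
  assumes "e 0 \<le> 0" "0 \<le> a" "\<And>i. i < n \<Longrightarrow> e (Suc i) \<le> (1 + a) * e i + r i" "\<And>i. i < n \<Longrightarrow> 0 \<le> r i"
  shows "e n \<le> (1 + a) ^ n * (\<Sum>i<n. r i)"
  using assms(3,4)
proof (induction n)
  case 0
  then show ?case using assms(1) by simp
next
  case (Suc n)
  have "e (Suc n) \<le> (1 + a) * e n + r n" using Suc.prems by simp
  also have "\<dots> \<le> (1 + a) * ((1 + a) ^ n * (\<Sum>i<n. r i)) + r n"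
    using Suc assms(2) by (intro add_mono mult_left_mono) auto
  also have "r n \<le> (1 + a) ^ Suc n * r n"
  proof -
    have "1 \<le> (1 + a) ^ Suc n" using assms(2) by (intro one_le_power) auto
    then show ?thesis using Suc.prems(2)[of n] mult_right_mono[of 1 "(1 + a) ^ Suc n" "r n"] by simp
  qed
  finally show ?case by (simp add: algebra_simps)
qed

text \<open>Stability and consistency: \<open>r i\<close> bounds the defect of the exact path in one
  step, and the Lipschitz constant \<open>1 + a\<close> of the step map propagates what has
  accumulated.\<close>

lemma euler_error:
  assumes "\<And>u v. \<bar>S u - S v\<bar> \<le> (1 + a) * \<bar>u - v\<bar>" "0 \<le> a" "X 0 = f 0"
    and "\<And>i. i < n \<Longrightarrow> \<bar>X (real (Suc i) * h) - (S (X (real i * h)) + f (real (Suc i) * h) - f (real i * h))\<bar> \<le> r i"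
  shows "\<bar>X (real n * h) - euler S f h n\<bar> \<le> (1 + a) ^ n * (\<Sum>i<n. r i)"
proof (rule discrete_gronwall[where e="\<lambda>i. \<bar>X (real i * h) - euler S f h i\<bar>"])
  fix i assume i: "i < n"
  show "0 \<le> r i" using assms(4)[OF i] by linarith
  show "\<bar>X (real (Suc i) * h) - euler S f h (Suc i)\<bar> \<le> (1 + a) * \<bar>X (real i * h) - euler S f h i\<bar> + r i"
    using assms(4)[OF i] assms(1)[of "X (real i * h)" "euler S f h i"] by simp
qed (use assms in auto)

lemma one_plus_power_le_exp: "0 \<le> x \<Longrightarrow> (1 + x) ^ n \<le> exp (real n * x)" for x :: real
  using power_mono[of "1 + x" "exp x" n] by (simp add: exp_of_nat_mult)

text \<open>\<open>rate_neg\<close> describes the constant continuation of the premium rate below 0.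
  The growth of \<open>G\<close> is then governed by the positive part of the surplus, so that an
  upper bound for a path bounds its rate.\<close>

locale premium_rate = lipschitz_rate +
  assumes rate_pos: "\<And>z. 0 < G z" and rate_neg: "\<And>z. z \<le> 0 \<Longrightarrow> G z = G 0"
begin

lemma rate_linear: "G z \<le> G 0 + L * max 0 z"
  using rate_neg[of z] lipschitz[of z 0] by (cases "z \<le> 0") auto

text \<open>The Gronwall bound up to time \<open>T\<close> for every flow whose driving path stays
  below \<open>x\<close>. It has no companion from below: claims may push the surplus down without
  limit while the rate stays at \<open>G 0\<close>.\<close>

definition reach :: "real \<Rightarrow> real \<Rightarrow> real" where
  "reach x T = x + (G 0 + L * x) * T * exp (L * T)"

definition top_rate :: "real \<Rightarrow> real \<Rightarrow> real" where
  "top_rate x T = G 0 + L * reach x T"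

lemma reach_ge: "0 \<le> x \<Longrightarrow> 0 \<le> T \<Longrightarrow> x \<le> reach x T"
  using L_pos rate_pos[of 0] by (auto simp: reach_def)

lemma top_rate_pos: "0 \<le> x \<Longrightarrow> 0 \<le> T \<Longrightarrow> 0 < top_rate x T"
  using L_pos rate_pos[of 0] reach_ge[of x T] by (auto simp: top_rate_def intro!: add_pos_nonneg)

lemma rate_le_top_rate: "0 \<le> x \<Longrightarrow> 0 \<le> T \<Longrightarrow> z \<le> reach x T \<Longrightarrow> G z \<le> top_rate x T"
  using rate_linear[of z] reach_ge[of x T] mult_left_mono[of "max 0 z" "reach x T" L, OF _ less_imp_le[OF L_pos]]
  by (simp add: top_rate_def)

context
  fixes f X :: "real \<Rightarrow> real" and x T :: real
  assumes flow: "flow_equation G f X" and f_le: "\<And>t. 0 \<le> t \<Longrightarrow> f t \<le> x" and x: "0 \<le> x"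
begin

lemma flow_le_reach: "X t \<le> reach x T" if t: "0 \<le> t" "t \<le> T"
proof -
  have int: "(\<lambda>s. G (X s)) integrable_on {0..s}" if "0 \<le> s" for s
    using flow_equationD[OF flow that] by blast
  define u where "u t = integral {0..t} (\<lambda>s. G (X s))" for t
  have u0: "0 \<le> u s" if "0 \<le> s" for s unfolding u_def
    by (rule integral_nonneg[OF int[OF that]]) (use rate_pos in \<open>auto intro: less_imp_le\<close>)
  have cont: "continuous_on {0..T} u" unfolding u_def
    by (rule indefinite_integral_continuous_1) (use int t in auto)
  have Gx: "0 \<le> G 0 + L * x" using rate_pos[of 0] L_pos x by auto
  have "u s \<le> (G 0 + L * x) * T + L * integral {0..s} u" if s: "s \<in> {0..T}" for s
  proof -
    have iu: "u integrable_on {0..s}"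
      by (rule integrable_continuous_real, rule continuous_on_subset[OF cont]) (use s in auto)
    then have i2: "(\<lambda>r. (G 0 + L * x) + L * u r) integrable_on {0..s}"
      by (intro integrable_add integrable_on_mult_right) auto
    have "u s \<le> integral {0..s} (\<lambda>r. (G 0 + L * x) + L * u r)" unfolding u_def
    proof (rule integral_le[OF int i2[unfolded u_def]])
      show "G (X r) \<le> G 0 + L * x + L * integral {0..r} (\<lambda>s. G (X s))" if r: "r \<in> {0..s}" for r
      proof -
        have "max 0 (X r) \<le> x + u r"
          using flow_equationD(2)[OF flow, of r] f_le[of r] u0[of r] r x by (auto simp: u_def)
        then have "L * max 0 (X r) \<le> L * (x + u r)" using L_pos by simp
        then show ?thesis using rate_linear[of "X r"] unfolding u_def by (simp add: algebra_simps)
      qed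
    qed (use s in auto)
    also have "\<dots> = (G 0 + L * x) * s + L * integral {0..s} u"
      using iu s by (subst Henstock_Kurzweil_Integration.integral_add) (auto intro: integrable_on_mult_right)
    also have "\<dots> \<le> (G 0 + L * x) * T + L * integral {0..s} u"
      using s Gx by (auto intro: mult_left_mono)
    finally show ?thesis .
  qed
  from gronwall_integral[OF cont _ this, of t] have "u t \<le> (G 0 + L * x) * T * exp (L * t)"
    using t L_pos by auto
  also have "\<dots> \<le> (G 0 + L * x) * T * exp (L * T)"
    using t L_pos Gx by (intro mult_left_mono mult_nonneg_nonneg) auto
  finally show ?thesis
    using flow_equationD(2)[OF flow t(1)] f_le[OF t(1)] by (simp add: u_def reach_def)
qed

lemma flow_increment_bounds:
  assumes "0 \<le> s" "s \<le> t" "t \<le> T"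
  shows "0 \<le> integral {s..t} (\<lambda>r. G (X r))" "integral {s..t} (\<lambda>r. G (X r)) \<le> top_rate x T * (t - s)"
    "X t = X s + integral {s..t} (\<lambda>r. G (X r)) - (f s - f t)"
proof -
  have int0: "(\<lambda>s. G (X s)) integrable_on {0..t}"
    using flow_equationD(1)[OF flow] assms by auto
  have int: "(\<lambda>s. G (X s)) integrable_on {s..t}"
    by (rule integrable_on_interval_mono[OF int0]) (use assms in auto)
  show "0 \<le> integral {s..t} (\<lambda>r. G (X r))"
    by (rule integral_nonneg[OF int]) (use rate_pos in \<open>auto intro: less_imp_le\<close>)
  have "integral {s..t} (\<lambda>r. G (X r)) \<le> integral {s..t} (\<lambda>r. top_rate x T)"
    by (rule integral_le[OF int]) (use flow_le_reach rate_le_top_rate x assms in auto)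
  then show "integral {s..t} (\<lambda>r. G (X r)) \<le> top_rate x T * (t - s)"
    using assms by (simp add: mult.commute)
  show "X t = X s + integral {s..t} (\<lambda>r. G (X r)) - (f s - f t)"
    using flow_equationD(2)[OF flow, of s] flow_equationD(2)[OF flow, of t] assms
      integral_diff_interval[OF int0 assms(1,2)] by simp
qed

text \<open>Inside the interval the path moves by at most the premium collected plus the drop of
  \<open>f\<close>; the Lipschitz constant turns this into a bound for the variation of the
  rate.\<close>

lemma flow_local_error:
  assumes anti: "antimono_on {0..} f" and "0 \<le> s" "s \<le> t" "t \<le> T"
  shows "\<bar>integral {s..t} (\<lambda>r. G (X r)) - (t - s) * G (X s)\<bar> \<le> (t - s) * (L * (top_rate x T * (t - s) + (f s - f t)))"
proof -
  have int0: "(\<lambda>s. G (X s)) integrable_on {0..t}"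
    using flow_equationD(1)[OF flow] assms by auto
  have int: "(\<lambda>s. G (X s)) integrable_on {s..t}"
    by (rule integrable_on_interval_mono[OF int0]) (use assms in auto)
  have le: "\<bar>G (X r) - G (X s)\<bar> \<le> L * (top_rate x T * (t - s) + (f s - f t))" if r: "r \<in> {s..t}" for r
  proof -
    have "f r \<le> f s" "f t \<le> f r" using anti r assms by (auto simp: monotone_on_def)
    moreover have "top_rate x T * (r - s) \<le> top_rate x T * (t - s)"
      using r top_rate_pos[of x T] x assms by (intro mult_left_mono) auto
    ultimately have "\<bar>X r - X s\<bar> \<le> top_rate x T * (t - s) + (f s - f t)"
      using flow_increment_bounds[of s r] r assms by auto
    then show ?thesis using lipschitz[of "X r" "X s"] L_pos by (meson less_imp_le mult_left_mono order_trans)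
  qed
  have "integral {s..t} (\<lambda>r. G (X r)) - (t - s) * G (X s) = integral {s..t} (\<lambda>r. G (X r) - G (X s))"
    using int assms by (subst Henstock_Kurzweil_Integration.integral_diff) auto
  also have "norm \<dots> \<le> integral {s..t} (\<lambda>r. L * (top_rate x T * (t - s) + (f s - f t)))"
    by (rule integral_norm_bound_integral) (use int le in \<open>auto intro: integrable_diff\<close>)
  finally show ?thesis using assms by (simp add: mult.left_commute)
qed

text \<open>The drops of the monotone path \<open>f\<close> telescope over the cells. So the total
  error is of order \<open>h\<close> although \<open>f\<close> may fall by any amount within a
  single cell.\<close>

lemma flow_total_error:
  assumes anti: "antimono_on {0..} f" and h: "0 \<le> h" "real n * h \<le> T"
  shows "(\<Sum>i<n. \<bar>integral {real i * h..real (Suc i) * h} (\<lambda>r. G (X r)) - h * G (X (real i * h))\<bar>)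
    \<le> h * (L * (top_rate x T * T + (f 0 - f (real n * h))))"
proof -
  have T: "0 \<le> T" using h by (meson mult_nonneg_nonneg of_nat_0_le_iff order_trans)
  have "(\<Sum>i<n. \<bar>integral {real i * h..real (Suc i) * h} (\<lambda>r. G (X r)) - h * G (X (real i * h))\<bar>)
    \<le> (\<Sum>i<n. h * (L * (top_rate x T * h + (f (real i * h) - f (real (Suc i) * h)))))"
  proof (rule sum_mono)
    fix i assume i: "i \<in> {..<n}"
    have "real (Suc i) * h \<le> real n * h" using i h by (intro mult_right_mono) auto
    then show "\<bar>integral {real i * h..real (Suc i) * h} (\<lambda>r. G (X r)) - h * G (X (real i * h))\<bar>
      \<le> h * (L * (top_rate x T * h + (f (real i * h) - f (real (Suc i) * h))))"
      using flow_local_error[OF anti, of "real i * h" "real (Suc i) * h"] h by (simp add: algebra_simps)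
  qed
  also have "\<dots> = h * (L * (top_rate x T * (real n * h) + (\<Sum>i<n. f (real i * h) - f (real (Suc i) * h))))"
    by (simp add: sum_distrib_left[symmetric] sum.distrib mult.commute mult.left_commute distrib_left)
  also have "(\<Sum>i<n. f (real i * h) - f (real (Suc i) * h)) = f 0 - f (real n * h)"
    using sum_lessThan_telescope'[of "\<lambda>i. f (real i * h)" n] by simp
  also have "h * (L * (top_rate x T * (real n * h) + (f 0 - f (real n * h)))) \<le> h * (L * (top_rate x T * T + (f 0 - f (real n * h))))"
    using h L_pos top_rate_pos[OF x T] by (intro mult_left_mono add_mono) auto
  finally show ?thesis .
qed

end

text \<open>Expresses the collected premium through values at grid times. This is how the dividends
  of a barrier strategy are recovered, as an adapted process, from its surplus.\<close>

lemma riemann_flow: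
  assumes flow: "flow_equation G f X" and anti: "antimono_on {0..} f" and x: "0 \<le> x" "f 0 \<le> x" and t: "0 \<le> t"
  shows "(\<lambda>n. \<Sum>i<n. t / real n * G (X (real i * (t / real n)))) \<longlonglongrightarrow> integral {0..t} (\<lambda>r. G (X r))"
proof (rule tendsto_if_error_le_inverse)
  have fx: "f s \<le> x" if "0 \<le> s" for s using anti that x by (auto simp: monotone_on_def intro: order_trans)
  let ?C = "t * (L * (top_rate x t * t + (f 0 - f t)))"
  let ?S = "\<lambda>n. \<Sum>i<n. t / real n * G (X (real i * (t / real n)))"
  show "\<bar>?S n - integral {0..t} (\<lambda>r. G (X r))\<bar> \<le> ?C / real n" if n: "0 < n" for n
  proof -
    define h where "h = t / real n"
    have nh: "real n * h = t" "0 \<le> h" using n t by (auto simp: h_def)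
    have int: "(\<lambda>r. G (X r)) integrable_on {0..t}" using flow_equationD(1)[OF flow t] .
    have "integral {0..real k * h} (\<lambda>r. G (X r)) = (\<Sum>i<k. integral {real i * h..real (Suc i) * h} (\<lambda>r. G (X r)))" for k
    proof (induction k)
      case (Suc k)
      have "integral {real k * h..real (Suc k) * h} (\<lambda>r. G (X r)) = integral {0..real (Suc k) * h} (\<lambda>r. G (X r)) - integral {0..real k * h} (\<lambda>r. G (X r))"
        by (rule integral_diff_interval) (use flow_equationD(1)[OF flow] nh in \<open>auto intro: mult_right_mono\<close>)
      then show ?case using Suc by simp
    qed auto
    then have "?S n - integral {0..t} (\<lambda>r. G (X r)) = (\<Sum>i<n. h * G (X (real i * h)) - integral {real i * h..real (Suc i) * h} (\<lambda>r. G (X r)))"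
      unfolding nh(1)[symmetric] by (simp add: sum_subtractf h_def[symmetric])
    also have "\<bar>\<dots>\<bar> \<le> (\<Sum>i<n. \<bar>integral {real i * h..real (Suc i) * h} (\<lambda>r. G (X r)) - h * G (X (real i * h))\<bar>)"
      by (rule order_trans[OF sum_abs]) (simp add: abs_minus_commute)
    also have "\<dots> \<le> h * (L * (top_rate x t * t + (f 0 - f t)))"
      using flow_total_error[OF flow fx x(1) anti nh(2), of n t] nh by simp
    finally show ?thesis by (simp add: h_def)
  qed
qed

text \<open>The scheme evaluates \<open>f\<close> at grid times up to \<open>t\<close> only, so the
  limit inherits measurability at time \<open>t\<close> from the driving path.\<close>

lemma euler_flow:
  assumes flow: "flow_equation G f X" and anti: "antimono_on {0..} f" and x: "0 \<le> x" "f 0 \<le> x" and t: "0 \<le> t"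
  shows "(\<lambda>n. euler (\<lambda>z. z + t / real n * G z) f (t / real n) n) \<longlonglongrightarrow> X t"
proof (rule tendsto_if_error_le_inverse)
  have fx: "f s \<le> x" if "0 \<le> s" for s using anti that x by (auto simp: monotone_on_def intro: order_trans)
  let ?C = "exp (L * t) * (t * (L * (top_rate x t * t + (f 0 - f t))))"
  let ?S = "\<lambda>n. euler (\<lambda>z. z + t / real n * G z) f (t / real n) n"
  show "\<bar>?S n - X t\<bar> \<le> ?C / real n" if n: "0 < n" for n
  proof -
    define h where "h = t / real n"
    have nh: "real n * h = t" "0 \<le> h" using n t by (auto simp: h_def)
    define r where "r i = \<bar>integral {real i * h..real (Suc i) * h} (\<lambda>r. G (X r)) - h * G (X (real i * h))\<bar>" for i
    have "\<bar>X (real n * h) - euler (\<lambda>z. z + h * G z) f h n\<bar> \<le> (1 + L * h) ^ n * (\<Sum>i<n. r i)"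
    proof (rule euler_error)
      show "\<bar>u + h * G u - (v + h * G v)\<bar> \<le> (1 + L * h) * \<bar>u - v\<bar>" for u v
      proof -
        have "\<bar>u + h * G u - (v + h * G v)\<bar> \<le> \<bar>u - v\<bar> + h * \<bar>G u - G v\<bar>"
        proof -
          have "h * \<bar>G u - G v\<bar> = \<bar>h * (G u - G v)\<bar>" using nh by (simp add: abs_mult)
          then show ?thesis by (simp add: algebra_simps)
        qed
        also have "\<dots> \<le> \<bar>u - v\<bar> + h * (L * \<bar>u - v\<bar>)"
          using lipschitz nh by (intro add_mono mult_left_mono) auto
        finally show ?thesis by (simp add: algebra_simps)
      qed
      show "0 \<le> L * h" using L_pos nh by simp
      show "X 0 = f 0" using flow_equationD(2)[OF flow, of 0] by simp
      fix i assume i: "i < n"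
      have "real (Suc i) * h \<le> real n * h" using i nh by (intro mult_right_mono) auto
      then show "\<bar>X (real (Suc i) * h) - (X (real i * h) + h * G (X (real i * h)) + f (real (Suc i) * h) - f (real i * h))\<bar> \<le> r i"
        using flow_increment_bounds(3)[OF flow fx x(1), of "real i * h" "real (Suc i) * h" t] nh
        by (auto simp: r_def mult_right_mono)
    qed
    also have "\<dots> \<le> exp (L * t) * (h * (L * (top_rate x t * t + (f 0 - f t))))"
    proof (rule mult_mono)
      show "(1 + L * h) ^ n \<le> exp (L * t)"
        using one_plus_power_le_exp[of "L * h" n] nh L_pos by (simp add: mult.left_commute)
      show "(\<Sum>i<n. r i) \<le> h * (L * (top_rate x t * t + (f 0 - f t)))"
        using flow_total_error[OF flow fx x(1) anti nh(2), of n t] nh by (simp add: r_def)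
    qed (auto simp: r_def intro: sum_nonneg)
    finally show ?thesis using nh by (simp add: h_def abs_minus_commute)
  qed
qed

end

section \<open>The barrier function\<close>

lemma hderiv_eqI:
  assumes "(f has_real_derivative D) (at x within {0..})" "0 \<le> x"
  shows "hderiv f x = D"
proof -
  have "at_right x \<le> at x within {0..}" by (rule at_le) (use assms in auto)
  then have "at x within {0..} \<noteq> bot"
    using trivial_limit_at_right_real[of x] by (metis bot.extremum_uniqueI)
  then show ?thesis unfolding hderiv_def
    by (intro vector_derivative_within)
       (use assms in \<open>auto simp: has_real_derivative_iff_has_vector_derivative\<close>)
qed

lemma C1_halflineD:
  assumes "C1_halfline f"
  shows "continuous_on {0..} (hderiv f)"
    "\<And>x. 0 \<le> x \<Longrightarrow> (f has_real_derivative hderiv f x) (at x within {0..})"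
proof -
  obtain f' where f': "continuous_on {0..} f'" "\<And>x. 0 \<le> x \<Longrightarrow> (f has_real_derivative f' x) (at x within {0..})"
    using assms by (auto simp: C1_halfline_def)
  have eq: "hderiv f x = f' x" if "0 \<le> x" for x using hderiv_eqI[OF f'(2)] that by auto
  show "continuous_on {0..} (hderiv f)" using f'(1) by (subst continuous_on_cong[OF refl eq]) auto
  show "(f has_real_derivative hderiv f x) (at x within {0..})" if "0 \<le> x" for x
    using f'(2)[OF that] eq[OF that] by simp
qed

lemma continuous_on_halfline:
  fixes f :: "real \<Rightarrow> real"
  assumes "\<And>T. 0 \<le> T \<Longrightarrow> continuous_on {0..T} f"
  shows "continuous_on {0..} f"
  unfolding continuous_on_eq_continuous_within
proof
  fix x :: real assume x: "x \<in> {0..}"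
  have "at x within {0..x + 1} = at x within {0..}"
    by (rule at_within_nhd[of x "{..<x + 1}"]) auto
  moreover have "continuous (at x within {0..x + 1}) f"
    using assms[of "x + 1"] x by (auto simp: continuous_on_eq_continuous_within)
  ultimately show "continuous (at x within {0..}) f" by simp
qed

text \<open>The mean of \<open>\<phi>\<close> after one claim from level \<open>x\<close>, for
  \<open>\<phi>\<close> vanishing on the negative axis: claims larger than \<open>x\<close>
  contribute nothing.\<close>

definition exp_conv :: "real \<Rightarrow> (real \<Rightarrow> real) \<Rightarrow> real \<Rightarrow> real" where
  "exp_conv alpha \<phi> x = (LBINT y:{0..x}. \<phi> (x - y) * (alpha * exp (- alpha * y)))"

lemma exp_conv_integrable:
  fixes \<phi> :: "real \<Rightarrow> real"
  assumes "continuous_on {0..} \<phi>"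
  shows "set_integrable lborel {0..x} (\<lambda>y. \<phi> (x - y) * (alpha * exp (- alpha * y)))"
proof -
  have "continuous_on {0..x} (\<lambda>y. \<phi> (x - y))"
    by (rule continuous_on_compose2[OF assms]) (auto intro!: continuous_intros)
  then show ?thesis
    unfolding set_integrable_def by (intro borel_integrable_compact continuous_intros) auto
qed

text \<open>Substituting \<open>w = x - y\<close> moves the dependence on \<open>x\<close> out of
  the integrand; continuity and estimates then concern an indefinite integral of a fixed
  function.\<close>

lemma exp_conv_eq:
  assumes "continuous_on {0..} \<phi>" "0 \<le> x"
  shows "exp_conv alpha \<phi> x = alpha * exp (- alpha * x) * integral {0..x} (\<lambda>w. \<phi> w * exp (alpha * w))"
proof -
  have "continuous_on {0..x} \<phi>" by (rule continuous_on_subset[OF assms(1)]) auto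
  then have int: "set_integrable lborel {0..x} (\<lambda>w. \<phi> w * exp (alpha * w))"
    unfolding set_integrable_def by (intro borel_integrable_compact continuous_intros) auto
  have "exp_conv alpha \<phi> x = (\<integral>w. indicator {0..x} (x + (-1) * w) *\<^sub>R (\<phi> (x - (x + (-1) * w)) * (alpha * exp (- alpha * (x + (-1) * w)))) \<partial>lborel)"
    unfolding exp_conv_def set_lebesgue_integral_def by (subst lborel_integral_real_affine[where c="-1" and t=x]) auto
  also have "\<dots> = (\<integral>w. (alpha * exp (- alpha * x)) * (indicator {0..x} w *\<^sub>R (\<phi> w * exp (alpha * w))) \<partial>lborel)"
    by (rule Bochner_Integration.integral_cong) (auto simp: indicator_def exp_add[symmetric] algebra_simps)
  also have "\<dots> = alpha * exp (- alpha * x) * (LBINT w:{0..x}. \<phi> w * exp (alpha * w))"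
    unfolding set_lebesgue_integral_def by simp
  finally show ?thesis using set_borel_integral_eq_integral(2)[OF int] by simp
qed

lemma continuous_exp_conv:
  assumes "continuous_on {0..} \<phi>"
  shows "continuous_on {0..} (exp_conv alpha \<phi>)"
proof (rule continuous_on_halfline)
  fix T :: real
  have "continuous_on {0..T} \<phi>" by (rule continuous_on_subset[OF assms(1)]) auto
  then have "(\<lambda>w. \<phi> w * exp (alpha * w)) integrable_on {0..T}"
    by (intro integrable_continuous_real continuous_intros)
  then have "continuous_on {0..T} (\<lambda>x. alpha * exp (- alpha * x) * integral {0..x} (\<lambda>w. \<phi> w * exp (alpha * w)))"
    by (intro continuous_intros indefinite_integral_continuous_1)
  then show "continuous_on {0..T} (exp_conv alpha \<phi>)"
    by (subst continuous_on_cong[OF refl exp_conv_eq[OF assms]]) auto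
qed

lemma exp_conv_linear:
  assumes "continuous_on {0..} \<phi>" "continuous_on {0..} \<eta>"
  shows "exp_conv alpha (\<lambda>x. c * \<phi> x - d * \<eta> x) x = c * exp_conv alpha \<phi> x - d * exp_conv alpha \<eta> x"
proof -
  have "exp_conv alpha (\<lambda>x. c * \<phi> x - d * \<eta> x) x =
    (LBINT y:{0..x}. c * (\<phi> (x - y) * (alpha * exp (- alpha * y))) - d * (\<eta> (x - y) * (alpha * exp (- alpha * y))))"
    unfolding exp_conv_def by (simp add: algebra_simps)
  also have "\<dots> = c * exp_conv alpha \<phi> x - d * exp_conv alpha \<eta> x"
    unfolding exp_conv_def
    using exp_conv_integrable[OF assms(1), of x alpha] exp_conv_integrable[OF assms(2), of x alpha]
    by (subst set_integral_diff(2)) auto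
  finally show ?thesis .
qed

lemma exp_conv_cong:
  assumes "\<And>z. 0 \<le> z \<Longrightarrow> z \<le> x \<Longrightarrow> \<phi> z = \<eta> z"
  shows "exp_conv alpha \<phi> x = exp_conv alpha \<eta> x"
  unfolding exp_conv_def set_lebesgue_integral_def
  by (rule Bochner_Integration.integral_cong) (use assms in \<open>auto simp: indicator_def\<close>)

text \<open>The exponential law gives \<open>[0, x]\<close> the mass
  \<open>1 - exp (- alpha * x)\<close>.\<close>

lemma exp_conv_le:
  assumes "continuous_on {0..} \<phi>" "0 < alpha" "0 \<le> x" "\<And>z. 0 \<le> z \<Longrightarrow> z \<le> x \<Longrightarrow> \<phi> z \<le> c" "0 \<le> c"
  shows "exp_conv alpha \<phi> x \<le> c * (1 - exp (- alpha * x))"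
proof -
  have "continuous_on {0..x} \<phi>" by (rule continuous_on_subset[OF assms(1)]) auto
  then have i: "(\<lambda>w. \<phi> w * exp (alpha * w)) integrable_on {0..x}"
    by (intro integrable_continuous_real continuous_intros)
  have h: "((\<lambda>w. c * exp (alpha * w)) has_integral (c * exp (alpha * x) / alpha - c * exp (alpha * 0) / alpha)) {0..x}"
    by (rule fundamental_theorem_of_calculus)
       (use assms in \<open>auto intro!: derivative_eq_intros simp: has_real_derivative_iff_has_vector_derivative[symmetric]\<close>)
  then have "integral {0..x} (\<lambda>w. \<phi> w * exp (alpha * w)) \<le> c * exp (alpha * x) / alpha - c * exp (alpha * 0) / alpha"
    by (rule has_integral_le[OF integrable_integral[OF i]]) (use assms in \<open>auto intro: mult_right_mono\<close>)
  then have "alpha * exp (- alpha * x) * integral {0..x} (\<lambda>w. \<phi> w * exp (alpha * w))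
     \<le> alpha * exp (- alpha * x) * (c * exp (alpha * x) / alpha - c * exp (alpha * 0) / alpha)"
    using assms by (intro mult_left_mono) auto
  also have "\<dots> = c * (1 - exp (- alpha * x))"
    using assms by (simp add: field_simps exp_minus)
  finally show ?thesis unfolding exp_conv_eq[OF assms(1,3)] .
qed

lemma integral_exponential_density:
  assumes [measurable]: "\<phi> \<in> borel_measurable borel" and "\<And>z. z < 0 \<Longrightarrow> \<phi> z = 0" "0 < alpha"
  shows "(\<integral>y. \<phi> (x - y) \<partial>density lborel (exponential_density alpha)) = exp_conv alpha \<phi> x"
proof -
  have "(\<integral>y. \<phi> (x - y) \<partial>density lborel (exponential_density alpha)) = (\<integral>y. exponential_density alpha y *\<^sub>R \<phi> (x - y) \<partial>lborel)"
    by (rule integral_density) (use assms in \<open>auto simp: exponential_density_def\<close>)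
  also have "\<dots> = exp_conv alpha \<phi> x"
    unfolding exp_conv_def set_lebesgue_integral_def
    by (rule Bochner_Integration.integral_cong)
       (use assms in \<open>auto simp: indicator_def exponential_density_def mult.commute\<close>)
  finally show ?thesis .
qed

section \<open>The candidate value function: smooth fit, slope and sign of the drift\<close>

locale barrier_problem =
  fixes g :: "real \<Rightarrow> real" and lam alpha delta :: real and \<psi> :: "real \<Rightarrow> real" and b :: real
  assumes lam_pos: "0 < lam" and alpha_pos: "0 < alpha" and delta_pos: "0 < delta" and b_pos: "0 < b"
    and g_pos: "\<And>x. 0 \<le> x \<Longrightarrow> 0 < g x" and g_cont: "continuous_on {0..} g"
    and psi_solution: "ide_solution g lam alpha delta \<psi>"
    and psi_pos: "\<And>x. 0 \<le> x \<Longrightarrow> 0 < \<psi> x"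
    and psi_mono: "strict_mono_on {0..} \<psi>"
    and b_min: "\<And>x. 0 \<le> x \<Longrightarrow> hderiv \<psi> b \<le> hderiv \<psi> x"
    and psi'_mono: "mono_on {b<..} (hderiv \<psi>)"
begin

abbreviation "\<Phi> \<equiv> barrier_function \<psi> b"

text \<open>Division by \<open>hderiv \<psi> b\<close> makes both branches equal to 1 at
  \<open>b\<close>: the smooth fit.\<close>

definition "\<Phi>' x = (if x \<le> b then hderiv \<psi> x / hderiv \<psi> b else 1)"

text \<open>The function \<open>(A - delta) \<Phi>\<close> of the variational inequality, written so
  that it also makes sense, and is continuous, at 0.\<close>

definition "drift x = g x * \<Phi>' x - (lam + delta) * \<Phi> x + lam * exp_conv alpha \<Phi> x"

lemma psi_C1: "C1_halfline \<psi>" using psi_solution by (simp add: ide_solution_def)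

lemma psi_continuous: "continuous_on {0..} \<psi>"
  by (rule DERIV_continuous_on) (use C1_halflineD(2)[OF psi_C1] in auto)

lemma psi_ide: "0 < x \<Longrightarrow> g x * hderiv \<psi> x - (lam + delta) * \<psi> x + lam * exp_conv alpha \<psi> x = 0"
  using psi_solution by (simp add: ide_solution_def exp_conv_def)

text \<open>Monotonicity bounds the convolution at \<open>b\<close> by \<open>\<psi> b\<close>, so
  the equation at \<open>b\<close> leaves at least \<open>delta * \<psi> b\<close> for
  \<open>g b * hderiv \<psi> b\<close>.\<close>

lemma psi'_pos: "0 < hderiv \<psi> b"
proof -
  have "exp_conv alpha \<psi> b \<le> \<psi> b * (1 - exp (- alpha * b))"
    by (rule exp_conv_le[OF psi_continuous alpha_pos])
       (use b_pos psi_pos[of b] strict_mono_onD[OF psi_mono] in \<open>auto simp: le_less\<close>)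
  also have "\<dots> < \<psi> b" using psi_pos[of b] b_pos by (simp add: algebra_simps)
  finally have "lam * exp_conv alpha \<psi> b \<le> lam * \<psi> b" using lam_pos by simp
  moreover have "0 < delta * \<psi> b" using psi_pos[of b] b_pos delta_pos by simp
  ultimately have "0 < g b * hderiv \<psi> b" using psi_ide[OF b_pos] by (simp add: algebra_simps)
  then show ?thesis using g_pos[of b] b_pos by (simp add: zero_less_mult_iff)
qed

lemma barrier_neg: "x < 0 \<Longrightarrow> \<Phi> x = 0" by (simp add: barrier_function_def)

lemma barrier_low: "0 \<le> x \<Longrightarrow> x \<le> b \<Longrightarrow> \<Phi> x = \<psi> x / hderiv \<psi> b"
  by (simp add: barrier_function_def)

lemma barrier_high: "b \<le> x \<Longrightarrow> \<Phi> x = \<Phi> b + (x - b)"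
  using b_pos by (simp add: barrier_function_def)

lemma barrier_deriv_ge_1: "0 \<le> x \<Longrightarrow> 1 \<le> \<Phi>' x"
  using b_min[of x] psi'_pos by (simp add: \<Phi>'_def)

lemma barrier_deriv_high: "b \<le> x \<Longrightarrow> \<Phi>' x = 1"
  using psi'_pos by (simp add: \<Phi>'_def)

lemma barrier_deriv_continuous: "continuous_on {0..} \<Phi>'"
proof -
  have "continuous_on ({0..b} \<union> {b..}) (\<lambda>x. if x \<le> b then hderiv \<psi> x / hderiv \<psi> b else 1)"
    by (rule continuous_on_cases)
       (use psi'_pos in \<open>auto intro!: continuous_intros intro: continuous_on_subset[OF C1_halflineD(1)[OF psi_C1]]\<close>)
  moreover have "{0..b} \<union> {b..} = {0..}" using b_pos by auto
  ultimately show ?thesis by (simp add: \<Phi>'_def[abs_def])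
qed

lemma barrier_has_derivative:
  assumes x: "0 \<le> x"
  shows "(\<Phi> has_real_derivative \<Phi>' x) (at x within {0..})"
proof -
  have low: "((\<lambda>x. \<psi> x / hderiv \<psi> b) has_real_derivative hderiv \<psi> x / hderiv \<psi> b) (at x within {0..})"
    by (rule DERIV_cdivide[OF C1_halflineD(2)[OF psi_C1 x]])
  have high: "((\<lambda>x. \<Phi> b + (x - b)) has_real_derivative 1) (at x within S)" for S
    by (auto intro!: derivative_eq_intros)
  consider "x < b" | "x = b" | "b < x" by linarith
  then show ?thesis
  proof cases
    case 1
    show ?thesis
      by (rule has_field_derivative_transform_within[where d="b - x" and f="\<lambda>x. \<psi> x / hderiv \<psi> b"])
         (use 1 low x in \<open>auto simp: \<Phi>'_def dist_real_def intro!: barrier_low[symmetric]\<close>)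
  next
    case 2
    have l: "(\<Phi> has_real_derivative \<Phi>' x) (at x within {0..b})"
      by (rule has_field_derivative_transform_within[where d=1 and f="\<lambda>x. \<psi> x / hderiv \<psi> b"])
         (use 2 x DERIV_subset[OF low, of "{0..b}"] in \<open>auto simp: \<Phi>'_def barrier_low\<close>)
    have h: "(\<Phi> has_real_derivative \<Phi>' x) (at x within {b..})"
      by (rule has_field_derivative_transform_within[where d=1 and f="\<lambda>x. \<Phi> b + (x - b)"])
         (use 2 x high in \<open>auto simp: barrier_deriv_high intro!: barrier_high[symmetric]\<close>)
    have "{0..} = {0..b} \<union> {b..}" using b_pos by auto
    then show ?thesis using l h by (simp add: has_field_derivative_iff Lim_within_Un)
  next
    case 3
    show ?thesis
      by (rule has_field_derivative_transform_within[where d="x - b" and f="\<lambda>x. \<Phi> b + (x - b)"])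
         (use 3 high x in \<open>auto simp: barrier_deriv_high dist_real_def intro!: barrier_high[symmetric]\<close>)
  qed
qed

lemma barrier_C1: "C1_halfline \<Phi>"
  unfolding C1_halfline_def using barrier_deriv_continuous barrier_has_derivative by blast

lemma barrier_continuous: "continuous_on {0..} \<Phi>"
  by (rule DERIV_continuous_on) (use barrier_has_derivative in auto)

lemma barrier_measurable [measurable]: "\<Phi> \<in> borel_measurable borel"
proof -
  have "(\<lambda>x. indicator {0..} x *\<^sub>R \<Phi> x) \<in> borel_measurable borel"
    by (rule borel_measurable_continuous_on_indicator[OF _ barrier_continuous]) simp
  also have "(\<lambda>x. indicator {0..} x *\<^sub>R \<Phi> x) = \<Phi>"
    using barrier_neg by (force simp: indicator_def)
  finally show ?thesis .
qed

text \<open>The part \<open>1 \<le> \<Phi>'\<close> of the variational inequality in integrated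
  form: measured by \<Phi>, a lump sum paid at once is worth no more than the surplus given up for
  it.\<close>

lemma barrier_mono_add:
  assumes "0 \<le> x" "x \<le> y"
  shows "\<Phi> x + (y - x) \<le> \<Phi> y"
proof -
  have "\<Phi> x - x \<le> \<Phi> y - y"
  proof (rule DERIV_nonneg_imp_increasing_open[where f="\<lambda>x. \<Phi> x - x"])
    show "continuous_on {x..y} (\<lambda>x. \<Phi> x - x)"
      by (intro continuous_intros continuous_on_subset[OF barrier_continuous]) (use assms in auto)
    fix z assume z: "x < z" "z < y"
    have "at z within {0..} = at z" by (rule at_within_interior) (use z assms in \<open>auto simp: interior_real_atLeast\<close>)
    then have "(\<Phi> has_real_derivative \<Phi>' z) (at z)" using barrier_has_derivative[of z] z assms by simp
    then have "((\<lambda>x. \<Phi> x - x) has_real_derivative (\<Phi>' z - 1)) (at z)"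
      by (auto intro!: derivative_eq_intros)
    then show "\<exists>D. ((\<lambda>x. \<Phi> x - x) has_real_derivative D) (at z) \<and> 0 \<le> D"
      using barrier_deriv_ge_1[of z] z assms by auto
  qed (use assms in auto)
  then show ?thesis by simp
qed

lemma barrier_nonneg: "0 \<le> \<Phi> x"
proof (cases "x < 0")
  case False
  have "0 \<le> \<Phi> 0" using psi_pos[of 0] psi'_pos barrier_low[of 0] b_pos by simp
  then show ?thesis using barrier_mono_add[of 0 x] False by simp
qed (simp add: barrier_neg)

lemma barrier_mono: "x \<le> y \<Longrightarrow> \<Phi> x \<le> \<Phi> y"
  using barrier_mono_add[of x y] barrier_neg[of x] barrier_nonneg[of y] by (cases "x < 0") auto

lemma drift_continuous: "continuous_on {0..} drift"
  unfolding drift_def[abs_def]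
  by (intro continuous_intros g_cont barrier_deriv_continuous barrier_continuous continuous_exp_conv)

lemma drift_low:
  assumes "0 \<le> x" "x \<le> b"
  shows "drift x = 0"
proof -
  have pos: "drift x = 0" if "0 < x" "x \<le> b" for x
  proof -
    have "exp_conv alpha \<Phi> x = exp_conv alpha (\<lambda>x. 1 / hderiv \<psi> b * \<psi> x - 0 * \<psi> x) x"
      by (rule exp_conv_cong) (use that barrier_low in auto)
    also have "\<dots> = exp_conv alpha \<psi> x / hderiv \<psi> b"
      by (subst exp_conv_linear[OF psi_continuous psi_continuous]) simp
    finally have "drift x = (g x * hderiv \<psi> x - (lam + delta) * \<psi> x + lam * exp_conv alpha \<psi> x) / hderiv \<psi> b"
      using that barrier_low[of x] by (simp add: drift_def \<Phi>'_def diff_divide_distrib add_divide_distrib)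
    then show ?thesis using psi_ide[OF that(1)] by simp
  qed
  show ?thesis
  proof (cases "x = 0")
    case True
    \<comment> \<open>The equation is assumed for positive arguments only; the value at 0 is reached
      by continuity from the right.\<close>
    have "(drift \<longlongrightarrow> drift 0) (at_right 0)"
      using drift_continuous by (auto simp: continuous_on_def intro: tendsto_within_subset)
    moreover have "\<forall>\<^sub>F x in at_right 0. drift x = 0"
      unfolding eventually_at_right_field using pos b_pos by (intro exI[of _ b]) auto
    then have "(drift \<longlongrightarrow> 0) (at_right 0)" by (rule tendsto_eventually)
    ultimately show ?thesis using True tendsto_unique[of "at_right (0::real)"] by auto
  qed (use pos assms in auto)
qed

text \<open>
  Beyond \<open>b\<close>, compare with \<open>\<psi>\<close> at a fixed point \<open>x\<close>: with
  \<open>P = \<psi>' x / \<psi>' b\<close> the function \<open>k = P * \<Phi> - \<psi> / \<psi>' b\<close> is nonnegative and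
  nondecreasing on \<open>[0, x]\<close>, and the first order terms of its drift cancel at \<open>x\<close>.
\<close>

lemma drift_high:
  assumes x: "b < x"
  shows "drift x \<le> 0"
proof -
  define P where "P = hderiv \<psi> x / hderiv \<psi> b"
  define Q where "Q = 1 / hderiv \<psi> b"
  define k where "k z = P * \<Phi> z - Q * \<psi> z" for z
  have P: "1 \<le> P" using b_min[of x] x b_pos psi'_pos by (simp add: P_def)
  have cont: "continuous_on {0..} k"
    unfolding k_def by (intro continuous_intros barrier_continuous psi_continuous)
  have k0: "0 \<le> k 0"
  proof -
    have "k 0 = (P - 1) * (\<psi> 0 / hderiv \<psi> b)" using b_pos by (simp add: k_def Q_def barrier_low left_diff_distrib diff_divide_distrib)
    then show ?thesis using P psi_pos[of 0] psi'_pos by simp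
  qed
  have mono: "k y \<le> k z" if yz: "0 \<le> y" "y \<le> z" "z \<le> x" for y z
  proof (rule DERIV_nonneg_imp_increasing_open[where f=k])
    show "continuous_on {y..z} k" by (rule continuous_on_subset[OF cont]) (use yz in auto)
    fix w assume w: "y < w" "w < z"
    have at: "at w within {0..} = at w"
      by (rule at_within_interior) (use w yz in \<open>auto simp: interior_real_atLeast\<close>)
    have "(k has_real_derivative P * \<Phi>' w - Q * hderiv \<psi> w) (at w)"
      using barrier_has_derivative[of w] C1_halflineD(2)[OF psi_C1, of w] w yz
      unfolding at k_def by (auto intro!: derivative_eq_intros)
    \<comment> \<open>Up to \<open>b\<close> the left side is \<open>\<Phi>' w\<close>, and
      \<open>1 \<le> P\<close> suffices. Beyond \<open>b\<close> the slope of \<Phi> is 1, and the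
      monotonicity of \<open>hderiv \<psi>\<close> compares \<open>w\<close> with
      \<open>x\<close>.\<close>
    moreover have "Q * hderiv \<psi> w \<le> P * \<Phi>' w"
    proof (cases "w \<le> b")
      case True
      then have "Q * hderiv \<psi> w = \<Phi>' w" by (simp add: \<Phi>'_def Q_def)
      then show ?thesis using mult_right_mono[OF P, of "\<Phi>' w"] barrier_deriv_ge_1[of w] w yz by simp
    next
      case False
      then have "hderiv \<psi> w \<le> hderiv \<psi> x"
        using w yz x by (intro mono_onD[OF psi'_mono]) auto
      then show ?thesis using False psi'_pos by (simp add: \<Phi>'_def Q_def P_def divide_right_mono)
    qed
    ultimately show "\<exists>D. (k has_real_derivative D) (at w) \<and> 0 \<le> D" by auto
  qed (use yz in auto)
  have kx: "0 \<le> k x" using k0 mono[of 0 x] x b_pos by auto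
  have "exp_conv alpha k x \<le> k x * (1 - exp (- alpha * x))"
    by (rule exp_conv_le[OF cont alpha_pos]) (use x b_pos mono kx in auto)
  also have "\<dots> \<le> k x" using kx mult_left_mono[of "1 - exp (- alpha * x)" 1 "k x"] by simp
  finally have "lam * exp_conv alpha k x \<le> lam * k x" using lam_pos by simp
  moreover have "0 \<le> delta * k x" using kx delta_pos by simp
  ultimately have le: "lam * exp_conv alpha k x - (lam + delta) * k x \<le> 0" by (simp add: algebra_simps)
  \<comment> \<open>The equation for \<open>\<psi>\<close> at \<open>x\<close> is subtracted in the
    multiple \<open>Q\<close>. Since \<Phi> has slope 1 at \<open>x\<close> and
    \<open>P = Q * hderiv \<psi> x\<close>, the premium terms cancel.\<close>
  have "P * drift x - Q * (g x * hderiv \<psi> x - (lam + delta) * \<psi> x + lam * exp_conv alpha \<psi> x)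
     = (P * g x - Q * (g x * hderiv \<psi> x)) - (lam + delta) * (P * \<Phi> x - Q * \<psi> x)
       + lam * (P * exp_conv alpha \<Phi> x - Q * exp_conv alpha \<psi> x)"
    using x barrier_deriv_high[of x] by (simp add: drift_def algebra_simps)
  also have "P * exp_conv alpha \<Phi> x - Q * exp_conv alpha \<psi> x = exp_conv alpha k x"
    unfolding k_def by (rule exp_conv_linear[OF barrier_continuous psi_continuous, symmetric])
  also have "P * g x - Q * (g x * hderiv \<psi> x) = 0" by (simp add: P_def Q_def)
  also have "P * \<Phi> x - Q * \<psi> x = k x" by (simp add: k_def)
  finally have "P * drift x - Q * (g x * hderiv \<psi> x - (lam + delta) * \<psi> x + lam * exp_conv alpha \<psi> x)
     = lam * exp_conv alpha k x - (lam + delta) * k x" by simp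
  then have "P * drift x \<le> 0" using le psi_ide[of x] x b_pos by simp
  then show ?thesis using P by (simp add: mult_le_0_iff)
qed

lemma drift_nonpos: "0 \<le> x \<Longrightarrow> drift x \<le> 0"
  using drift_low[of x] drift_high[of x] by (cases "x \<le> b") auto

lemma barrier_hderiv: "0 \<le> x \<Longrightarrow> hderiv \<Phi> x = \<Phi>' x"
  by (rule hderiv_eqI[OF barrier_has_derivative])

text \<open>Up to \<open>b\<close> the drift is 0 and the slope of \<Phi> at least 1; beyond
  \<open>b\<close> the slope is 1 and the drift nonpositive. So in each region one entry of the
  maximum is 0 and the other is not positive.\<close>

lemma barrier_qvi: "qvi_solution g lam alpha delta \<Phi>"
  unfolding qvi_solution_def
proof (intro conjI allI impI)
  fix x :: real assume x: "0 < x"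
  have gen: "generator g lam alpha \<Phi> x - delta * \<Phi> x = drift x"
    unfolding generator_def drift_def
    using x barrier_hderiv[of x] integral_exponential_density[OF barrier_measurable barrier_neg alpha_pos]
    by (simp add: algebra_simps)
  show "max (generator g lam alpha \<Phi> x - delta * \<Phi> x) (1 - hderiv \<Phi> x) = 0"
    unfolding gen using x drift_low[of x] drift_high[of x] barrier_deriv_high[of x] barrier_deriv_ge_1[of x]
    by (cases "x \<le> b") (auto simp: barrier_hderiv)
qed (use barrier_C1 barrier_neg in auto)

end

section \<open>Poisson weights\<close>

lemma continuous_on_Icc_bounded:
  fixes f :: "real \<Rightarrow> real"
  assumes "continuous_on {a..b} f"
  obtains c where "0 \<le> c" "\<And>x. a \<le> x \<Longrightarrow> x \<le> b \<Longrightarrow> \<bar>f x\<bar> \<le> c"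
proof -
  have "bounded (f ` {a..b})" by (intro compact_imp_bounded compact_continuous_image assms) simp
  then obtain c where c: "\<forall>y\<in>f ` {a..b}. norm y \<le> c" by (auto simp: bounded_iff)
  show thesis
  proof (rule that[of "max 0 c"])
    fix x assume "a \<le> x" "x \<le> b"
    then have "norm (f x) \<le> c" using c by simp
    then show "\<bar>f x\<bar> \<le> max 0 c" by simp
  qed simp
qed

definition poisson_weight :: "real \<Rightarrow> nat \<Rightarrow> real" where
  "poisson_weight a j = a ^ j / fact j * exp (- a)"

text \<open>The backward equation of the Poisson process; \<open>1 - x\<close> is the time left
  until the end of a unit interval.\<close>

lemma poisson_weight_derivative:
  "((\<lambda>x. poisson_weight (lam * (1 - x)) (Suc j)) has_real_derivative
     lam * (poisson_weight (lam * (1 - x)) (Suc j) - poisson_weight (lam * (1 - x)) j)) (at x within S)"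
proof -
  have "((\<lambda>x. poisson_weight (lam * (1 - x)) (Suc j)) has_real_derivative
    (lam * (1 - x)) ^ Suc j / fact (Suc j) * (exp (- (lam * (1 - x))) * lam)
     + - lam * ((lam * (1 - x)) ^ j / fact j) * exp (- (lam * (1 - x)))) (at x within S)"
    unfolding poisson_weight_def
  proof (rule DERIV_mult')
    have "((\<lambda>x. (lam * (1 - x)) ^ Suc j / fact (Suc j)) has_real_derivative
       real (Suc j) * (lam * (1 - x)) ^ j * (- lam) / fact (Suc j)) (at x within S)"
      by (auto intro!: derivative_eq_intros simp del: power_Suc fact_Suc)
    also have "real (Suc j) * (lam * (1 - x)) ^ j * (- lam) / fact (Suc j) = - lam * ((lam * (1 - x)) ^ j / fact j)"
      by (simp add: mult.assoc del: of_nat_Suc)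
    finally show "((\<lambda>x. (lam * (1 - x)) ^ Suc j / fact (Suc j)) has_real_derivative - lam * ((lam * (1 - x)) ^ j / fact j)) (at x within S)" .
  qed (auto intro!: derivative_eq_intros)
  then show ?thesis by (simp add: poisson_weight_def algebra_simps del: power_Suc fact_Suc)
qed

lemma poisson_weight_bounds:
  assumes "0 \<le> a" "a \<le> c"
  shows "0 \<le> poisson_weight a j" "poisson_weight a j \<le> c ^ j / fact j"
proof -
  show "0 \<le> poisson_weight a j" using assms by (simp add: poisson_weight_def)
  have "a ^ j / fact j * exp (- a) \<le> c ^ j / fact j * 1"
    using assms by (intro mult_mono divide_right_mono power_mono) auto
  then show "poisson_weight a j \<le> c ^ j / fact j" by (simp add: poisson_weight_def)
qed

text \<open>Polynomials in \<open>1 - x\<close> are dense. If all moments vanish, the integral of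
  the square of \<open>u\<close> equals that of \<open>u * (u - p)\<close> for any such polynomial
  \<open>p\<close>, which can be made arbitrarily small.\<close>

lemma continuous_moments_zero:
  fixes u :: "real \<Rightarrow> real"
  assumes cont: "continuous_on {0..1} u"
    and zero: "\<And>j::nat. integral {0..1} (\<lambda>x. u x * (1 - x) ^ j) = 0"
    and x: "x \<in> {0..1}"
  shows "u x = 0"
proof -
  have int: "(\<lambda>x. u x * q x) integrable_on {0..1}" if "continuous_on {0..1} q" for q
    by (intro integrable_continuous_real continuous_intros cont that)
  obtain c where c: "\<And>x. 0 \<le> x \<Longrightarrow> x \<le> 1 \<Longrightarrow> \<bar>u x\<bar> \<le> c"
    using continuous_on_Icc_bounded[OF cont] by blast
  have c0: "0 \<le> c" using c[of 0] by simp
  have le: "integral {0..1} (\<lambda>x. u x * u x) \<le> c * e" if e: "0 < e" for e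
  proof -
    have cu: "continuous_on {0..1} (\<lambda>y. u (1 - y))"
      by (rule continuous_on_compose2[OF cont]) (auto intro!: continuous_intros)
    obtain p where p: "real_polynomial_function p" "\<And>y. y \<in> {0..1} \<Longrightarrow> \<bar>u (1 - y) - p y\<bar> < e"
      using Stone_Weierstrass_real_polynomial_function[OF compact_Icc cu e] by auto
    obtain a n where a: "p = (\<lambda>y. \<Sum>i\<le>n. a i * y ^ i)"
      using p(1) real_polynomial_function_iff_sum by auto
    have cp: "continuous_on {0..1} (\<lambda>x. p (1 - x))" unfolding a by (intro continuous_intros)
    have "integral {0..1} (\<lambda>x. u x * p (1 - x)) = integral {0..1} (\<lambda>x. \<Sum>i\<le>n. a i * (u x * (1 - x) ^ i))"
      unfolding a by (simp add: sum_distrib_left mult.left_commute)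
    also have "\<dots> = (\<Sum>i\<le>n. integral {0..1} (\<lambda>x. a i * (u x * (1 - x) ^ i)))"
      by (rule integral_sum) (auto intro!: integrable_on_mult_right int continuous_intros)
    also have "\<dots> = 0" by (simp add: zero)
    finally have "integral {0..1} (\<lambda>x. u x * u x) = integral {0..1} (\<lambda>x. u x * (u x - p (1 - x)))"
      using int[OF cont] int[OF cp] by (simp add: right_diff_distrib Henstock_Kurzweil_Integration.integral_diff)
    also have "\<dots> \<le> integral {0..1} (\<lambda>x::real. c * e)"
    proof (rule integral_le)
      show "(\<lambda>x. u x * (u x - p (1 - x))) integrable_on {0..1}" by (intro int continuous_intros cont cp)
      fix x :: real assume x: "x \<in> {0..1}"
      have "\<bar>u x * (u x - p (1 - x))\<bar> \<le> c * e"
        unfolding abs_mult using c[of x] p(2)[of "1 - x"] x by (intro mult_mono) auto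
      then show "u x * (u x - p (1 - x)) \<le> c * e" by linarith
    qed auto
    finally show ?thesis by simp
  qed
  have "integral {0..1} (\<lambda>x. u x * u x) \<le> 0"
  proof (rule field_le_epsilon)
    fix e :: real assume "0 < e"
    then have "integral {0..1} (\<lambda>x. u x * u x) \<le> c * (e / (c + 1))" using le[of "e / (c + 1)"] c0 by simp
    also have "\<dots> \<le> e" using c0 \<open>0 < e\<close> by (simp add: field_simps)
    finally show "integral {0..1} (\<lambda>x. u x * u x) \<le> 0 + e" by simp
  qed
  moreover have "0 \<le> integral {0..1} (\<lambda>x. u x * u x)" by (rule integral_nonneg[OF int[OF cont]]) auto
  ultimately have "integral {0..1} (\<lambda>x. u x * u x) = 0" by linarith
  then have "u x * u x = 0"
    using integral_eq_0_iff[OF continuous_on_mult[OF cont cont]] x by simp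
  then show ?thesis by simp
qed

text \<open>
  Abel summation turns the hypothesis into equality of all integrals of \<open>v\<close> against the weights of
  \<open>poisson_weight\<close>; these tend to 0, so that all moments of \<open>v\<close> vanish.
\<close>

lemma poisson_moments_zero:
  fixes v :: "real \<Rightarrow> real"
  assumes lip: "\<And>x y. x \<in> {0..1} \<Longrightarrow> y \<in> {0..1} \<Longrightarrow> \<bar>v x - v y\<bar> \<le> D * \<bar>x - y\<bar>"
    and v0: "v 0 = 0" and lam: "0 < lam"
    and sums: "\<And>j n. 0 < n \<Longrightarrow> \<bar>\<Sum>i<n. (v (real (Suc i) / real n) - v (real i / real n)) *
        poisson_weight (lam * (1 - real (Suc i) / real n)) (Suc j)\<bar> \<le> K / real n"
    and x: "x \<in> {0..1}"
  shows "v x = 0"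
proof -
  define q where "q j x = poisson_weight (lam * (1 - x)) j" for j x
  \<comment> \<open>By \<open>poisson_weight_derivative\<close> this is the derivative of
    \<open>q (Suc j)\<close>.\<close>
  define q' where "q' j x = lam * (q (Suc j) x - q j x)" for j x
  have D: "0 \<le> D" using lip[of 0 1] by auto
  have cv: "continuous_on {0..1} v"
  proof -
    have "D-lipschitz_on {0..1} v" using lip D by (auto simp: lipschitz_on_def dist_real_def)
    then show ?thesis by (rule lipschitz_on_continuous_on)
  qed
  have cq: "continuous_on S (q j)" for S j unfolding q_def poisson_weight_def by (intro continuous_intros) auto
  have cq': "continuous_on S (q' j)" for S j unfolding q'_def by (intro continuous_intros cq)
  have int: "(\<lambda>x. v x * r x) integrable_on {a..b}" if "continuous_on {0..1} r" "0 \<le> a" "b \<le> 1" for r a b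
  proof (rule integrable_continuous_real)
    have "{a..b} \<subseteq> {0..1}" using that by auto
    then show "continuous_on {a..b} (\<lambda>x. v x * r x)"
      by (intro continuous_on_mult continuous_on_subset[OF cv] continuous_on_subset[OF that(1)])
  qed
  have zero: "integral {0..1} (\<lambda>x. v x * q' j x) = 0" for j
  proof -
    obtain Q where Q: "\<And>x. 0 \<le> x \<Longrightarrow> x \<le> 1 \<Longrightarrow> \<bar>q' j x\<bar> \<le> Q"
      using continuous_on_Icc_bounded[OF cq'] by blast
    have Q0: "0 \<le> Q" using Q[of 0] by simp
    have bound: "\<bar>integral {0..1} (\<lambda>x. v x * q' j x)\<bar> \<le> (D * Q + K) / real n" if n: "0 < n" for n
    proof -
      define t where "t i = real i / real n" for i
      have t: "t i \<in> {0..1}" if "i \<le> n" for i using that n by (auto simp: t_def)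
      have tS: "t (Suc i) - t i = 1 / real n" for i by (simp add: t_def add_divide_distrib)
      have tn: "t 0 = 0" "t n = 1" using n by (auto simp: t_def)
      have tle: "t i \<le> t (Suc i)" for i by (simp add: t_def divide_right_mono)
      have "integral {0..t k} (\<lambda>x. v x * q' j x) = (\<Sum>i<k. integral {t i..t (Suc i)} (\<lambda>x. v x * q' j x))" if "k \<le> n" for k
        using that
      proof (induction k)
        case (Suc k)
        have "integral {t k..t (Suc k)} (\<lambda>x. v x * q' j x) = integral {0..t (Suc k)} (\<lambda>x. v x * q' j x) - integral {0..t k} (\<lambda>x. v x * q' j x)"
          by (rule integral_diff_interval) (use t[of k] t[of "Suc k"] tle[of k] Suc.prems in \<open>auto intro!: int cq'\<close>)
        then show ?case using Suc by simp
      qed (simp add: tn)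
      from this[of n] have sp: "integral {0..1} (\<lambda>x. v x * q' j x) = (\<Sum>i<n. integral {t i..t (Suc i)} (\<lambda>x. v x * q' j x))"
        by (simp add: tn)
      \<comment> \<open>On one cell \<open>v\<close> is frozen at the left end. The Lipschitz bound
        and the cell length each contribute a factor 1/n, so all \<open>n\<close> cells together err
        by O(1/n).\<close>
      have cell: "\<bar>integral {t i..t (Suc i)} (\<lambda>x. v x * q' j x) - v (t i) * (q (Suc j) (t (Suc i)) - q (Suc j) (t i))\<bar>
         \<le> D * Q / (real n)\<^sup>2" if i: "i < n" for i
      proof -
        have ti: "t i \<in> {0..1}" "t (Suc i) \<in> {0..1}" using t i by auto
        have h: "(q' j has_integral (q (Suc j) (t (Suc i)) - q (Suc j) (t i))) {t i..t (Suc i)}"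
          unfolding q_def q'_def
          by (rule fundamental_theorem_of_calculus[OF tle])
             (auto intro!: poisson_weight_derivative simp: has_real_derivative_iff_has_vector_derivative[symmetric])
        have i1: "(\<lambda>x. v x * q' j x) integrable_on {t i..t (Suc i)}" by (rule int[OF cq']) (use ti in auto)
        have i2: "((\<lambda>x. v (t i) * q' j x) has_integral (v (t i) * (q (Suc j) (t (Suc i)) - q (Suc j) (t i)))) {t i..t (Suc i)}"
          by (rule has_integral_mult_right[OF h])
        have i3: "((\<lambda>x. v x * q' j x - v (t i) * q' j x) has_integral
            (integral {t i..t (Suc i)} (\<lambda>x. v x * q' j x) - v (t i) * (q (Suc j) (t (Suc i)) - q (Suc j) (t i)))) {t i..t (Suc i)}"
          by (rule has_integral_diff[OF integrable_integral[OF i1] i2])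
        have "norm (integral {t i..t (Suc i)} (\<lambda>x. v x * q' j x) - v (t i) * (q (Suc j) (t (Suc i)) - q (Suc j) (t i)))
          \<le> integral {t i..t (Suc i)} (\<lambda>x. D * (1 / real n) * Q)"
          unfolding integral_unique[OF i3, symmetric]
        proof (rule integral_norm_bound_integral)
          show "(\<lambda>x. v x * q' j x - v (t i) * q' j x) integrable_on {t i..t (Suc i)}"
            by (rule has_integral_integrable[OF i3])
          fix x assume x: "x \<in> {t i..t (Suc i)}"
          then have x01: "x \<in> {0..1}" using ti by auto
          have "\<bar>v x - v (t i)\<bar> \<le> D * (1 / real n)"
            using lip[OF x01 ti(1)] x tS[of i] mult_left_mono[OF _ D, of "\<bar>x - t i\<bar>" "1 / real n"] by auto
          then have "\<bar>v x - v (t i)\<bar> * \<bar>q' j x\<bar> \<le> D * (1 / real n) * Q"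
            using Q[of x] x01 D by (intro mult_mono) auto
          then show "norm (v x * q' j x - v (t i) * q' j x) \<le> D * (1 / real n) * Q"
            by (simp add: left_diff_distrib[symmetric] abs_mult)
        qed auto
        also have "\<dots> = D * Q / (real n)\<^sup>2"
          using tS[of i] tle[of i] by (simp add: power2_eq_square)
        finally show ?thesis by simp
      qed
      let ?S = "\<Sum>i<n. v (t i) * (q (Suc j) (t (Suc i)) - q (Suc j) (t i))"
      have "\<bar>integral {0..1} (\<lambda>x. v x * q' j x) - ?S\<bar> \<le> (\<Sum>i<n. D * Q / (real n)\<^sup>2)"
        unfolding sp sum_subtractf[symmetric] by (rule order_trans[OF sum_abs sum_mono]) (use cell in auto)
      also have "\<dots> = D * Q / real n" using n by (simp add: power2_eq_square)
      finally have 1: "\<bar>integral {0..1} (\<lambda>x. v x * q' j x) - ?S\<bar> \<le> D * Q / real n" .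
      have "?S = (\<Sum>i<n. v (t (Suc i)) * q (Suc j) (t (Suc i)) - v (t i) * q (Suc j) (t i))
         - (\<Sum>i<n. (v (t (Suc i)) - v (t i)) * q (Suc j) (t (Suc i)))"
        by (simp add: sum_subtractf[symmetric] algebra_simps)
      \<comment> \<open>Both boundary terms vanish: \<open>v 0 = 0\<close> on the left, and on the
        right a Poisson weight of positive index is 0 because no time is left.\<close>
      also have "(\<Sum>i<n. v (t (Suc i)) * q (Suc j) (t (Suc i)) - v (t i) * q (Suc j) (t i)) = 0"
        by (subst sum_lessThan_telescope) (simp add: tn v0 q_def poisson_weight_def)
      finally have "\<bar>?S\<bar> \<le> K / real n" using sums[OF n, of j] by (simp add: t_def q_def)
      with 1 show ?thesis by (simp add: add_divide_distrib)
    qed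
    have "(\<lambda>n. (D * Q + K) / real n) \<longlonglongrightarrow> 0" by (rule lim_const_over_n)
    then have "\<bar>integral {0..1} (\<lambda>x. v x * q' j x)\<bar> \<le> 0"
    proof (rule LIMSEQ_le_const)
      show "\<exists>k. \<forall>n\<ge>k. \<bar>integral {0..1} (\<lambda>x. v x * q' j x)\<bar> \<le> (D * Q + K) / real n"
        using bound by (intro exI[of _ 1]) simp
    qed
    then show ?thesis by simp
  qed
  \<comment> \<open>That all integrals against \<open>q'\<close> vanish says that \<open>I j\<close>
    does not depend on \<open>j\<close>. The weights tend to 0 as \<open>j\<close> grows, hence the
    common value is 0.\<close>
  define I where "I j = integral {0..1} (\<lambda>x. v x * q j x)" for j
  have "I (Suc j) = I j" for j
  proof -
    have "integral {0..1} (\<lambda>x. v x * q' j x) = integral {0..1} (\<lambda>x. lam * (v x * q (Suc j) x - v x * q j x))"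
      by (simp add: q'_def algebra_simps)
    also have "\<dots> = lam * (I (Suc j) - I j)"
      unfolding I_def using int[OF cq] by (simp add: Henstock_Kurzweil_Integration.integral_diff)
    finally show ?thesis using zero[of j] lam by simp
  qed
  then have I0: "I j = I 0" for j by (induction j) auto
  obtain V where V: "\<And>x. 0 \<le> x \<Longrightarrow> x \<le> 1 \<Longrightarrow> \<bar>v x\<bar> \<le> V"
    using continuous_on_Icc_bounded[OF cv] by blast
  have I_le: "\<bar>I 0\<bar> \<le> V * (lam ^ j / fact j)" for j
  proof -
    have "norm (I j) \<le> integral {0..1} (\<lambda>x::real. V * (lam ^ j / fact j))"
      unfolding I_def
    proof (rule integral_norm_bound_integral)
      fix x :: real assume x: "x \<in> {0..1}"
      then have "\<bar>q j x\<bar> \<le> lam ^ j / fact j"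
        unfolding q_def using poisson_weight_bounds[of "lam * (1 - x)" lam j] lam by (simp add: mult_left_le)
      then show "norm (v x * q j x) \<le> V * (lam ^ j / fact j)"
        unfolding real_norm_def abs_mult using V[of x] x by (intro mult_mono) auto
    qed (auto intro!: int cq)
    then show ?thesis using I0[of j] by simp
  qed
  have "(\<lambda>j. lam ^ j / fact j) \<longlonglongrightarrow> 0"
    using summable_LIMSEQ_zero[OF summable_exp[of lam]] by (simp add: divide_inverse mult.commute)
  from tendsto_mult[OF tendsto_const[of V] this]
  have "\<bar>I 0\<bar> \<le> V * 0" by (rule LIMSEQ_le_const) (use I_le in blast)
  then have Iz: "I j = 0" for j using I0[of j] by simp
  have "v x * exp (- (lam * (1 - x))) = 0"
  proof (rule continuous_moments_zero[OF _ _ x])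
    show "continuous_on {0..1} (\<lambda>x. v x * exp (- (lam * (1 - x))))" by (intro continuous_intros cv)
    fix j
    have "(\<lambda>x. v x * exp (- (lam * (1 - x))) * (1 - x) ^ j) = (\<lambda>x. fact j / lam ^ j * (v x * q j x))"
      using lam by (simp add: q_def poisson_weight_def power_mult_distrib fun_eq_iff)
    then show "integral {0..1} (\<lambda>x. v x * exp (- (lam * (1 - x))) * (1 - x) ^ j) = 0"
      using Iz[of j] by (simp add: I_def)
  qed
  then show ?thesis by simp
qed

section \<open>Paths and increments of the claims\<close>

lemma abs_mult_le: "\<bar>a\<bar> \<le> A \<Longrightarrow> \<bar>z\<bar> \<le> 1 \<Longrightarrow> \<bar>a * z\<bar> \<le> A" for a A z :: real
  using mult_mono[of "\<bar>a\<bar>" A "\<bar>z\<bar>" 1] by (simp add: abs_mult)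

context prob_space
begin

text \<open>Fubini for the product law, in both orders. The first is used with a variable known at
  the start of a time step held fixed, the second with the claim counts held fixed.\<close>

lemma indep_var_integral:
  fixes h :: "_ \<Rightarrow> real"
  assumes ind: "indep_var S U T V" and h [measurable]: "h \<in> borel_measurable (S \<Otimes>\<^sub>M T)"
    and bdd: "\<And>p. \<bar>h p\<bar> \<le> B"
  shows "expectation (\<lambda>\<omega>. h (U \<omega>, V \<omega>)) = expectation (\<lambda>\<omega>. expectation (\<lambda>\<omega>'. h (U \<omega>, V \<omega>')))"
    and "expectation (\<lambda>\<omega>. h (U \<omega>, V \<omega>)) = expectation (\<lambda>\<omega>'. expectation (\<lambda>\<omega>. h (U \<omega>, V \<omega>')))"
proof -
  have [measurable]: "U \<in> measurable M S" "V \<in> measurable M T"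
    using ind by (auto simp: indep_var_distribution_eq)
  interpret D1: prob_space "distr M S U" by (rule prob_space_distr) simp
  interpret D2: prob_space "distr M T V" by (rule prob_space_distr) simp
  interpret P: pair_prob_space "distr M S U" "distr M T V" ..
  have eq: "distr M (S \<Otimes>\<^sub>M T) (\<lambda>\<omega>. (U \<omega>, V \<omega>)) = distr M S U \<Otimes>\<^sub>M distr M T V"
    using ind by (auto simp: indep_var_distribution_eq)
  have int: "integrable (distr M S U \<Otimes>\<^sub>M distr M T V) h"
    by (rule P.P.integrable_const_bound[where B=B]) (use bdd in auto)
  have 1: "expectation (\<lambda>\<omega>. h (U \<omega>, V \<omega>)) = integral\<^sup>L (distr M S U \<Otimes>\<^sub>M distr M T V) h"
    unfolding eq[symmetric] by (subst integral_distr) auto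
  have "integral\<^sup>L (distr M S U \<Otimes>\<^sub>M distr M T V) h = (\<integral>x. (\<integral>y. h (x, y) \<partial>distr M T V) \<partial>distr M S U)"
    by (rule P.integral_fst'[OF int, symmetric])
  also have "\<dots> = expectation (\<lambda>\<omega>. expectation (\<lambda>\<omega>'. h (U \<omega>, V \<omega>')))"
    by (subst integral_distr; measurable?) (auto simp: integral_distr intro!: Bochner_Integration.integral_cong measurable_compose[OF _ h])
  finally show "expectation (\<lambda>\<omega>. h (U \<omega>, V \<omega>)) = expectation (\<lambda>\<omega>. expectation (\<lambda>\<omega>'. h (U \<omega>, V \<omega>')))"
    using 1 by simp
  have "integral\<^sup>L (distr M S U \<Otimes>\<^sub>M distr M T V) h = (\<integral>y. (\<integral>x. h (x, y) \<partial>distr M S U) \<partial>distr M T V)"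
    using P.integral_snd[of "\<lambda>x y. h (x, y)"] int by (simp add: case_prod_beta')
  also have "\<dots> = expectation (\<lambda>\<omega>'. expectation (\<lambda>\<omega>. h (U \<omega>, V \<omega>')))"
    by (subst integral_distr; measurable?) (auto simp: integral_distr intro!: Bochner_Integration.integral_cong measurable_compose[OF _ h])
  finally show "expectation (\<lambda>\<omega>. h (U \<omega>, V \<omega>)) = expectation (\<lambda>\<omega>'. expectation (\<lambda>\<omega>. h (U \<omega>, V \<omega>')))"
    using 1 by simp
qed

lemma indep_var_expectation_mult:
  fixes u v :: "real \<Rightarrow> real"
  assumes ind: "indep_var borel U borel V" and [measurable]: "u \<in> borel_measurable borel" "v \<in> borel_measurable borel"
    and bdd: "\<And>x. \<bar>u x\<bar> \<le> B" "\<And>x. \<bar>v x\<bar> \<le> B'"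
  shows "expectation (\<lambda>\<omega>. u (U \<omega>) * v (V \<omega>)) = expectation (\<lambda>\<omega>. u (U \<omega>)) * expectation (\<lambda>\<omega>. v (V \<omega>))"
proof -
  have "0 \<le> B" using bdd(1)[of 0] by linarith
  then have bd: "\<bar>u (fst p) * v (snd p)\<bar> \<le> B * B'" for p unfolding abs_mult by (intro mult_mono bdd) auto
  show ?thesis
    using indep_var_integral(1)[OF ind, of "\<lambda>p. u (fst p) * v (snd p)", OF _ bd] by simp
qed

lemma bounded_integrable:
  fixes u :: "_ \<Rightarrow> real"
  assumes "u \<in> borel_measurable M" "\<And>\<omega>. \<omega> \<in> space M \<Longrightarrow> \<bar>u \<omega>\<bar> \<le> B"
  shows "integrable M u"
  by (rule integrable_const_bound[where B=B]) (use assms in auto)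

lemma expectation_close:
  fixes u v r :: "_ \<Rightarrow> real"
  assumes "integrable M u" "integrable M v" "integrable M r" "AE \<omega> in M. \<bar>u \<omega> - v \<omega>\<bar> \<le> r \<omega>"
  shows "\<bar>expectation u - expectation v\<bar> \<le> expectation r"
proof -
  have "\<bar>expectation (\<lambda>\<omega>. u \<omega> - v \<omega>)\<bar> \<le> expectation r"
    by (rule order_trans[OF integral_abs_bound integral_mono_AE]) (use assms in auto)
  then show ?thesis using assms by simp
qed

end

context dividend_model
begin

lemma N_event:
  assumes "0 \<le> s" "0 \<le> t"
  shows "{\<omega>\<in>space M. P (N s \<omega>) (N t \<omega>)} \<in> events"
proof -
  have "(\<lambda>\<omega>. P (N s \<omega>) (N t \<omega>)) \<in> measurable M (count_space UNIV)"
  proof (rule measurable_compose_countable[OF _ N_measurable[OF assms(1)], where f="\<lambda>i \<omega>. P i (N t \<omega>)"])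
    fix i show "(\<lambda>\<omega>. P i (N t \<omega>)) \<in> measurable M (count_space UNIV)"
      by (rule measurable_compose[OF N_measurable[OF assms(2)]]) simp
  qed
  then show ?thesis by (simp add: pred_def)
qed

abbreviation "C \<equiv> claims N Y"

text \<open>Positivity is demanded of all claim sizes at once, so that no claim can be invisible in
  the aggregate claims.\<close>

definition good_path :: "'a \<Rightarrow> bool" where
  "good_path \<omega> \<longleftrightarrow> N 0 \<omega> = 0 \<and> mono_on {0..} (\<lambda>t. N t \<omega>) \<and>
     (\<forall>t\<ge>0. continuous (at_right t) (\<lambda>t. real (N t \<omega>))) \<and> (\<forall>i. 0 < Y i \<omega>)"

lemma Y_measurable [measurable]: "Y i \<in> borel_measurable M"
  using distributed_measurable[OF Y_exponential[of i]] by simp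

lemma AE_good_path: "AE \<omega> in M. good_path \<omega>"
proof -
  have "AE \<omega> in M. 0 < Y i \<omega>" for i
  proof -
    have "AE x in lborel. x \<noteq> (0::real)" by (rule AE_lborel_singleton)
    then have "AE x in lborel. 0 < exponential_density alpha x \<longrightarrow> 0 < x"
      by eventually_elim (auto simp: exponential_density_def split: if_splits)
    then show ?thesis by (subst distributed_AE2[OF Y_exponential]) auto
  qed
  then have "AE \<omega> in M. \<forall>i. 0 < Y i \<omega>" by (simp add: AE_all_countable)
  with N_paths show ?thesis by eventually_elim (auto simp: good_path_def)
qed

lemma good_path_N_mono: "good_path \<omega> \<Longrightarrow> 0 \<le> s \<Longrightarrow> s \<le> t \<Longrightarrow> N s \<omega> \<le> N t \<omega>"
  by (auto simp: good_path_def monotone_on_def)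

lemma good_path_claims:
  assumes "good_path \<omega>"
  shows "C 0 \<omega> = 0" "mono_on {0..} (\<lambda>t. C t \<omega>)"
proof -
  show "C 0 \<omega> = 0" using assms by (simp add: claims_def good_path_def)
  show "mono_on {0..} (\<lambda>t. C t \<omega>)"
  proof (rule monotone_onI)
    fix s t :: real assume "s \<in> {0..}" "t \<in> {0..}" "s \<le> t"
    then show "C s \<omega> \<le> C t \<omega>"
      using good_path_N_mono[OF assms, of s t] assms unfolding claims_def
      by (intro sum_mono2) (auto simp: good_path_def less_imp_le)
  qed
qed

text \<open>Since every claim strictly raises the aggregate amount, events about claim numbers can
  be read off increments of \<open>C\<close>, and it is for these that independence of the past is
  assumed.\<close>

lemma good_path_claims_eq_iff:
  assumes "good_path \<omega>" "0 \<le> s" "s \<le> t"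
  shows "C t \<omega> = C s \<omega> \<longleftrightarrow> N t \<omega> = N s \<omega>"
proof
  assume eq: "C t \<omega> = C s \<omega>"
  have le: "N s \<omega> \<le> N t \<omega>" by (rule good_path_N_mono[OF assms])
  show "N t \<omega> = N s \<omega>"
  proof (rule ccontr)
    assume "N t \<omega> \<noteq> N s \<omega>"
    then have "C s \<omega> < C t \<omega>" unfolding claims_def
      using assms(1) le by (intro sum_strict_mono2[where b="N s \<omega>"]) (auto simp: good_path_def less_imp_le)
    then show False using eq by simp
  qed
qed (simp add: claims_def)

lemma good_path_single_claim:
  assumes "N t \<omega> = Suc (N s \<omega>)"
  shows "C t \<omega> - C s \<omega> = Y (N s \<omega>) \<omega>"
  using assms by (simp add: claims_def)

lemma good_path_right_const:
  assumes "good_path \<omega>" "0 \<le> t"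
  obtains \<eta> where "0 < \<eta>" "\<And>s. t \<le> s \<Longrightarrow> s < t + \<eta> \<Longrightarrow> N s \<omega> = N t \<omega>"
proof -
  have "((\<lambda>t. real (N t \<omega>)) \<longlongrightarrow> real (N t \<omega>)) (at_right t)"
    using assms by (auto simp: good_path_def continuous_within)
  then have "\<forall>\<^sub>F s in at_right t. dist (real (N s \<omega>)) (real (N t \<omega>)) < 1"
    by (rule tendstoD) simp
  then obtain u where u: "t < u" "\<And>s. t < s \<Longrightarrow> s < u \<Longrightarrow> dist (real (N s \<omega>)) (real (N t \<omega>)) < 1"
    unfolding eventually_at_right_field by auto
  show thesis
  proof (rule that[of "u - t"])
    fix s assume s: "t \<le> s" "s < t + (u - t)"
    show "N s \<omega> = N t \<omega>" using u(2)[of s] s by (cases "s = t") (auto simp: dist_real_def)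
  qed (use u in simp)
qed

lemma claims_measurable [measurable]: "0 \<le> t \<Longrightarrow> C t \<in> borel_measurable M"
  using claims_adapted[of t] F_subalgebra[of t] measurable_from_subalg by blast

lemma F_measurable_mono: "u \<in> borel_measurable (F s) \<Longrightarrow> s \<le> t \<Longrightarrow> (u :: 'a \<Rightarrow> real) \<in> borel_measurable (F t)"
  using sets_F_mono[of s t] space_F by (auto simp: measurable_def)

lemma F_measurable_M: "u \<in> borel_measurable (F s) \<Longrightarrow> 0 \<le> s \<Longrightarrow> (u :: 'a \<Rightarrow> real) \<in> borel_measurable M"
  using F_subalgebra[of s] measurable_from_subalg by blast

text \<open>\<open>M\<close> is complete and \<open>F 0\<close> contains its null sets, so every
  subset of a null set is \<open>F t\<close>-measurable. This admits processes that are limits only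
  almost surely.\<close>

lemma measurable_F_AE_cong:
  assumes t: "0 \<le> t" and f: "f \<in> borel_measurable (F t)" and ae: "AE \<omega> in M. f \<omega> = u \<omega>"
  shows "(u :: 'a \<Rightarrow> real) \<in> borel_measurable (F t)"
proof (rule measurableI)
  have sp: "space (F t) = space M" by (rule space_F)
  obtain Z where Z: "Z \<in> null_sets M" "{\<omega>\<in>space M. f \<omega> \<noteq> u \<omega>} \<subseteq> Z"
    using ae by (auto elim!: AE_E)
  have null: "A \<in> sets (F t)" if "A \<subseteq> Z" for A
  proof -
    have "A \<in> null_sets M" by (rule null_sets_subset[OF Z(1) complete[OF that Z(1)] that])
    then show ?thesis using F_null sets_F_mono[OF t] by auto
  qed
  fix A :: "real set" assume A: "A \<in> sets borel"
  have "u -` A \<inter> space (F t) = (f -` A \<inter> space (F t) - Z) \<union> (u -` A \<inter> space M \<inter> Z)"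
    using Z(2) sp by auto
  also have "\<dots> \<in> sets (F t)"
    using measurable_sets[OF f A] null[of Z] null[of "u -` A \<inter> space M \<inter> Z"] by auto
  finally show "u -` A \<inter> space (F t) \<in> sets (F t)" .
qed auto

section \<open>Short-time probabilities and independence of the past for claim numbers\<close>

lemma prob_increment:
  assumes "0 \<le> s" "s \<le> t"
  shows "prob {\<omega>\<in>space M. N t \<omega> = N s \<omega> + k} = poisson_weight (lam * (t - s)) k"
proof (cases "s = t")
  case True
  have "{\<omega>\<in>space M. N t \<omega> = N s \<omega> + k} = (if k = 0 then space M else {})" using True by auto
  then show ?thesis using True by (simp add: poisson_weight_def prob_space)
next
  case False
  have pos: "0 < lam * (t - s)" using assms lam_pos False by simp
  have [measurable]: "N t \<in> measurable M (count_space UNIV)" "N s \<in> measurable M (count_space UNIV)"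
    using assms by (auto intro!: N_measurable)
  have "{\<omega>\<in>space M. N t \<omega> = N s \<omega> + k} = {\<omega>\<in>space M. real (N t \<omega>) - real (N s \<omega>) = real k}"
    by auto
  then have "prob {\<omega>\<in>space M. N t \<omega> = N s \<omega> + k}
     = measure (distr M borel (\<lambda>\<omega>. real (N t \<omega>) - real (N s \<omega>))) {real k}"
    by (subst measure_distr) (auto intro!: arg_cong[where f=prob])
  also have "\<dots> = measure (measure_pmf (poisson_pmf (lam * (t - s)))) (real -` {real k})"
    using N_increments[of s t] assms False by (subst N_increments) (auto simp: measure_distr)
  also have "real -` {real k} = {k}" by auto
  finally show ?thesis using pos by (simp add: measure_pmf_single poisson_weight_def)
qed

text \<open>On a good path: at least two claims in the interval. Its probability is of second order
  in the length, so the union over the cells of a fine grid is negligible.\<close>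

definition two_claims :: "real \<Rightarrow> real \<Rightarrow> 'a set" where
  "two_claims s t = {\<omega>\<in>space M. N t \<omega> \<noteq> N s \<omega> \<and> N t \<omega> \<noteq> Suc (N s \<omega>)}"

lemma two_claims_measurable [measurable]: "0 \<le> s \<Longrightarrow> 0 \<le> t \<Longrightarrow> two_claims s t \<in> events"
  unfolding two_claims_def by (rule N_event)

lemma prob_two_claims:
  assumes "0 \<le> s" "s \<le> t"
  shows "prob (two_claims s t) \<le> (lam * (t - s))\<^sup>2"
proof -
  let ?a = "lam * (t - s)" and ?E = "\<lambda>k. {\<omega>\<in>space M. N t \<omega> = N s \<omega> + k}"
  have a: "0 \<le> ?a" using assms lam_pos by simp
  have m: "?E k \<in> events" for k by (rule N_event) (use assms in auto)
  have "prob (two_claims s t) = prob (space M - (?E 0 \<union> ?E 1))"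
    by (rule arg_cong[where f=prob]) (auto simp: two_claims_def)
  also have "\<dots> = 1 - prob (?E 0 \<union> ?E 1)" by (rule prob_compl[OF sets.Un[OF m m]])
  also have "prob (?E 0 \<union> ?E 1) = prob (?E 0) + prob (?E 1)"
    by (rule finite_measure_Union[OF m m]) auto
  also have "1 - \<dots> = 1 - exp (- ?a) * (1 + ?a)"
    unfolding prob_increment[OF assms] by (simp add: poisson_weight_def algebra_simps)
  also have "\<dots> \<le> 1 - (1 - ?a) * (1 + ?a)"
    using mult_right_mono[of "1 - ?a" "exp (- ?a)" "1 + ?a"] exp_ge_add_one_self[of "- ?a"] a by auto
  also have "\<dots> = ?a\<^sup>2" by (simp add: power2_eq_square algebra_simps)
  finally show ?thesis .
qed

lemma prob_claim_le:
  assumes "0 \<le> s" "s \<le> t"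
  shows "prob {\<omega>\<in>space M. N t \<omega> \<noteq> N s \<omega>} \<le> lam * (t - s)"
proof -
  have m: "{\<omega>\<in>space M. N t \<omega> = N s \<omega> + 0} \<in> events" by (rule N_event) (use assms in auto)
  have "prob {\<omega>\<in>space M. N t \<omega> \<noteq> N s \<omega>} = prob (space M - {\<omega>\<in>space M. N t \<omega> = N s \<omega> + 0})"
    by (rule arg_cong[where f=prob]) auto
  also have "\<dots> = 1 - exp (- (lam * (t - s)))"
    using prob_compl[OF m] prob_increment[OF assms, of 0] by (simp add: poisson_weight_def)
  finally show ?thesis using exp_ge_add_one_self[of "- (lam * (t - s))"] by simp
qed

lemma expectation_claim_size:
  fixes f :: "real \<Rightarrow> real"
  assumes "f \<in> borel_measurable borel"
  shows "expectation (\<lambda>\<omega>. f (Y k \<omega>)) = (\<integral>y. f y \<partial>density lborel (exponential_density alpha))"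
  unfolding distributed_distr_eq_density[OF Y_exponential, symmetric, of k]
  by (rule integral_distr[symmetric]) (use assms in auto)

text \<open>The model states independence between \<open>F s\<close> and preimages under the
  increment. Both families are stable under intersection, so it passes to the generated
  sigma-algebras, and that of \<open>U\<close> lies inside \<open>F s\<close>.\<close>

lemma claims_increment_indep:
  assumes st: "0 \<le> s" "s \<le> t" and U: "U \<in> borel_measurable (F s)"
  shows "indep_var borel U borel (\<lambda>\<omega>. C t \<omega> - C s \<omega>)"
  unfolding indep_var_eq
proof (intro conjI)
  have sub: "subalgebra M (F s)" using F_subalgebra st by auto
  show "random_variable borel U" using measurable_from_subalg[OF sub] U by blast
  show "random_variable borel (\<lambda>\<omega>. C t \<omega> - C s \<omega>)"
    using st by (intro borel_measurable_diff claims_measurable) auto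
  let ?B = "{(\<lambda>\<omega>. C t \<omega> - C s \<omega>) -` A \<inter> space M | A. A \<in> sets borel}"
  have "indep_set (sigma_sets (space M) (sets (F s))) (sigma_sets (space M) ?B)"
  proof (rule indep_set_sigma_sets[OF claims_indep[OF st]])
    show "Int_stable (sets (F s))" by (rule sets.Int_stable)
    show "Int_stable ?B"
    proof (rule Int_stableI, clarify)
      fix A A' :: "real set" assume "A \<in> sets borel" "A' \<in> sets borel"
      then show "\<exists>A''. (\<lambda>\<omega>. C t \<omega> - C s \<omega>) -` A \<inter> space M \<inter> ((\<lambda>\<omega>. C t \<omega> - C s \<omega>) -` A' \<inter> space M) = (\<lambda>\<omega>. C t \<omega> - C s \<omega>) -` A'' \<inter> space M \<and> A'' \<in> sets borel"
        by (intro exI[of _ "A \<inter> A'"]) auto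
    qed
  qed
  then show "indep_set (sigma_sets (space M) {U -` A \<inter> space M | A. A \<in> sets borel}) (sigma_sets (space M) ?B)"
    unfolding indep_set_def
  proof (rule indep_sets_mono_sets)
    fix i :: bool
    have "{U -` A \<inter> space M | A. A \<in> sets borel} \<subseteq> sets (F s)"
      using measurable_sets[OF U] sub by (auto simp: subalgebra_def)
    then have "sigma_sets (space M) {U -` A \<inter> space M | A. A \<in> sets borel} \<subseteq> sigma_sets (space M) (sets (F s))"
      by (rule sigma_sets_mono')
    then show "case_bool (sigma_sets (space M) {U -` A \<inter> space M | A. A \<in> sets borel}) (sigma_sets (space M) ?B) i
      \<subseteq> case_bool (sigma_sets (space M) (sets (F s))) (sigma_sets (space M) ?B) i"
      by (auto split: bool.split)
  qed
qed

lemma expectation_mult_claims_increment: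
  assumes "0 \<le> s" "s \<le> t" and U: "U \<in> borel_measurable (F s)" "\<And>\<omega>. \<bar>U \<omega>\<bar> \<le> B"
    and v: "v \<in> borel_measurable borel" "\<And>x. \<bar>v x\<bar> \<le> (B'::real)"
  shows "expectation (\<lambda>\<omega>. U \<omega> * v (C t \<omega> - C s \<omega>)) = expectation U * expectation (\<lambda>\<omega>. v (C t \<omega> - C s \<omega>))"
proof -
  \<comment> \<open>Truncation at \<open>B\<close> leaves \<open>U\<close> unchanged but is bounded
    on the whole line, as the product rule for functions of the two variables demands.\<close>
  define u where "u x = max (- B) (min B x)" for x :: real
  have B: "0 \<le> B" using U(2) by (meson abs_ge_zero order_trans)
  have u: "u (U \<omega>) = U \<omega>" for \<omega> using U(2)[of \<omega>] by (auto simp: u_def)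
  have "expectation (\<lambda>\<omega>. u (U \<omega>) * v (C t \<omega> - C s \<omega>)) = expectation (\<lambda>\<omega>. u (U \<omega>)) * expectation (\<lambda>\<omega>. v (C t \<omega> - C s \<omega>))"
    by (rule indep_var_expectation_mult[OF claims_increment_indep[OF assms(1,2) U(1)] _ v(1) _ v(2), of _ B])
       (use B in \<open>auto simp: u_def\<close>)
  then show ?thesis by (simp add: u)
qed

text \<open>Counts cells, not claims: each summand depends on a single increment of the aggregate
  claims, so that independence of the past can be used cell by cell.\<close>

primrec grid_count :: "real \<Rightarrow> real \<Rightarrow> nat \<Rightarrow> 'a \<Rightarrow> nat" where
  "grid_count t h 0 \<omega> = 0"
| "grid_count t h (Suc l) \<omega> = grid_count t h l \<omega> + (if C (t + real (Suc l) * h) \<omega> - C (t + real l * h) \<omega> = 0 then 0 else 1)"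

lemma grid_count_measurable:
  assumes "0 \<le> t" "0 \<le> h"
  shows "grid_count t h l \<in> measurable (F (t + real l * h)) (count_space UNIV)"
proof (induction l)
  case (Suc l)
  have le: "t + real l * h \<le> t + real (Suc l) * h" using assms by (simp add: mult_right_mono)
  have [measurable]: "grid_count t h l \<in> measurable (F (t + real (Suc l) * h)) (count_space UNIV)"
    using Suc sets_F_mono[OF le] space_F by (auto simp: measurable_def)
  have [measurable]: "C (t + real l * h) \<in> borel_measurable (F (t + real (Suc l) * h))"
    by (rule F_measurable_mono[OF claims_adapted le]) (use assms in simp)
  have [measurable]: "C (t + real (Suc l) * h) \<in> borel_measurable (F (t + real (Suc l) * h))"
    by (rule claims_adapted) (use assms in simp)
  show ?case unfolding grid_count.simps by measurable
qed simp

text \<open>The expectation splits according to whether the last cell contains a claim, and that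
  cell is independent of everything before it. The step is proved for general \<open>V\<close>
  because it is needed twice: for \<open>U\<close>, and for the constant 1, where it evaluates the
  second factor of the right side.\<close>

lemma grid_count_indep:
  fixes \<phi> :: "nat \<Rightarrow> real"
  assumes t: "0 \<le> t" "0 \<le> h" and U: "U \<in> borel_measurable (F t)" "\<And>\<omega>. \<bar>U \<omega>\<bar> \<le> B"
    and \<phi>: "\<And>n. \<bar>\<phi> n\<bar> \<le> B'"
  shows "expectation (\<lambda>\<omega>. U \<omega> * \<phi> (grid_count t h l \<omega>)) = expectation U * expectation (\<lambda>\<omega>. \<phi> (grid_count t h l \<omega>))"
  using \<phi>
proof (induction l arbitrary: \<phi>)
  case 0
  then show ?case by (simp add: prob_space)
next
  case (Suc l)
  let ?s = "t + real l * h" and ?t = "t + real (Suc l) * h"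
  have st: "0 \<le> ?s" "?s \<le> ?t" "t \<le> ?s" using t by (auto simp: mult_right_mono)
  define z :: "real \<Rightarrow> real" where "z x = (if x = 0 then 1 else 0)" for x
  have zm [measurable]: "z \<in> borel_measurable borel" unfolding z_def by measurable
  have zm': "(\<lambda>x. 1 - z x) \<in> borel_measurable borel" by measurable
  have zb: "\<bar>z x\<bar> \<le> 1" "\<bar>1 - z x\<bar> \<le> 1" for x by (auto simp: z_def)
  let ?z = "\<lambda>\<omega>. z (C ?t \<omega> - C ?s \<omega>)" and ?G = "grid_count t h l"
  have B: "0 \<le> B" "0 \<le> B'" using U(2) Suc.prems by (meson abs_ge_zero order_trans)+
  have step: "expectation (\<lambda>\<omega>. V \<omega> * \<phi> (grid_count t h (Suc l) \<omega>))
     = expectation V * (expectation (\<lambda>\<omega>. \<phi> (?G \<omega>)) * expectation ?z + expectation (\<lambda>\<omega>. \<phi> (Suc (?G \<omega>))) * expectation (\<lambda>\<omega>. 1 - ?z \<omega>))"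
    if V: "V \<in> borel_measurable (F t)" "\<And>\<omega>. \<bar>V \<omega>\<bar> \<le> K"
      and IH: "\<And>\<phi>. (\<And>n. \<bar>\<phi> n\<bar> \<le> B') \<Longrightarrow> expectation (\<lambda>\<omega>. V \<omega> * \<phi> (?G \<omega>)) = expectation V * expectation (\<lambda>\<omega>. \<phi> (?G \<omega>))" for V K
  proof -
    have [measurable]: "V \<in> borel_measurable (F ?s)" by (rule F_measurable_mono[OF V(1) st(3)])
    have [measurable]: "V \<in> borel_measurable M" by (rule F_measurable_M[OF V(1) t(1)])
    have [measurable]: "?G \<in> measurable (F ?s) (count_space UNIV)" by (rule grid_count_measurable[OF t])
    have K: "0 \<le> K" using V(2) by (meson abs_ge_zero order_trans)
    have bb: "\<bar>V \<omega> * \<phi> n\<bar> \<le> K * B'" for \<omega> n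
      unfolding abs_mult using V(2) Suc.prems K by (intro mult_mono) auto
    have m1: "(\<lambda>\<omega>. V \<omega> * \<phi> (?G \<omega>)) \<in> borel_measurable (F ?s)" "(\<lambda>\<omega>. V \<omega> * \<phi> (Suc (?G \<omega>))) \<in> borel_measurable (F ?s)"
      by measurable
    have [measurable]: "(\<lambda>\<omega>. V \<omega> * \<phi> (?G \<omega>)) \<in> borel_measurable M" "(\<lambda>\<omega>. V \<omega> * \<phi> (Suc (?G \<omega>))) \<in> borel_measurable M"
      by (rule F_measurable_M[OF m1(1) st(1)], rule F_measurable_M[OF m1(2) st(1)])
    have [measurable]: "?z \<in> borel_measurable M"
      using st t by (intro measurable_compose[OF _ zm] borel_measurable_diff claims_measurable) auto
    have int: "integrable M (\<lambda>\<omega>. V \<omega> * \<phi> (?G \<omega>) * ?z \<omega>)" "integrable M (\<lambda>\<omega>. V \<omega> * \<phi> (Suc (?G \<omega>)) * (1 - ?z \<omega>))"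
      by (rule bounded_integrable[where B="K * B'"], measurable, rule abs_mult_le[OF bb], simp add: zb)+
    have "expectation (\<lambda>\<omega>. V \<omega> * \<phi> (grid_count t h (Suc l) \<omega>)) = expectation (\<lambda>\<omega>. V \<omega> * \<phi> (?G \<omega>) * ?z \<omega> + V \<omega> * \<phi> (Suc (?G \<omega>)) * (1 - ?z \<omega>))"
      by (rule Bochner_Integration.integral_cong) (auto simp: z_def)
    also have "\<dots> = expectation (\<lambda>\<omega>. V \<omega> * \<phi> (?G \<omega>)) * expectation ?z + expectation (\<lambda>\<omega>. V \<omega> * \<phi> (Suc (?G \<omega>))) * expectation (\<lambda>\<omega>. 1 - ?z \<omega>)"
      by (simp only: Bochner_Integration.integral_add[OF int] expectation_mult_claims_increment[OF st(1,2) m1(1) bb zm zb(1)]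
        expectation_mult_claims_increment[OF st(1,2) m1(2) bb zm' zb(2)])
    finally show ?thesis
      using IH[of \<phi>] IH[of "\<lambda>n. \<phi> (Suc n)"] Suc.prems by (simp add: algebra_simps)
  qed
  have 1: "expectation (\<lambda>\<omega>. 1 * \<phi> (grid_count t h (Suc l) \<omega>))
     = expectation (\<lambda>_. 1) * (expectation (\<lambda>\<omega>. \<phi> (?G \<omega>)) * expectation ?z + expectation (\<lambda>\<omega>. \<phi> (Suc (?G \<omega>))) * expectation (\<lambda>\<omega>. 1 - ?z \<omega>))"
    by (rule step[of "\<lambda>_. 1" 1]) (auto simp: prob_space)
  have e1: "expectation (\<lambda>_. 1 :: real) = 1" by (simp add: prob_space)
  show ?case using step[OF U Suc.IH] by (simp only: 1[unfolded e1 mult_1_left])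
qed

lemma grid_count_eq:
  assumes good: "good_path \<omega>" "\<omega> \<in> space M" and t: "0 \<le> t" "0 \<le> h"
    and single: "\<And>i. i < l \<Longrightarrow> \<omega> \<notin> two_claims (t + real i * h) (t + real (Suc i) * h)"
  shows "N (t + real l * h) \<omega> = N t \<omega> + grid_count t h l \<omega>"
  using single
proof (induction l)
  case (Suc l)
  have le: "0 \<le> t + real l * h" "t + real l * h \<le> t + real (Suc l) * h" using t by (auto simp: mult_right_mono)
  have "N (t + real (Suc l) * h) \<omega> = N (t + real l * h) \<omega> \<or> N (t + real (Suc l) * h) \<omega> = Suc (N (t + real l * h) \<omega>)"
    using Suc.prems[of l] good(2) by (auto simp: two_claims_def)
  moreover have "N (t + real l * h) \<omega> = N t \<omega> + grid_count t h l \<omega>" using Suc by simp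
  ultimately show ?case using good_path_claims_eq_iff[OF good(1) le] by auto
qed simp

text \<open>
  The number of claims in \<open>(t, u]\<close> is approximated by the number of grid cells with a claim,
  which is determined by increments of the aggregate claims.
\<close>

lemma count_increment_indep:
  assumes tu: "0 \<le> t" "t \<le> u" and U: "U \<in> borel_measurable (F t)" "\<And>\<omega>. \<bar>U \<omega>\<bar> \<le> B"
  shows "expectation (\<lambda>\<omega>. U \<omega> * indicator {\<omega>\<in>space M. N u \<omega> = N t \<omega> + j} \<omega>) = expectation U * poisson_weight (lam * (u - t)) j"
proof -
  let ?A = "{\<omega>\<in>space M. N u \<omega> = N t \<omega> + j}"
  have [measurable]: "?A \<in> events" by (rule N_event) (use tu in auto)
  have B: "0 \<le> B" using U(2) by (meson abs_ge_zero order_trans)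
  have Um [measurable]: "U \<in> borel_measurable M" by (rule F_measurable_M[OF U(1) tu(1)])
  \<comment> \<open>The left side is free of \<open>n\<close>. The error comes from cells with two
    claims, of total probability at most \<open>n * (lam * h)\<^sup>2\<close>, which is of order
    1/n.\<close>
  have bound: "\<bar>expectation (\<lambda>\<omega>. U \<omega> * indicator ?A \<omega>) - expectation U * prob ?A\<bar> \<le> 2 * B * (lam * (u - t))\<^sup>2 / real n"
    if n: "0 < n" for n
  proof -
    define h where "h = (u - t) / real n"
    have h: "0 \<le> h" "t + real n * h = u" using tu n by (auto simp: h_def)
    let ?G = "grid_count t h n"
    define \<phi> :: "nat \<Rightarrow> real" where "\<phi> i = (if i = j then 1 else 0)" for i
    define A where "A i = two_claims (t + real i * h) (t + real (Suc i) * h)" for i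
    let ?R = "\<lambda>\<omega>. \<Sum>i<n. indicator (A i) \<omega> :: real"
    have pos: "0 \<le> t + real i * h" for i using tu h by simp
    have Gm [measurable]: "?G \<in> measurable M (count_space UNIV)"
      using grid_count_measurable[OF tu(1) h(1), of n] F_subalgebra[of u] h(2) tu
      by (auto simp: measurable_def subalgebra_def)
    have Am [measurable]: "A i \<in> events" for i
      unfolding A_def by (intro two_claims_measurable pos)
    have ae: "AE \<omega> in M. \<bar>indicator ?A \<omega> - \<phi> (?G \<omega>)\<bar> \<le> ?R \<omega>"
      using AE_good_path AE_space
    proof eventually_elim
      fix \<omega> assume good: "good_path \<omega>" "\<omega> \<in> space M"
      show "\<bar>indicator ?A \<omega> - \<phi> (?G \<omega>)\<bar> \<le> ?R \<omega>"
      proof (cases "\<exists>i<n. \<omega> \<in> A i")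
        case True
        then obtain i where i: "i < n" "\<omega> \<in> A i" by auto
        then have "1 \<le> ?R \<omega>"
          using member_le_sum[of i "{..<n}" "\<lambda>i. indicator (A i) \<omega> :: real"] by simp
        moreover have "\<bar>indicator ?A \<omega> - \<phi> (?G \<omega>)\<bar> \<le> 1" by (auto simp: \<phi>_def indicator_def)
        ultimately show ?thesis by linarith
      next
        case False
        then have "N u \<omega> = N t \<omega> + ?G \<omega>"
          using grid_count_eq[OF good tu(1) h(1), of n] h(2) by (auto simp: A_def)
        then have "indicator ?A \<omega> = \<phi> (?G \<omega>)" using good by (auto simp: \<phi>_def indicator_def)
        then show ?thesis by (simp add: sum_nonneg)
      qed
    qed
    have ER: "expectation ?R \<le> (lam * (u - t))\<^sup>2 / real n"
    proof -
      have "expectation ?R = (\<Sum>i<n. prob (A i))"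
        by (subst Bochner_Integration.integral_sum) (auto simp: emeasure_eq_measure Int_absorb2 sets.sets_into_space[OF Am])
      also have "\<dots> \<le> (\<Sum>i<n. (lam * h)\<^sup>2)"
      proof (rule sum_mono)
        fix i
        show "prob (A i) \<le> (lam * h)\<^sup>2"
          using prob_two_claims[of "t + real i * h" "t + real (Suc i) * h"] pos[of i] h
          by (simp add: A_def algebra_simps)
      qed
      also have "\<dots> = (lam * (u - t))\<^sup>2 / real n" using n by (simp add: h_def power2_eq_square)
      finally show ?thesis .
    qed
    have iR: "integrable M ?R" by (intro Bochner_Integration.integrable_sum) (auto simp: emeasure_eq_measure)
    have i1: "integrable M (\<lambda>\<omega>. U \<omega> * indicator ?A \<omega>)" "integrable M (\<lambda>\<omega>. U \<omega> * \<phi> (?G \<omega>))"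
      by (rule bounded_integrable[where B=B]; use U(2) B in \<open>auto simp: \<phi>_def indicator_def\<close>)+
    have i2: "integrable M (indicator ?A :: 'a \<Rightarrow> real)" "integrable M (\<lambda>\<omega>. \<phi> (?G \<omega>))"
      by (rule bounded_integrable[where B=1]; auto simp: \<phi>_def indicator_def)+
    have "\<bar>expectation (\<lambda>\<omega>. U \<omega> * indicator ?A \<omega>) - expectation (\<lambda>\<omega>. U \<omega> * \<phi> (?G \<omega>))\<bar> \<le> expectation (\<lambda>\<omega>. B * ?R \<omega>)"
    proof (rule expectation_close[OF i1])
      show "integrable M (\<lambda>\<omega>. B * ?R \<omega>)" using iR by simp
      show "AE \<omega> in M. \<bar>U \<omega> * indicator ?A \<omega> - U \<omega> * \<phi> (?G \<omega>)\<bar> \<le> B * ?R \<omega>"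
        using ae
      proof eventually_elim
        fix \<omega> assume "\<bar>indicator ?A \<omega> - \<phi> (?G \<omega>)\<bar> \<le> ?R \<omega>"
        then show "\<bar>U \<omega> * indicator ?A \<omega> - U \<omega> * \<phi> (?G \<omega>)\<bar> \<le> B * ?R \<omega>"
          unfolding right_diff_distrib[symmetric] abs_mult using U(2) B by (intro mult_mono) auto
      qed
    qed
    moreover have "\<bar>expectation (\<lambda>\<omega>. indicator ?A \<omega>) - expectation (\<lambda>\<omega>. \<phi> (?G \<omega>))\<bar> \<le> expectation ?R"
      by (rule expectation_close[OF i2 iR ae])
    moreover have "expectation (\<lambda>\<omega>. U \<omega> * \<phi> (?G \<omega>)) = expectation U * expectation (\<lambda>\<omega>. \<phi> (?G \<omega>))"
      by (rule grid_count_indep[OF tu(1) h(1) U, of _ 1]) (auto simp: \<phi>_def)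
    moreover have "\<bar>expectation U\<bar> \<le> B"
    proof -
      have "\<bar>expectation U\<bar> \<le> expectation (\<lambda>_. B)"
        by (rule order_trans[OF integral_abs_bound integral_mono]) (use U(2) bounded_integrable[OF Um U(2)] in auto)
      then show ?thesis by (simp add: prob_space)
    qed
    ultimately have "\<bar>expectation (\<lambda>\<omega>. U \<omega> * indicator ?A \<omega>) - expectation U * expectation (\<lambda>\<omega>. \<phi> (?G \<omega>))\<bar> \<le> B * expectation ?R"
      "\<bar>expectation U * prob ?A - expectation U * expectation (\<lambda>\<omega>. \<phi> (?G \<omega>))\<bar> \<le> B * expectation ?R"
      using B by (auto simp: right_diff_distrib[symmetric] abs_mult intro!: mult_mono)
    then have "\<bar>expectation (\<lambda>\<omega>. U \<omega> * indicator ?A \<omega>) - expectation U * prob ?A\<bar> \<le> 2 * (B * expectation ?R)" by linarith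
    also have "\<dots> \<le> 2 * (B * ((lam * (u - t))\<^sup>2 / real n))" using ER B by (intro mult_left_mono) auto
    finally show ?thesis by (simp add: algebra_simps)
  qed
  have "\<bar>expectation (\<lambda>\<omega>. U \<omega> * indicator ?A \<omega>) - expectation U * prob ?A\<bar> \<le> 0"
    by (rule LIMSEQ_le_const[OF lim_const_over_n[of "2 * B * (lam * (u - t))\<^sup>2"]]) (use bound in \<open>auto intro!: exI[of _ 1]\<close>)
  then show ?thesis using prob_increment[OF tu, of j] by simp
qed

end

section \<open>First-order expansion over a short time step\<close>

lemma abs_indicator_le: "\<bar>indicator A x :: real\<bar> \<le> 1"
  by (simp add: indicator_def)

context dividend_model
begin

context
  fixes f :: "real \<Rightarrow> real" and B m :: real and k :: nat
  assumes f [measurable]: "f \<in> borel_measurable borel" and f_bdd: "\<And>y. \<bar>f y\<bar> \<le> B"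
    and m: "m = (\<integral>y. f y \<partial>density lborel (exponential_density alpha))"
begin

lemma bound_nonneg: "0 \<le> B" using f_bdd[of 0] by linarith

lemma f_Y_integrable: "integrable M (\<lambda>\<omega>. f (Y i \<omega>))"
  by (rule bounded_integrable[where B=B]) (use f_bdd in auto)

lemma mean_bounded: "\<bar>m\<bar> \<le> B"
proof -
  have "\<bar>expectation (\<lambda>\<omega>. f (Y 0 \<omega>))\<bar> \<le> expectation (\<lambda>_. B)"
    by (rule order_trans[OF integral_abs_bound integral_mono]) (use f_bdd f_Y_integrable[of 0] in auto)
  then show ?thesis using expectation_claim_size[OF f, of 0] by (simp add: m prob_space)
qed

lemma centered_bounded: "\<bar>f y - m\<bar> \<le> 2 * B"
  using f_bdd[of y] mean_bounded by linarith

text \<open>The centred value of \<open>f\<close> at the first claim after time \<open>k\<close>.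
  Claims are numbered from 0, so its index is \<open>N (real k) \<omega>\<close> itself.\<close>

definition next_claim :: "'a \<Rightarrow> real" where
  "next_claim \<omega> = f (Y (N (real k) \<omega>) \<omega>) - m"

lemma next_claim_measurable [measurable]: "next_claim \<in> borel_measurable M"
proof -
  have "(\<lambda>\<omega>. f (Y (N (real k) \<omega>) \<omega>)) \<in> borel_measurable M"
    by (rule measurable_compose_countable[OF _ N_measurable, where f="\<lambda>i \<omega>. f (Y i \<omega>)"]) auto
  then show ?thesis unfolding next_claim_def[abs_def] by measurable
qed

text \<open>
  The hypothesis on \<open>Y\<close> and \<open>N\<close> yields independence of the claim sizes from the claim
  numbers at integer times only: the index of the second family is coerced to a natural number.
\<close>

lemma next_claim_integer_mean:
  "expectation (\<lambda>\<omega>. next_claim \<omega> * indicator {\<omega>\<in>space M. N (real (Suc k)) \<omega> = N (real k) \<omega> + j} \<omega>) = 0"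
proof -
  let ?T = "PiM {0..} (\<lambda>_. count_space UNIV) :: (nat \<Rightarrow> real) measure"
  let ?V = "\<lambda>\<omega> (i::nat). real ((\<lambda>t\<in>{0..}. N t \<omega>) (real i))"
  \<comment> \<open>The coerced counts are real numbers; rounding down and \<open>nat\<close> turn
    the count at time \<open>k\<close> back into a claim index.\<close>
  define h :: "(nat \<Rightarrow> real) \<times> (nat \<Rightarrow> real) \<Rightarrow> real" where
    "h p = (f (fst p (nat \<lfloor>snd p k\<rfloor>)) - m) * (if snd p (Suc k) = snd p k + real j then 1 else 0)" for p
  have comp: "(\<lambda>n. n i) \<in> measurable ?T (count_space UNIV)" for i
    by (rule measurable_component_singleton) simp
  have comp_b: "(\<lambda>p. snd p i) \<in> borel_measurable (PiM UNIV (\<lambda>_. borel) \<Otimes>\<^sub>M ?T)" for i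
    by (rule measurable_compose[OF measurable_snd measurable_compose[OF comp]]) simp
  have comp_n: "(\<lambda>p. nat \<lfloor>snd p k\<rfloor>) \<in> measurable (PiM UNIV (\<lambda>_. borel) \<Otimes>\<^sub>M ?T) (count_space UNIV)"
    by (rule measurable_compose[OF measurable_snd measurable_compose[OF comp]]) simp
  have comp_f: "(\<lambda>p. f (fst p (nat \<lfloor>snd p k\<rfloor>))) \<in> borel_measurable (PiM UNIV (\<lambda>_. borel) \<Otimes>\<^sub>M ?T)"
    by (rule measurable_compose_countable[OF _ comp_n, where f="\<lambda>i p. f (fst p i)"])
       (rule measurable_compose[OF measurable_fst], measurable)
  have hm: "h \<in> borel_measurable (PiM UNIV (\<lambda>_. borel) \<Otimes>\<^sub>M ?T)"
    unfolding h_def using comp_f comp_b[of k] comp_b[of "Suc k"] by measurable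
  have hb: "\<bar>h p\<bar> \<le> 2 * B" for p
    unfolding h_def using centered_bounded bound_nonneg by (auto simp: abs_mult)
  have "expectation (\<lambda>\<omega>. next_claim \<omega> * indicator {\<omega>\<in>space M. N (real (Suc k)) \<omega> = N (real k) \<omega> + j} \<omega>)
     = expectation (\<lambda>\<omega>. h (\<lambda>i. Y i \<omega>, ?V \<omega>))"
    by (rule Bochner_Integration.integral_cong) (auto simp: h_def next_claim_def indicator_def)
  also have "\<dots> = expectation (\<lambda>\<omega>'. expectation (\<lambda>\<omega>. h (\<lambda>i. Y i \<omega>, ?V \<omega>')))"
    by (rule indep_var_integral(2)[OF Y_N_indep hm hb])
  also have "\<dots> = expectation (\<lambda>\<omega>'. 0)"
  proof (rule Bochner_Integration.integral_cong[OF refl])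
    fix \<omega>'
    \<comment> \<open>With the counts held fixed the claim index is a constant, and \<open>m\<close>
      is the mean of \<open>f\<close> at every index.\<close>
    show "expectation (\<lambda>\<omega>. h (\<lambda>i. Y i \<omega>, ?V \<omega>')) = 0"
      using expectation_claim_size[OF f] f_Y_integrable by (simp add: h_def m prob_space)
  qed
  finally show ?thesis by simp
qed

definition claimed :: "real \<Rightarrow> 'a \<Rightarrow> real" where
  "claimed t = indicator {\<omega>\<in>space M. N t \<omega> \<noteq> N (real k) \<omega>}"

text \<open>The correlation between the size of the first claim after \<open>k\<close> and the event
  that it has occurred by time \<open>t\<close>. That it vanishes on the unit interval is the
  independence of size and time which has to be recovered.\<close>

definition first_claim_mean :: "real \<Rightarrow> real" where
  "first_claim_mean t = expectation (\<lambda>\<omega>. next_claim \<omega> * claimed t \<omega>)"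

text \<open>An observable version, built from increments of \<open>C\<close> alone, of the
  contribution of a first claim in \<open>(s, t]\<close>: no claim in \<open>(k, s]\<close>, then a
  claim in the cell. It differs from the increment of \<open>next_claim * claimed\<close> only on
  \<open>two_claims s t\<close>, and it is known at time \<open>t\<close>.\<close>

definition cell_claim :: "real \<Rightarrow> real \<Rightarrow> 'a \<Rightarrow> real" where
  "cell_claim s t \<omega> = (if C s \<omega> - C (real k) \<omega> = 0 then 1 else 0) *
     ((f (C t \<omega> - C s \<omega>) - m) * (if C t \<omega> - C s \<omega> = 0 then 0 else 1))"

lemma next_claim_bounded: "\<bar>next_claim \<omega>\<bar> \<le> 2 * B"
  unfolding next_claim_def by (rule centered_bounded)

lemma cell_claim_bounded: "\<bar>cell_claim s t \<omega>\<bar> \<le> 2 * B"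
  unfolding cell_claim_def using centered_bounded bound_nonneg by (auto simp: abs_mult)

lemma cell_claim_measurable:
  assumes "real k \<le> s" "s \<le> t"
  shows "cell_claim s t \<in> borel_measurable (F t)"
proof -
  have le: "0 \<le> s" "0 \<le> t" "real k \<le> t" using assms by auto
  have [measurable]: "C t \<in> borel_measurable (F t)" by (rule claims_adapted[OF le(2)])
  have [measurable]: "C s \<in> borel_measurable (F t)" by (rule F_measurable_mono[OF claims_adapted[OF le(1)] assms(2)])
  have [measurable]: "C (real k) \<in> borel_measurable (F t)" by (rule F_measurable_mono[OF claims_adapted le(3)]) simp
  show ?thesis unfolding cell_claim_def[abs_def] by measurable
qed

lemma claimed_measurable [measurable]: "0 \<le> t \<Longrightarrow> claimed t \<in> borel_measurable M"
  unfolding claimed_def by (intro borel_measurable_indicator N_event) auto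

lemma claimed_range: "claimed t \<omega> \<in> {0..1}"
  by (auto simp: claimed_def indicator_def)

lemma next_claimed_integrable: "0 \<le> t \<Longrightarrow> integrable M (\<lambda>\<omega>. next_claim \<omega> * claimed t \<omega>)"
  using claimed_range by (intro bounded_integrable[where B="2 * B"] abs_mult_le next_claim_bounded) auto

lemma cell_cases:
  assumes good: "good_path \<omega>" "\<omega> \<in> space M" and st: "real k \<le> s" "s \<le> t"
  shows "\<omega> \<in> two_claims s t \<or>
    cell_claim s t \<omega> = next_claim \<omega> * (claimed t \<omega> - claimed s \<omega>) \<and>
    (claimed t \<omega> - claimed s \<omega> \<noteq> 0 \<longrightarrow> N t \<omega> = Suc (N (real k) \<omega>))"
proof (cases "N s \<omega> = N (real k) \<omega>")
  case True
  have c: "C s \<omega> = C (real k) \<omega>" using True by (simp add: claims_def)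
  show ?thesis
  proof (cases "N t \<omega> = Suc (N s \<omega>)")
    case t: True
    have "C t \<omega> \<noteq> C s \<omega>" using good_path_claims_eq_iff[OF good(1) _ st(2)] st t by auto
    then show ?thesis using True t c good_path_single_claim[OF t] good(2)
      by (auto simp: cell_claim_def next_claim_def claimed_def)
  next
    case False
    then have "N t \<omega> = N s \<omega> \<or> \<omega> \<in> two_claims s t" using good(2) by (auto simp: two_claims_def)
    then show ?thesis using True good(2) by (auto simp: cell_claim_def claimed_def claims_def)
  qed
next
  case False
  then have "C s \<omega> \<noteq> C (real k) \<omega>" using good_path_claims_eq_iff[OF good(1) _ st(1)] by auto
  moreover have "N t \<omega> \<noteq> N (real k) \<omega>"
    using False good_path_N_mono[OF good(1), of "real k" s] good_path_N_mono[OF good(1), of s t] st by auto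
  ultimately show ?thesis using False good(2) by (auto simp: cell_claim_def claimed_def)
qed

lemma claimed_diff_bounded: "\<bar>next_claim \<omega> * (claimed t \<omega> - claimed s \<omega>)\<bar> \<le> 2 * B"
  using claimed_range[of t \<omega>] claimed_range[of s \<omega>] by (intro abs_mult_le next_claim_bounded) auto

lemma two_claims_error:
  assumes st: "real k \<le> s" "s \<le> t"
  shows "expectation (\<lambda>\<omega>. 4 * B * indicator (two_claims s t) \<omega>) \<le> 4 * B * (lam * (t - s))\<^sup>2"
    "integrable M (\<lambda>\<omega>. 4 * B * indicator (two_claims s t) \<omega>)"
proof -
  have [measurable]: "two_claims s t \<in> events" by (rule two_claims_measurable) (use st in auto)
  show "integrable M (\<lambda>\<omega>. 4 * B * indicator (two_claims s t) \<omega>)" by (simp add: emeasure_eq_measure)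
  have "expectation (\<lambda>\<omega>. 4 * B * indicator (two_claims s t) \<omega>) = 4 * B * prob (two_claims s t)" by simp
  also have "\<dots> \<le> 4 * B * (lam * (t - s))\<^sup>2"
    using prob_two_claims[of s t] st bound_nonneg by (intro mult_left_mono) auto
  finally show "expectation (\<lambda>\<omega>. 4 * B * indicator (two_claims s t) \<omega>) \<le> 4 * B * (lam * (t - s))\<^sup>2" .
qed

lemma cell_claim_expectation:
  assumes st: "real k \<le> s" "s \<le> t"
  shows "\<bar>expectation (cell_claim s t) - (first_claim_mean t - first_claim_mean s)\<bar> \<le> 4 * B * (lam * (t - s))\<^sup>2"
proof -
  have pos: "0 \<le> s" "0 \<le> t" using st by auto
  have [measurable]: "cell_claim s t \<in> borel_measurable M" by (rule F_measurable_M[OF cell_claim_measurable[OF st] pos(2)])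
  have "\<bar>expectation (cell_claim s t) - expectation (\<lambda>\<omega>. next_claim \<omega> * claimed t \<omega> - next_claim \<omega> * claimed s \<omega>)\<bar>
     \<le> expectation (\<lambda>\<omega>. 4 * B * indicator (two_claims s t) \<omega>)"
  proof (rule expectation_close)
    show "integrable M (cell_claim s t)" by (rule bounded_integrable[OF _ cell_claim_bounded]) measurable
    show "integrable M (\<lambda>\<omega>. next_claim \<omega> * claimed t \<omega> - next_claim \<omega> * claimed s \<omega>)"
      by (intro Bochner_Integration.integrable_diff next_claimed_integrable pos)
    show "AE \<omega> in M. \<bar>cell_claim s t \<omega> - (next_claim \<omega> * claimed t \<omega> - next_claim \<omega> * claimed s \<omega>)\<bar> \<le> 4 * B * indicator (two_claims s t) \<omega>"
      using AE_good_path AE_space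
    proof eventually_elim
      fix \<omega> assume good: "good_path \<omega>" "\<omega> \<in> space M"
      have "\<bar>cell_claim s t \<omega> - next_claim \<omega> * (claimed t \<omega> - claimed s \<omega>)\<bar> \<le> 4 * B"
        using cell_claim_bounded[of s t \<omega>] claimed_diff_bounded[of \<omega> t s] by linarith
      then show "\<bar>cell_claim s t \<omega> - (next_claim \<omega> * claimed t \<omega> - next_claim \<omega> * claimed s \<omega>)\<bar> \<le> 4 * B * indicator (two_claims s t) \<omega>"
        using cell_cases[OF good st] bound_nonneg by (auto simp: right_diff_distrib[symmetric] indicator_def)
    qed
  qed (rule two_claims_error(2)[OF st])
  also have "\<dots> \<le> 4 * B * (lam * (t - s))\<^sup>2" by (rule two_claims_error(1)[OF st])
  also have "expectation (\<lambda>\<omega>. next_claim \<omega> * claimed t \<omega> - next_claim \<omega> * claimed s \<omega>) = first_claim_mean t - first_claim_mean s"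
    unfolding first_claim_mean_def by (intro Bochner_Integration.integral_diff next_claimed_integrable pos)
  finally show ?thesis .
qed

text \<open>The number of claims after \<open>t\<close> is independent of \<open>F t\<close>, which
  produces the Poisson weight. If the first claim after \<open>k\<close> is the only one up to
  \<open>t\<close>, then \<open>j\<close> further claims until the end of the unit interval make
  \<open>Suc j\<close> in total.\<close>

lemma cell_claim_count_expectation:
  fixes j :: nat
  assumes st: "real k \<le> s" "s \<le> t" "t \<le> real (Suc k)"
  defines "A \<equiv> {\<omega>\<in>space M. N (real (Suc k)) \<omega> = N (real k) \<omega> + Suc j}"
  shows "\<bar>expectation (cell_claim s t) * poisson_weight (lam * (real (Suc k) - t)) j
    - expectation (\<lambda>\<omega>. next_claim \<omega> * (claimed t \<omega> - claimed s \<omega>) * indicator A \<omega>)\<bar> \<le> 4 * B * (lam * (t - s))\<^sup>2"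
proof -
  define E where "E = {\<omega>\<in>space M. N (real (Suc k)) \<omega> = N t \<omega> + j}"
  have pos: "0 \<le> s" "0 \<le> t" using st by auto
  have cm [measurable]: "cell_claim s t \<in> borel_measurable M" by (rule F_measurable_M[OF cell_claim_measurable[OF st(1,2)] pos(2)])
  have E [measurable]: "E \<in> events" unfolding E_def by (rule N_event) (use pos in auto)
  have [measurable]: "A \<in> events" unfolding A_def by (rule N_event) auto
  have [measurable]: "claimed s \<in> borel_measurable M" "claimed t \<in> borel_measurable M" using pos by auto
  have "\<bar>expectation (\<lambda>\<omega>. cell_claim s t \<omega> * indicator E \<omega>) - expectation (\<lambda>\<omega>. next_claim \<omega> * (claimed t \<omega> - claimed s \<omega>) * indicator A \<omega>)\<bar>
     \<le> expectation (\<lambda>\<omega>. 4 * B * indicator (two_claims s t) \<omega>)"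
  proof (rule expectation_close)
    show "integrable M (\<lambda>\<omega>. cell_claim s t \<omega> * indicator E \<omega>)"
      by (rule bounded_integrable[OF borel_measurable_times[OF cm borel_measurable_indicator[OF E]] abs_mult_le[OF cell_claim_bounded abs_indicator_le]])
    show "integrable M (\<lambda>\<omega>. next_claim \<omega> * (claimed t \<omega> - claimed s \<omega>) * indicator A \<omega>)"
      by (rule bounded_integrable[OF _ abs_mult_le[OF claimed_diff_bounded abs_indicator_le]]) measurable
    show "AE \<omega> in M. \<bar>cell_claim s t \<omega> * indicator E \<omega> - next_claim \<omega> * (claimed t \<omega> - claimed s \<omega>) * indicator A \<omega>\<bar> \<le> 4 * B * indicator (two_claims s t) \<omega>"
      using AE_good_path AE_space
    proof eventually_elim
      fix \<omega> assume good: "good_path \<omega>" "\<omega> \<in> space M"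
      have "\<bar>cell_claim s t \<omega> * indicator E \<omega>\<bar> \<le> 2 * B" by (rule abs_mult_le[OF cell_claim_bounded]) (simp add: indicator_def)
      moreover have "\<bar>next_claim \<omega> * (claimed t \<omega> - claimed s \<omega>) * indicator A \<omega>\<bar> \<le> 2 * B"
        by (rule abs_mult_le[OF claimed_diff_bounded]) (simp add: indicator_def)
      ultimately have b: "\<bar>cell_claim s t \<omega> * indicator E \<omega> - next_claim \<omega> * (claimed t \<omega> - claimed s \<omega>) * indicator A \<omega>\<bar> \<le> 4 * B"
        by linarith
      show "\<bar>cell_claim s t \<omega> * indicator E \<omega> - next_claim \<omega> * (claimed t \<omega> - claimed s \<omega>) * indicator A \<omega>\<bar> \<le> 4 * B * indicator (two_claims s t) \<omega>"
      proof (cases "\<omega> \<in> two_claims s t")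
        case False
        then have c: "cell_claim s t \<omega> = next_claim \<omega> * (claimed t \<omega> - claimed s \<omega>)"
          "claimed t \<omega> - claimed s \<omega> \<noteq> 0 \<Longrightarrow> N t \<omega> = Suc (N (real k) \<omega>)"
          using cell_cases[OF good st(1,2)] by auto
        have "claimed t \<omega> - claimed s \<omega> \<noteq> 0 \<Longrightarrow> indicator E \<omega> = (indicator A \<omega> :: real)"
          using c(2) good(2) by (auto simp: A_def E_def indicator_def)
        then show ?thesis unfolding c(1) using bound_nonneg by (cases "claimed t \<omega> - claimed s \<omega> = 0") auto
      qed (use b in simp)
    qed
  qed (rule two_claims_error(2)[OF st(1,2)])
  also have "\<dots> \<le> 4 * B * (lam * (t - s))\<^sup>2" by (rule two_claims_error(1)[OF st(1,2)])
  finally show ?thesis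
    unfolding E_def count_increment_indep[OF pos(2) st(3) cell_claim_measurable[OF st(1,2)] cell_claim_bounded] .
qed

lemma first_claim_mean_lipschitz:
  assumes st: "real k \<le> s" "s \<le> t"
  shows "\<bar>first_claim_mean t - first_claim_mean s\<bar> \<le> 2 * B * lam * (t - s)"
proof -
  have pos: "0 \<le> s" "0 \<le> t" using st by auto
  let ?E = "{\<omega>\<in>space M. N t \<omega> \<noteq> N s \<omega>}"
  have [measurable]: "?E \<in> events" by (rule N_event[OF pos])
  have "\<bar>first_claim_mean t - first_claim_mean s\<bar> \<le> expectation (\<lambda>\<omega>. 2 * B * indicator ?E \<omega>)"
    unfolding first_claim_mean_def
  proof (rule expectation_close)
    show "AE \<omega> in M. \<bar>next_claim \<omega> * claimed t \<omega> - next_claim \<omega> * claimed s \<omega>\<bar> \<le> 2 * B * indicator ?E \<omega>"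
      using AE_space
    proof eventually_elim
      fix \<omega> assume "\<omega> \<in> space M"
      then show "\<bar>next_claim \<omega> * claimed t \<omega> - next_claim \<omega> * claimed s \<omega>\<bar> \<le> 2 * B * indicator ?E \<omega>"
        using claimed_diff_bounded[of \<omega> t s] by (auto simp: right_diff_distrib[symmetric] indicator_def claimed_def)
    qed
  qed (auto intro: next_claimed_integrable pos simp: emeasure_eq_measure)
  also have "\<dots> = 2 * B * prob ?E" by simp
  also have "\<dots> \<le> 2 * B * (lam * (t - s))" using prob_claim_le[OF pos(1) st(2)] bound_nonneg by (intro mult_left_mono) auto
  finally show ?thesis by (simp add: mult.assoc)
qed

lemma first_claim_mean_start: "first_claim_mean (real k) = 0"
  by (simp add: first_claim_mean_def claimed_def)

text \<open>Independence at integer times makes \<open>next_claim\<close> average to 0 on the event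
  of a given number of claims in the unit interval. Splitting that event by the cell of the first
  claim gives a weighted sum of increments of \<open>first_claim_mean\<close> with error O(1/n), the
  hypothesis of \<open>poisson_moments_zero\<close>.\<close>

lemma first_claim_mean_zero:
  assumes t: "real k \<le> t" "t \<le> real (Suc k)"
  shows "first_claim_mean t = 0"
proof -
  define v where "v x = first_claim_mean (real k + x)" for x
  have "v (t - real k) = 0"
  proof (rule poisson_moments_zero[OF _ _ lam_pos, where v=v and x="t - real k" and D="2 * B * lam" and K="8 * B * lam\<^sup>2"])
    show "\<bar>v x - v y\<bar> \<le> 2 * B * lam * \<bar>x - y\<bar>" if "x \<in> {0..1}" "y \<in> {0..1}" for x y
      using first_claim_mean_lipschitz[of "real k + x" "real k + y"] first_claim_mean_lipschitz[of "real k + y" "real k + x"] that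
      by (cases "x \<le> y") (auto simp: v_def abs_minus_commute)
    show "v 0 = 0" by (simp add: v_def first_claim_mean_start)
    show "t - real k \<in> {0..1}" using t by auto
    fix j n :: nat assume n: "0 < n"
    define s where "s i = real k + real i / real n" for i
    \<comment> \<open>With \<open>Suc (Suc j)\<close> claims in the interval, \<open>Suc j\<close>
      remain after the first one; this positive index is the one that the moment lemma
      expects.\<close>
    define A where "A = {\<omega>\<in>space M. N (real (Suc k)) \<omega> = N (real k) \<omega> + Suc (Suc j)}"
    have [measurable]: "A \<in> events" unfolding A_def by (rule N_event) auto
    have s: "real k \<le> s i" "s i \<le> s (Suc i)" "s (Suc i) - s i = 1 / real n" for i
      by (auto simp: s_def divide_right_mono add_divide_distrib)
    have s1: "s (Suc i) \<le> real (Suc k)" if "i < n" for i using that n by (simp add: s_def)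
    have sn: "s 0 = real k" "s n = real (Suc k)" using n by (auto simp: s_def)
    let ?p = "\<lambda>i. poisson_weight (lam * (real (Suc k) - s (Suc i))) (Suc j)"
    let ?e = "\<lambda>i. expectation (\<lambda>\<omega>. next_claim \<omega> * (claimed (s (Suc i)) \<omega> - claimed (s i) \<omega>) * indicator A \<omega>)"
    \<comment> \<open>The constant 8 is 4 for replacing an increment of
      \<open>first_claim_mean\<close> by the mean of \<open>cell_claim\<close>, and 4 for inserting
      the event \<open>A\<close>.\<close>
    have cell: "\<bar>(first_claim_mean (s (Suc i)) - first_claim_mean (s i)) * ?p i - ?e i\<bar> \<le> 8 * B * (lam / real n)\<^sup>2"
      if i: "i < n" for i
    proof -
      have "0 \<le> s (Suc i)" using s(1)[of "Suc i"] by (meson of_nat_0_le_iff order_trans)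
      then have "prob {\<omega>\<in>space M. N (real (Suc k)) \<omega> = N (s (Suc i)) \<omega> + Suc j} = ?p i"
        by (rule prob_increment[OF _ s1[OF i]])
      from this[symmetric] have p: "0 \<le> ?p i" "?p i \<le> 1" by simp_all
      have "\<bar>(first_claim_mean (s (Suc i)) - first_claim_mean (s i)) * ?p i - expectation (cell_claim (s i) (s (Suc i))) * ?p i\<bar>
        \<le> 4 * B * (lam * (s (Suc i) - s i))\<^sup>2"
        unfolding left_diff_distrib[symmetric]
        using cell_claim_expectation[OF s(1,2), of i] p by (intro abs_mult_le) (auto simp: abs_minus_commute)
      moreover have "\<bar>expectation (cell_claim (s i) (s (Suc i))) * ?p i - ?e i\<bar> \<le> 4 * B * (lam * (s (Suc i) - s i))\<^sup>2"
        unfolding A_def by (rule cell_claim_count_expectation[OF s(1,2) s1[OF i]])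
      ultimately show ?thesis unfolding s(3) by (simp add: algebra_simps)
    qed
    have "(\<Sum>i<n. ?e i) = expectation (\<lambda>\<omega>. \<Sum>i<n. next_claim \<omega> * (claimed (s (Suc i)) \<omega> - claimed (s i) \<omega>) * indicator A \<omega>)"
    proof (rule Bochner_Integration.integral_sum[symmetric])
      fix i
      have [measurable]: "claimed (s i) \<in> borel_measurable M" for i
        using s(1)[of i] by (intro claimed_measurable) (meson of_nat_0_le_iff order_trans)
      show "integrable M (\<lambda>\<omega>. next_claim \<omega> * (claimed (s (Suc i)) \<omega> - claimed (s i) \<omega>) * indicator A \<omega>)"
        by (rule bounded_integrable[OF _ abs_mult_le[OF claimed_diff_bounded abs_indicator_le]]) measurable
    qed
    also have "\<dots> = expectation (\<lambda>\<omega>. next_claim \<omega> * indicator A \<omega>)"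
    proof (rule Bochner_Integration.integral_cong[OF refl])
      fix \<omega> assume w: "\<omega> \<in> space M"
      have "(\<Sum>i<n. next_claim \<omega> * (claimed (s (Suc i)) \<omega> - claimed (s i) \<omega>) * indicator A \<omega>)
        = next_claim \<omega> * indicator A \<omega> * (\<Sum>i<n. claimed (s (Suc i)) \<omega> - claimed (s i) \<omega>)"
        unfolding sum_distrib_left by (intro sum.cong refl) (simp only: ac_simps)
      also have "(\<Sum>i<n. claimed (s (Suc i)) \<omega> - claimed (s i) \<omega>) = claimed (real (Suc k)) \<omega> - claimed (real k) \<omega>"
        by (subst sum_lessThan_telescope) (simp add: sn)
      also have "next_claim \<omega> * indicator A \<omega> * (claimed (real (Suc k)) \<omega> - claimed (real k) \<omega>) = next_claim \<omega> * indicator A \<omega>"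
        using w by (auto simp: claimed_def A_def indicator_def)
      finally show "(\<Sum>i<n. next_claim \<omega> * (claimed (s (Suc i)) \<omega> - claimed (s i) \<omega>) * indicator A \<omega>) = next_claim \<omega> * indicator A \<omega>" .
    qed
    also have "\<dots> = 0" unfolding A_def by (rule next_claim_integer_mean)
    finally have e0: "(\<Sum>i<n. ?e i) = 0" .
    have "\<bar>(\<Sum>i<n. (first_claim_mean (s (Suc i)) - first_claim_mean (s i)) * ?p i) - (\<Sum>i<n. ?e i)\<bar> \<le> (\<Sum>i<n. 8 * B * (lam / real n)\<^sup>2)"
      unfolding sum_subtractf[symmetric] by (rule order_trans[OF sum_abs sum_mono]) (use cell in auto)
    also have "\<dots> = 8 * B * lam\<^sup>2 / real n" using n by (simp add: power2_eq_square)
    finally show "\<bar>\<Sum>i<n. (v (real (Suc i) / real n) - v (real i / real n)) * poisson_weight (lam * (1 - real (Suc i) / real n)) (Suc j)\<bar>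
       \<le> 8 * B * lam\<^sup>2 / real n"
      unfolding e0 by (simp add: v_def s_def algebra_simps)
  qed
  then show ?thesis by (simp add: v_def)
qed

text \<open>Let \<open>r\<close> be \<open>f - m\<close> on increments with a claim and 0 otherwise.
  Multiplied by the independent event of no claim in \<open>(k, s]\<close> it becomes
  \<open>cell_claim s t\<close>, whose mean is of second order because
  \<open>first_claim_mean\<close> vanishes. Dividing that probability out again costs at most
  \<open>exp lam\<close>, the source of \<open>4 * exp lam\<close>; the summand 2 is the
  second-order remainder of the probability of no claim.\<close>

lemma claims_increment_expansion:
  assumes st: "real k \<le> s" "s \<le> t" "t \<le> real (Suc k)"
  defines "a \<equiv> lam * (t - s)"
  shows "\<bar>expectation (\<lambda>\<omega>. f (C t \<omega> - C s \<omega>)) - (f 0 + a * (m - f 0))\<bar> \<le> (4 * exp lam + 2) * B * a\<^sup>2"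
proof -
  have pos: "0 \<le> s" "0 \<le> t" "0 \<le> a" using st lam_pos by (auto simp: a_def)
  define z :: "real \<Rightarrow> real" where "z x = (if x = 0 then 1 else 0)" for x
  define r where "r x = (f x - m) * (if x = 0 then 0 else 1)" for x
  have zm [measurable]: "z \<in> borel_measurable borel" unfolding z_def by measurable
  have rm [measurable]: "r \<in> borel_measurable borel" unfolding r_def by measurable
  have rb: "\<bar>r x\<bar> \<le> 2 * B" for x unfolding r_def using centered_bounded[of x] bound_nonneg by auto
  have [measurable]: "C t \<in> borel_measurable M" "C s \<in> borel_measurable M" using pos by auto
  let ?D = "\<lambda>\<omega>. C t \<omega> - C s \<omega>" and ?Z = "\<lambda>\<omega>. z (C s \<omega> - C (real k) \<omega>)"
  have count: "expectation (\<lambda>\<omega>. z (C v \<omega> - C u \<omega>)) = exp (- (lam * (v - u)))" if uv: "0 \<le> u" "u \<le> v" for u v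
  proof -
    have [measurable]: "C v \<in> borel_measurable M" "C u \<in> borel_measurable M" using uv by auto
    have ev: "{\<omega>\<in>space M. N v \<omega> = N u \<omega> + 0} \<in> events" by (rule N_event) (use uv in auto)
    have "expectation (\<lambda>\<omega>. z (C v \<omega> - C u \<omega>)) = expectation (indicator {\<omega>\<in>space M. N v \<omega> = N u \<omega> + 0})"
    proof (rule integral_cong_AE)
      show "AE \<omega> in M. z (C v \<omega> - C u \<omega>) = indicator {\<omega>\<in>space M. N v \<omega> = N u \<omega> + 0} \<omega>"
        using AE_good_path AE_space
        by eventually_elim (use good_path_claims_eq_iff[OF _ uv] in \<open>auto simp: z_def indicator_def\<close>)
    qed (use ev in measurable)
    also have "\<dots> = exp (- (lam * (v - u)))" using prob_increment[OF uv, of 0] ev by (simp add: poisson_weight_def)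
    finally show ?thesis .
  qed
  have Zm: "?Z \<in> borel_measurable (F s)"
  proof -
    have [measurable]: "C s \<in> borel_measurable (F s)" by (rule claims_adapted[OF pos(1)])
    have [measurable]: "C (real k) \<in> borel_measurable (F s)" by (rule F_measurable_mono[OF claims_adapted st(1)]) simp
    show ?thesis by measurable
  qed
  have "expectation (\<lambda>\<omega>. ?Z \<omega> * r (?D \<omega>)) = expectation ?Z * expectation (\<lambda>\<omega>. r (?D \<omega>))"
    by (rule expectation_mult_claims_increment[OF pos(1) st(2) Zm _ rm rb, of 1]) (simp add: z_def)
  moreover have "(\<lambda>\<omega>. ?Z \<omega> * r (?D \<omega>)) = cell_claim s t"
    by (rule ext) (simp add: cell_claim_def z_def r_def)
  ultimately have "expectation (cell_claim s t) = exp (- (lam * (s - real k))) * expectation (\<lambda>\<omega>. r (?D \<omega>))"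
    using count[of "real k" s] st by simp
  then have "expectation (\<lambda>\<omega>. r (?D \<omega>)) = exp (lam * (s - real k)) * expectation (cell_claim s t)"
    by (simp add: exp_minus)
  also have "\<bar>\<dots>\<bar> \<le> exp lam * (4 * B * a\<^sup>2)"
    unfolding abs_mult
  proof (rule mult_mono)
    show "\<bar>exp (lam * (s - real k))\<bar> \<le> exp lam" using st lam_pos by (simp add: mult_left_le)
    show "\<bar>expectation (cell_claim s t)\<bar> \<le> 4 * B * a\<^sup>2"
      using cell_claim_expectation[OF st(1,2)] first_claim_mean_zero[of s] first_claim_mean_zero[of t] st
      by (simp add: a_def)
  qed auto
  finally have r: "\<bar>expectation (\<lambda>\<omega>. r (?D \<omega>))\<bar> \<le> exp lam * (4 * B * a\<^sup>2)" .
  have int: "integrable M (\<lambda>\<omega>. r (?D \<omega>))" "integrable M (\<lambda>\<omega>. z (?D \<omega>))"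
    by (rule bounded_integrable[OF _ rb], measurable) (rule bounded_integrable[where B=1], measurable, simp add: z_def)
  have "expectation (\<lambda>\<omega>. f (?D \<omega>)) = expectation (\<lambda>\<omega>. r (?D \<omega>) + (f 0 - m) * z (?D \<omega>) + m)"
    by (rule Bochner_Integration.integral_cong) (auto simp: r_def z_def)
  also have "\<dots> = expectation (\<lambda>\<omega>. r (?D \<omega>)) + (f 0 - m) * exp (- a) + m"
    using int count[OF pos(1) st(2)] by (simp add: prob_space a_def)
  finally have "expectation (\<lambda>\<omega>. f (?D \<omega>)) - (f 0 + a * (m - f 0)) = expectation (\<lambda>\<omega>. r (?D \<omega>)) + (f 0 - m) * (exp (- a) - 1 + a)"
    by (simp add: algebra_simps)
  moreover have "\<bar>(f 0 - m) * (exp (- a) - 1 + a)\<bar> \<le> 2 * B * a\<^sup>2"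
    unfolding abs_mult
  proof (rule mult_mono)
    have "exp (- a) \<le> 1 / (1 + a)" using exp_ge_add_one_self[of a] pos by (simp add: exp_minus field_simps)
    also have "1 / (1 + a) \<le> 1 - a + a\<^sup>2"
    proof -
      have "(1 - a + a\<^sup>2) * (1 + a) = 1 + a ^ 3"
        by (simp add: power2_eq_square power3_eq_cube algebra_simps)
      then have "1 \<le> (1 - a + a\<^sup>2) * (1 + a)" using pos by simp
      then show ?thesis using pos by (simp add: pos_divide_le_eq)
    qed
    finally show "\<bar>exp (- a) - 1 + a\<bar> \<le> a\<^sup>2" using exp_ge_add_one_self[of "- a"] by simp
  qed (use centered_bounded[of 0] bound_nonneg in auto)
  ultimately show ?thesis using r by (simp add: algebra_simps)
qed

end

end

lemma exp_minus_expansion: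
  fixes a :: real
  assumes "0 \<le> a"
  shows "\<bar>exp (- a) - 1 + a\<bar> \<le> a\<^sup>2" "\<bar>exp (- a) - 1\<bar> \<le> a"
proof -
  have "exp (- a) \<le> 1 / (1 + a)" using exp_ge_add_one_self[of a] assms by (simp add: exp_minus field_simps)
  also have "1 / (1 + a) \<le> 1 - a + a\<^sup>2"
  proof -
    have "(1 - a + a\<^sup>2) * (1 + a) = 1 + a ^ 3"
      by (simp add: power2_eq_square power3_eq_cube algebra_simps)
    then have "1 \<le> (1 - a + a\<^sup>2) * (1 + a)" using assms by simp
    then show ?thesis using assms by (simp add: pos_divide_le_eq)
  qed
  finally show "\<bar>exp (- a) - 1 + a\<bar> \<le> a\<^sup>2" using exp_ge_add_one_self[of "- a"] by simp
  show "\<bar>exp (- a) - 1\<bar> \<le> a" using exp_ge_add_one_self[of "- a"] assms by simp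
qed

section \<open>Expansion of the barrier function along one Euler step\<close>

context barrier_problem
begin

lemma barrier_mvt:
  assumes "0 \<le> x" "x < y"
  obtains \<xi> where "x < \<xi>" "\<xi> < y" "\<Phi> y - \<Phi> x = (y - x) * \<Phi>' \<xi>"
proof -
  have "continuous_on {x..y} \<Phi>" by (rule continuous_on_subset[OF barrier_continuous]) (use assms in auto)
  moreover have "(\<Phi> has_real_derivative \<Phi>' z) (at z)" if "x < z" "z < y" for z
  proof -
    have "at z within {0..} = at z" by (rule at_within_interior) (use that assms in \<open>auto simp: interior_real_atLeast\<close>)
    then show ?thesis using barrier_has_derivative[of z] that assms by simp
  qed
  ultimately obtain \<xi> where "x < \<xi>" "\<xi> < y" "\<Phi> y - \<Phi> x = \<Phi>' \<xi> * (y - x)"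
    using mvt[OF assms(2), of \<Phi> "\<lambda>z. (*) (\<Phi>' z)"] by (metis has_field_derivative_def)
  then show thesis using that by (simp add: mult.commute)
qed

lemma barrier_lipschitz:
  assumes "0 \<le> R"
  obtains c where "1 \<le> c" "\<And>x y. 0 \<le> x \<Longrightarrow> x \<le> R \<Longrightarrow> 0 \<le> y \<Longrightarrow> y \<le> R \<Longrightarrow> \<bar>\<Phi> x - \<Phi> y\<bar> \<le> c * \<bar>x - y\<bar>"
proof -
  obtain c where c: "0 \<le> c" "\<And>x. 0 \<le> x \<Longrightarrow> x \<le> R \<Longrightarrow> \<bar>\<Phi>' x\<bar> \<le> c"
    using continuous_on_Icc_bounded[OF continuous_on_subset[OF barrier_deriv_continuous], of 0 R] by auto
  have le: "\<bar>\<Phi> x - \<Phi> y\<bar> \<le> c * \<bar>x - y\<bar>" if "0 \<le> x" "x < y" "y \<le> R" for x y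
  proof -
    obtain \<xi> where \<xi>: "x < \<xi>" "\<xi> < y" "\<Phi> y - \<Phi> x = (y - x) * \<Phi>' \<xi>" using barrier_mvt \<open>0 \<le> x\<close> \<open>x < y\<close> by blast
    then have "\<bar>\<Phi> y - \<Phi> x\<bar> \<le> \<bar>y - x\<bar> * c" unfolding \<xi>(3) abs_mult using c that by (intro mult_left_mono) auto
    then show ?thesis by (simp add: abs_minus_commute mult.commute)
  qed
  show thesis
  proof (rule that[of "max 1 c"])
    fix x y assume xy: "0 \<le> x" "x \<le> R" "0 \<le> y" "y \<le> R"
    have "\<bar>\<Phi> x - \<Phi> y\<bar> \<le> c * \<bar>x - y\<bar>"
      using le[of x y] le[of y x] xy by (cases x y rule: linorder_cases) (auto simp: abs_minus_commute)
    also have "\<dots> \<le> max 1 c * \<bar>x - y\<bar>" by (intro mult_right_mono) auto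
    finally show "\<bar>\<Phi> x - \<Phi> y\<bar> \<le> max 1 c * \<bar>x - y\<bar>" .
  qed simp
qed

text \<open>The deterministic half of the one-step estimate: discounting, an Euler step of the
  premium, and one claim with probability \<open>lam * h\<close>. As \<Phi> has one continuous
  derivative only, the error is o(h), uniformly on compact sets by uniform continuity.\<close>

lemma generator_expansion:
  assumes R: "0 \<le> R" and e: "0 < e"
  obtains h\<^sub>0 where "0 < h\<^sub>0"
    "\<And>h z. 0 < h \<Longrightarrow> h < h\<^sub>0 \<Longrightarrow> 0 \<le> z \<Longrightarrow> z \<le> R \<Longrightarrow>
       \<bar>exp (- delta * h) * (\<Phi> (z + h * g z) + lam * h * (exp_conv alpha \<Phi> (z + h * g z) - \<Phi> (z + h * g z)))
        - (\<Phi> z + h * drift z)\<bar> \<le> e * h"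
proof -
  let ?K = "exp_conv alpha \<Phi>"
  obtain gm where gm: "0 \<le> gm" "\<And>z. 0 \<le> z \<Longrightarrow> z \<le> R \<Longrightarrow> \<bar>g z\<bar> \<le> gm"
    using continuous_on_Icc_bounded[OF continuous_on_subset[OF g_cont], of 0 R] by auto
  define R' where "R' = R + gm"
  obtain p where p: "0 \<le> p" "\<And>z. 0 \<le> z \<Longrightarrow> z \<le> R' \<Longrightarrow> \<bar>\<Phi>' z\<bar> \<le> p"
    using continuous_on_Icc_bounded[OF continuous_on_subset[OF barrier_deriv_continuous], of 0 R'] by auto
  obtain q where q: "0 \<le> q" "\<And>z. 0 \<le> z \<Longrightarrow> z \<le> R' \<Longrightarrow> \<bar>?K z\<bar> \<le> q"
    using continuous_on_Icc_bounded[OF continuous_on_subset[OF continuous_exp_conv[OF barrier_continuous]], of 0 R'] by auto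
  \<comment> \<open>Half of \<open>e\<close> pays for the moduli of continuity of
    \<open>\<Phi>'\<close> and of the convolution, which enter with factors \<open>gm\<close> and
    \<open>lam\<close>; the other half absorbs the second-order terms, whose coefficients are
    collected in \<open>m\<close> below.\<close>
  define \<eta> where "\<eta> = e / (2 * (gm + lam + 1))"
  have \<eta>: "0 < \<eta>" using e gm lam_pos by (simp add: \<eta>_def)
  have "uniformly_continuous_on {0..R'} \<Phi>'" "uniformly_continuous_on {0..R'} ?K"
    by (auto intro!: compact_uniformly_continuous continuous_on_subset[OF barrier_deriv_continuous]
        continuous_on_subset[OF continuous_exp_conv[OF barrier_continuous]])
  then obtain d\<^sub>1 d\<^sub>2 where d1: "0 < d\<^sub>1" "\<And>x y. x \<in> {0..R'} \<Longrightarrow> y \<in> {0..R'} \<Longrightarrow> dist y x < d\<^sub>1 \<Longrightarrow> dist (\<Phi>' y) (\<Phi>' x) < \<eta>"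
    and d2: "0 < d\<^sub>2" "\<And>x y. x \<in> {0..R'} \<Longrightarrow> y \<in> {0..R'} \<Longrightarrow> dist y x < d\<^sub>2 \<Longrightarrow> dist (?K y) (?K x) < \<eta>"
    unfolding uniformly_continuous_on_def using \<eta> by metis
  define m where "m = gm * (lam + delta) * p + (delta\<^sup>2 + lam * delta) * \<Phi> R + lam * delta * q"
  have m: "0 \<le> m" unfolding m_def using gm p q lam_pos delta_pos barrier_nonneg[of R] by (intro add_nonneg_nonneg mult_nonneg_nonneg) auto
  define h\<^sub>0 where "h\<^sub>0 = Min {1, d\<^sub>1 / (gm + 1), d\<^sub>2 / (gm + 1), e / (2 * (m + 1))}"
  have h0: "0 < h\<^sub>0" using d1 d2 gm e m by (auto simp: h\<^sub>0_def)
  show thesis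
  proof (rule that[OF h0])
    fix h z assume h: "0 < h" "h < h\<^sub>0" and z: "0 \<le> z" "z \<le> R"
    have hb: "h \<le> 1" "h * (gm + 1) < d\<^sub>1" "h * (gm + 1) < d\<^sub>2" "h * (m + 1) \<le> e / 2"
      using h gm m by (auto simp: h\<^sub>0_def field_simps)
    define z' where "z' = z + h * g z"
    have gz: "0 < g z" "g z \<le> gm" using gm(2)[OF z] g_pos[OF z(1)] by auto
    have hg: "0 < h * g z" "h * g z \<le> gm" "h * g z < h * (gm + 1)"
      using h gz hb gm mult_mono[of h 1 "g z" gm] by auto
    have z': "z < z'" "z' \<le> R'" using hg z by (auto simp: z'_def R'_def)
    obtain \<xi> where \<xi>: "z < \<xi>" "\<xi> < z'" "\<Phi> z' - \<Phi> z = (z' - z) * \<Phi>' \<xi>" using barrier_mvt[OF z(1) z'(1)] by blast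
    have dP: "\<bar>\<Phi>' \<xi> - \<Phi>' z\<bar> \<le> \<eta>"
      using d1(2)[of z \<xi>] \<xi> z z' hg hb by (auto simp: dist_real_def z'_def)
    have dK: "\<bar>?K z' - ?K z\<bar> \<le> \<eta>"
      using d2(2)[of z z'] z z' hg hb by (auto simp: dist_real_def z'_def)
    define \<kappa> where "\<kappa> = exp (- delta * h)"
    have dh: "0 \<le> delta * h" using delta_pos h by simp
    have \<kappa>: "0 \<le> \<kappa>" "\<kappa> \<le> 1" "\<bar>\<kappa> - 1\<bar> \<le> delta * h" "\<bar>\<kappa> - 1 + delta * h\<bar> \<le> (delta * h)\<^sup>2"
      using exp_minus_expansion[OF dh] dh by (auto simp: \<kappa>_def)
    have lh: "0 \<le> lam * h" using lam_pos h by simp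
    have c1: "\<bar>\<kappa> * (1 - lam * h) - 1\<bar> \<le> (lam + delta) * h"
    proof -
      have "\<kappa> * (1 - lam * h) - 1 = (\<kappa> - 1) - \<kappa> * (lam * h)" by (simp add: algebra_simps)
      moreover have "0 \<le> \<kappa> * (lam * h)" "\<kappa> * (lam * h) \<le> lam * h" using \<kappa> lh by (auto simp: mult_left_le_one_le)
      ultimately show ?thesis using \<kappa>(3) by (simp add: algebra_simps)
    qed
    have c2: "\<bar>\<kappa> * (1 - lam * h) - 1 + (lam + delta) * h\<bar> \<le> (delta\<^sup>2 + lam * delta) * h\<^sup>2"
    proof -
      have "\<kappa> * (1 - lam * h) - 1 + (lam + delta) * h = (\<kappa> - 1 + delta * h) + lam * h * (1 - \<kappa>)" by (simp add: algebra_simps)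
      moreover have "\<bar>lam * h * (1 - \<kappa>)\<bar> \<le> lam * h * (delta * h)"
        unfolding abs_mult[of "lam * h"] using lh \<kappa>(3) by (simp add: mult_left_mono abs_minus_commute)
      moreover have "(delta * h)\<^sup>2 + lam * h * (delta * h) = (delta\<^sup>2 + lam * delta) * h\<^sup>2" by (simp add: power2_eq_square algebra_simps)
      ultimately show ?thesis using \<kappa>(4) by linarith
    qed
    \<comment> \<open>The mean value theorem writes the increment of \<Phi> as
      \<open>h * g z * \<Phi>' \<xi>\<close>. The three groups are the effects of the premium, of
      discounting together with the rate of claims, and of the level after a claim.\<close>
    have "\<kappa> * (\<Phi> z' + lam * h * (?K z' - \<Phi> z')) - (\<Phi> z + h * drift z)
      = h * g z * ((\<kappa> * (1 - lam * h) - 1) * \<Phi>' \<xi> + (\<Phi>' \<xi> - \<Phi>' z))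
        + (\<kappa> * (1 - lam * h) - 1 + (lam + delta) * h) * \<Phi> z
        + lam * h * (\<kappa> * (?K z' - ?K z) + (\<kappa> - 1) * ?K z)"
    proof -
      have "\<Phi> z' = \<Phi> z + h * g z * \<Phi>' \<xi>" using \<xi>(3) by (simp add: z'_def)
      then show ?thesis by (simp add: drift_def algebra_simps)
    qed
    also have "\<bar>\<dots>\<bar> \<le> h * gm * ((lam + delta) * h * p + \<eta>) + (delta\<^sup>2 + lam * delta) * h\<^sup>2 * \<Phi> R + lam * h * (\<eta> + delta * h * q)"
    proof -
      have "\<bar>(\<kappa> * (1 - lam * h) - 1) * \<Phi>' \<xi>\<bar> \<le> (lam + delta) * h * p"
        unfolding abs_mult using c1 p(2)[of \<xi>] \<xi> z z' lam_pos delta_pos h by (intro mult_mono) auto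
      then have "\<bar>(\<kappa> * (1 - lam * h) - 1) * \<Phi>' \<xi> + (\<Phi>' \<xi> - \<Phi>' z)\<bar> \<le> (lam + delta) * h * p + \<eta>"
        using dP by linarith
      then have 1: "\<bar>h * g z * ((\<kappa> * (1 - lam * h) - 1) * \<Phi>' \<xi> + (\<Phi>' \<xi> - \<Phi>' z))\<bar> \<le> h * gm * ((lam + delta) * h * p + \<eta>)"
        unfolding abs_mult[of "h * g z"] using h gz by (intro mult_mono) auto
      have 2: "\<bar>(\<kappa> * (1 - lam * h) - 1 + (lam + delta) * h) * \<Phi> z\<bar> \<le> (delta\<^sup>2 + lam * delta) * h\<^sup>2 * \<Phi> R"
        unfolding abs_mult using c2 barrier_mono[OF z(2)] barrier_nonneg[of z] lam_pos delta_pos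
        by (intro mult_mono) auto
      have "\<bar>\<kappa> * (?K z' - ?K z)\<bar> \<le> 1 * \<eta>" unfolding abs_mult using \<kappa> dK by (intro mult_mono) auto
      moreover have "\<bar>(\<kappa> - 1) * ?K z\<bar> \<le> delta * h * q"
        unfolding abs_mult using \<kappa>(3) q(2)[of z] z z' dh by (intro mult_mono) auto
      ultimately have "\<bar>\<kappa> * (?K z' - ?K z) + (\<kappa> - 1) * ?K z\<bar> \<le> \<eta> + delta * h * q" by linarith
      then have 3: "\<bar>lam * h * (\<kappa> * (?K z' - ?K z) + (\<kappa> - 1) * ?K z)\<bar> \<le> lam * h * (\<eta> + delta * h * q)"
        unfolding abs_mult[of "lam * h"] using lh by (intro mult_mono) auto
      from 1 2 3 show ?thesis by linarith
    qed
    also have "\<dots> = h * ((gm + lam) * \<eta> + h * m)" by (simp add: m_def power2_eq_square algebra_simps)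
    also have "\<dots> \<le> h * (e / 2 + e / 2)"
    proof -
      have "(gm + lam) * \<eta> \<le> e / 2" using e gm lam_pos by (simp add: \<eta>_def field_simps)
      moreover have "h * m \<le> e / 2" using hb(4) h m by (simp add: algebra_simps)
      ultimately show ?thesis using h by (intro mult_left_mono add_mono) auto
    qed
    finally show "\<bar>exp (- delta * h) * (\<Phi> (z + h * g z) + lam * h * (?K (z + h * g z) - \<Phi> (z + h * g z))) - (\<Phi> z + h * drift z)\<bar> \<le> e * h"
      by (simp add: z'_def \<kappa>_def mult.commute)
  qed
qed

end

context dividend_model
begin

definition rate :: "real \<Rightarrow> real" where "rate z = g (max 0 z)"

text \<open>Adding 1 makes the constant strictly positive even if the chosen Lipschitz constant is
  0.\<close>

definition rate_lip :: real where "rate_lip = (SOME L. L-lipschitz_on {0..} g) + 1"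

lemma rate_lipschitz: "0 < rate_lip" "\<bar>rate u - rate v\<bar> \<le> rate_lip * \<bar>u - v\<bar>"
proof -
  define L where "L = (SOME L. L-lipschitz_on {0..} g)"
  have L: "L-lipschitz_on {0..} g" unfolding L_def using g_lipschitz by (rule someI_ex)
  then show pos: "0 < rate_lip" using lipschitz_on_nonneg by (fastforce simp: rate_lip_def L_def)
  have "\<bar>rate u - rate v\<bar> \<le> L * \<bar>max 0 u - max 0 v\<bar>"
    unfolding rate_def using lipschitz_onD[OF L, of "max 0 u" "max 0 v"] by (simp add: dist_real_def)
  also have "\<dots> \<le> rate_lip * \<bar>u - v\<bar>"
    using lipschitz_on_nonneg[OF L] by (intro mult_mono) (auto simp: rate_lip_def L_def)
  finally show "\<bar>rate u - rate v\<bar> \<le> rate_lip * \<bar>u - v\<bar>" .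
qed

sublocale premium_rate rate rate_lip
  by unfold_locales (use rate_lipschitz in \<open>auto simp: rate_def g_pos\<close>)

end

section \<open>Averaging one Euler step over the claims\<close>

locale dividend_barrier = dividend_model M F N Y g lam alpha
  for M :: "'a measure" and F :: "real \<Rightarrow> 'a measure" and N :: "real \<Rightarrow> 'a \<Rightarrow> nat" and Y :: "nat \<Rightarrow> 'a \<Rightarrow> real"
    and g :: "real \<Rightarrow> real" and lam alpha :: real +
  fixes delta :: real and \<psi> :: "real \<Rightarrow> real" and b :: real
  assumes discount: "0 < delta" and barrier: "0 < b"
    and solution: "ide_solution g lam alpha delta \<psi>"
    and positive: "\<And>x. 0 \<le> x \<Longrightarrow> 0 < \<psi> x"
    and increasing: "strict_mono_on {0..} \<psi>"
    and minimum: "\<And>x. 0 \<le> x \<Longrightarrow> hderiv \<psi> b \<le> hderiv \<psi> x"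
    and convex: "mono_on {b<..} (hderiv \<psi>)"
begin

sublocale barrier_problem g lam alpha delta \<psi> b
proof
  show "continuous_on {0..} g"
    using g_lipschitz lipschitz_on_continuous_on by blast
qed (use lam_pos alpha_pos discount barrier g_pos solution positive increasing minimum convex in auto)

lemma AE_claims_increasing:
  assumes "0 \<le> s" "s \<le> t"
  shows "AE \<omega> in M. C s \<omega> \<le> C t \<omega>"
  using AE_good_path
  by eventually_elim (use assms good_path_claims(2) in \<open>auto simp: monotone_on_def\<close>)

definition law_const :: real where "law_const = 4 * exp lam + 2"

lemma law_const_pos: "0 \<le> law_const" by (simp add: law_const_def add_nonneg_nonneg)

text \<open>The increment of the claims is independent of \<open>F s\<close>, so it may be averaged
  with \<open>U\<close> held fixed. \<open>claims_increment_expansion\<close> for the test function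
  \<Phi> after the step then reduces the mean to \<open>generator_expansion\<close>. The step has to
  lie within one unit interval because that expansion does.\<close>

lemma one_step_generator:
  assumes R: "0 \<le> R" and e: "0 < e"
  obtains h\<^sub>0 where "0 < h\<^sub>0"
    "\<And>k s h U. 0 < h \<Longrightarrow> h < h\<^sub>0 \<Longrightarrow> real k \<le> s \<Longrightarrow> s + h \<le> real (Suc k) \<Longrightarrow> U \<in> borel_measurable (F s) \<Longrightarrow>
       (\<And>\<omega>. U \<omega> \<le> R) \<Longrightarrow>
       \<bar>expectation (\<lambda>\<omega>. indicator {0..} (U \<omega>) * (exp (- delta * h) * \<Phi> (U \<omega> + h * g (U \<omega>) - (C (s + h) \<omega> - C s \<omega>))))
        - expectation (\<lambda>\<omega>. indicator {0..} (U \<omega>) * (\<Phi> (U \<omega>) + h * drift (U \<omega>)))\<bar> \<le> e * h"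
proof -
  obtain h\<^sub>1 where h1: "0 < h\<^sub>1" "\<And>h z. 0 < h \<Longrightarrow> h < h\<^sub>1 \<Longrightarrow> 0 \<le> z \<Longrightarrow> z \<le> R \<Longrightarrow>
       \<bar>exp (- delta * h) * (\<Phi> (z + h * g z) + lam * h * (exp_conv alpha \<Phi> (z + h * g z) - \<Phi> (z + h * g z)))
        - (\<Phi> z + h * drift z)\<bar> \<le> e / 2 * h"
    using generator_expansion[OF R half_gt_zero[OF e]] by metis
  obtain gm where gm: "0 \<le> gm" "\<And>z. 0 \<le> z \<Longrightarrow> z \<le> R \<Longrightarrow> \<bar>g z\<bar> \<le> gm"
    using continuous_on_Icc_bounded[OF continuous_on_subset[OF g_cont], of 0 R] by auto
  define B where "B = \<Phi> (R + gm)"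
  have B: "0 \<le> B" unfolding B_def by (rule barrier_nonneg)
  obtain D where D: "0 \<le> D" "\<And>z. 0 \<le> z \<Longrightarrow> z \<le> R \<Longrightarrow> \<bar>drift z\<bar> \<le> D"
    using continuous_on_Icc_bounded[OF continuous_on_subset[OF drift_continuous], of 0 R] by auto
  define m where "m = law_const * B * lam\<^sup>2"
  have m: "0 \<le> m" using law_const_pos B by (simp add: m_def)
  define h\<^sub>0 where "h\<^sub>0 = Min {1, h\<^sub>1, e / (2 * (m + 1))}"
  have h0: "0 < h\<^sub>0" using h1 e m by (auto simp: h\<^sub>0_def)
  show thesis
  proof (rule that[OF h0])
    fix k s h U
    assume h: "0 < h" "h < h\<^sub>0" and s: "real k \<le> s" "s + h \<le> real (Suc k)"
      and U: "U \<in> borel_measurable (F s)" "\<And>\<omega>. U \<omega> \<le> R"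
    have hb: "h \<le> 1" "h < h\<^sub>1" "h * (m + 1) \<le> e / 2" using h m by (auto simp: h\<^sub>0_def field_simps)
    have s0: "0 \<le> s" "0 \<le> s + h" using s h by auto
    have Um [measurable]: "U \<in> borel_measurable M" by (rule F_measurable_M[OF U(1) s0(1)])
    have Cm [measurable]: "C (s + h) \<in> borel_measurable M" "C s \<in> borel_measurable M" using s0 by auto
    let ?D = "\<lambda>\<omega>. C (s + h) \<omega> - C s \<omega>"
    \<comment> \<open>Restricting the level to \<open>{0..R}\<close> and taking the positive part of
      the increment make \<open>W\<close> bounded everywhere; almost surely neither changes the
      value at the arguments that occur.\<close>
    define W where "W p = indicator {0..R} (fst p) * (exp (- delta * h) * \<Phi> (fst p + h * rate (fst p) - max 0 (snd p)))" for p :: "real \<times> real"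
    define V where "V z = indicator {0..R} z * (\<Phi> z + h * drift (max 0 z))" for z
    have Wm [measurable]: "W \<in> borel_measurable (borel \<Otimes>\<^sub>M borel)" unfolding W_def by measurable
    have drift_m [measurable]: "(\<lambda>z. drift (max 0 z)) \<in> borel_measurable borel"
      by (intro borel_measurable_continuous_onI continuous_on_compose2[OF drift_continuous] continuous_intros) auto
    have Vm [measurable]: "V \<in> borel_measurable borel" unfolding V_def by measurable
    have \<Phi>b: "\<Phi> (z + h * rate z - max 0 y) \<le> B" if "0 \<le> z" "z \<le> R" for z y
    proof -
      have "h * rate z \<le> gm" using that gm(2)[of z] hb h gm(1) mult_mono[of h 1 "rate z" gm] rate_pos[of z]
        by (auto simp: rate_def max_def)
      then show ?thesis unfolding B_def using that by (intro barrier_mono) auto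
    qed
    have \<kappa>: "exp (- delta * h) \<le> 1" using discount h by simp
    have Wb: "\<bar>W p\<bar> \<le> B" for p
      unfolding W_def using \<Phi>b[of "fst p" "snd p"] barrier_nonneg \<kappa> B
      by (auto simp: indicator_def abs_mult intro: order_trans[OF mult_left_le_one_le])
    have Vb: "\<bar>V z\<bar> \<le> B + D" for z
    proof (cases "z \<in> {0..R}")
      case True
      have "\<Phi> z \<le> B" unfolding B_def using True gm by (intro barrier_mono) auto
      moreover have "\<bar>h * drift z\<bar> \<le> 1 * D" unfolding abs_mult using True D hb h by (intro mult_mono) auto
      ultimately show ?thesis using True barrier_nonneg[of z] by (auto simp: V_def indicator_def max_def)
    qed (use B D in \<open>auto simp: V_def\<close>)
    have inner: "\<bar>expectation (\<lambda>\<omega>'. W (z, ?D \<omega>')) - V z\<bar> \<le> e * h" for z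
    proof (cases "z \<in> {0..R}")
      case True
      then have z: "0 \<le> z" "z \<le> R" and rz: "rate z = g z" by (auto simp: rate_def)
      define f where "f y = \<Phi> (z + h * g z - max 0 y)" for y
      have fm: "f \<in> borel_measurable borel" unfolding f_def by measurable
      have fb: "\<bar>f y\<bar> \<le> B" for y using \<Phi>b[OF z, of y] barrier_nonneg by (simp add: f_def rz)
      have "(\<integral>y. f y \<partial>density lborel (exponential_density alpha)) = (\<integral>y. \<Phi> (z + h * g z - y) \<partial>density lborel (exponential_density alpha))"
      proof (rule integral_cong_AE)
        show "AE y in density lborel (exponential_density alpha). f y = \<Phi> (z + h * g z - y)"
          by (subst AE_density) (auto simp: f_def exponential_density_def)
      qed (use fm in auto)
      also have "\<dots> = exp_conv alpha \<Phi> (z + h * g z)"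
        by (rule integral_exponential_density[OF barrier_measurable barrier_neg alpha_pos])
      finally have mean: "exp_conv alpha \<Phi> (z + h * g z) = (\<integral>y. f y \<partial>density lborel (exponential_density alpha))" by simp
      have "\<bar>expectation (\<lambda>\<omega>. f (?D \<omega>)) - (f 0 + lam * (s + h - s) * (exp_conv alpha \<Phi> (z + h * g z) - f 0))\<bar>
         \<le> (4 * exp lam + 2) * B * (lam * (s + h - s))\<^sup>2"
        by (rule claims_increment_expansion[OF fm fb mean s(1) _ s(2)]) (use h in simp)
      then have "\<bar>expectation (\<lambda>\<omega>. f (?D \<omega>)) - (f 0 + lam * h * (exp_conv alpha \<Phi> (z + h * g z) - f 0))\<bar> \<le> m * h\<^sup>2"
        by (simp add: m_def law_const_def power_mult_distrib mult.assoc)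
      then have "\<bar>exp (- delta * h) * (expectation (\<lambda>\<omega>. f (?D \<omega>)) - (f 0 + lam * h * (exp_conv alpha \<Phi> (z + h * g z) - f 0)))\<bar> \<le> 1 * (m * h\<^sup>2)"
        unfolding abs_mult using \<kappa> by (intro mult_mono) auto
      moreover have "m * h\<^sup>2 \<le> e / 2 * h" using hb(3) h m by (simp add: power2_eq_square algebra_simps)
      moreover have "expectation (\<lambda>\<omega>'. W (z, ?D \<omega>')) = exp (- delta * h) * expectation (\<lambda>\<omega>. f (?D \<omega>))"
        using True by (simp add: W_def f_def rz)
      moreover have "V z = \<Phi> z + h * drift z" using True by (simp add: V_def)
      moreover have "exp (- delta * h) * expectation (\<lambda>\<omega>. f (?D \<omega>)) - (\<Phi> z + h * drift z)
        = exp (- delta * h) * (expectation (\<lambda>\<omega>. f (?D \<omega>)) - (f 0 + lam * h * (exp_conv alpha \<Phi> (z + h * g z) - f 0)))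
          + (exp (- delta * h) * (f 0 + lam * h * (exp_conv alpha \<Phi> (z + h * g z) - f 0)) - (\<Phi> z + h * drift z))"
        by (simp only: right_diff_distrib)
      moreover have "f 0 = \<Phi> (z + h * g z)" by (simp add: f_def)
      ultimately show ?thesis using h1(2)[OF h(1) hb(2) z] by (simp only:)
    qed (use e h in \<open>auto simp: W_def V_def\<close>)
    have "expectation (\<lambda>\<omega>. indicator {0..} (U \<omega>) * (exp (- delta * h) * \<Phi> (U \<omega> + h * g (U \<omega>) - ?D \<omega>))) = expectation (\<lambda>\<omega>. W (U \<omega>, ?D \<omega>))"
    proof (rule Bochner_Integration.integral_cong_AE)
      show "AE \<omega> in M. indicator {0..} (U \<omega>) * (exp (- delta * h) * \<Phi> (U \<omega> + h * g (U \<omega>) - ?D \<omega>)) = W (U \<omega>, ?D \<omega>)"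
        using AE_claims_increasing[OF s0(1), of "s + h"] h U(2)
        by (auto simp: W_def indicator_def rate_def)
      have "(\<lambda>\<omega>. indicator {0..} (U \<omega>) * (exp (- delta * h) * \<Phi> (U \<omega> + h * g (U \<omega>) - ?D \<omega>))) = (\<lambda>\<omega>. indicator {0..} (U \<omega>) * (exp (- delta * h) * \<Phi> (U \<omega> + h * rate (U \<omega>) - ?D \<omega>)))"
        by (auto simp: indicator_def rate_def)
      also have "\<dots> \<in> borel_measurable M" by measurable
      finally show "(\<lambda>\<omega>. indicator {0..} (U \<omega>) * (exp (- delta * h) * \<Phi> (U \<omega> + h * g (U \<omega>) - ?D \<omega>))) \<in> borel_measurable M" .
    qed measurable
    also have "\<dots> = expectation (\<lambda>\<omega>. expectation (\<lambda>\<omega>'. W (U \<omega>, ?D \<omega>')))"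
      by (rule indep_var_integral(1)[OF claims_increment_indep[OF s0(1) _ U(1)] Wm Wb]) (use h in simp)
    finally have eq1: "expectation (\<lambda>\<omega>. indicator {0..} (U \<omega>) * (exp (- delta * h) * \<Phi> (U \<omega> + h * g (U \<omega>) - ?D \<omega>))) = \<dots>" .
    have eq2: "expectation (\<lambda>\<omega>. indicator {0..} (U \<omega>) * (\<Phi> (U \<omega>) + h * drift (U \<omega>))) = expectation (\<lambda>\<omega>. V (U \<omega>))"
      by (rule Bochner_Integration.integral_cong) (use U(2) in \<open>auto simp: V_def indicator_def\<close>)
    have im: "(\<lambda>\<omega>. expectation (\<lambda>\<omega>'. W (U \<omega>, ?D \<omega>'))) \<in> borel_measurable M"
      by measurable
    have ib: "\<bar>expectation (\<lambda>\<omega>'. W (U \<omega>, ?D \<omega>'))\<bar> \<le> e * h + (B + D)" for \<omega>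
      using inner[of "U \<omega>"] Vb[of "U \<omega>"] by linarith
    have "\<bar>expectation (\<lambda>\<omega>. expectation (\<lambda>\<omega>'. W (U \<omega>, ?D \<omega>'))) - expectation (\<lambda>\<omega>. V (U \<omega>))\<bar> \<le> expectation (\<lambda>_. e * h)"
    proof (rule expectation_close)
      show "integrable M (\<lambda>\<omega>. expectation (\<lambda>\<omega>'. W (U \<omega>, ?D \<omega>')))" by (rule bounded_integrable[OF im ib])
      show "integrable M (\<lambda>\<omega>. V (U \<omega>))" by (rule bounded_integrable[OF _ Vb]) measurable
    qed (use inner in auto)
    then show "\<bar>expectation (\<lambda>\<omega>. indicator {0..} (U \<omega>) * (exp (- delta * h) * \<Phi> (U \<omega> + h * g (U \<omega>) - ?D \<omega>)))
        - expectation (\<lambda>\<omega>. indicator {0..} (U \<omega>) * (\<Phi> (U \<omega>) + h * drift (U \<omega>)))\<bar> \<le> e * h"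
      unfolding eq1 eq2 by (simp add: prob_space)
  qed
qed

text \<open>A claim occurs with probability about \<open>lam * h\<close>, and its size falls into a
  window of length \<open>2 * c * h\<close> with probability at most
  \<open>alpha * (2 * c * h)\<close>. The product is of second order, which makes the jump of \<Phi>
  at 0 harmless on the grid.\<close>

lemma one_step_hit:
  assumes h: "0 < h" "0 \<le> c" and s: "real k \<le> s" "s + h \<le> real (Suc k)" and U: "U \<in> borel_measurable (F s)"
  shows "expectation (\<lambda>\<omega>. if C (s + h) \<omega> - C s \<omega> \<noteq> 0 \<and> \<bar>C (s + h) \<omega> - C s \<omega> - (U \<omega> + h * rate (U \<omega>))\<bar> \<le> c * h then 1 else 0 :: real)
    \<le> (2 * lam * alpha * c + law_const * lam\<^sup>2) * h\<^sup>2"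
proof -
  have s0: "0 \<le> s" "0 \<le> s + h" using s h by auto
  have Um [measurable]: "U \<in> borel_measurable M" by (rule F_measurable_M[OF U(1) s0(1)])
  have Cm [measurable]: "C (s + h) \<in> borel_measurable M" "C s \<in> borel_measurable M" using s0 by auto
  let ?D = "\<lambda>\<omega>. C (s + h) \<omega> - C s \<omega>"
  define W where "W p = (if snd p \<noteq> 0 \<and> \<bar>snd p - (fst p + h * rate (fst p))\<bar> \<le> c * h then 1 else 0 :: real)" for p :: "real \<times> real"
  have Wm [measurable]: "W \<in> borel_measurable (borel \<Otimes>\<^sub>M borel)" unfolding W_def by measurable
  have Wb: "\<bar>W p\<bar> \<le> 1" for p by (auto simp: W_def)
  have inner: "expectation (\<lambda>\<omega>'. W (z, ?D \<omega>')) \<le> (2 * lam * alpha * c + law_const * lam\<^sup>2) * h\<^sup>2" for z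
  proof -
    define f where "f y = W (z, y)" for y
    have fm [measurable]: "f \<in> borel_measurable borel" unfolding f_def by measurable
    define z' where "z' = z + h * rate z"
    have "(\<integral>y. f y \<partial>density lborel (exponential_density alpha)) = (\<integral>y. exponential_density alpha y *\<^sub>R f y \<partial>lborel)"
      by (rule integral_density) (use alpha_pos in \<open>auto simp: exponential_density_def\<close>)
    also have "\<dots> \<le> (\<integral>y. alpha * indicator {z' - c * h..z' + c * h} y \<partial>lborel)"
    proof (rule integral_mono')
      show "integrable lborel (\<lambda>y. alpha * indicator {z' - c * h..z' + c * h} y)"
        by (intro integrable_mult_right integrable_real_indicator) (auto simp: emeasure_lborel_Icc_eq)
      fix y
      have "exponential_density alpha y \<le> alpha" using alpha_pos by (auto simp: exponential_density_def mult_le_cancel_left1)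
      then show "exponential_density alpha y *\<^sub>R f y \<le> alpha * indicator {z' - c * h..z' + c * h} y"
        using alpha_pos by (auto simp: f_def W_def z'_def indicator_def)
      show "0 \<le> alpha * indicator {z' - c * h..z' + c * h} y"
        using alpha_pos by simp
    qed
    also have "\<dots> = alpha * (2 * c * h)" using h by simp
    finally have mean: "(\<integral>y. f y \<partial>density lborel (exponential_density alpha)) \<le> alpha * (2 * c * h)" .
    have "\<bar>expectation (\<lambda>\<omega>. f (?D \<omega>)) - (f 0 + lam * (s + h - s) * ((\<integral>y. f y \<partial>density lborel (exponential_density alpha)) - f 0))\<bar>
         \<le> (4 * exp lam + 2) * 1 * (lam * (s + h - s))\<^sup>2"
      by (rule claims_increment_expansion[OF fm _ refl s(1) _ s(2)]) (use h Wb in \<open>auto simp: f_def\<close>)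
    moreover have "f 0 = 0" by (simp add: f_def W_def)
    ultimately have "expectation (\<lambda>\<omega>. f (?D \<omega>)) \<le> lam * h * (\<integral>y. f y \<partial>density lborel (exponential_density alpha)) + law_const * (lam * h)\<^sup>2"
      by (simp add: law_const_def)
    also have "\<dots> \<le> lam * h * (alpha * (2 * c * h)) + law_const * (lam * h)\<^sup>2"
      using mean lam_pos h by (intro add_right_mono mult_left_mono) auto
    also have "\<dots> = (2 * lam * alpha * c + law_const * lam\<^sup>2) * h\<^sup>2" by (simp add: power2_eq_square algebra_simps)
    finally show ?thesis by (simp add: f_def)
  qed
  have "expectation (\<lambda>\<omega>. if ?D \<omega> \<noteq> 0 \<and> \<bar>?D \<omega> - (U \<omega> + h * rate (U \<omega>))\<bar> \<le> c * h then 1 else 0 :: real) = expectation (\<lambda>\<omega>. W (U \<omega>, ?D \<omega>))"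
    by (simp add: W_def)
  also have "\<dots> = expectation (\<lambda>\<omega>. expectation (\<lambda>\<omega>'. W (U \<omega>, ?D \<omega>')))"
    by (rule indep_var_integral(1)[OF claims_increment_indep[OF s0(1) _ U(1)] Wm Wb]) (use h in simp)
  also have "\<dots> \<le> expectation (\<lambda>_. (2 * lam * alpha * c + law_const * lam\<^sup>2) * h\<^sup>2)"
  proof (rule integral_mono[OF bounded_integrable[where B=1]])
    show "(\<lambda>\<omega>. expectation (\<lambda>\<omega>'. W (U \<omega>, ?D \<omega>'))) \<in> borel_measurable M" by measurable
    fix \<omega>
    have "\<bar>expectation (\<lambda>\<omega>'. W (U \<omega>, ?D \<omega>'))\<bar> \<le> expectation (\<lambda>_. 1)"
      by (rule order_trans[OF integral_abs_bound integral_mono[OF integrable_abs[OF bounded_integrable[OF _ Wb]]]]) (use Wb in auto)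
    then show "\<bar>expectation (\<lambda>\<omega>'. W (U \<omega>, ?D \<omega>'))\<bar> \<le> 1" by (simp add: prob_space)
  qed (use inner in auto)
  finally show ?thesis by (simp add: prob_space)
qed

end

section \<open>The controlled surplus on a time grid\<close>

text \<open>Discounted one-step inequalities telescope, and discount factors below 1 only shrink the
  errors. \<open>\<sigma>\<close> will be 1 for the upper and -1 for the lower bound.\<close>

lemma grid_sum_bound:
  fixes A j r :: "nat \<Rightarrow> real"
  assumes step: "\<And>i. i < n \<Longrightarrow> \<sigma> * (exp (- delta * h) * (A (Suc i) + j i)) \<le> \<sigma> * A i + r i"
    and r: "\<And>i. i < n \<Longrightarrow> 0 \<le> r i" and dh: "0 \<le> delta * h"
  shows "\<sigma> * ((\<Sum>i<n. exp (- delta * (real (Suc i) * h)) * j i) + exp (- delta * (real n * h)) * A n) \<le> \<sigma> * A 0 + (\<Sum>i<n. r i)"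
  using step r
proof (induction n)
  case (Suc n)
  let ?k = "exp (- delta * (real n * h))"
  have "0 \<le> real n * (delta * h)" by (rule mult_nonneg_nonneg[OF of_nat_0_le_iff dh])
  then have k: "0 < ?k" "?k \<le> 1" by (simp_all add: mult.left_commute)
  have ex: "exp (- delta * (real (Suc n) * h)) = ?k * exp (- delta * h)"
    by (simp add: exp_add[symmetric] algebra_simps)
  have "?k * (\<sigma> * (exp (- delta * h) * (A (Suc n) + j n))) \<le> ?k * (\<sigma> * A n + r n)"
    using Suc.prems(1)[of n] k by (intro mult_left_mono) auto
  also have "\<dots> \<le> ?k * (\<sigma> * A n) + r n"
    using mult_right_mono[of ?k 1 "r n"] k Suc.prems(2)[of n] by (simp add: distrib_left)
  finally have "\<sigma> * (exp (- delta * (real (Suc n) * h)) * (A (Suc n) + j n)) \<le> ?k * (\<sigma> * A n) + r n"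
    unfolding ex by (simp add: mult.left_commute mult.assoc)
  moreover have "\<sigma> * ((\<Sum>i<n. exp (- delta * (real (Suc i) * h)) * j i) + ?k * A n) \<le> \<sigma> * A 0 + (\<Sum>i<n. r i)"
    using Suc by auto
  ultimately show ?case by (simp add: algebra_simps)
qed simp

lemma is_surplus_pathD:
  assumes "is_surplus_path g x c d X"
  shows "flow_equation (\<lambda>z. g (max 0 z)) (\<lambda>t. x - c t - d t) X" "\<And>t. t < 0 \<Longrightarrow> X t = x"
proof -
  show "flow_equation (\<lambda>z. g (max 0 z)) (\<lambda>t. x - c t - d t) X"
    unfolding flow_equation_def
  proof (intro allI impI)
    fix t :: real assume "0 \<le> t"
    then have i: "set_integrable lborel {0..t} (\<lambda>s. g (max 0 (X s)))"
      and e: "X t = x + (LBINT s:{0..t}. g (max 0 (X s))) - c t - d t"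
      using assms by (auto simp: is_surplus_path_def)
    show "(\<lambda>s. g (max 0 (X s))) integrable_on {0..t} \<and> X t = x - c t - d t + integral {0..t} (\<lambda>s. g (max 0 (X s)))"
      using set_borel_integral_eq_integral[OF i] e by simp
  qed
  show "\<And>t. t < 0 \<Longrightarrow> X t = x" using assms by (auto simp: is_surplus_path_def)
qed

context dividend_model
begin

lemma rate_eq: "(\<lambda>z. g (max 0 z)) = rate"
  by (simp add: rate_def fun_eq_iff)

text \<open>Justifies the definite description. Existence needs measurability and local boundedness
  of the driving path, both due to its monotonicity; uniqueness is that of flows.\<close>

lemma is_surplus_path_surplus_path:
  assumes x: "0 \<le> x" and anti: "antimono_on {0..} (\<lambda>t. x - c t - d t)" and start: "x - c 0 - d 0 \<le> x"
  shows "is_surplus_path g x c d (surplus_path g x c d)"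
proof -
  let ?f = "\<lambda>t. x - c t - d t"
  \<comment> \<open>Freezing the driving path at its initial value for negative times makes it
    monotone on the whole line.\<close>
  define f where "f s = ?f (max 0 s)" for s
  have am: "f t \<le> f s" if "s \<le> t" for s t
    unfolding f_def using anti that by (auto simp: monotone_on_def)
  have "mono (\<lambda>s. - f s)" using am by (auto simp: mono_def)
  then have "(\<lambda>s. - f s) \<in> borel_measurable borel" by (rule borel_measurable_mono)
  then have fm: "f \<in> borel_measurable borel" by simp
  have "\<bar>f s\<bar> \<le> \<bar>f 0\<bar> + \<bar>f T\<bar>" if "s \<in> {0..T}" for s T
    using am[of 0 s] am[of s T] that by auto
  then have bd: "\<exists>B. \<forall>s\<in>{0..T}. \<bar>f s\<bar> \<le> B" for T by blast
  obtain X\<^sub>0 where X0: "flow_equation rate f X\<^sub>0" "X\<^sub>0 \<in> borel_measurable borel"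
    using flow_exists[OF fm bd] by blast
  define X where "X t = (if t < 0 then x else X\<^sub>0 t)" for t
  have fx: "f t \<le> x" for t using am[of 0 "max 0 t"] start by (simp add: f_def)
  have "is_surplus_path g x c d X"
    unfolding is_surplus_path_def
  proof (intro conjI allI impI)
    fix t :: real assume t: "0 \<le> t"
    have m: "(\<lambda>s. g (max 0 (X s))) \<in> borel_measurable borel"
    proof -
      have "X \<in> borel_measurable borel" unfolding X_def using X0(2) by measurable
      then have "(\<lambda>s. rate (X s)) \<in> borel_measurable borel" by measurable
      then show ?thesis by (simp add: rate_def)
    qed
    have "\<bar>g (max 0 (X s))\<bar> \<le> top_rate x t" if "s \<in> {0..t}" for s
    proof -
      have "X s \<le> reach x t" using flow_le_reach[OF X0(1) fx x, of s t] that by (simp add: X_def)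
      then show ?thesis using rate_le_top_rate[OF x t, of "X s"] rate_pos[of "X s"] by (simp add: rate_def)
    qed
    with m show i: "set_integrable lborel {0..t} (\<lambda>s. g (max 0 (X s)))" by (rule bounded_measurable_set_integrable)
    have "X t = f t + integral {0..t} (\<lambda>s. rate (X\<^sub>0 s))" using flow_equationD(2)[OF X0(1) t] t by (simp add: X_def)
    also have "integral {0..t} (\<lambda>s. rate (X\<^sub>0 s)) = integral {0..t} (\<lambda>s. g (max 0 (X s)))"
      by (rule integral_cong) (simp add: X_def rate_def)
    finally show "X t = x + (LBINT s:{0..t}. g (max 0 (X s))) - c t - d t"
      using set_borel_integral_eq_integral(2)[OF i] t by (simp add: f_def)
  qed (simp add: X_def)
  moreover have "X' = X" if "is_surplus_path g x c d X'" for X'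
  proof
    fix t show "X' t = X t"
      using is_surplus_pathD[OF that] is_surplus_pathD[OF calculation] flow_unique[of ?f X' X t]
      by (cases "t < 0") (auto simp: rate_eq)
  qed
  ultimately show ?thesis unfolding surplus_path_def by (rule theI)
qed

lemma control_pathD:
  assumes "control_path d"
  shows "mono d" "\<And>t. t < 0 \<Longrightarrow> d t = 0" "0 \<le> d 0" "\<And>t. continuous (at_right t) d"
proof -
  show "mono d" "\<And>t. t < 0 \<Longrightarrow> d t = 0" "\<And>t. continuous (at_right t) d"
    using assms by (auto simp: control_path_def cadlag_def)
  then show "0 \<le> d 0" using monoD[of d "-1" 0] by simp
qed

lemma controlled_path:
  assumes good: "good_path \<omega>" and d: "control_path (\<lambda>t. D t \<omega>)" and x: "0 \<le> x"
  defines "f \<equiv> \<lambda>t. x - C t \<omega> - D t \<omega>"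
  shows "flow_equation rate f (surplus g N Y x D \<omega>)" "antimono_on {0..} f" "f 0 \<le> x"
    "\<And>t. 0 \<le> t \<Longrightarrow> f t \<le> x" "\<And>t. t < 0 \<Longrightarrow> surplus g N Y x D \<omega> t = x"
    "surplus g N Y x D \<omega> 0 = x - D 0 \<omega>"
proof -
  show anti: "antimono_on {0..} f"
    using good_path_claims(2)[OF good] control_pathD(1)[OF d]
    by (auto simp: f_def monotone_on_def mono_def intro: diff_mono)
  show f0: "f 0 \<le> x" using good_path_claims(1)[OF good] control_pathD(3)[OF d] by (simp add: f_def)
  show "f t \<le> x" if "0 \<le> t" for t using anti f0 that by (auto simp: monotone_on_def intro: order_trans)
  have p: "is_surplus_path g x (\<lambda>t. C t \<omega>) (\<lambda>t. D t \<omega>) (surplus g N Y x D \<omega>)"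
    unfolding surplus_def by (rule is_surplus_path_surplus_path[OF x anti[unfolded f_def] f0[unfolded f_def]])
  show fe: "flow_equation rate f (surplus g N Y x D \<omega>)" using is_surplus_pathD(1)[OF p] by (simp add: rate_eq f_def)
  show "\<And>t. t < 0 \<Longrightarrow> surplus g N Y x D \<omega> t = x" by (rule is_surplus_pathD(2)[OF p])
  show "surplus g N Y x D \<omega> 0 = x - D 0 \<omega>"
    using flow_equationD(2)[OF fe, of 0] good_path_claims(1)[OF good] by (simp add: f_def)
qed

section \<open>Adaptedness through Euler schemes\<close>

lemma euler_measurable:
  assumes S [measurable]: "S \<in> borel_measurable borel" and f: "\<And>t. 0 \<le> t \<Longrightarrow> f t \<in> borel_measurable (F t)" and h: "0 \<le> h"
  shows "(\<lambda>\<omega>. euler S (\<lambda>t. f t \<omega>) h i) \<in> borel_measurable (F (real i * h))"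
proof (induction i)
  case 0
  then show ?case using f[of 0] by simp
next
  case (Suc i)
  have le: "real i * h \<le> real (Suc i) * h" "0 \<le> real i * h" "0 \<le> real (Suc i) * h" using h by (auto intro: mult_right_mono)
  have [measurable]: "(\<lambda>\<omega>. euler S (\<lambda>t. f t \<omega>) h i) \<in> borel_measurable (F (real (Suc i) * h))"
    by (rule F_measurable_mono[OF Suc le(1)])
  have [measurable]: "f (real i * h) \<in> borel_measurable (F (real (Suc i) * h))" by (rule F_measurable_mono[OF f[OF le(2)] le(1)])
  have [measurable]: "f (real (Suc i) * h) \<in> borel_measurable (F (real (Suc i) * h))" by (rule f[OF le(3)])
  show ?case unfolding euler.simps by measurable
qed

text \<open>Each scheme is known at time \<open>t\<close>. The limit exists only almost surely, and
  \<open>measurable_F_AE_cong\<close> transfers measurability to a process that equals it off a null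
  set.\<close>

lemma euler_limit_measurable:
  assumes S: "\<And>n. S n \<in> borel_measurable borel" and f: "\<And>t. 0 \<le> t \<Longrightarrow> f t \<in> borel_measurable (F t)" and t: "0 \<le> t"
    and lim: "AE \<omega> in M. (\<lambda>n. euler (S n) (\<lambda>t. f t \<omega>) (t / real n) n) \<longlonglongrightarrow> X \<omega>"
  shows "X \<in> borel_measurable (F t)"
proof -
  let ?e = "\<lambda>n \<omega>. euler (S n) (\<lambda>t. f t \<omega>) (t / real n) n"
  have "?e n \<in> borel_measurable (F t)" for n
  proof -
    have "?e n \<in> borel_measurable (F (real n * (t / real n)))" using t by (intro euler_measurable S f) auto
    moreover have "real n * (t / real n) \<le> t" using t by (cases "n = 0") auto
    ultimately show ?thesis by (rule F_measurable_mono)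
  qed
  then have "(\<lambda>\<omega>. lim (\<lambda>n. ?e n \<omega>)) \<in> borel_measurable (F t)" by (rule borel_measurable_lim_metric)
  moreover have "AE \<omega> in M. lim (\<lambda>n. ?e n \<omega>) = X \<omega>" using lim by eventually_elim (rule limI)
  ultimately show ?thesis by (rule measurable_F_AE_cong[OF t])
qed

lemma surplus_adapted:
  assumes D: "\<And>t. 0 \<le> t \<Longrightarrow> D t \<in> borel_measurable (F t)" "AE \<omega> in M. control_path (\<lambda>t. D t \<omega>)"
    and x: "0 \<le> x" and t: "0 \<le> t"
  shows "(\<lambda>\<omega>. surplus g N Y x D \<omega> t) \<in> borel_measurable (F t)"
proof (rule euler_limit_measurable[OF _ _ t])
  show "(\<lambda>z. z + t / real n * rate z) \<in> borel_measurable borel" for n by measurable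
  show "(\<lambda>\<omega>. x - C t \<omega> - D t \<omega>) \<in> borel_measurable (F t)" if "0 \<le> t" for t
    using D(1)[OF that] claims_adapted[OF that] by measurable
  show "AE \<omega> in M. (\<lambda>n. euler (\<lambda>z. z + t / real n * rate z) (\<lambda>t. x - C t \<omega> - D t \<omega>) (t / real n) n) \<longlonglongrightarrow> surplus g N Y x D \<omega> t"
    using AE_good_path D(2)
  proof eventually_elim
    fix \<omega> assume "good_path \<omega>" "control_path (\<lambda>t. D t \<omega>)"
    note c = controlled_path[where D=D and \<omega>=\<omega>, OF this x]
    show "(\<lambda>n. euler (\<lambda>z. z + t / real n * rate z) (\<lambda>t. x - C t \<omega> - D t \<omega>) (t / real n) n) \<longlonglongrightarrow> surplus g N Y x D \<omega> t"
      by (rule euler_flow[OF c(1,2) x c(3) t])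
  qed
qed

end

text \<open>The horizon \<open>m\<close> is a natural number, so that it is filled exactly by
  \<open>n * m\<close> cells of length \<open>1 / n\<close> for every mesh.\<close>

locale controlled_surplus = dividend_barrier M F N Y g lam alpha delta \<psi> b
  for M :: "'a measure" and F :: "real \<Rightarrow> 'a measure" and N :: "real \<Rightarrow> 'a \<Rightarrow> nat" and Y :: "nat \<Rightarrow> 'a \<Rightarrow> real"
    and g :: "real \<Rightarrow> real" and lam alpha delta :: real and \<psi> :: "real \<Rightarrow> real" and b :: real +
  fixes D :: "real \<Rightarrow> 'a \<Rightarrow> real" and x :: real and m :: nat
  assumes D_adapted: "\<And>t. 0 \<le> t \<Longrightarrow> D t \<in> borel_measurable (F t)"
    and D_control: "AE \<omega> in M. control_path (\<lambda>t. D t \<omega>)" and x: "0 \<le> x"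
begin

definition X :: "real \<Rightarrow> 'a \<Rightarrow> real" where "X t \<omega> = surplus g N Y x D \<omega> t"

definition R :: real where "R = reach x (real m)"

definition max_rate :: real where "max_rate = top_rate x (real m)"

definition survive :: "real \<Rightarrow> nat \<Rightarrow> 'a \<Rightarrow> bool" where
  "survive h i \<omega> \<longleftrightarrow> (\<forall>j\<le>i. 0 \<le> X (real j * h) \<omega>)"

text \<open>The surplus stopped when ruin is seen on the grid. The value -1 is a cemetery where
  \<Phi> is 0; the cap \<open>R\<close> does not act on regular paths up to the horizon, but makes
  \<open>Z\<close> bounded above everywhere.\<close>

definition Z :: "real \<Rightarrow> nat \<Rightarrow> 'a \<Rightarrow> real" where
  "Z h i \<omega> = (if survive h i \<omega> then min R (X (real i * h) \<omega>) else - 1)"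

text \<open>Payments in the cell at whose right end ruin is first seen are dropped.\<close>

definition paid :: "real \<Rightarrow> nat \<Rightarrow> 'a \<Rightarrow> real" where
  "paid h i \<omega> = (if survive h (Suc i) \<omega> then D (real (Suc i) * h) \<omega> - D (real i * h) \<omega> else 0)"

definition \<Delta>C :: "real \<Rightarrow> nat \<Rightarrow> 'a \<Rightarrow> real" where
  "\<Delta>C h i \<omega> = C (real i * h + h) \<omega> - C (real i * h) \<omega>"

text \<open>By the flow equation the terms before \<open>h * rate\<close> add up to the premium
  collected in the cell; the payments and claims are put back exactly.\<close>

definition local_error :: "real \<Rightarrow> nat \<Rightarrow> 'a \<Rightarrow> real" where
  "local_error h i \<omega> = \<bar>X (real (Suc i) * h) \<omega> - X (real i * h) \<omega> + \<Delta>C h i \<omega>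
     + (D (real (Suc i) * h) \<omega> - D (real i * h) \<omega>) - h * rate (X (real i * h) \<omega>)\<bar>"

text \<open>The claim nearly exhausts the predicted surplus, so the prediction and the true surplus
  may disagree about survival. One \<open>max_rate * h\<close> allows for the local error, the other
  for the dividends of the cell, as the lower bound requires.\<close>

definition hit :: "real \<Rightarrow> nat \<Rightarrow> 'a \<Rightarrow> real" where
  "hit h i \<omega> = (if \<Delta>C h i \<omega> \<noteq> 0 \<and> \<bar>\<Delta>C h i \<omega> - (Z h i \<omega> + h * rate (Z h i \<omega>))\<bar> \<le> 2 * max_rate * h then 1 else 0)"

definition claim_cell :: "real \<Rightarrow> nat \<Rightarrow> 'a \<Rightarrow> real" where
  "claim_cell h i \<omega> = (if \<Delta>C h i \<omega> \<noteq> 0 then 1 else 0)"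

definition regular :: "'a \<Rightarrow> bool" where
  "regular \<omega> \<longleftrightarrow> good_path \<omega> \<and> control_path (\<lambda>t. D t \<omega>)"

lemma AE_regular: "AE \<omega> in M. regular \<omega>"
  using AE_good_path D_control by eventually_elim (simp add: regular_def)

lemma X_path: "surplus g N Y x D \<omega> = (\<lambda>t. X t \<omega>)" by (simp add: X_def fun_eq_iff)

lemmas regular_path = controlled_path[where D=D and x=x, OF _ _ x, unfolded X_path]

lemma X_F: "0 \<le> t \<Longrightarrow> X t \<in> borel_measurable (F t)"
  unfolding X_def[abs_def] by (rule surplus_adapted[OF D_adapted D_control x])

lemma X_measurable [measurable]: "0 \<le> t \<Longrightarrow> X t \<in> borel_measurable M"
  by (rule F_measurable_M[OF X_F])

lemma D_measurable [measurable]: "0 \<le> t \<Longrightarrow> D t \<in> borel_measurable M"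
  by (rule F_measurable_M[OF D_adapted])

lemma R_nonneg: "0 \<le> R" unfolding R_def using reach_ge[OF x, of "real m"] x by simp

lemma max_rate_pos: "0 < max_rate" unfolding max_rate_def by (rule top_rate_pos[OF x]) simp

lemma rate_le_max_rate: "z \<le> R \<Longrightarrow> rate z \<le> max_rate"
  unfolding max_rate_def R_def by (rule rate_le_top_rate[OF x]) simp

lemma survive_measurable:
  assumes h: "0 \<le> h"
  shows "Measurable.pred (F (real i * h)) (survive h i)"
proof -
  have "Measurable.pred (F (real i * h)) (\<lambda>\<omega>. \<forall>j\<in>{..i}. 0 \<le> X (real j * h) \<omega>)"
  proof (rule pred_intros_finite(3)[OF finite_atMost])
    fix j assume "j \<in> {..i}"
    then have [measurable]: "X (real j * h) \<in> borel_measurable (F (real i * h))"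
      using h by (intro F_measurable_mono[OF X_F] mult_right_mono) auto
    show "Measurable.pred (F (real i * h)) (\<lambda>\<omega>. 0 \<le> X (real j * h) \<omega>)" by measurable
  qed
  moreover have "survive h i = (\<lambda>\<omega>. \<forall>j\<in>{..i}. 0 \<le> X (real j * h) \<omega>)"
    by (rule ext) (auto simp: survive_def)
  ultimately show ?thesis by (simp only:)
qed

lemma Z_F: "0 \<le> h \<Longrightarrow> Z h i \<in> borel_measurable (F (real i * h))"
proof -
  assume h: "0 \<le> h"
  have [measurable]: "Measurable.pred (F (real i * h)) (survive h i)" by (rule survive_measurable[OF h])
  have [measurable]: "X (real i * h) \<in> borel_measurable (F (real i * h))" using h by (intro X_F) auto
  show "Z h i \<in> borel_measurable (F (real i * h))" unfolding Z_def[abs_def] by measurable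
qed

lemma Z_measurable [measurable]: "0 \<le> h \<Longrightarrow> Z h i \<in> borel_measurable M"
  by (rule F_measurable_M[OF Z_F]) auto

lemma Z_le: "Z h i \<omega> \<le> R" using R_nonneg by (simp add: Z_def)

lemma survive_M: "0 \<le> h \<Longrightarrow> Measurable.pred M (survive h i)"
  using survive_measurable[of h i] F_subalgebra[of "real i * h"] by (auto simp: measurable_def subalgebra_def)

lemma paid_measurable [measurable]: "0 \<le> h \<Longrightarrow> paid h i \<in> borel_measurable M"
proof -
  assume h: "0 \<le> h"
  have [measurable]: "Measurable.pred M (survive h (Suc i))" by (rule survive_M[OF h])
  have [measurable]: "D (real (Suc i) * h) \<in> borel_measurable M" "D (real i * h) \<in> borel_measurable M"
    using h by (auto intro!: D_measurable simp del: of_nat_Suc)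
  show ?thesis unfolding paid_def[abs_def] by measurable
qed

lemma \<Delta>C_measurable [measurable]: "0 \<le> h \<Longrightarrow> \<Delta>C h i \<in> borel_measurable M"
  unfolding \<Delta>C_def[abs_def] by (intro borel_measurable_diff claims_measurable) auto

lemma local_error_measurable [measurable]: "0 \<le> h \<Longrightarrow> local_error h i \<in> borel_measurable M"
proof -
  assume h: "0 \<le> h"
  have [measurable]: "D (real (Suc i) * h) \<in> borel_measurable M" "D (real i * h) \<in> borel_measurable M"
    "X (real (Suc i) * h) \<in> borel_measurable M" "X (real i * h) \<in> borel_measurable M" "\<Delta>C h i \<in> borel_measurable M"
    using h by (auto intro!: D_measurable X_measurable \<Delta>C_measurable simp del: of_nat_Suc)
  show ?thesis unfolding local_error_def[abs_def] by measurable
qed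

lemma hit_measurable [measurable]: "0 \<le> h \<Longrightarrow> hit h i \<in> borel_measurable M"
proof -
  assume h: "0 \<le> h"
  have [measurable]: "Z h i \<in> borel_measurable M" "\<Delta>C h i \<in> borel_measurable M" using h by auto
  show ?thesis unfolding hit_def[abs_def] by measurable
qed

lemma claim_cell_measurable [measurable]: "0 \<le> h \<Longrightarrow> claim_cell h i \<in> borel_measurable M"
proof -
  assume h: "0 \<le> h"
  have [measurable]: "\<Delta>C h i \<in> borel_measurable M" using h by auto
  show ?thesis unfolding claim_cell_def[abs_def] by measurable
qed

lemma regular_cell:
  assumes w: "regular \<omega>" and h: "0 < h" and i: "real (Suc i) * h \<le> real m"
  defines "I \<equiv> X (real (Suc i) * h) \<omega> - X (real i * h) \<omega> + \<Delta>C h i \<omega> + (D (real (Suc i) * h) \<omega> - D (real i * h) \<omega>)"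
  shows "I = integral {real i * h..real (Suc i) * h} (\<lambda>s. rate (X s \<omega>))"
    "0 \<le> I" "I \<le> max_rate * h" "0 \<le> \<Delta>C h i \<omega>" "0 \<le> D (real (Suc i) * h) \<omega> - D (real i * h) \<omega>"
    "local_error h i \<omega> = \<bar>I - h * rate (X (real i * h) \<omega>)\<bar>" "local_error h i \<omega> \<le> max_rate * h"
    "X (real i * h) \<omega> \<le> R" "X (real (Suc i) * h) \<omega> \<le> R"
proof -
  have w': "good_path \<omega>" "control_path (\<lambda>t. D t \<omega>)" using w by (auto simp: regular_def)
  note p = regular_path[OF w']
  have st: "0 \<le> real i * h" "real i * h \<le> real (Suc i) * h" "real (Suc i) * h - real i * h = h" "real (Suc i) * h = real i * h + h"
    using h by (auto simp: mult_right_mono algebra_simps)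
  note fb = flow_increment_bounds[OF p(1) p(4) x st(1,2) i]
  show I: "I = integral {real i * h..real (Suc i) * h} (\<lambda>s. rate (X s \<omega>))"
  proof -
    have "\<Delta>C h i \<omega> = C (real (Suc i) * h) \<omega> - C (real i * h) \<omega>" by (simp only: \<Delta>C_def st(4))
    then show ?thesis using fb(3) by (simp add: I_def del: of_nat_Suc)
  qed
  show I0: "0 \<le> I" using fb(1) I by simp
  show It: "I \<le> max_rate * h" using fb(2)[unfolded st(3)] I by (simp add: max_rate_def del: of_nat_Suc)
  show "0 \<le> \<Delta>C h i \<omega>" using good_path_claims(2)[OF w'(1)] st h by (auto simp: \<Delta>C_def monotone_on_def)
  show "0 \<le> D (real (Suc i) * h) \<omega> - D (real i * h) \<omega>" using control_pathD(1)[OF w'(2)] st(2) by (simp add: mono_def)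
  show le: "local_error h i \<omega> = \<bar>I - h * rate (X (real i * h) \<omega>)\<bar>" by (simp add: local_error_def I_def)
  show R1: "X (real i * h) \<omega> \<le> R" "X (real (Suc i) * h) \<omega> \<le> R"
    unfolding R_def using st i by (auto intro!: flow_le_reach[OF p(1) p(4) x] simp del: of_nat_Suc)
  have "0 \<le> h * rate (X (real i * h) \<omega>)" "h * rate (X (real i * h) \<omega>) \<le> max_rate * h"
    using rate_le_max_rate[OF R1(1)] rate_pos[of "X (real i * h) \<omega>"] h by (auto simp: mult.commute)
  then show "local_error h i \<omega> \<le> max_rate * h" unfolding le using I0 It by linarith
qed

definition value_bound :: real where "value_bound = \<Phi> (R + max_rate)"

lemma value_bound_nonneg: "0 \<le> value_bound" unfolding value_bound_def by (rule barrier_nonneg)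

lemma paid_bounds:
  assumes w: "regular \<omega>" and h: "0 < h" "h \<le> 1" and i: "real (Suc i) * h \<le> real m"
  shows "0 \<le> paid h i \<omega>" "paid h i \<omega> \<le> R + max_rate"
proof -
  note c = regular_cell[OF w h(1) i]
  have th: "max_rate * h \<le> max_rate" using h max_rate_pos by simp
  have "0 \<le> paid h i \<omega> \<and> paid h i \<omega> \<le> R + max_rate"
  proof (cases "survive h (Suc i) \<omega>")
    case True
    then have "0 \<le> X (real (Suc i) * h) \<omega>" by (auto simp: survive_def)
    then have "D (real (Suc i) * h) \<omega> - D (real i * h) \<omega> \<le> R + max_rate" using th c(3,4,8) by linarith
    then show ?thesis using True c(5) by (simp only: paid_def if_True)
  qed (use R_nonneg max_rate_pos in \<open>auto simp: paid_def\<close>)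
  then show "0 \<le> paid h i \<omega>" "paid h i \<omega> \<le> R + max_rate" by auto
qed

text \<open>Let \<open>u\<close> be the new surplus with the dividends of the cell put back, and
  \<open>a\<close> the Euler prediction; their distance is the local error. Paying the dividends
  gains nothing by \<open>barrier_mono_add\<close>, and \<Phi> is Lipschitz between \<open>u\<close>
  and \<open>a\<close> unless \<open>a\<close> is negative, in which case a claim has hit the window
  around 0 and \<open>value_bound\<close> pays for it.\<close>

lemma upper_step:
  assumes lip: "1 \<le> c" "\<And>u v. 0 \<le> u \<Longrightarrow> u \<le> R + max_rate \<Longrightarrow> 0 \<le> v \<Longrightarrow> v \<le> R + max_rate \<Longrightarrow> \<bar>\<Phi> u - \<Phi> v\<bar> \<le> c * \<bar>u - v\<bar>"
    and w: "regular \<omega>" and h: "0 < h" "h \<le> 1" and i: "real (Suc i) * h \<le> real m"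
  shows "\<Phi> (Z h (Suc i) \<omega>) + paid h i \<omega> \<le> indicator {0..} (Z h i \<omega>) * \<Phi> (Z h i \<omega> + h * g (Z h i \<omega>) - \<Delta>C h i \<omega>)
     + (c + value_bound) * (local_error h i \<omega> + hit h i \<omega>)"
proof (cases "survive h (Suc i) \<omega>")
  case True
  note c = regular_cell[OF w h(1) i]
  have X: "0 \<le> X (real i * h) \<omega>" "0 \<le> X (real (Suc i) * h) \<omega>" "survive h i \<omega>"
    using True by (auto simp: survive_def simp del: of_nat_Suc)
  have Zi: "Z h i \<omega> = X (real i * h) \<omega>" "Z h (Suc i) \<omega> = X (real (Suc i) * h) \<omega>"
    using X True c(8,9) by (simp_all add: Z_def del: of_nat_Suc)
  define dD where "dD = D (real (Suc i) * h) \<omega> - D (real i * h) \<omega>"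
  define a where "a = X (real i * h) \<omega> + h * rate (X (real i * h) \<omega>) - \<Delta>C h i \<omega>"
  define u where "u = X (real (Suc i) * h) \<omega> + dD"
  have th: "max_rate * h \<le> max_rate" using h max_rate_pos by simp
  have u: "0 \<le> u" "u \<le> R + max_rate" using X c(3,4,5,8) th by (auto simp: u_def dD_def simp del: of_nat_Suc)
  have ua: "\<bar>u - a\<bar> = local_error h i \<omega>" by (simp add: u_def a_def local_error_def dD_def del: of_nat_Suc)
  have "h * rate (X (real i * h) \<omega>) \<le> 1 * max_rate" using rate_le_max_rate[OF c(8)] rate_pos[of "X (real i * h) \<omega>"] h by (intro mult_mono) auto
  then have aR: "a \<le> R + max_rate" using c(4,8) by (simp add: a_def)
  have "\<Phi> (Z h (Suc i) \<omega>) + paid h i \<omega> \<le> \<Phi> u"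
    using barrier_mono_add[of "X (real (Suc i) * h) \<omega>" u] X True c(5) by (simp add: Zi paid_def u_def dD_def del: of_nat_Suc)
  also have "\<dots> \<le> \<Phi> a + (c + value_bound) * (local_error h i \<omega> + hit h i \<omega>)"
  proof (cases "0 \<le> a")
    case a: True
    have "\<Phi> u \<le> \<Phi> a + c * local_error h i \<omega>" using lip(2)[OF u a aR] ua by simp
    also have "\<dots> \<le> \<Phi> a + (c + value_bound) * (local_error h i \<omega> + hit h i \<omega>)"
      using lip(1) value_bound_nonneg ua[symmetric] by (intro add_left_mono mult_mono) (auto simp: hit_def)
    finally show ?thesis .
  next
    case False
    have pos: "0 < h * rate (X (real i * h) \<omega>)" using h rate_pos by simp
    have "\<Delta>C h i \<omega> \<noteq> 0" using False X(1) pos by (auto simp: a_def)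
    moreover have "\<bar>\<Delta>C h i \<omega> - (X (real i * h) \<omega> + h * rate (X (real i * h) \<omega>))\<bar> = \<bar>a\<bar>" by (simp add: a_def abs_minus_commute)
    moreover have "\<bar>a\<bar> \<le> 2 * max_rate * h" using False u(1) ua c(7) max_rate_pos h by (auto simp: abs_if split: if_splits)
    ultimately have "hit h i \<omega> = 1" by (simp add: hit_def Zi)
    then have "value_bound \<le> (c + value_bound) * (local_error h i \<omega> + hit h i \<omega>)"
      using lip(1) value_bound_nonneg ua mult_mono[of value_bound "c + value_bound" 1 "local_error h i \<omega> + hit h i \<omega>"] by auto
    moreover have "\<Phi> u \<le> value_bound" unfolding value_bound_def by (rule barrier_mono[OF u(2)])
    ultimately show ?thesis using barrier_nonneg[of a] by linarith
  qed
  finally show ?thesis using X by (simp add: Zi a_def rate_def del: of_nat_Suc)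
next
  case False
  have "0 \<le> (c + value_bound) * (local_error h i \<omega> + hit h i \<omega>)"
    using lip(1) value_bound_nonneg by (auto simp: local_error_def hit_def)
  moreover have "Z h (Suc i) \<omega> = - 1" "paid h i \<omega> = 0" using False by (auto simp: Z_def paid_def)
  ultimately show ?thesis using barrier_nonneg by (simp add: barrier_neg add_nonneg_nonneg del: of_nat_Suc)
qed

end

section \<open>Summation of the one-step inequalities over the grid\<close>

context controlled_surplus
begin

text \<open>Payments are discounted from the right end of their cell. The payment at time 0 is left
  out and treated separately.\<close>

definition total_paid :: "nat \<Rightarrow> 'a \<Rightarrow> real" where
  "total_paid n \<omega> = (\<Sum>i<n * m. exp (- delta * (real (Suc i) * (1 / real n))) * paid (1 / real n) i \<omega>)"

lemma grid_le:
  assumes "0 < n" "i < n * m"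
  shows "real (Suc i) * (1 / real n) \<le> real m"
proof -
  have "real (Suc i) \<le> real (n * m)" using assms by (simp del: of_nat_Suc of_nat_mult)
  then show ?thesis using assms(1) by (simp add: divide_le_eq mult.commute del: of_nat_Suc)
qed

lemma local_error_sum_bound:
  assumes w: "regular \<omega>" and n: "0 < n"
  shows "(\<Sum>i<n * m. local_error (1 / real n) i \<omega>)
    \<le> rate_lip * (max_rate * real m + (C (real m) \<omega> + D (real m) \<omega>)) / real n"
proof -
  have w': "good_path \<omega>" "control_path (\<lambda>t. D t \<omega>)" using w by (auto simp: regular_def)
  note p = regular_path[OF w']
  let ?h = "1 / real n"
  have nm: "real (n * m) * ?h = real m" using n by simp
  have h: "0 < ?h" using n by simp
  have "(\<Sum>i<n * m. local_error ?h i \<omega>) = (\<Sum>i<n * m. \<bar>integral {real i * ?h..real (Suc i) * ?h} (\<lambda>r. rate (X r \<omega>)) - ?h * rate (X (real i * ?h) \<omega>)\<bar>)"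
  proof (rule sum.cong[OF refl])
    fix i assume "i \<in> {..<n * m}"
    then have i: "real (Suc i) * ?h \<le> real m" using grid_le[OF n] by simp
    show "local_error ?h i \<omega> = \<bar>integral {real i * ?h..real (Suc i) * ?h} (\<lambda>r. rate (X r \<omega>)) - ?h * rate (X (real i * ?h) \<omega>)\<bar>"
      unfolding regular_cell(6)[OF w h i] regular_cell(1)[OF w h i] ..
  qed
  also have "\<dots> \<le> ?h * (rate_lip * (top_rate x (real m) * real m + (x - C 0 \<omega> - D 0 \<omega> - (x - C (real (n * m) * ?h) \<omega> - D (real (n * m) * ?h) \<omega>))))"
    by (rule flow_total_error[OF p(1,4) x p(2)]) (use h nm in auto)
  also have "\<dots> \<le> ?h * (rate_lip * (max_rate * real m + (C (real m) \<omega> + D (real m) \<omega>)))"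
    using good_path_claims(1)[OF w'(1)] control_pathD(3)[OF w'(2)] h rate_lipschitz(1)
    unfolding nm max_rate_def by (intro mult_left_mono) auto
  finally show ?thesis by simp
qed

lemma local_error_nonneg: "0 \<le> local_error h i \<omega>" by (simp add: local_error_def)

lemma local_error_integrable:
  assumes "0 < h" "real (Suc i) * h \<le> real m"
  shows "integrable M (local_error h i)"
proof (rule integrable_const_bound[where B="max_rate * h"])
  show "AE \<omega> in M. norm (local_error h i \<omega>) \<le> max_rate * h"
    using AE_regular by eventually_elim (use regular_cell(7)[OF _ assms] local_error_nonneg in simp)
qed (use assms in simp)

text \<open>On each path the sum is O(1/n), with a random constant that involves the dividends paid.
  Passing to means therefore uses dominated convergence, with the bound \<open>max_rate * h\<close>
  for each cell as majorant.\<close>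

lemma local_error_expectation_tendsto:
  "(\<lambda>n. \<Sum>i<n * m. expectation (local_error (1 / real n) i)) \<longlonglongrightarrow> 0"
proof -
  let ?s = "\<lambda>n \<omega>. \<Sum>i<n * m. local_error (1 / real n) i \<omega>"
  have "(\<lambda>n. expectation (?s n)) \<longlonglongrightarrow> expectation (\<lambda>\<omega>. 0)"
  proof (rule integral_dominated_convergence[where w="\<lambda>_. max_rate * real m"])
    show "?s n \<in> borel_measurable M" for n by (intro borel_measurable_sum local_error_measurable) simp
    show "AE \<omega> in M. (\<lambda>n. ?s n \<omega>) \<longlonglongrightarrow> 0"
      using AE_regular
    proof eventually_elim
      fix \<omega> assume w: "regular \<omega>"
      show "(\<lambda>n. ?s n \<omega>) \<longlonglongrightarrow> 0"
      proof (rule tendsto_if_error_le_inverse)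
        fix n :: nat assume "0 < n"
        then show "\<bar>?s n \<omega> - 0\<bar> \<le> rate_lip * (max_rate * real m + (C (real m) \<omega> + D (real m) \<omega>)) / real n"
          using local_error_sum_bound[OF w] local_error_nonneg by (simp add: sum_nonneg)
      qed
    qed
    show "AE \<omega> in M. norm (?s n \<omega>) \<le> max_rate * real m" for n
      using AE_regular
    proof eventually_elim
      fix \<omega> assume w: "regular \<omega>"
      show "norm (?s n \<omega>) \<le> max_rate * real m"
      proof (cases "n = 0")
        case False
        have "?s n \<omega> \<le> (\<Sum>i<n * m. max_rate * (1 / real n))"
          by (rule sum_mono) (use regular_cell(7)[OF w _ grid_le] False in simp)
        then show ?thesis using False local_error_nonneg by (simp add: sum_nonneg mult.commute)
      qed (use max_rate_pos in simp)
    qed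
  qed auto
  moreover have "expectation (?s n) = (\<Sum>i<n * m. expectation (local_error (1 / real n) i))" for n
    by (rule Bochner_Integration.integral_sum) (use local_error_integrable grid_le in \<open>cases "n = 0"; simp\<close>)
  ultimately show ?thesis by simp
qed

lemma claim_cell_expectation:
  assumes "0 < h"
  shows "expectation (claim_cell h i) \<le> lam * h" "integrable M (claim_cell h i)"
proof -
  let ?s = "real i * h"
  have st: "0 \<le> ?s" "?s \<le> ?s + h" "0 \<le> ?s + h" using assms by auto
  have ev: "{\<omega>\<in>space M. N (?s + h) \<omega> \<noteq> N ?s \<omega>} \<in> events" by (rule N_event[OF st(1,3)])
  show i: "integrable M (claim_cell h i)"
    by (rule bounded_integrable[where B=1]) (use assms in \<open>auto simp: claim_cell_def\<close>)
  have "expectation (claim_cell h i) = expectation (indicator {\<omega>\<in>space M. N (?s + h) \<omega> \<noteq> N ?s \<omega>})"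
  proof (rule integral_cong_AE)
    show "AE \<omega> in M. claim_cell h i \<omega> = indicator {\<omega>\<in>space M. N (?s + h) \<omega> \<noteq> N ?s \<omega>} \<omega>"
      using AE_good_path AE_space
      by eventually_elim (use good_path_claims_eq_iff[OF _ st(1,2)] in \<open>auto simp: claim_cell_def \<Delta>C_def indicator_def\<close>)
  qed (use ev assms in auto)
  also have "\<dots> \<le> lam * h" using prob_claim_le[OF st(1,2)] ev by simp
  finally show "expectation (claim_cell h i) \<le> lam * h" .
qed

text \<open>The first two summands come from \<open>one_step_hit\<close> with a window of half-width
  \<open>2 * max_rate * h\<close>; the last one comes from the probability of a claim in the
  cell.\<close>

definition hit_const :: real where
  "hit_const = 4 * lam * alpha * max_rate + law_const * lam\<^sup>2 + lam"

lemma hit_const_nonneg: "0 \<le> hit_const"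
  unfolding hit_const_def using lam_pos alpha_pos max_rate_pos law_const_pos
  by (intro add_nonneg_nonneg mult_nonneg_nonneg) auto

text \<open>Taking means in \<open>step\<close> and applying \<open>one_step_generator\<close>
  yields a one-step inequality for the mean of \<Phi> along the grid, where the drift contributes
  with the sign fixed by \<open>drift\<close>; \<open>grid_sum_bound\<close> adds up. With
  \<open>\<sigma> = 1\<close> it serves every control, with \<open>\<sigma> = - 1\<close> the
  barrier strategy.\<close>

lemma grid_sum_estimate:
  assumes sgn: "\<sigma> = 1 \<or> \<sigma> = - 1" and K: "0 \<le> K"
    and step: "\<And>h i. 0 < h \<Longrightarrow> h \<le> 1 \<Longrightarrow> real (Suc i) * h \<le> real m \<Longrightarrow>
      AE \<omega> in M. \<sigma> * (\<Phi> (Z h (Suc i) \<omega>) + paid h i \<omega>)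
        \<le> \<sigma> * (indicator {0..} (Z h i \<omega>) * \<Phi> (Z h i \<omega> + h * g (Z h i \<omega>) - \<Delta>C h i \<omega>))
          + K * (local_error h i \<omega> + hit h i \<omega> + h * claim_cell h i \<omega>)"
    and drift: "\<And>h i. 0 < h \<Longrightarrow> real i * h \<le> real m \<Longrightarrow> AE \<omega> in M. \<sigma> * (indicator {0..} (Z h i \<omega>) * drift (Z h i \<omega>)) \<le> 0"
    and e: "0 < e"
  shows "\<forall>\<^sub>F n in sequentially. \<sigma> * (expectation (total_paid n) + exp (- delta * real m) * expectation (\<lambda>\<omega>. \<Phi> (Z (1 / real n) (n * m) \<omega>)))
     \<le> \<sigma> * expectation (\<lambda>\<omega>. \<Phi> (Z 1 0 \<omega>)) + e"
proof -
  \<comment> \<open>One third of \<open>e\<close> covers the generator errors, which sum to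
    \<open>e' * real m\<close>; the summand 1 keeps the denominator positive for
    \<open>m = 0\<close>. Another third covers everything multiplied by \<open>K\<close>.\<close>
  define e' where "e' = e / (3 * (real m + 1))"
  have e': "0 < e'" using e by (simp add: e'_def)
  show ?thesis
  proof (rule one_step_generator[OF R_nonneg e'])
  fix h\<^sub>0 assume h0: "0 < h\<^sub>0" and gen:
    "\<And>k s h U. 0 < h \<Longrightarrow> h < h\<^sub>0 \<Longrightarrow> real k \<le> s \<Longrightarrow> s + h \<le> real (Suc k) \<Longrightarrow> U \<in> borel_measurable (F s) \<Longrightarrow>
       (\<And>\<omega>. U \<omega> \<le> R) \<Longrightarrow>
       \<bar>expectation (\<lambda>\<omega>. indicator {0..} (U \<omega>) * (exp (- delta * h) * \<Phi> (U \<omega> + h * g (U \<omega>) - (C (s + h) \<omega> - C s \<omega>))))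
        - expectation (\<lambda>\<omega>. indicator {0..} (U \<omega>) * (\<Phi> (U \<omega>) + h * drift (U \<omega>)))\<bar> \<le> e' * h"
  have "(\<lambda>n. K * ((\<Sum>i<n * m. expectation (local_error (1 / real n) i)) + hit_const * real m / real n)) \<longlonglongrightarrow> K * (0 + 0)"
    by (intro tendsto_mult tendsto_add tendsto_const local_error_expectation_tendsto lim_const_over_n)
  then have small: "\<forall>\<^sub>F n in sequentially. K * ((\<Sum>i<n * m. expectation (local_error (1 / real n) i)) + hit_const * real m / real n) < e / 3"
    using order_tendstoD(2)[of _ "K * (0 + 0)" sequentially "e / 3"] e by simp
  have "(\<lambda>n. 1 / real n) \<longlonglongrightarrow> 0" by (rule lim_const_over_n)
  then have "\<forall>\<^sub>F n in sequentially. 1 / real n < h\<^sub>0" using order_tendstoD(2) h0 by blast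
  with small eventually_gt_at_top[of "0::nat"] show ?thesis
  proof eventually_elim
    fix n :: nat
    assume sm: "K * ((\<Sum>i<n * m. expectation (local_error (1 / real n) i)) + hit_const * real m / real n) < e / 3"
      and n: "0 < n" and nh: "1 / real n < h\<^sub>0"
    define h where "h = 1 / real n"
    have h: "0 < h" "h \<le> 1" "h < h\<^sub>0" using n nh by (auto simp: h_def)
    let ?A = "\<lambda>i. expectation (\<lambda>\<omega>. \<Phi> (Z h i \<omega>))" and ?j = "\<lambda>i. expectation (paid h i)"
    let ?r = "\<lambda>i. e' * h + K * (expectation (local_error h i) + hit_const * h\<^sup>2)"
    have Zm [measurable]: "Z h i \<in> borel_measurable M" for i using h by simp
    have gl: "real (Suc i) * h \<le> real m" if "i < n * m" for i using grid_le[OF n that] by (simp add: h_def)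
    have \<Phi>b: "\<bar>\<Phi> (Z h i \<omega>)\<bar> \<le> \<Phi> R" for i \<omega> using barrier_mono[OF Z_le] barrier_nonneg by simp
    have i\<Phi>: "integrable M (\<lambda>\<omega>. \<Phi> (Z h i \<omega>))" for i by (rule bounded_integrable[OF _ \<Phi>b]) measurable
    have ipaid: "integrable M (paid h i)" if "i < n * m" for i
    proof (rule integrable_const_bound[where B="R + max_rate"])
      show "AE \<omega> in M. norm (paid h i \<omega>) \<le> R + max_rate"
        using AE_regular by eventually_elim (use paid_bounds[OF _ h(1,2) gl[OF that]] in simp)
    qed (use h in simp)
    have stp: "\<sigma> * (exp (- delta * h) * (?A (Suc i) + ?j i)) \<le> \<sigma> * ?A i + ?r i" if i: "i < n * m" for i
    proof -
      \<comment> \<open>With mesh \<open>1 / n\<close> no cell straddles an integer;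
        \<open>k\<close> is the left end of the unit interval that contains cell
        \<open>i\<close>.\<close>
      define k where "k = i div n"
      have k: "real k \<le> real i * h" "real i * h + h \<le> real (Suc k)"
      proof -
        have "k * n \<le> i" "Suc i \<le> Suc k * n"
          unfolding k_def using n by (simp_all add: div_mult2_eq[symmetric] Suc_leI dividend_less_div_times add.commute)
        then have "real (k * n) \<le> real i" "real (Suc i) \<le> real (Suc k * n)" by (simp_all only: of_nat_le_iff)
        then show "real k \<le> real i * h" "real i * h + h \<le> real (Suc k)"
          using n by (simp_all add: h_def field_simps)
      qed
      have s0: "0 \<le> real i * h" using h by simp
      have im: "real i * h \<le> real m" using gl[OF i] h by (simp add: algebra_simps)
      have ZF: "Z h i \<in> borel_measurable (F (real i * h))" using h by (intro Z_F) simp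
      let ?W = "\<lambda>\<omega>. indicator {0..} (Z h i \<omega>) * \<Phi> (Z h i \<omega> + h * g (Z h i \<omega>) - \<Delta>C h i \<omega>)"
      let ?err = "\<lambda>\<omega>. local_error h i \<omega> + hit h i \<omega> + h * claim_cell h i \<omega>"
      have W_eq: "?W = (\<lambda>\<omega>. indicator {0..} (Z h i \<omega>) * \<Phi> (Z h i \<omega> + h * rate (Z h i \<omega>) - \<Delta>C h i \<omega>))"
        by (auto simp: fun_eq_iff indicator_def rate_def)
      have Dm [measurable]: "\<Delta>C h i \<in> borel_measurable M" using h by simp
      have iW: "integrable M ?W"
      proof (rule integrable_const_bound[where B=value_bound])
        show "?W \<in> borel_measurable M" unfolding W_eq by measurable
        show "AE \<omega> in M. norm (?W \<omega>) \<le> value_bound"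
          using AE_regular
        proof eventually_elim
          fix \<omega> assume w: "regular \<omega>"
          have "h * rate (Z h i \<omega>) \<le> 1 * max_rate"
            using h rate_le_max_rate[OF Z_le] rate_pos by (intro mult_mono) (auto intro: less_imp_le)
          then have "\<Phi> (Z h i \<omega> + h * rate (Z h i \<omega>) - \<Delta>C h i \<omega>) \<le> value_bound"
            unfolding value_bound_def using Z_le[of h i \<omega>] regular_cell(4)[OF w h(1) gl[OF i]] by (intro barrier_mono) auto
          then have "norm (indicator {0..} (Z h i \<omega>) * \<Phi> (Z h i \<omega> + h * rate (Z h i \<omega>) - \<Delta>C h i \<omega>)) \<le> value_bound"
            using value_bound_nonneg barrier_nonneg by (simp add: indicator_def)
          then show "norm (?W \<omega>) \<le> value_bound" using fun_cong[OF W_eq, of \<omega>] by (simp only:)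
        qed
      qed
      have ihit: "integrable M (hit h i)"
        by (rule bounded_integrable[where B=1]) (use h in \<open>auto simp: hit_def\<close>)
      have icell: "integrable M (claim_cell h i)" by (rule claim_cell_expectation(2)[OF h(1)])
      have iloc: "integrable M (local_error h i)" by (rule local_error_integrable[OF h(1) gl[OF i]])
      have ierr: "integrable M ?err"
        by (intro Bochner_Integration.integrable_add integrable_mult_right iloc ihit icell)
      have Ehit: "expectation (hit h i) \<le> (2 * lam * alpha * (2 * max_rate) + law_const * lam\<^sup>2) * h\<^sup>2"
        using one_step_hit[OF h(1) _ k ZF, of "2 * max_rate"] max_rate_pos
        by (simp add: hit_def[abs_def] \<Delta>C_def)
      have Eerr: "expectation ?err \<le> expectation (local_error h i) + hit_const * h\<^sup>2"
      proof -
        have "expectation ?err = expectation (local_error h i) + expectation (hit h i) + h * expectation (claim_cell h i)"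
          using iloc ihit icell by simp
        also have "h * expectation (claim_cell h i) \<le> h * (lam * h)"
          using claim_cell_expectation(1)[OF h(1)] h by (intro mult_left_mono) auto
        finally show ?thesis using Ehit by (simp add: hit_const_def power2_eq_square algebra_simps)
      qed
      have "\<sigma> * (?A (Suc i) + ?j i) = expectation (\<lambda>\<omega>. \<sigma> * (\<Phi> (Z h (Suc i) \<omega>) + paid h i \<omega>))"
        using i\<Phi>[of "Suc i"] ipaid[OF i] by simp
      also have "\<dots> \<le> expectation (\<lambda>\<omega>. \<sigma> * ?W \<omega> + K * ?err \<omega>)"
      proof (rule integral_mono_AE)
        show "integrable M (\<lambda>\<omega>. \<sigma> * (\<Phi> (Z h (Suc i) \<omega>) + paid h i \<omega>))"
          by (intro integrable_mult_right Bochner_Integration.integrable_add i\<Phi> ipaid[OF i])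
        show "integrable M (\<lambda>\<omega>. \<sigma> * ?W \<omega> + K * ?err \<omega>)"
          by (intro integrable_mult_right Bochner_Integration.integrable_add iW ierr)
        show "AE \<omega> in M. \<sigma> * (\<Phi> (Z h (Suc i) \<omega>) + paid h i \<omega>) \<le> \<sigma> * ?W \<omega> + K * ?err \<omega>"
          by (rule step[OF h(1,2) gl[OF i]])
      qed
      also have "\<dots> = \<sigma> * expectation ?W + K * expectation ?err"
      proof -
        have "expectation (\<lambda>\<omega>. \<sigma> * ?W \<omega> + K * ?err \<omega>) = expectation (\<lambda>\<omega>. \<sigma> * ?W \<omega>) + expectation (\<lambda>\<omega>. K * ?err \<omega>)"
          by (intro Bochner_Integration.integral_add integrable_mult_right iW ierr)
        then show ?thesis by simp
      qed
      also have "\<dots> \<le> \<sigma> * expectation ?W + K * (expectation (local_error h i) + hit_const * h\<^sup>2)"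
        using Eerr K by (intro add_left_mono mult_left_mono)
      finally have 1: "\<sigma> * (?A (Suc i) + ?j i) \<le> \<sigma> * expectation ?W + K * (expectation (local_error h i) + hit_const * h\<^sup>2)" .
      have Eloc: "0 \<le> expectation (local_error h i)" by (rule Bochner_Integration.integral_nonneg) (rule local_error_nonneg)
      have kap: "0 < exp (- delta * h)" "exp (- delta * h) \<le> 1" using h delta_pos by auto
      have "\<sigma> * (exp (- delta * h) * (?A (Suc i) + ?j i)) = exp (- delta * h) * (\<sigma> * (?A (Suc i) + ?j i))" by (simp add: mult.left_commute)
      also have "\<dots> \<le> exp (- delta * h) * (\<sigma> * expectation ?W + K * (expectation (local_error h i) + hit_const * h\<^sup>2))"
        using 1 kap by (intro mult_left_mono) auto
      also have "\<dots> \<le> \<sigma> * (exp (- delta * h) * expectation ?W) + K * (expectation (local_error h i) + hit_const * h\<^sup>2)"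
      proof -
        have "exp (- delta * h) * (K * (expectation (local_error h i) + hit_const * h\<^sup>2)) \<le> 1 * (K * (expectation (local_error h i) + hit_const * h\<^sup>2))"
          using kap K Eloc hit_const_nonneg by (intro mult_right_mono mult_nonneg_nonneg add_nonneg_nonneg) auto
        then show ?thesis by (simp add: distrib_left mult.left_commute)
      qed
      also have "exp (- delta * h) * expectation ?W = expectation (\<lambda>\<omega>. indicator {0..} (Z h i \<omega>) * (exp (- delta * h) * \<Phi> (Z h i \<omega> + h * g (Z h i \<omega>) - (C (real i * h + h) \<omega> - C (real i * h) \<omega>))))"
        by (simp add: mult.left_commute \<Delta>C_def)
      finally have 2: "\<sigma> * (exp (- delta * h) * (?A (Suc i) + ?j i)) \<le> \<sigma> * expectation (\<lambda>\<omega>. indicator {0..} (Z h i \<omega>) * (exp (- delta * h) * \<Phi> (Z h i \<omega> + h * g (Z h i \<omega>) - (C (real i * h + h) \<omega> - C (real i * h) \<omega>))))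
          + K * (expectation (local_error h i) + hit_const * h\<^sup>2)" .
      let ?V = "\<lambda>\<omega>. indicator {0..} (Z h i \<omega>) * (\<Phi> (Z h i \<omega>) + h * drift (Z h i \<omega>))"
      have V_eq: "?V \<omega> = \<Phi> (Z h i \<omega>) + h * (indicator {0..} (Z h i \<omega>) * drift (Z h i \<omega>))" for \<omega>
        by (auto simp: indicator_def barrier_neg)
      have idr: "integrable M (\<lambda>\<omega>. indicator {0..} (Z h i \<omega>) * drift (Z h i \<omega>))"
      proof -
        obtain B where B: "0 \<le> B" "\<And>z. 0 \<le> z \<Longrightarrow> z \<le> R \<Longrightarrow> \<bar>drift z\<bar> \<le> B"
          using continuous_on_Icc_bounded[OF continuous_on_subset[OF drift_continuous], of 0 R] by auto
        have dm [measurable]: "(\<lambda>z. drift (max 0 z)) \<in> borel_measurable borel"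
          by (intro borel_measurable_continuous_onI continuous_on_compose2[OF drift_continuous] continuous_intros) auto
        have eq: "(\<lambda>\<omega>. indicator {0..} (Z h i \<omega>) * drift (Z h i \<omega>)) = (\<lambda>\<omega>. indicator {0..} (Z h i \<omega>) * drift (max 0 (Z h i \<omega>)))"
          by (auto simp: fun_eq_iff indicator_def)
        show ?thesis
        proof (rule bounded_integrable[where B=B])
          show "(\<lambda>\<omega>. indicator {0..} (Z h i \<omega>) * drift (Z h i \<omega>)) \<in> borel_measurable M" unfolding eq by measurable
          show "\<bar>indicator {0..} (Z h i \<omega>) * drift (Z h i \<omega>)\<bar> \<le> B" for \<omega>
            using B Z_le[of h i \<omega>] by (auto simp: indicator_def)
        qed
      qed
      have "\<sigma> * expectation ?V = \<sigma> * ?A i + h * expectation (\<lambda>\<omega>. \<sigma> * (indicator {0..} (Z h i \<omega>) * drift (Z h i \<omega>)))"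
        unfolding V_eq using i\<Phi>[of i] idr by (simp add: distrib_left mult.left_commute)
      also have "\<dots> \<le> \<sigma> * ?A i + h * 0"
        using drift[OF h(1) im] idr h integral_nonneg_AE[of "\<lambda>\<omega>. - (\<sigma> * (indicator {0..} (Z h i \<omega>) * drift (Z h i \<omega>)))" M]
        by (intro add_left_mono mult_left_mono) auto
      finally have 3: "\<sigma> * expectation ?V \<le> \<sigma> * ?A i" by simp
      have g: "\<bar>expectation (\<lambda>\<omega>. indicator {0..} (Z h i \<omega>) * (exp (- delta * h) * \<Phi> (Z h i \<omega> + h * g (Z h i \<omega>) - (C (real i * h + h) \<omega> - C (real i * h) \<omega>))))
        - expectation ?V\<bar> \<le> e' * h"
        by (rule gen[OF h(1,3) k ZF Z_le])
      have "\<sigma> * expectation (\<lambda>\<omega>. indicator {0..} (Z h i \<omega>) * (exp (- delta * h) * \<Phi> (Z h i \<omega> + h * g (Z h i \<omega>) - (C (real i * h + h) \<omega> - C (real i * h) \<omega>))))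
         \<le> \<sigma> * expectation ?V + e' * h"
        using sgn g by auto
      with 2 3 show ?thesis by linarith
    qed
    have rn: "0 \<le> ?r i" for i
      using e' h K hit_const_nonneg local_error_nonneg
      by (intro add_nonneg_nonneg mult_nonneg_nonneg Bochner_Integration.integral_nonneg) auto
    have fin: "\<sigma> * ((\<Sum>i<n * m. exp (- delta * (real (Suc i) * h)) * ?j i) + exp (- delta * (real (n * m) * h)) * ?A (n * m)) \<le> \<sigma> * ?A 0 + (\<Sum>i<n * m. ?r i)"
      by (rule grid_sum_bound[where A="?A" and j="?j" and r="?r"]) (use stp rn h delta_pos in auto)
    have nm: "real (n * m) * h = real m" using n by (simp add: h_def)
    have "(\<Sum>i<n * m. ?r i) = e' * real m + K * ((\<Sum>i<n * m. expectation (local_error h i)) + hit_const * real m / real n)"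
    proof -
      have "(\<Sum>i<n * m. ?r i) = e' * (real (n * m) * h) + K * ((\<Sum>i<n * m. expectation (local_error h i)) + hit_const * (real (n * m) * h) * h)"
        by (simp add: sum.distrib sum_distrib_left distrib_left power2_eq_square algebra_simps)
      then show ?thesis unfolding nm by (simp add: h_def)
    qed
    also have "\<dots> \<le> e / 3 + e / 3"
    proof (rule add_mono)
      show "e' * real m \<le> e / 3" using e by (simp add: e'_def field_simps)
    qed (use sm in \<open>simp add: h_def\<close>)
    finally have "(\<Sum>i<n * m. ?r i) \<le> e" using e by simp
    moreover have tp: "expectation (total_paid n) = (\<Sum>i<n * m. exp (- delta * (real (Suc i) * h)) * ?j i)"
      unfolding total_paid_def[abs_def] h_def[symmetric]
      by (subst Bochner_Integration.integral_sum) (use ipaid in auto)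
    \<comment> \<open>At index 0 the mesh has no influence; \<open>Z 1 0\<close> merely represents
      the surplus after the initial payment.\<close>
    moreover have "Z h 0 = Z 1 0" by (auto simp: fun_eq_iff Z_def survive_def)
    then have A0: "?A 0 = expectation (\<lambda>\<omega>. \<Phi> (Z 1 0 \<omega>))" by (simp only:)
    ultimately show "\<sigma> * (expectation (total_paid n) + exp (- delta * real m) * expectation (\<lambda>\<omega>. \<Phi> (Z (1 / real n) (n * m) \<omega>)))
     \<le> \<sigma> * expectation (\<lambda>\<omega>. \<Phi> (Z 1 0 \<omega>)) + e"
      unfolding h_def[symmetric] using fin[unfolded nm, folded tp, unfolded A0] by linarith
  qed
qed
qed

lemma upper_estimate:
  assumes e: "0 < e"
  shows "\<forall>\<^sub>F n in sequentially. expectation (total_paid n) \<le> expectation (\<lambda>\<omega>. \<Phi> (Z 1 0 \<omega>)) + e"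
proof -
  have "0 \<le> R + max_rate" using R_nonneg max_rate_pos by simp
  then obtain c where c: "1 \<le> c" "\<And>u v. 0 \<le> u \<Longrightarrow> u \<le> R + max_rate \<Longrightarrow> 0 \<le> v \<Longrightarrow> v \<le> R + max_rate \<Longrightarrow> \<bar>\<Phi> u - \<Phi> v\<bar> \<le> c * \<bar>u - v\<bar>"
    using barrier_lipschitz by metis
  have "\<forall>\<^sub>F n in sequentially. 1 * (expectation (total_paid n) + exp (- delta * real m) * expectation (\<lambda>\<omega>. \<Phi> (Z (1 / real n) (n * m) \<omega>)))
     \<le> 1 * expectation (\<lambda>\<omega>. \<Phi> (Z 1 0 \<omega>)) + e"
  proof (rule grid_sum_estimate[where K="c + value_bound"])
    show "0 \<le> c + value_bound" using c value_bound_nonneg by simp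
    fix h :: real and i :: nat assume h: "0 < h" "h \<le> 1" "real (Suc i) * h \<le> real m"
    show "AE \<omega> in M. 1 * (\<Phi> (Z h (Suc i) \<omega>) + paid h i \<omega>)
        \<le> 1 * (indicator {0..} (Z h i \<omega>) * \<Phi> (Z h i \<omega> + h * g (Z h i \<omega>) - \<Delta>C h i \<omega>))
          + (c + value_bound) * (local_error h i \<omega> + hit h i \<omega> + h * claim_cell h i \<omega>)"
      using AE_regular
    proof eventually_elim
      fix \<omega> assume w: "regular \<omega>"
      have "0 \<le> (c + value_bound) * (h * claim_cell h i \<omega>)"
        using c value_bound_nonneg h by (intro mult_nonneg_nonneg) (auto simp: claim_cell_def)
      then show "1 * (\<Phi> (Z h (Suc i) \<omega>) + paid h i \<omega>)
        \<le> 1 * (indicator {0..} (Z h i \<omega>) * \<Phi> (Z h i \<omega> + h * g (Z h i \<omega>) - \<Delta>C h i \<omega>))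
          + (c + value_bound) * (local_error h i \<omega> + hit h i \<omega> + h * claim_cell h i \<omega>)"
        using upper_step[OF c w h] by (simp add: distrib_left del: of_nat_Suc)
    qed
  next
    fix h :: real and i :: nat
    show "AE \<omega> in M. 1 * (indicator {0..} (Z h i \<omega>) * drift (Z h i \<omega>)) \<le> 0"
      using drift_nonpos by (auto simp: indicator_def)
  qed (use e in auto)
  then show ?thesis
  proof eventually_elim
    fix n
    have "0 \<le> exp (- delta * real m) * expectation (\<lambda>\<omega>. \<Phi> (Z (1 / real n) (n * m) \<omega>))"
      using barrier_nonneg by (intro mult_nonneg_nonneg Bochner_Integration.integral_nonneg) auto
    moreover assume "1 * (expectation (total_paid n) + exp (- delta * real m) * expectation (\<lambda>\<omega>. \<Phi> (Z (1 / real n) (n * m) \<omega>)))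
       \<le> 1 * expectation (\<lambda>\<omega>. \<Phi> (Z 1 0 \<omega>)) + e"
    ultimately show "expectation (total_paid n) \<le> expectation (\<lambda>\<omega>. \<Phi> (Z 1 0 \<omega>)) + e"
      unfolding mult_1_left by linarith
  qed
qed

end

section \<open>Upper bound for the value of a control\<close>

context controlled_surplus
begin

text \<open>The integrand whose Stieltjes integral against \<open>D\<close> is
  \<open>total_paid n\<close>. Cells are open on the left, so that an atom at time 0 is not
  seen.\<close>

definition step_weight :: "nat \<Rightarrow> real \<Rightarrow> 'a \<Rightarrow> real" where
  "step_weight n u \<omega> = (\<Sum>i<n * m. (if survive (1 / real n) (Suc i) \<omega> then exp (- delta * (real (Suc i) * (1 / real n))) else 0)
     * indicator {real i * (1 / real n)<..real (Suc i) * (1 / real n)} u)"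

lemma step_weight_measurable [measurable]: "(\<lambda>u. step_weight n u \<omega>) \<in> borel_measurable borel"
  unfolding step_weight_def by (intro borel_measurable_sum borel_measurable_times borel_measurable_indicator) auto

lemma step_weight_nonneg: "0 \<le> step_weight n u \<omega>"
  unfolding step_weight_def by (intro sum_nonneg) auto

lemma step_weight_eq:
  assumes n: "0 < n" and u: "0 < u"
  obtains k where "real k / real n < u" "u \<le> real (Suc k) / real n"
    "step_weight n u \<omega> = (if k < n * m \<and> survive (1 / real n) (Suc k) \<omega> then exp (- delta * (real (Suc k) / real n)) else 0)"
proof -
  \<comment> \<open>Cells contain their right end, hence the ceiling minus 1 rather than the
    floor.\<close>
  define k where "k = nat \<lceil>u * real n\<rceil> - 1"
  have un: "0 < u * real n" using n u by simp
  have c: "0 < \<lceil>u * real n\<rceil>" using un by simp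
  have rk: "real k = real_of_int \<lceil>u * real n\<rceil> - 1"
    using c unfolding k_def by linarith
  have k: "real k < u * real n" "u * real n \<le> real (Suc k)" using rk by linarith+
  have ind: "indicator {real i * (1 / real n)<..real (Suc i) * (1 / real n)} u = (if i = k then 1 else 0 :: real)" for i
  proof -
    have "u \<in> {real i * (1 / real n)<..real (Suc i) * (1 / real n)} \<longleftrightarrow> real i < u * real n \<and> u * real n \<le> real (Suc i)"
      using n by (simp add: divide_less_eq le_divide_eq del: of_nat_Suc)
    also have "\<dots> \<longleftrightarrow> i = k"
    proof
      assume "real i < u * real n \<and> u * real n \<le> real (Suc i)"
      then have "real i < real (Suc k)" "real k < real (Suc i)" using k by linarith+
      then show "i = k" by simp
    qed (use k in auto)
    finally show ?thesis by (simp add: indicator_def)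
  qed
  show thesis
  proof (rule that[of k])
    show "real k / real n < u" "u \<le> real (Suc k) / real n"
      using k n by (simp_all add: divide_less_eq le_divide_eq del: of_nat_Suc)
    show "step_weight n u \<omega> = (if k < n * m \<and> survive (1 / real n) (Suc k) \<omega> then exp (- delta * (real (Suc k) / real n)) else 0)"
    proof -
      let ?c = "\<lambda>i. if survive (1 / real n) (Suc i) \<omega> then exp (- delta * (real (Suc i) * (1 / real n))) else 0"
      have "step_weight n u \<omega> = (\<Sum>i<n * m. if i = k then ?c i else 0)"
        unfolding step_weight_def ind by (intro sum.cong refl) simp
      then show ?thesis by simp
    qed
  qed
qed

lemma step_weight_outside:
  assumes "0 < n" "u \<le> 0"
  shows "step_weight n u \<omega> = 0"
  unfolding step_weight_def
proof (rule sum.neutral, rule ballI)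
  fix i
  have "0 \<le> real i * (1 / real n)" by simp
  then have "u \<notin> {real i * (1 / real n)<..real (Suc i) * (1 / real n)}"
    using assms unfolding greaterThanAtMost_iff by linarith
  then show "(if survive (1 / real n) (Suc i) \<omega> then exp (- delta * (real (Suc i) * (1 / real n))) else 0)
     * indicator {real i * (1 / real n)<..real (Suc i) * (1 / real n)} u = 0" by simp
qed

lemma emeasure_dividend_Ioc:
  assumes "regular \<omega>" "a \<le> c"
  shows "emeasure (interval_measure (\<lambda>t. D t \<omega>)) {a<..c} = ennreal (D c \<omega> - D a \<omega>)"
proof (rule emeasure_interval_measure_Ioc[OF assms(2)])
  have d: "control_path (\<lambda>t. D t \<omega>)" using assms(1) by (simp add: regular_def)
  show "D s \<omega> \<le> D t \<omega>" if "s \<le> t" for s t using control_pathD(1)[OF d] that by (simp add: mono_def)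
  show "continuous (at_right t) (\<lambda>t. D t \<omega>)" for t by (rule control_pathD(4)[OF d])
qed

lemma total_paid_integral:
  assumes w: "regular \<omega>" and n: "0 < n"
  shows "(\<integral>\<^sup>+u. ennreal (step_weight n u \<omega>) \<partial>interval_measure (\<lambda>t. D t \<omega>)) = ennreal (total_paid n \<omega>)"
proof -
  let ?\<mu> = "interval_measure (\<lambda>t. D t \<omega>)" and ?h = "1 / real n"
  let ?c = "\<lambda>i. if survive ?h (Suc i) \<omega> then exp (- delta * (real (Suc i) * ?h)) else 0"
  let ?I = "\<lambda>i. {real i * ?h<..real (Suc i) * ?h}"
  have le: "real i * ?h \<le> real (Suc i) * ?h" for i by (intro mult_right_mono) auto
  have mono: "0 \<le> D (real (Suc i) * ?h) \<omega> - D (real i * ?h) \<omega>" for i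
    using control_pathD(1)[of "\<lambda>t. D t \<omega>"] w le[of i] by (simp add: regular_def mono_def del: of_nat_Suc)
  have "(\<integral>\<^sup>+u. ennreal (step_weight n u \<omega>) \<partial>?\<mu>) = (\<integral>\<^sup>+u. (\<Sum>i<n * m. ennreal (?c i) * indicator (?I i) u) \<partial>?\<mu>)"
  proof (rule nn_integral_cong)
    fix u
    have "ennreal (step_weight n u \<omega>) = (\<Sum>i<n * m. ennreal (?c i * indicator (?I i) u))"
      unfolding step_weight_def by (rule sum_ennreal[symmetric]) auto
    also have "\<dots> = (\<Sum>i<n * m. ennreal (?c i) * indicator (?I i) u)"
      by (intro sum.cong refl) (simp add: indicator_def)
    finally show "ennreal (step_weight n u \<omega>) = (\<Sum>i<n * m. ennreal (?c i) * indicator (?I i) u)" .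
  qed
  also have "\<dots> = (\<Sum>i<n * m. \<integral>\<^sup>+u. ennreal (?c i) * indicator (?I i) u \<partial>?\<mu>)"
    by (rule nn_integral_sum) measurable
  also have "\<dots> = (\<Sum>i<n * m. ennreal (exp (- delta * (real (Suc i) * ?h)) * paid ?h i \<omega>))"
  proof (intro sum.cong refl)
    fix i
    have "(\<integral>\<^sup>+u. ennreal (?c i) * indicator (?I i) u \<partial>?\<mu>) = ennreal (?c i) * emeasure ?\<mu> (?I i)"
      by (rule nn_integral_cmult_indicator) simp
    also have "\<dots> = ennreal (?c i * (D (real (Suc i) * ?h) \<omega> - D (real i * ?h) \<omega>))"
      unfolding emeasure_dividend_Ioc[OF w le] by (rule ennreal_mult[symmetric]) (use mono in auto)
    also have "?c i * (D (real (Suc i) * ?h) \<omega> - D (real i * ?h) \<omega>) = exp (- delta * (real (Suc i) * ?h)) * paid ?h i \<omega>"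
      by (simp add: paid_def)
    finally show "(\<integral>\<^sup>+u. ennreal (?c i) * indicator (?I i) u \<partial>?\<mu>) = ennreal (exp (- delta * (real (Suc i) * ?h)) * paid ?h i \<omega>)" .
  qed
  also have "\<dots> = ennreal (total_paid n \<omega>)"
    unfolding total_paid_def by (rule sum_ennreal) (use mono in \<open>auto simp: paid_def\<close>)
  finally show ?thesis .
qed

section \<open>Dividends before ruin as limits of grid sums\<close>

definition alive :: "'a \<Rightarrow> real set" where
  "alive \<omega> = {t. 0 \<le> t \<and> ereal t < ruin_time (surplus g N Y x D \<omega>)}"

lemma alive_nonneg:
  assumes "t \<in> alive \<omega>" "0 \<le> s" "s \<le> t"
  shows "0 \<le> X s \<omega>"
proof (rule ccontr)
  assume "\<not> 0 \<le> X s \<omega>"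
  then have "ruin_time (surplus g N Y x D \<omega>) \<le> ereal s"
    unfolding ruin_time_def using assms(2) by (intro Inf_lower) (auto simp: X_def)
  also have "\<dots> \<le> ereal t" using assms(3) by simp
  finally show False using assms(1) by (auto simp: alive_def)
qed

text \<open>Strictness leaves room between \<open>t\<close> and ruin: on fine grids the right end of
  the cell containing \<open>t\<close> is still before ruin.\<close>

lemma alive_extend:
  assumes "t \<in> alive \<omega>"
  obtains r where "t < r" "r \<in> alive \<omega>"
proof -
  obtain q where "t < q" "ereal q < ruin_time (surplus g N Y x D \<omega>)"
    using assms ereal_dense2[of "ereal t"] by (auto simp: alive_def)
  then show thesis using that assms by (auto simp: alive_def)
qed

lemma alive_measurable [measurable]: "alive \<omega> \<in> sets borel"
proof -
  have "alive \<omega> = {0..} \<inter> {t. ereal t < ruin_time (surplus g N Y x D \<omega>)}" by (auto simp: alive_def)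
  also have "\<dots> \<in> sets borel" by measurable
  finally show ?thesis .
qed

definition discounted :: "'a \<Rightarrow> ennreal" where
  "discounted \<omega> = (\<integral>\<^sup>+t. ennreal (exp (- delta * t)) * indicator (alive \<omega> \<inter> {..real m}) t \<partial>interval_measure (\<lambda>t. D t \<omega>))"

text \<open>Once the mesh is smaller than the room left before ruin, every grid value up to the
  right end of the cell of \<open>u\<close> is nonnegative. The weight is then the discount factor
  at that right end, which tends to the one at \<open>u\<close>.\<close>

lemma step_weight_alive:
  assumes u: "u \<in> alive \<omega>" "0 < u" "u \<le> real m"
  shows "ennreal (exp (- delta * u)) \<le> liminf (\<lambda>n. ennreal (step_weight n u \<omega>))"
proof -
  obtain r where r: "u < r" "r \<in> alive \<omega>" using alive_extend[OF u(1)] .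
  have "(\<lambda>n. 1 / real n) \<longlonglongrightarrow> 0" by (rule lim_const_over_n)
  then have "\<forall>\<^sub>F n in sequentially. 1 / real n < r - u" using order_tendstoD(2) r(1) by fastforce
  then have ev: "\<forall>\<^sub>F n in sequentially. ennreal (exp (- delta * (u + 1 / real n))) \<le> ennreal (step_weight n u \<omega>)"
    using eventually_gt_at_top[of "0::nat"]
  proof eventually_elim
    fix n :: nat assume nr: "1 / real n < r - u" and n: "0 < n"
    obtain k where k: "real k / real n < u" "u \<le> real (Suc k) / real n"
      "step_weight n u \<omega> = (if k < n * m \<and> survive (1 / real n) (Suc k) \<omega> then exp (- delta * (real (Suc k) / real n)) else 0)"
      using step_weight_eq[OF n u(2)] .
    have kn: "real (Suc k) / real n \<le> u + 1 / real n" using k(1) by (simp add: add_divide_distrib)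
    have "survive (1 / real n) (Suc k) \<omega>"
      unfolding survive_def
    proof (intro allI impI)
      fix j assume "j \<le> Suc k"
      then have "real j * (1 / real n) \<le> real (Suc k) / real n" by (simp add: divide_right_mono del: of_nat_Suc)
      then have "real j * (1 / real n) \<le> r" using kn nr by linarith
      then show "0 \<le> X (real j * (1 / real n)) \<omega>" using alive_nonneg[OF r(2)] by simp
    qed
    moreover have "k < n * m"
    proof -
      have "real k / real n < real m" using k(1) u(3) by linarith
      then have "real k < real (n * m)" using n by (simp add: divide_less_eq mult.commute)
      then show ?thesis by (simp only: of_nat_less_iff)
    qed
    ultimately have "step_weight n u \<omega> = exp (- delta * (real (Suc k) / real n))" using k(3) by simp
    moreover have "exp (- delta * (u + 1 / real n)) \<le> exp (- delta * (real (Suc k) / real n))"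
      using mult_left_mono[OF kn less_imp_le[OF delta_pos]] by (simp only: exp_le_cancel_iff mult_minus_left neg_le_iff_le)
    ultimately show "ennreal (exp (- delta * (u + 1 / real n))) \<le> ennreal (step_weight n u \<omega>)" by simp
  qed
  have "(\<lambda>n. exp (- delta * (u + 1 / real n))) \<longlonglongrightarrow> exp (- delta * (u + 0))"
    by (intro tendsto_exp tendsto_mult tendsto_add tendsto_const lim_const_over_n)
  then have "(\<lambda>n. ennreal (exp (- delta * (u + 1 / real n)))) \<longlonglongrightarrow> ennreal (exp (- delta * u))"
    by (intro tendsto_ennrealI) simp
  then have "ennreal (exp (- delta * u)) = liminf (\<lambda>n. ennreal (exp (- delta * (u + 1 / real n))))"
    by (rule lim_imp_Liminf[OF sequentially_bot, symmetric])
  also have "\<dots> \<le> liminf (\<lambda>n. ennreal (step_weight n u \<omega>))" by (rule Liminf_mono[OF ev])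
  finally show ?thesis .
qed

text \<open>The atom at time 0 lies in no cell. It is covered by \<open>indicator {-1<..0}\<close>,
  whose mass is the initial payment because \<open>D\<close> vanishes at negative times. The rest is
  Fatou's lemma under the Stieltjes measure.\<close>

lemma discounted_le_liminf:
  assumes w: "regular \<omega>"
  shows "discounted \<omega> \<le> ennreal (D 0 \<omega>) + liminf (\<lambda>n. ennreal (total_paid n \<omega>))"
proof -
  let ?\<mu> = "interval_measure (\<lambda>t. D t \<omega>)"
  have "discounted \<omega> \<le> (\<integral>\<^sup>+u. indicator {-1<..0} u + liminf (\<lambda>n. ennreal (step_weight n u \<omega>)) \<partial>?\<mu>)"
    unfolding discounted_def
  proof (rule nn_integral_mono)
    fix u
    show "ennreal (exp (- delta * u)) * indicator (alive \<omega> \<inter> {..real m}) u \<le> indicator {-1<..0} u + liminf (\<lambda>n. ennreal (step_weight n u \<omega>))"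
    proof (cases "u \<in> alive \<omega> \<inter> {..real m}")
      case True
      then have "0 \<le> u" by (auto simp: alive_def)
      then show ?thesis
        using True step_weight_alive[of u \<omega>] by (cases "u = 0") (auto intro: order_trans)
    qed simp
  qed
  also have "\<dots> = (\<integral>\<^sup>+u. indicator {-1<..0} u \<partial>?\<mu>) + (\<integral>\<^sup>+u. liminf (\<lambda>n. ennreal (step_weight n u \<omega>)) \<partial>?\<mu>)"
    by (rule nn_integral_add) measurable
  also have "(\<integral>\<^sup>+u. indicator {-1<..0} u \<partial>?\<mu>) = ennreal (D 0 \<omega>)"
    using emeasure_dividend_Ioc[OF w, of "-1" 0] control_pathD(2)[of "\<lambda>t. D t \<omega>"] w by (simp add: regular_def)
  also have "(\<integral>\<^sup>+u. liminf (\<lambda>n. ennreal (step_weight n u \<omega>)) \<partial>?\<mu>) \<le> liminf (\<lambda>n. \<integral>\<^sup>+u. ennreal (step_weight n u \<omega>) \<partial>?\<mu>)"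
    by (rule nn_integral_liminf) measurable
  also have "\<dots> = liminf (\<lambda>n. ennreal (total_paid n \<omega>))"
    by (rule Liminf_eq, rule eventually_mono[OF eventually_gt_at_top[of "0::nat"]], rule total_paid_integral[OF w])
  finally show ?thesis by (simp add: add_left_mono)
qed

lemma paid_integrable:
  assumes "0 < n" "i < n * m"
  shows "integrable M (paid (1 / real n) i)" "AE \<omega> in M. 0 \<le> paid (1 / real n) i \<omega>"
proof -
  have h: "0 < 1 / real n" "1 / real n \<le> 1" using assms by auto
  show "AE \<omega> in M. 0 \<le> paid (1 / real n) i \<omega>"
    using AE_regular by eventually_elim (rule paid_bounds[OF _ h grid_le[OF assms]])
  show "integrable M (paid (1 / real n) i)"
  proof (rule integrable_const_bound[where B="R + max_rate"])
    show "AE \<omega> in M. norm (paid (1 / real n) i \<omega>) \<le> R + max_rate"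
      using AE_regular by eventually_elim (use paid_bounds[OF _ h grid_le[OF assms]] in simp)
  qed (use h in simp)
qed

lemma total_paid_integrable: "0 < n \<Longrightarrow> integrable M (total_paid n)"
  unfolding total_paid_def[abs_def]
  by (intro Bochner_Integration.integrable_sum integrable_mult_right paid_integrable) auto

lemma total_paid_measurable [measurable]: "total_paid n \<in> borel_measurable M"
  unfolding total_paid_def[abs_def]
  by (intro borel_measurable_sum borel_measurable_times borel_measurable_const paid_measurable) auto

lemma total_paid_nonneg: "0 < n \<Longrightarrow> AE \<omega> in M. 0 \<le> total_paid n \<omega>"
proof -
  assume n: "0 < n"
  have "AE \<omega> in M. \<forall>i\<in>{..<n * m}. 0 \<le> paid (1 / real n) i \<omega>"
    by (rule AE_finite_allI) (use paid_integrable(2)[OF n] in auto)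
  then show ?thesis
    by eventually_elim (auto simp: total_paid_def intro!: sum_nonneg mult_nonneg_nonneg)
qed

lemma initial_payment:
  assumes "AE \<omega> in M. D 0 \<omega> \<le> x"
  shows "integrable M (D 0)" "AE \<omega> in M. 0 \<le> D 0 \<omega>"
    "expectation (D 0) + expectation (\<lambda>\<omega>. \<Phi> (Z 1 0 \<omega>)) \<le> \<Phi> x"
proof -
  have D0: "AE \<omega> in M. 0 \<le> D 0 \<omega>" using AE_regular by eventually_elim (auto simp: regular_def dest: control_pathD(3))
  show "AE \<omega> in M. 0 \<le> D 0 \<omega>" by (rule D0)
  show iD: "integrable M (D 0)"
    by (rule integrable_const_bound[where B=x]) (use D0 assms in \<open>auto elim!: eventually_elim2\<close>)
  have \<Phi>b: "\<bar>\<Phi> (Z 1 0 \<omega>)\<bar> \<le> \<Phi> R" for \<omega> using barrier_mono[OF Z_le] barrier_nonneg by simp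
  have i\<Phi>: "integrable M (\<lambda>\<omega>. \<Phi> (Z 1 0 \<omega>))" by (rule bounded_integrable[OF _ \<Phi>b]) simp
  have "expectation (\<lambda>\<omega>. D 0 \<omega> + \<Phi> (Z 1 0 \<omega>)) \<le> expectation (\<lambda>_. \<Phi> x)"
  proof (rule integral_mono_AE)
    show "AE \<omega> in M. D 0 \<omega> + \<Phi> (Z 1 0 \<omega>) \<le> \<Phi> x"
      using AE_regular assms
    proof eventually_elim
      fix \<omega> assume w: "regular \<omega>" and Dx: "D 0 \<omega> \<le> x"
      have X0: "X 0 \<omega> = x - D 0 \<omega>" using regular_path(6)[of \<omega>] w by (auto simp: regular_def)
      have "0 \<le> D 0 \<omega>" using w by (auto simp: regular_def dest: control_pathD(3))
      then have "\<Phi> (x - D 0 \<omega>) + D 0 \<omega> \<le> \<Phi> x" using barrier_mono_add[of "x - D 0 \<omega>" x] Dx by simp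
      moreover have "\<Phi> (Z 1 0 \<omega>) \<le> \<Phi> (x - D 0 \<omega>)" using X0 Dx by (intro barrier_mono) (auto simp: Z_def)
      ultimately show "D 0 \<omega> + \<Phi> (Z 1 0 \<omega>) \<le> \<Phi> x" by linarith
    qed
  qed (use iD i\<Phi> in auto)
  then show "expectation (D 0) + expectation (\<lambda>\<omega>. \<Phi> (Z 1 0 \<omega>)) \<le> \<Phi> x"
    using iD i\<Phi> by (simp add: prob_space)
qed

text \<open>A bound for the discounted dividends up to the horizon that is visibly measurable in
  \<open>\<omega>\<close>, so that Fatou's lemma applies to it as the horizon grows.\<close>

definition majorant :: "'a \<Rightarrow> ennreal" where
  "majorant \<omega> = ennreal (D 0 \<omega>) + liminf (\<lambda>n. ennreal (total_paid n \<omega>))"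

lemma majorant_measurable [measurable]: "majorant \<in> borel_measurable M"
  unfolding majorant_def[abs_def] by measurable

lemma majorant_expectation:
  assumes D0: "AE \<omega> in M. D 0 \<omega> \<le> x"
  shows "(\<integral>\<^sup>+\<omega>. majorant \<omega> \<partial>M) \<le> ennreal (\<Phi> x)"
proof -
  note i = initial_payment[OF D0]
  have pos: "0 \<le> expectation (D 0)" by (rule integral_nonneg_AE[OF i(2)])
  have pZ: "0 \<le> expectation (\<lambda>\<omega>. \<Phi> (Z 1 0 \<omega>))" by (rule Bochner_Integration.integral_nonneg) (rule barrier_nonneg)
  have "(\<integral>\<^sup>+\<omega>. majorant \<omega> \<partial>M) = (\<integral>\<^sup>+\<omega>. ennreal (D 0 \<omega>) \<partial>M) + (\<integral>\<^sup>+\<omega>. liminf (\<lambda>n. ennreal (total_paid n \<omega>)) \<partial>M)"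
    unfolding majorant_def by (rule nn_integral_add) measurable
  also have "(\<integral>\<^sup>+\<omega>. ennreal (D 0 \<omega>) \<partial>M) = ennreal (expectation (D 0))"
    by (rule nn_integral_eq_integral[OF i(1,2)])
  also have "(\<integral>\<^sup>+\<omega>. liminf (\<lambda>n. ennreal (total_paid n \<omega>)) \<partial>M) \<le> liminf (\<lambda>n. \<integral>\<^sup>+\<omega>. ennreal (total_paid n \<omega>) \<partial>M)"
    by (rule nn_integral_liminf) measurable
  also have "\<dots> \<le> ennreal (expectation (\<lambda>\<omega>. \<Phi> (Z 1 0 \<omega>)))"
  proof (rule ennreal_le_epsilon)
    fix e :: real assume e: "0 < e"
    have "liminf (\<lambda>n. \<integral>\<^sup>+\<omega>. ennreal (total_paid n \<omega>) \<partial>M) \<le> limsup (\<lambda>n. \<integral>\<^sup>+\<omega>. ennreal (total_paid n \<omega>) \<partial>M)"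
      by (rule Liminf_le_Limsup) simp
    also have "\<dots> \<le> ennreal (expectation (\<lambda>\<omega>. \<Phi> (Z 1 0 \<omega>)) + e)"
    proof (rule Limsup_bounded)
      show "\<forall>\<^sub>F n in sequentially. (\<integral>\<^sup>+\<omega>. ennreal (total_paid n \<omega>) \<partial>M) \<le> ennreal (expectation (\<lambda>\<omega>. \<Phi> (Z 1 0 \<omega>)) + e)"
        using upper_estimate[OF e] eventually_gt_at_top[of "0::nat"]
        by eventually_elim (simp add: nn_integral_eq_integral[OF total_paid_integrable total_paid_nonneg] ennreal_leI)
    qed
    also have "\<dots> = ennreal (expectation (\<lambda>\<omega>. \<Phi> (Z 1 0 \<omega>))) + ennreal e" using pZ e by (intro ennreal_plus) auto
    finally show "liminf (\<lambda>n. \<integral>\<^sup>+\<omega>. ennreal (total_paid n \<omega>) \<partial>M) \<le> ennreal (expectation (\<lambda>\<omega>. \<Phi> (Z 1 0 \<omega>))) + ennreal e" .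
  qed
  also have "ennreal (expectation (D 0)) + ennreal (expectation (\<lambda>\<omega>. \<Phi> (Z 1 0 \<omega>))) = ennreal (expectation (D 0) + expectation (\<lambda>\<omega>. \<Phi> (Z 1 0 \<omega>)))"
    by (rule ennreal_plus[OF pos pZ, symmetric])
  also have "\<dots> \<le> ennreal (\<Phi> x)" by (rule ennreal_leI[OF i(3)])
  finally show ?thesis by (simp add: add_left_mono)
qed

end

section \<open>Passage to the infinite horizon for an arbitrary control\<close>

context dividend_barrier
begin

text \<open>This is the jump constraint at time 0, which never lies beyond ruin: the left limits
  there are the constant values before time 0, namely 0 for the dividends and \<open>x\<close> for
  the surplus.\<close>

lemma admissible_initial:
  assumes "D \<in> admissible M F N Y g x" "0 \<le> x"
  shows "AE \<omega> in M. D 0 \<omega> \<le> x"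
proof -
  have "AE \<omega> in M. control_path (\<lambda>t. D t \<omega>) \<and>
        (\<forall>t\<ge>0. ereal t \<le> ruin_time (surplus g N Y x D \<omega>) \<longrightarrow>
           jump (\<lambda>t. D t \<omega>) t \<le> left_limit (surplus g N Y x D \<omega>) t)"
    using assms(1) by (simp add: admissible_def)
  with AE_good_path show ?thesis
  proof eventually_elim
    fix \<omega> assume good: "good_path \<omega>" and d: "control_path (\<lambda>t. D t \<omega>) \<and>
        (\<forall>t\<ge>0. ereal t \<le> ruin_time (surplus g N Y x D \<omega>) \<longrightarrow>
           jump (\<lambda>t. D t \<omega>) t \<le> left_limit (surplus g N Y x D \<omega>) t)"
    note p = controlled_path[where D=D and \<omega>=\<omega>, OF good conjunct1[OF d] assms(2)]
    have const: "left_limit f 0 = c" if "\<And>t. t < 0 \<Longrightarrow> f t = c" for f :: "real \<Rightarrow> real" and c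
    proof -
      have "\<forall>\<^sub>F t in at_left 0. f t = c" using that by (simp add: eventually_at_left_field) (metis lt_ex)
      then have "(f \<longlongrightarrow> c) (at_left 0)" by (rule tendsto_eventually)
      then show ?thesis unfolding left_limit_def by (intro tendsto_Lim) auto
    qed
    have "ereal 0 \<le> ruin_time (surplus g N Y x D \<omega>)"
      unfolding ruin_time_def by (intro Inf_greatest) auto
    then have "jump (\<lambda>t. D t \<omega>) 0 \<le> left_limit (surplus g N Y x D \<omega>) 0" using d by auto
    then show "D 0 \<omega> \<le> x"
      using const[of "\<lambda>t. D t \<omega>" 0] const[of "surplus g N Y x D \<omega>" x] p(5) control_pathD(2)[OF conjunct1[OF d]]
      by (simp add: jump_def)
  qed
qed

theorem dividend_value_le_barrier:
  assumes D: "D \<in> admissible M F N Y g x" and x: "0 \<le> x"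
  shows "dividend_value M N Y g delta x D \<le> ennreal (\<Phi> x)"
proof -
  interpret cs: controlled_surplus M F N Y g lam alpha delta \<psi> b D x m for m
    by unfold_locales (use D x in \<open>auto simp: admissible_def elim: eventually_mono\<close>)
  note D0 = admissible_initial[OF D x]
  have "dividend_value M N Y g delta x D \<le> (\<integral>\<^sup>+\<omega>. liminf (\<lambda>m. cs.majorant m \<omega>) \<partial>M)"
    unfolding dividend_value_def
  proof (rule nn_integral_mono_AE)
    show "AE \<omega> in M. (\<integral>\<^sup>+t\<in>{t. 0 \<le> t \<and> ereal t < ruin_time (surplus g N Y x D \<omega>)}. ennreal (exp (- delta * t)) \<partial>interval_measure (\<lambda>t. D t \<omega>))
       \<le> liminf (\<lambda>m. cs.majorant m \<omega>)"
      using cs.AE_regular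
    proof eventually_elim
      fix \<omega> assume w: "cs.regular \<omega>"
      let ?f = "\<lambda>m t. ennreal (exp (- delta * t)) * indicator (cs.alive \<omega> \<inter> {..real m}) t"
      let ?\<mu> = "interval_measure (\<lambda>t. D t \<omega>)"
      have inc: "incseq ?f"
        by (auto simp: incseq_def le_fun_def indicator_def)
      have lim: "(SUP m. ?f m t) = ennreal (exp (- delta * t)) * indicator (cs.alive \<omega>) t" for t
      proof (rule antisym)
        show "(SUP m. ?f m t) \<le> ennreal (exp (- delta * t)) * indicator (cs.alive \<omega>) t"
          by (rule SUP_least) (auto simp: indicator_def)
        have "t \<le> real (nat \<lceil>t\<rceil>)" by (rule real_nat_ceiling_ge)
        then have "ennreal (exp (- delta * t)) * indicator (cs.alive \<omega>) t \<le> ?f (nat \<lceil>t\<rceil>) t" by (simp add: indicator_def)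
        also have "\<dots> \<le> (SUP m. ?f m t)" by (rule SUP_upper) simp
        finally show "ennreal (exp (- delta * t)) * indicator (cs.alive \<omega>) t \<le> (SUP m. ?f m t)" .
      qed
      have "(\<integral>\<^sup>+t\<in>{t. 0 \<le> t \<and> ereal t < ruin_time (surplus g N Y x D \<omega>)}. ennreal (exp (- delta * t)) \<partial>?\<mu>) = (\<integral>\<^sup>+t. (SUP m. ?f m t) \<partial>?\<mu>)"
        unfolding lim unfolding cs.alive_def by simp
      also have "\<dots> = (SUP m. integral\<^sup>N ?\<mu> (?f m))"
        by (rule nn_integral_monotone_convergence_SUP[OF inc]) measurable
      \<comment> \<open>The monotone limit is rewritten as a lower limit, the form in which the
        majorants can be inserted.\<close>
      also have "\<dots> = liminf (\<lambda>m. integral\<^sup>N ?\<mu> (?f m))"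
      proof (rule lim_imp_Liminf[symmetric])
        show "(\<lambda>m. integral\<^sup>N ?\<mu> (?f m)) \<longlonglongrightarrow> (SUP m. integral\<^sup>N ?\<mu> (?f m))"
          using inc by (intro LIMSEQ_SUP) (auto simp: incseq_def le_fun_def intro!: nn_integral_mono)
      qed simp
      also have "\<dots> \<le> liminf (\<lambda>m. cs.majorant m \<omega>)"
        by (intro Liminf_mono always_eventually allI)
           (use cs.discounted_le_liminf[OF w] in \<open>simp add: cs.majorant_def cs.discounted_def\<close>)
      finally show "(\<integral>\<^sup>+t\<in>{t. 0 \<le> t \<and> ereal t < ruin_time (surplus g N Y x D \<omega>)}. ennreal (exp (- delta * t)) \<partial>?\<mu>) \<le> liminf (\<lambda>m. cs.majorant m \<omega>)" .
    qed
  qed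
  also have "\<dots> \<le> liminf (\<lambda>m. \<integral>\<^sup>+\<omega>. cs.majorant m \<omega> \<partial>M)"
    by (rule nn_integral_liminf) simp
  also have "\<dots> \<le> ennreal (\<Phi> x)"
    by (rule order_trans[OF Liminf_le_Limsup Limsup_bounded])
       (auto intro!: always_eventually cs.majorant_expectation[OF D0])
  finally show ?thesis .
qed

end

section \<open>Paths under a barrier strategy\<close>

lemma left_limit_eqI:
  assumes "(f \<longlongrightarrow> l) (at_left t)"
  shows "left_limit f t = l"
  unfolding left_limit_def using assms by (intro tendsto_Lim) auto

context dividend_model
begin

text \<open>Before \<open>t\<close> the count takes finitely many values; where it attains its
  maximum \<open>s\<close> can be chosen.\<close>

lemma good_path_left_const:
  assumes good: "good_path \<omega>" and t: "0 < t"
  obtains s where "0 \<le> s" "s < t" "\<And>u. s \<le> u \<Longrightarrow> u < t \<Longrightarrow> N u \<omega> = N s \<omega>"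
proof -
  let ?A = "(\<lambda>u. N u \<omega>) ` {0..<t}"
  have "?A \<subseteq> {..N t \<omega>}" using good_path_N_mono[OF good] by auto
  then have fin: "finite ?A" by (rule finite_subset) simp
  have ne: "?A \<noteq> {}" using t by auto
  obtain s where s: "s \<in> {0..<t}" "N s \<omega> = Max ?A" using Max_in[OF fin ne] by auto
  show thesis
  proof (rule that[of s])
    fix u assume u: "s \<le> u" "u < t"
    have "N u \<omega> \<le> Max ?A" using u s fin by (intro Max_ge) auto
    then show "N u \<omega> = N s \<omega>" using good_path_N_mono[OF good, of s u] u s by auto
  qed (use s in auto)
qed

end

context dividend_barrier
begin

definition barrier_path :: "(real \<Rightarrow> 'a \<Rightarrow> real) \<Rightarrow> real \<Rightarrow> 'a \<Rightarrow> bool" where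
  "barrier_path D x \<omega> \<longleftrightarrow> (let X = surplus g N Y x D \<omega>; d = (\<lambda>t. D t \<omega>) in
        control_path d \<and>
        (\<forall>t\<ge>0. jump d t = (if left_limit X t > b then left_limit X t - b else 0)) \<and>
        (\<forall>t\<ge>0. (jump d has_sum (d t - (LBINT s:{0..t}. g b * indicator {s. X s = b} s))) {0..t}))"

lemma is_barrier_strategy_iff:
  "is_barrier_strategy M N Y g b x D \<longleftrightarrow> (AE \<omega> in M. barrier_path D x \<omega>)"
  by (simp add: is_barrier_strategy_def barrier_path_def)

lemma rate_barrier: "rate b = g b" using b_pos by (simp add: rate_def)

context
  fixes D :: "real \<Rightarrow> 'a \<Rightarrow> real" and x :: real and \<omega> :: 'a and X :: "real \<Rightarrow> real" and f :: "real \<Rightarrow> real"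
  assumes good: "good_path \<omega>" and bar: "barrier_path D x \<omega>" and x: "0 \<le> x"
    and X_eq: "X = surplus g N Y x D \<omega>" and f_eq: "f = (\<lambda>t. x - C t \<omega> - D t \<omega>)"
begin

lemma barrier_control: "control_path (\<lambda>t. D t \<omega>)"
  using bar by (simp add: barrier_path_def Let_def)

lemma barrier_jump: "0 \<le> t \<Longrightarrow> jump (\<lambda>t. D t \<omega>) t = (if left_limit X t > b then left_limit X t - b else 0)"
  using bar by (simp add: barrier_path_def Let_def X_eq)

lemma barrier_has_sum:
  "0 \<le> t \<Longrightarrow> (jump (\<lambda>t. D t \<omega>) has_sum (D t \<omega> - (LBINT s:{0..t}. g b * indicator {s. X s = b} s))) {0..t}"
  using bar by (simp add: barrier_path_def Let_def X_eq)

lemmas barrier_flow = controlled_path[where D=D and x=x and \<omega>=\<omega>, OF good barrier_control x, folded f_eq X_eq]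

lemma f_le: "0 \<le> t \<Longrightarrow> f t \<le> x"
  using barrier_flow(4)[of t] by (simp add: f_eq)

lemma barrier_start: "D 0 \<omega> = max 0 (x - b)" "X 0 = min x b"
proof -
  have ev: "\<forall>\<^sub>F t in at_left (0::real). t < 0" by (simp add: eventually_at_filter)
  have "left_limit X 0 = x"
    by (rule left_limit_eqI, rule tendsto_eventually) (use ev barrier_flow(5) in \<open>auto elim: eventually_mono\<close>)
  moreover have "left_limit (\<lambda>t. D t \<omega>) 0 = 0"
    by (rule left_limit_eqI, rule tendsto_eventually) (use ev control_pathD(2)[OF barrier_control] in \<open>auto elim: eventually_mono\<close>)
  ultimately show D0: "D 0 \<omega> = max 0 (x - b)" using barrier_jump[of 0] by (auto simp: jump_def)
  show "X 0 = min x b" using barrier_flow(6) D0 by auto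
qed

lemma barrier_left_limit:
  assumes t: "0 < t"
  obtains l lc where "(X \<longlongrightarrow> l) (at_left t)" "lc \<le> C t \<omega>" "X t = l - (C t \<omega> - lc) - jump (\<lambda>t. D t \<omega>) t"
proof -
  let ?A = "\<lambda>u. integral {0..u} (\<lambda>s. rate (X s))"
  have "continuous_on {0..t} ?A"
    by (rule indefinite_integral_continuous_1) (use flow_equationD(1)[OF barrier_flow(1)] t in auto)
  then have "continuous (at t within {0..t}) ?A" using t by (auto simp: continuous_on_eq_continuous_within)
  moreover have at: "at t within {0..t} = at_left t" using t by (simp add: at_within_Icc_at_left)
  ultimately have A: "(?A \<longlongrightarrow> ?A t) (at_left t)" by (simp add: continuous_within)
  obtain s where s: "0 \<le> s" "s < t" "\<And>u. s \<le> u \<Longrightarrow> u < t \<Longrightarrow> N u \<omega> = N s \<omega>"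
    using good_path_left_const[OF good t] by blast
  have ev: "\<forall>\<^sub>F u in at_left t. s < u \<and> u < t"
    by (rule eventually_mono[OF eventually_at_left_real[OF s(2)]]) simp
  have "\<forall>\<^sub>F u in at_left t. C u \<omega> = C s \<omega>"
    using ev
  proof eventually_elim
    fix u assume "s < u \<and> u < t"
    then show "C u \<omega> = C s \<omega>" using s(3)[of u] by (simp add: claims_def)
  qed
  then have C: "((\<lambda>u. C u \<omega>) \<longlongrightarrow> C s \<omega>) (at_left t)" by (rule tendsto_eventually)
  obtain ld where ld: "((\<lambda>u. D u \<omega>) \<longlongrightarrow> ld) (at_left t)"
    using barrier_control by (auto simp: control_path_def cadlag_def)
  have lim: "((\<lambda>u. x - C u \<omega> - D u \<omega> + ?A u) \<longlongrightarrow> x - C s \<omega> - ld + ?A t) (at_left t)"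
    by (intro tendsto_intros A C ld)
  have eq: "\<forall>\<^sub>F u in at_left t. x - C u \<omega> - D u \<omega> + ?A u = X u"
    using ev by eventually_elim (use flow_equationD(2)[OF barrier_flow(1)] s(1) in \<open>auto simp: f_eq\<close>)
  have "(X \<longlongrightarrow> x - C s \<omega> - ld + ?A t) (at_left t)" by (rule Lim_transform_eventually[OF lim eq])
  moreover have "C s \<omega> \<le> C t \<omega>" using good_path_claims(2)[OF good] s t by (auto simp: monotone_on_def)
  moreover have "X t = x - C s \<omega> - ld + ?A t - (C t \<omega> - C s \<omega>) - jump (\<lambda>t. D t \<omega>) t"
    using flow_equationD(2)[OF barrier_flow(1), of t] t left_limit_eqI[OF ld] by (simp add: f_eq jump_def)
  ultimately show thesis by (rule that)
qed

text \<open>At a positive time the left limit is either at most \<open>b\<close>, and a claim only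
  lowers it, or above \<open>b\<close>, and the prescribed jump pays out the excess.\<close>

lemma barrier_le: "0 \<le> t \<Longrightarrow> X t \<le> b"
proof (cases "t = 0")
  case False
  assume "0 \<le> t"
  then have t: "0 < t" using False by simp
  obtain l lc where "(X \<longlongrightarrow> l) (at_left t)" "lc \<le> C t \<omega>" "X t = l - (C t \<omega> - lc) - jump (\<lambda>t. D t \<omega>) t"
    using barrier_left_limit[OF t] .
  then show ?thesis using barrier_jump[of t] t left_limit_eqI[of X l t] by (auto split: if_splits)
qed (use barrier_start in auto)

text \<open>By \<open>barrier_le\<close> the left limit cannot exceed \<open>b\<close>, so the
  feedback rule prescribes no jump: lump sums are confined to time 0.\<close>

lemma barrier_no_jump:
  assumes t: "0 < t"
  shows "jump (\<lambda>t. D t \<omega>) t = 0"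
proof -
  obtain l lc where l: "(X \<longlongrightarrow> l) (at_left t)" "lc \<le> C t \<omega>" "X t = l - (C t \<omega> - lc) - jump (\<lambda>t. D t \<omega>) t"
    using barrier_left_limit[OF t] .
  have "\<forall>\<^sub>F u in at_left t. 0 < u \<and> u < t" by (rule eventually_mono[OF eventually_at_left_real[OF t]]) simp
  then have "\<forall>\<^sub>F u in at_left t. X u \<le> b" by eventually_elim (use barrier_le in auto)
  then have "l \<le> b" by (intro tendsto_upperbound[OF l(1)]) auto
  then show ?thesis using barrier_jump[of t] t left_limit_eqI[OF l(1)] by auto
qed

lemma barrier_X_measurable: "(\<lambda>s. X (max 0 s)) \<in> borel_measurable borel"
proof -
  have "mono (\<lambda>s. - f (max 0 s))"
    using barrier_flow(2) by (auto simp: mono_def monotone_on_def)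
  then have "(\<lambda>s. - f (max 0 s)) \<in> borel_measurable borel" by (rule borel_measurable_mono)
  then have 1: "(\<lambda>s. f (max 0 s)) \<in> borel_measurable borel" by simp
  have "continuous_on {0..} (\<lambda>u. integral {0..u} (\<lambda>s. rate (X s)))"
    by (rule continuous_on_halfline, rule indefinite_integral_continuous_1) (use flow_equationD(1)[OF barrier_flow(1)] in auto)
  then have "continuous_on UNIV (\<lambda>u. integral {0..max 0 u} (\<lambda>s. rate (X s)))"
    by (rule continuous_on_compose2) (auto intro!: continuous_intros)
  then have 2: "(\<lambda>u. integral {0..max 0 u} (\<lambda>s. rate (X s))) \<in> borel_measurable borel"
    by (rule borel_measurable_continuous_onI)
  have "(\<lambda>s. X (max 0 s)) = (\<lambda>s. f (max 0 s) + integral {0..max 0 s} (\<lambda>s. rate (X s)))"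
    using flow_equationD(2)[OF barrier_flow(1)] by (intro ext) simp
  then show ?thesis using 1 2 by simp
qed

definition pay_rate :: "real \<Rightarrow> real" where "pay_rate s = g b * indicator {s. X s = b} s"

text \<open>The premium left after dividends: all of it below \<open>b\<close>, nothing at
  \<open>b\<close>.\<close>

definition net_rate :: "real \<Rightarrow> real" where "net_rate s = (if X s < b then rate (X s) else 0)"

lemma pay_rate_set_integrable: "0 \<le> t \<Longrightarrow> set_integrable lborel {0..t} pay_rate"
proof -
  assume t: "0 \<le> t"
  have "set_integrable lborel {0..t} (\<lambda>s. if X (max 0 s) = b then g b else 0)"
  proof (rule bounded_measurable_set_integrable[where B="g b"])
    show "(\<lambda>s. if X (max 0 s) = b then g b else 0) \<in> borel_measurable borel"
      using barrier_X_measurable by measurable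
  qed (use g_pos[of b] b_pos in auto)
  also have "set_integrable lborel {0..t} (\<lambda>s. if X (max 0 s) = b then g b else 0) \<longleftrightarrow> set_integrable lborel {0..t} pay_rate"
    by (rule set_integrable_cong) (auto simp: pay_rate_def)
  finally show ?thesis .
qed

lemma pay_rate_integrable: "0 \<le> t \<Longrightarrow> pay_rate integrable_on {0..t}"
  by (rule set_borel_integral_eq_integral(1)[OF pay_rate_set_integrable])

text \<open>The series of jumps reduces to its term at time 0, the initial excess over
  \<open>b\<close>.\<close>

lemma barrier_dividends:
  assumes t: "0 \<le> t"
  shows "D t \<omega> = max 0 (x - b) + integral {0..t} pay_rate"
proof -
  let ?j = "jump (\<lambda>t. D t \<omega>)"
  have "(LBINT s:{0..t}. g b * indicator {s. X s = b} s) = integral {0..t} pay_rate"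
    using set_borel_integral_eq_integral(2)[OF pay_rate_set_integrable[OF t]] by (simp only: pay_rate_def[abs_def])
  then have "(?j has_sum (D t \<omega> - integral {0..t} pay_rate)) {0..t}"
    using barrier_has_sum[OF t] by (simp only:)
  then have 1: "(?j has_sum (D t \<omega> - integral {0..t} pay_rate)) {0}"
    by (subst (asm) has_sum_cong_neutral[where T="{0}" and g="?j"]) (use barrier_no_jump t in auto)
  have "(?j has_sum ?j 0) {0}" using has_sum_finite[of "{0}" ?j] by simp
  then have "?j 0 = D t \<omega> - integral {0..t} pay_rate" using 1 by (rule has_sum_unique)
  moreover have "?j 0 = max 0 (x - b)"
  proof -
    have ev: "\<forall>\<^sub>F t in at_left (0::real). t < 0" by (simp add: eventually_at_filter)
    have "left_limit (\<lambda>t. D t \<omega>) 0 = 0"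
      by (rule left_limit_eqI, rule tendsto_eventually) (use ev control_pathD(2)[OF barrier_control] in \<open>auto elim: eventually_mono\<close>)
    then show ?thesis using barrier_start(1) by (simp add: jump_def)
  qed
  ultimately show ?thesis by simp
qed

lemma net_rate_eq: "0 \<le> s \<Longrightarrow> rate (X s) - pay_rate s = net_rate s"
  using barrier_le[of s] rate_barrier by (auto simp: net_rate_def pay_rate_def)

lemma barrier_increments:
  assumes st: "0 \<le> s" "s \<le> t"
  shows "(\<lambda>r. rate (X r)) integrable_on {s..t}" "pay_rate integrable_on {s..t}" "net_rate integrable_on {s..t}"
    "D t \<omega> - D s \<omega> = integral {s..t} pay_rate"
    "X t = X s + integral {s..t} net_rate - (C t \<omega> - C s \<omega>)"
    "0 \<le> integral {s..t} net_rate" "0 \<le> integral {s..t} pay_rate"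
    "integral {s..t} (\<lambda>r. rate (X r)) = integral {s..t} net_rate + integral {s..t} pay_rate"
proof -
  have i0: "(\<lambda>r. rate (X r)) integrable_on {0..t}" "pay_rate integrable_on {0..t}"
    using flow_equationD(1)[OF barrier_flow(1)] pay_rate_integrable st by auto
  show i1: "(\<lambda>r. rate (X r)) integrable_on {s..t}" and i2: "pay_rate integrable_on {s..t}"
    by (rule integrable_on_interval_mono[OF i0(1) st(1) order_refl], rule integrable_on_interval_mono[OF i0(2) st(1) order_refl])
  have d: "(\<lambda>r. rate (X r) - pay_rate r) integrable_on {s..t}" by (rule integrable_diff[OF i1 i2])
  then show i3: "net_rate integrable_on {s..t}"
    by (rule integrable_eq) (use net_rate_eq st in auto)
  have "integral {s..t} net_rate = integral {s..t} (\<lambda>r. rate (X r) - pay_rate r)"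
    by (rule integral_cong) (use net_rate_eq st in auto)
  then show sum: "integral {s..t} (\<lambda>r. rate (X r)) = integral {s..t} net_rate + integral {s..t} pay_rate"
    using Henstock_Kurzweil_Integration.integral_diff[OF i1 i2] by simp
  show D: "D t \<omega> - D s \<omega> = integral {s..t} pay_rate"
    using barrier_dividends[of s] barrier_dividends[of t] st integral_diff_interval[OF i0(2) st] by simp
  show "0 \<le> integral {s..t} net_rate"
    by (rule integral_nonneg[OF i3]) (use rate_pos in \<open>auto simp: net_rate_def intro: less_imp_le\<close>)
  show "0 \<le> integral {s..t} pay_rate"
    by (rule integral_nonneg[OF i2]) (use g_pos[of b] b_pos in \<open>auto simp: pay_rate_def\<close>)
  show "X t = X s + integral {s..t} net_rate - (C t \<omega> - C s \<omega>)"
    using flow_increment_bounds(3)[OF barrier_flow(1) f_le x st order_refl] sum D by (simp add: f_eq)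
qed

text \<open>The net rate is nonnegative, so without claims the surplus does not decrease. A surplus
  below \<open>b\<close> at the end was below \<open>b\<close> throughout, where nothing is
  paid.\<close>

lemma barrier_claimless:
  assumes st: "0 \<le> s" "s \<le> t" and c: "C t \<omega> = C s \<omega>" and lt: "X t < b"
  shows "D t \<omega> = D s \<omega>"
proof -
  have "integral {s..t} pay_rate = integral {s..t} (\<lambda>_. 0)"
  proof (rule integral_cong)
    fix u assume u: "u \<in> {s..t}"
    have "C s \<omega> \<le> C u \<omega>" "C u \<omega> \<le> C t \<omega>" using good_path_claims(2)[OF good] u st by (auto simp: monotone_on_def)
    then have "X u \<le> X t" using barrier_increments(5,6)[of u t] u st c by auto
    then show "pay_rate u = 0" using lt by (simp add: pay_rate_def)
  qed
  then show ?thesis using barrier_increments(4)[OF st] by simp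
qed

text \<open>In a cell without claims the path either ends below \<open>b\<close>, where it is the
  free flow, or ends at \<open>b\<close>, where the capped step errs by no more than the free one. A
  cell with a claim gets a crude bound of order \<open>h\<close>, charged to the number of claims;
  the total of these charges is \<open>h\<close> times a number fixed by the path.\<close>

lemma barrier_euler_error:
  assumes h: "0 \<le> h" and T: "real (Suc i) * h \<le> T"
  defines "s \<equiv> real i * h" and "t \<equiv> real (Suc i) * h"
  shows "\<bar>X t - (min b (X s + h * rate (X s)) + (- C t \<omega>) - (- C s \<omega>))\<bar>
    \<le> \<bar>integral {s..t} (\<lambda>r. rate (X r)) - h * rate (X s)\<bar> + top_rate x T * h * (real (N t \<omega>) - real (N s \<omega>))"
proof -
  have ts: "t = s + h" by (simp add: s_def t_def algebra_simps)
  have s0: "0 \<le> s" using h by (simp add: s_def)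
  have st: "0 \<le> s" "s \<le> t" "t - s = h" "0 \<le> T" "t \<le> T"
    using ts s0 h T unfolding t_def by auto
  note inc = barrier_increments[OF st(1,2)]
  let ?J = "integral {s..t} (\<lambda>r. rate (X r))" and ?I = "integral {s..t} net_rate"
  have J: "?J \<le> top_rate x T * h" using flow_increment_bounds(2)[OF barrier_flow(1) f_le x st(1,2,5)] st(3) by simp
  have top: "0 < top_rate x T" by (rule top_rate_pos[OF x st(4)])
  have Nm: "N s \<omega> \<le> N t \<omega>" by (rule good_path_N_mono[OF good st(1,2)])
  have eq: "X t - (min b (X s + h * rate (X s)) + (- C t \<omega>) - (- C s \<omega>)) = X s + ?I - min b (X s + h * rate (X s))"
    using inc(5) by simp
  show ?thesis
  proof (cases "N t \<omega> = N s \<omega>")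
    case True
    have c: "C t \<omega> = C s \<omega>" using True by (simp add: claims_def)
    have "\<bar>X s + ?I - min b (X s + h * rate (X s))\<bar> \<le> \<bar>?J - h * rate (X s)\<bar>"
    proof (cases "X t < b")
      case lt: True
      have "?I = ?J" using barrier_claimless[OF st(1,2) c lt] inc(4,8) by simp
      then show ?thesis using lt inc(5) c by auto
    next
      case False
      then have "X t = b" using barrier_le[of t] st by auto
      then have "X s + ?I = b" using inc(5) c by simp
      moreover have "?I \<le> ?J" using inc(7,8) by simp
      ultimately show ?thesis by (auto simp: min_def)
    qed
    then show ?thesis unfolding eq using True by simp
  next
    case False
    then have "1 \<le> real (N t \<omega>) - real (N s \<omega>)" using Nm by linarith
    then have "top_rate x T * h * 1 \<le> top_rate x T * h * (real (N t \<omega>) - real (N s \<omega>))"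
      using top h by (intro mult_left_mono) auto
    moreover have "0 \<le> ?I" "?I \<le> top_rate x T * h" using inc(6,7,8) J by auto
    moreover have "0 \<le> min b (X s + h * rate (X s)) - X s" "min b (X s + h * rate (X s)) - X s \<le> top_rate x T * h"
    proof -
      have "X s \<le> reach x T" using flow_le_reach[OF barrier_flow(1) f_le x] st by auto
      then have "h * rate (X s) \<le> top_rate x T * h" using mult_left_mono[OF rate_le_top_rate[OF x st(4)] h] by (simp add: mult.commute)
      moreover have "0 \<le> h * rate (X s)" using h rate_pos[of "X s"] by simp
      ultimately show "0 \<le> min b (X s + h * rate (X s)) - X s" "min b (X s + h * rate (X s)) - X s \<le> top_rate x T * h"
        using barrier_le[OF st(1)] by auto
    qed
    ultimately show ?thesis unfolding eq by linarith
  qed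
qed

lemma barrier_euler:
  assumes t: "0 \<le> t"
  shows "(\<lambda>n. euler (\<lambda>z. min b (z + t / real n * rate z)) (\<lambda>s. min x b - C s \<omega>) (t / real n) n) \<longlonglongrightarrow> X t"
proof (rule tendsto_if_error_le_inverse)
  let ?C1 = "t * (rate_lip * (top_rate x t * t + (f 0 - f t)))" and ?C2 = "top_rate x t * t * real (N t \<omega>)"
  fix n :: nat assume n: "0 < n"
  define h where "h = t / real n"
  have nh: "real n * h = t" "0 \<le> h" using n t by (auto simp: h_def)
  define r where "r i = \<bar>integral {real i * h..real (Suc i) * h} (\<lambda>r. rate (X r)) - h * rate (X (real i * h))\<bar>
     + top_rate x t * h * (real (N (real (Suc i) * h) \<omega>) - real (N (real i * h) \<omega>))" for i
  have "\<bar>X (real n * h) - euler (\<lambda>z. min b (z + h * rate z)) (\<lambda>s. min x b - C s \<omega>) h n\<bar> \<le> (1 + rate_lip * h) ^ n * (\<Sum>i<n. r i)"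
  proof (rule euler_error)
    show "\<bar>min b (u + h * rate u) - min b (v + h * rate v)\<bar> \<le> (1 + rate_lip * h) * \<bar>u - v\<bar>" for u v
    proof -
      have "h * \<bar>rate u - rate v\<bar> = \<bar>h * (rate u - rate v)\<bar>" using nh by (simp add: abs_mult)
      moreover have "h * \<bar>rate u - rate v\<bar> \<le> h * (rate_lip * \<bar>u - v\<bar>)" using rate_lipschitz(2) nh by (intro mult_left_mono) auto
      moreover have "\<bar>min b (u + h * rate u) - min b (v + h * rate v)\<bar> \<le> \<bar>(u - v) + h * (rate u - rate v)\<bar>"
        by (auto simp: min_def algebra_simps)
      moreover have "\<bar>(u - v) + h * (rate u - rate v)\<bar> \<le> \<bar>u - v\<bar> + \<bar>h * (rate u - rate v)\<bar>" by (rule abs_triangle_ineq)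
      ultimately have "\<bar>min b (u + h * rate u) - min b (v + h * rate v)\<bar> \<le> \<bar>u - v\<bar> + h * (rate_lip * \<bar>u - v\<bar>)" by linarith
      then show ?thesis by (simp add: algebra_simps)
    qed
    show "0 \<le> rate_lip * h" using rate_lipschitz(1) nh by simp
    show "X 0 = min x b - C 0 \<omega>" using barrier_start(2) good_path_claims(1)[OF good] by simp
    fix i assume i: "i < n"
    have "real (Suc i) * h \<le> real n * h" using i nh by (intro mult_right_mono) auto
    then show "\<bar>X (real (Suc i) * h) - (min b (X (real i * h) + h * rate (X (real i * h))) + (min x b - C (real (Suc i) * h) \<omega>) - (min x b - C (real i * h) \<omega>))\<bar> \<le> r i"
      using barrier_euler_error[OF nh(2), of i t] nh unfolding r_def by (simp del: of_nat_Suc)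
  qed
  also have "\<dots> \<le> exp (rate_lip * t) * (h * (rate_lip * (top_rate x t * t + (f 0 - f t))) + top_rate x t * h * real (N t \<omega>))"
  proof (rule mult_mono)
    show "(1 + rate_lip * h) ^ n \<le> exp (rate_lip * t)"
    proof -
      have "real n * (rate_lip * h) = rate_lip * t" unfolding nh(1)[symmetric] by simp
      then show ?thesis using one_plus_power_le_exp[of "rate_lip * h" n] mult_nonneg_nonneg[OF less_imp_le[OF rate_lipschitz(1)] nh(2)] by (simp only:)
    qed
    have "(\<Sum>i<n. real (N (real (Suc i) * h) \<omega>) - real (N (real i * h) \<omega>)) = real (N (real n * h) \<omega>) - real (N (real 0 * h) \<omega>)"
      by (rule sum_lessThan_telescope)
    then have s: "(\<Sum>i<n. real (N (real (Suc i) * h) \<omega>) - real (N (real i * h) \<omega>)) = real (N t \<omega>)"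
      using nh good by (simp add: good_path_def)
    have "(\<Sum>i<n. r i) = (\<Sum>i<n. \<bar>integral {real i * h..real (Suc i) * h} (\<lambda>r. rate (X r)) - h * rate (X (real i * h))\<bar>)
       + top_rate x t * h * real (N t \<omega>)"
      unfolding r_def sum.distrib sum_distrib_left[symmetric] s ..
    then show "(\<Sum>i<n. r i) \<le> h * (rate_lip * (top_rate x t * t + (f 0 - f t))) + top_rate x t * h * real (N t \<omega>)"
      using flow_total_error[OF barrier_flow(1) f_le x barrier_flow(2) nh(2), of n t] nh by simp
    show "0 \<le> (\<Sum>i<n. r i)"
    proof (rule sum_nonneg)
      fix i
      have "N (real i * h) \<omega> \<le> N (real (Suc i) * h) \<omega>" using nh by (intro good_path_N_mono[OF good]) (auto intro: mult_right_mono)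
      then show "0 \<le> r i" unfolding r_def using top_rate_pos[OF x t] nh by (intro add_nonneg_nonneg mult_nonneg_nonneg) auto
    qed
  qed simp
  also have "\<dots> = exp (rate_lip * t) * (?C1 + ?C2) / real n"
  proof -
    have "h * a + q * h * c = (t * a + q * t * c) / real n" for a q c by (simp add: h_def add_divide_distrib)
    then show ?thesis by (simp only: times_divide_eq_right)
  qed
  finally show "\<bar>euler (\<lambda>z. min b (z + t / real n * rate z)) (\<lambda>s. min x b - C s \<omega>) (t / real n) n - X t\<bar> \<le> exp (rate_lip * t) * (?C1 + ?C2) / real n"
    using nh by (simp add: h_def abs_minus_commute)
qed

text \<open>The constraint includes the ruin time. At positive times the jump is 0, while the left
  limit is nonnegative because the surplus was nonnegative before; at time 0 the jump
  \<open>max 0 (x - b)\<close> is at most \<open>x\<close>.\<close>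

lemma barrier_admissible_jump:
  assumes t: "0 \<le> t" "ereal t \<le> ruin_time X"
  shows "jump (\<lambda>t. D t \<omega>) t \<le> left_limit X t"
proof (cases "t = 0")
  case True
  have ev: "\<forall>\<^sub>F t in at_left (0::real). t < 0" by (simp add: eventually_at_filter)
  have "left_limit X 0 = x"
    by (rule left_limit_eqI, rule tendsto_eventually) (use ev barrier_flow(5) in \<open>auto elim: eventually_mono\<close>)
  then show ?thesis using True barrier_jump[of 0] x b_pos by auto
next
  case False
  then have t0: "0 < t" using t by simp
  obtain l lc where l: "(X \<longlongrightarrow> l) (at_left t)" "lc \<le> C t \<omega>" "X t = l - (C t \<omega> - lc) - jump (\<lambda>t. D t \<omega>) t"
    using barrier_left_limit[OF t0] .
  have nonneg: "0 \<le> X u" if "0 < u" "u < t" for u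
  proof (rule ccontr)
    assume "\<not> 0 \<le> X u"
    then have "ruin_time X \<le> ereal u" unfolding ruin_time_def using that by (intro Inf_lower) auto
    then have "ereal t \<le> ereal u" using t(2) by (rule order_trans[rotated])
    then show False using that by simp
  qed
  have "\<forall>\<^sub>F u in at_left t. 0 < u \<and> u < t" by (rule eventually_mono[OF eventually_at_left_real[OF t0]]) simp
  then have "\<forall>\<^sub>F u in at_left t. 0 \<le> X u" by eventually_elim (use nonneg in auto)
  then have "0 \<le> l" by (intro tendsto_lowerbound[OF l(1)]) auto
  then show ?thesis using barrier_no_jump[OF t0] left_limit_eqI[OF l(1)] by simp
qed

end

text \<open>The feedback equations determine the surplus from the claims alone, as the limit of
  Euler schemes capped at \<open>b\<close>, so the surplus is adapted. The surplus equation is then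
  solved for \<open>D\<close>, with the premium integral obtained as a limit of Riemann
  sums.\<close>

lemma barrier_strategy_adapted:
  assumes D: "is_barrier_strategy M N Y g b x D" and x: "0 \<le> x" and t: "0 \<le> t"
  shows "D t \<in> borel_measurable (F t)"
proof -
  have AE: "AE \<omega> in M. good_path \<omega> \<and> barrier_path D x \<omega>"
    using D AE_good_path by (auto simp: is_barrier_strategy_iff)
  have X_F: "(\<lambda>\<omega>. surplus g N Y x D \<omega> s) \<in> borel_measurable (F s)" if s: "0 \<le> s" for s
  proof (rule euler_limit_measurable[OF _ _ s])
    show "(\<lambda>z. min b (z + s / real n * rate z)) \<in> borel_measurable borel" for n by measurable
    show "(\<lambda>\<omega>. min x b - C u \<omega>) \<in> borel_measurable (F u)" if "0 \<le> u" for u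
      using claims_adapted[OF that] by measurable
    show "AE \<omega> in M. (\<lambda>n. euler (\<lambda>z. min b (z + s / real n * rate z)) (\<lambda>u. min x b - C u \<omega>) (s / real n) n) \<longlonglongrightarrow> surplus g N Y x D \<omega> s"
      using AE by eventually_elim (use barrier_euler[OF _ _ x refl refl s] in auto)
  qed
  let ?S = "\<lambda>n \<omega>. \<Sum>i<n. t / real n * rate (surplus g N Y x D \<omega> (real i * (t / real n)))"
  have "?S n \<in> borel_measurable (F t)" for n
  proof (rule borel_measurable_sum)
    fix i assume i: "i \<in> {..<n}"
    then have "real i * t \<le> real n * t" using t by (intro mult_right_mono) auto
    then have le: "0 \<le> real i * (t / real n)" "real i * (t / real n) \<le> t" using i t by (auto simp: divide_le_eq mult.commute)
    have [measurable]: "(\<lambda>\<omega>. surplus g N Y x D \<omega> (real i * (t / real n))) \<in> borel_measurable (F t)"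
      by (rule F_measurable_mono[OF X_F[OF le(1)] le(2)])
    show "(\<lambda>\<omega>. t / real n * rate (surplus g N Y x D \<omega> (real i * (t / real n)))) \<in> borel_measurable (F t)" by measurable
  qed
  then have [measurable]: "(\<lambda>\<omega>. lim (\<lambda>n. ?S n \<omega>)) \<in> borel_measurable (F t)" by (rule borel_measurable_lim_metric)
  have [measurable]: "C t \<in> borel_measurable (F t)" by (rule claims_adapted[OF t])
  have [measurable]: "(\<lambda>\<omega>. surplus g N Y x D \<omega> t) \<in> borel_measurable (F t)" by (rule X_F[OF t])
  show ?thesis
  proof (rule measurable_F_AE_cong[OF t])
    show "(\<lambda>\<omega>. x + lim (\<lambda>n. ?S n \<omega>) - C t \<omega> - surplus g N Y x D \<omega> t) \<in> borel_measurable (F t)" by measurable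
    show "AE \<omega> in M. x + lim (\<lambda>n. ?S n \<omega>) - C t \<omega> - surplus g N Y x D \<omega> t = D t \<omega>"
      using AE
    proof eventually_elim
      fix \<omega> assume w: "good_path \<omega> \<and> barrier_path D x \<omega>"
      note p = controlled_path[where D=D and \<omega>=\<omega>, OF conjunct1[OF w] barrier_control[OF conjunct1[OF w] conjunct2[OF w] x refl refl] x]
      have "lim (\<lambda>n. ?S n \<omega>) = integral {0..t} (\<lambda>r. rate (surplus g N Y x D \<omega> r))"
        by (rule limI, rule riemann_flow[OF p(1,2) x p(3) t])
      then show "x + lim (\<lambda>n. ?S n \<omega>) - C t \<omega> - surplus g N Y x D \<omega> t = D t \<omega>"
        using flow_equationD(2)[OF p(1) t] by simp
    qed
  qed
qed

lemma barrier_strategy_admissible: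
  assumes D: "is_barrier_strategy M N Y g b x D" and x: "0 \<le> x"
  shows "D \<in> admissible M F N Y g x"
  unfolding admissible_def
proof (intro CollectI conjI allI impI)
  show "\<And>t. 0 \<le> t \<Longrightarrow> D t \<in> borel_measurable (F t)" by (rule barrier_strategy_adapted[OF D x])
  have "AE \<omega> in M. good_path \<omega> \<and> barrier_path D x \<omega>"
    using D AE_good_path by (auto simp: is_barrier_strategy_iff)
  then show "AE \<omega> in M. control_path (\<lambda>t. D t \<omega>) \<and>
        (\<forall>t\<ge>0. ereal t \<le> ruin_time (surplus g N Y x D \<omega>) \<longrightarrow>
           jump (\<lambda>t. D t \<omega>) t \<le> left_limit (surplus g N Y x D \<omega>) t)"
    by eventually_elim
       (use barrier_control[OF _ _ x refl refl] barrier_admissible_jump[OF _ _ x refl refl] in blast)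
qed

end

section \<open>Value of a barrier strategy\<close>

locale barrier_surplus = controlled_surplus M F N Y g lam alpha delta \<psi> b D x m
  for M :: "'a measure" and F :: "real \<Rightarrow> 'a measure" and N :: "real \<Rightarrow> 'a \<Rightarrow> nat" and Y :: "nat \<Rightarrow> 'a \<Rightarrow> real"
    and g :: "real \<Rightarrow> real" and lam alpha delta :: real and \<psi> :: "real \<Rightarrow> real" and b :: real
    and D :: "real \<Rightarrow> 'a \<Rightarrow> real" and x :: real and m :: nat +
  assumes barrier_strategy: "is_barrier_strategy M N Y g b x D"
begin

lemma AE_barrier_path: "AE \<omega> in M. regular \<omega> \<and> barrier_path D x \<omega>"
  using AE_regular barrier_strategy by (auto simp: is_barrier_strategy_iff)

context
  fixes \<omega>
  assumes w: "regular \<omega>" and bar: "barrier_path D x \<omega>"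
begin

lemma good: "good_path \<omega>" using w by (simp add: regular_def)

lemmas path_start = barrier_start[OF good bar x refl refl, unfolded X_path]
lemmas path_le = barrier_le[OF good bar x refl refl, unfolded X_path]
lemmas path_increments = barrier_increments[OF good bar x refl refl, unfolded X_path]
lemmas path_claimless = barrier_claimless[OF good bar x refl refl, unfolded X_path]
lemmas path_flow = regular_path[OF good barrier_control[OF good bar x refl refl]]

lemma Z_le_barrier: "0 \<le> h \<Longrightarrow> Z h i \<omega> \<le> b"
  using path_le[of "real i * h"] b_pos by (auto simp: Z_def)

lemma cell_dividend_le:
  assumes h: "0 < h" and i: "real (Suc i) * h \<le> real m"
  shows "D (real (Suc i) * h) \<omega> - D (real i * h) \<omega> \<le> max_rate * h"
proof -
  have st: "0 \<le> real i * h" "real i * h \<le> real (Suc i) * h" using h by (auto intro: mult_right_mono)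
  note inc = path_increments[OF st]
  have "integral {real i * h..real (Suc i) * h} (\<lambda>r. rate (X r \<omega>)) \<le> max_rate * h"
    using regular_cell(1,3)[OF w h i] by simp
  then show ?thesis using inc(4,6,8) by simp
qed

text \<open>Reverses \<open>upper_step\<close>. Without a claim, dividends flow only if the cell
  ends at \<open>b\<close>, where \<Phi> has slope 1 and nothing is lost. With a claim the dividends
  of the cell cost at most \<open>c * max_rate * h\<close>, which is charged to
  \<open>claim_cell\<close>. If ruin occurs although the prediction is nonnegative, the claim has
  hit the window around 0.\<close>

lemma lower_step:
  assumes lip: "1 \<le> c" "\<And>u v. 0 \<le> u \<Longrightarrow> u \<le> R + max_rate \<Longrightarrow> 0 \<le> v \<Longrightarrow> v \<le> R + max_rate \<Longrightarrow> \<bar>\<Phi> u - \<Phi> v\<bar> \<le> c * \<bar>u - v\<bar>"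
    and h: "0 < h" "h \<le> 1" and i: "real (Suc i) * h \<le> real m"
  shows "indicator {0..} (Z h i \<omega>) * \<Phi> (Z h i \<omega> + h * g (Z h i \<omega>) - \<Delta>C h i \<omega>)
    \<le> \<Phi> (Z h (Suc i) \<omega>) + paid h i \<omega>
     + (c * (1 + max_rate) + value_bound) * (local_error h i \<omega> + hit h i \<omega> + h * claim_cell h i \<omega>)"
proof -
  \<comment> \<open>Large enough for each of the three error coefficients: \<open>c\<close> for the
    local error, \<open>value_bound\<close> for a hit, \<open>c * max_rate\<close> for a cell with a
    claim.\<close>
  define K where "K = c * (1 + max_rate) + value_bound"
  note rc = regular_cell[OF w h(1) i]
  have K: "c \<le> K" "value_bound \<le> K" "c * max_rate \<le> K"
    using lip(1) value_bound_nonneg max_rate_pos by (auto simp: K_def algebra_simps)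
  have nn: "0 \<le> local_error h i \<omega>" "0 \<le> hit h i \<omega>" "0 \<le> h * claim_cell h i \<omega>" "0 \<le> paid h i \<omega>"
    using local_error_nonneg h paid_bounds(1)[OF w h i] by (auto simp: hit_def claim_cell_def)
  have K0: "0 \<le> K" using K(1) lip(1) by linarith
  have err: "c * local_error h i \<omega> + value_bound * hit h i \<omega> + c * max_rate * (h * claim_cell h i \<omega>)
    \<le> K * (local_error h i \<omega> + hit h i \<omega> + h * claim_cell h i \<omega>)"
    unfolding distrib_left using K nn by (intro add_mono mult_right_mono) auto
  have err0: "0 \<le> K * (local_error h i \<omega> + hit h i \<omega> + h * claim_cell h i \<omega>)"
    by (rule mult_nonneg_nonneg[OF K0]) (use nn in auto)
  show ?thesis
  proof (cases "survive h i \<omega>")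
    case False
    then show ?thesis using err0 nn barrier_nonneg[of "Z h (Suc i) \<omega>"] by (simp add: K_def Z_def del: of_nat_Suc)
  next
    case True
    have Xi: "0 \<le> X (real i * h) \<omega>" using True by (auto simp: survive_def)
    have Zi: "Z h i \<omega> = X (real i * h) \<omega>" using True rc(8) by (simp add: Z_def)
    define dD where "dD = D (real (Suc i) * h) \<omega> - D (real i * h) \<omega>"
    define a where "a = X (real i * h) \<omega> + h * rate (X (real i * h) \<omega>) - \<Delta>C h i \<omega>"
    define u where "u = X (real (Suc i) * h) \<omega> + dD"
    have ti: "real i * h + h = real (Suc i) * h" by (simp add: algebra_simps)
    have st: "0 \<le> real i * h" "real i * h \<le> real (Suc i) * h" using h by (auto intro: mult_right_mono)
    have dD: "0 \<le> dD" "dD \<le> max_rate * h" using rc(5) cell_dividend_le[OF h(1) i] by (auto simp: dD_def)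
    have th: "max_rate * h \<le> max_rate" using h max_rate_pos by simp
    have uR: "u \<le> R + max_rate" using rc(3,4,8) th by (simp add: u_def dD_def del: of_nat_Suc)
    have ua: "\<bar>u - a\<bar> = local_error h i \<omega>" by (simp add: u_def a_def local_error_def dD_def del: of_nat_Suc)
    have "h * rate (X (real i * h) \<omega>) \<le> 1 * max_rate"
      using rate_le_max_rate[OF rc(8)] rate_pos[of "X (real i * h) \<omega>"] h by (intro mult_mono) auto
    then have aR: "a \<le> R + max_rate" using rc(4,8) by (simp add: a_def)
    have lhs: "indicator {0..} (Z h i \<omega>) * \<Phi> (Z h i \<omega> + h * g (Z h i \<omega>) - \<Delta>C h i \<omega>) = \<Phi> a"
      using Xi by (simp add: Zi a_def rate_def)
    have claimless: "C (real (Suc i) * h) \<omega> = C (real i * h) \<omega>" if "\<Delta>C h i \<omega> = 0"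
      using that by (simp add: \<Delta>C_def ti del: of_nat_Suc)
    show ?thesis
    proof (cases "0 \<le> X (real (Suc i) * h) \<omega>")
      case X': True
      have sv: "survive h (Suc i) \<omega>"
        using True X' by (auto simp: survive_def le_Suc_eq simp del: of_nat_Suc)
      have Z': "Z h (Suc i) \<omega> = X (real (Suc i) * h) \<omega>" and p: "paid h i \<omega> = dD"
        using sv rc(9) by (simp_all add: Z_def paid_def dD_def del: of_nat_Suc)
      have u0: "0 \<le> u" using X' dD by (simp add: u_def)
      have 1: "\<Phi> a \<le> \<Phi> u + c * local_error h i \<omega>"
      proof (cases "0 \<le> a")
        case a: True
        then show ?thesis using lip(2)[OF a aR u0 uR] ua by (simp add: abs_minus_commute)
      next
        case False
        then show ?thesis using barrier_nonneg[of u] lip(1) nn(1) by (simp add: barrier_neg)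
      qed
      have 2: "\<Phi> u \<le> \<Phi> (X (real (Suc i) * h) \<omega>) + dD + c * max_rate * (h * claim_cell h i \<omega>)"
      proof (cases "\<Delta>C h i \<omega> = 0")
        case c0: True
        have "\<Phi> u = \<Phi> (X (real (Suc i) * h) \<omega>) + dD"
        proof (cases "X (real (Suc i) * h) \<omega> < b")
          case True
          then have "dD = 0" using path_claimless[OF st claimless[OF c0]] by (simp add: dD_def)
          then show ?thesis by (simp add: u_def)
        next
          case False
          then have "X (real (Suc i) * h) \<omega> = b" using path_le[of "real (Suc i) * h"] st by simp
          then show ?thesis using barrier_high[of u] dD by (simp add: u_def)
        qed
        then show ?thesis using c0 by (simp add: claim_cell_def)
      next
        case False
        have "\<bar>\<Phi> u - \<Phi> (X (real (Suc i) * h) \<omega>)\<bar> \<le> c * \<bar>u - X (real (Suc i) * h) \<omega>\<bar>"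
          using lip(2)[OF u0 uR X'] rc(9) max_rate_pos by simp
        also have "\<dots> \<le> c * (max_rate * h)" using dD lip(1) by (intro mult_left_mono) (auto simp: u_def)
        finally show ?thesis using False dD by (simp add: claim_cell_def mult.assoc)
      qed
      have "value_bound * hit h i \<omega> \<ge> 0" using value_bound_nonneg nn by simp
      then show ?thesis unfolding lhs Z' p K_def[symmetric] using 1 2 err by linarith
    next
      case X': False
      have "\<not> survive h (Suc i) \<omega>" using X' by (auto simp: survive_def simp del: of_nat_Suc)
      then have Z': "\<Phi> (Z h (Suc i) \<omega>) = 0" and p: "paid h i \<omega> = 0" by (simp_all add: Z_def paid_def barrier_neg)
      have "\<Phi> a \<le> value_bound * hit h i \<omega>"
      proof (cases "0 \<le> a")
        case a: True
        have "\<Delta>C h i \<omega> \<noteq> 0"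
        proof
          assume "\<Delta>C h i \<omega> = 0"
          then have "X (real i * h) \<omega> \<le> X (real (Suc i) * h) \<omega>" using path_increments(5,6)[OF st] claimless by simp
          then show False using X' Xi by simp
        qed
        moreover have "\<bar>\<Delta>C h i \<omega> - (X (real i * h) \<omega> + h * rate (X (real i * h) \<omega>))\<bar> = \<bar>a\<bar>" by (simp add: a_def abs_minus_commute)
        moreover have "\<bar>a\<bar> \<le> 2 * max_rate * h" using a X' dD ua rc(7) by (auto simp: u_def abs_if split: if_splits)
        ultimately have "hit h i \<omega> = 1" by (simp add: hit_def Zi)
        then show ?thesis using barrier_mono[OF aR] by (simp add: value_bound_def)
      next
        case False
        then show ?thesis using value_bound_nonneg nn(2) by (simp add: barrier_neg)
      qed
      moreover have "0 \<le> c * local_error h i \<omega>" "0 \<le> c * max_rate * (h * claim_cell h i \<omega>)"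
        using lip(1) nn max_rate_pos by auto
      ultimately show ?thesis unfolding lhs Z' p K_def[symmetric] using err by linarith
    qed
  qed
qed

text \<open>A negative surplus recovers at speed at most \<open>max_rate\<close>, hence stays
  negative for a while. On a fine grid some grid point falls into that time and before
  \<open>u\<close>, so ruin is noticed by the end of the cell of \<open>u\<close>.\<close>

lemma ruin_grid:
  assumes s: "0 \<le> s" "s < u" "X s \<omega> < 0" and um: "u \<le> real m"
  shows "\<forall>\<^sub>F n in sequentially. step_weight n u \<omega> = 0"
proof -
  define \<eta> where "\<eta> = min (- X s \<omega> / max_rate) (u - s)"
  have \<eta>: "0 < \<eta>" using s max_rate_pos by (simp add: \<eta>_def divide_neg_pos)
  have "(\<lambda>n. 1 / real n) \<longlonglongrightarrow> 0" by (rule lim_const_over_n)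
  then have "\<forall>\<^sub>F n in sequentially. 1 / real n < \<eta>" by (rule order_tendstoD(2)) (rule \<eta>)
  with eventually_gt_at_top[of "0::nat"] show ?thesis
  proof eventually_elim
    fix n :: nat assume n: "0 < n" and n\<eta>: "1 / real n < \<eta>"
    obtain k where k: "real k / real n < u" "u \<le> real (Suc k) / real n"
      "step_weight n u \<omega> = (if k < n * m \<and> survive (1 / real n) (Suc k) \<omega> then exp (- delta * (real (Suc k) / real n)) else 0)"
      using step_weight_eq[OF n order_le_less_trans[OF s(1,2)]] .
    define j where "j = nat \<lceil>s * real n\<rceil>"
    have sn: "0 \<le> s * real n" using s n by simp
    have j: "s * real n \<le> real j" "real j < s * real n + 1" using sn unfolding j_def by linarith+
    have js: "s \<le> real j * (1 / real n)" "real j * (1 / real n) < s + 1 / real n"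
      using j n by (simp_all add: field_simps)
    have "s < real (Suc k) / real n" using s(2) k(2) by linarith
    then have "s * real n < real (Suc k)" using n by (simp add: less_divide_eq del: of_nat_Suc)
    then have jk: "j \<le> Suc k" unfolding j_def by linarith
    have "real j * (1 / real n) \<le> real m" using js(2) n\<eta> um by (simp add: \<eta>_def)
    then have "X (real j * (1 / real n)) \<omega> \<le> X s \<omega> + max_rate * (real j * (1 / real n) - s)"
      using flow_increment_bounds(2,3)[OF path_flow(1,4) x s(1) js(1), of "real m"] good_path_claims(2)[OF good]
        path_flow(2) s(1) js(1)
      by (force simp: max_rate_def monotone_on_def)
    also have "\<dots> < X s \<omega> + max_rate * \<eta>"
      using js(2) n\<eta> max_rate_pos by (intro add_strict_left_mono mult_strict_left_mono) auto
    also have "\<dots> \<le> 0" using max_rate_pos by (simp add: \<eta>_def min_def field_simps)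
    finally have "\<not> survive (1 / real n) (Suc k) \<omega>" using jk by (auto simp: survive_def)
    then show "step_weight n u \<omega> = 0" using k(3) by simp
  qed
qed

section \<open>The dividend measure of a barrier path and the limit of the grid sums\<close>

lemma step_weight_le:
  shows "step_weight n u \<omega> \<le> indicator {0<..real m} u" "0 < n \<Longrightarrow> step_weight n u \<omega> \<le> exp (- delta * u)"
proof -
  have "step_weight n u \<omega> \<le> indicator {0<..real m} u \<and> (0 < n \<longrightarrow> step_weight n u \<omega> \<le> exp (- delta * u))"
  proof (cases "n = 0 \<or> u \<le> 0")
    case True
    then show ?thesis using step_weight_outside[of n u \<omega>] by (cases "n = 0") (auto simp: step_weight_def)
  next
    case False
    then have n: "0 < n" and u: "0 < u" by auto
    obtain k where k: "real k / real n < u" "u \<le> real (Suc k) / real n"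
      "step_weight n u \<omega> = (if k < n * m \<and> survive (1 / real n) (Suc k) \<omega> then exp (- delta * (real (Suc k) / real n)) else 0)"
      using step_weight_eq[OF n u] .
    have "u \<le> real m" if "k < n * m" using k(2) grid_le[OF n that] by simp
    moreover have "delta * u \<le> delta * (real (Suc k) / real n)" using k(2) delta_pos by (intro mult_left_mono) auto
    moreover have "0 \<le> delta * (real (Suc k) / real n)" using delta_pos by simp
    ultimately show ?thesis unfolding k(3) using u by (auto simp: indicator_def simp del: of_nat_Suc)
  qed
  then show "step_weight n u \<omega> \<le> indicator {0<..real m} u" "0 < n \<Longrightarrow> step_weight n u \<omega> \<le> exp (- delta * u)" by auto
qed

text \<open>After time 0 dividends accrue at a rate of at most \<open>max_rate\<close>, so shrinking
  left neighbourhoods of \<open>t\<close> have vanishing mass.\<close>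

lemma no_atom:
  assumes t: "0 < t" "t \<le> real m"
  shows "emeasure (interval_measure (\<lambda>t. D t \<omega>)) {t} = 0"
proof -
  have "emeasure (interval_measure (\<lambda>t. D t \<omega>)) {t} \<le> ennreal (max_rate * t / real n)" if n: "0 < n" for n
  proof -
    let ?a = "t - t / real n"
    have a: "0 \<le> ?a" "?a < t" using t n by (auto simp: divide_le_eq)
    have "emeasure (interval_measure (\<lambda>t. D t \<omega>)) {t} \<le> emeasure (interval_measure (\<lambda>t. D t \<omega>)) {?a<..t}"
      by (rule emeasure_mono) (use a in auto)
    also have "\<dots> = ennreal (D t \<omega> - D ?a \<omega>)" by (rule emeasure_dividend_Ioc[OF w]) (use a in simp)
    also have "\<dots> \<le> ennreal (max_rate * t / real n)"
    proof (rule ennreal_leI)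
      have "D t \<omega> - D ?a \<omega> \<le> integral {?a..t} (\<lambda>r. rate (X r \<omega>))"
        using path_increments(4,6,8)[of ?a t] a by simp
      also have "\<dots> \<le> max_rate * (t - ?a)"
        unfolding max_rate_def by (rule flow_increment_bounds(2)[OF path_flow(1,4) x]) (use a t in auto)
      finally show "D t \<omega> - D ?a \<omega> \<le> max_rate * t / real n" by simp
    qed
    finally show ?thesis .
  qed
  moreover have "(\<lambda>n. ennreal (max_rate * t / real n)) \<longlonglongrightarrow> ennreal 0"
    by (intro tendsto_ennrealI lim_const_over_n)
  ultimately have "emeasure (interval_measure (\<lambda>t. D t \<omega>)) {t} \<le> ennreal 0"
    by (intro LIMSEQ_le_const) (auto intro!: exI[of _ 1])
  then show ?thesis by simp
qed

text \<open>The interval \<open>{-1<..0}\<close> carries the initial payment, and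
  \<open>{-1<..<0}\<close> is null because \<open>D\<close> vanishes there.\<close>

lemma start_atom: "emeasure (interval_measure (\<lambda>t. D t \<omega>)) {0} = ennreal (D 0 \<omega>)"
proof -
  let ?\<mu> = "interval_measure (\<lambda>t. D t \<omega>)"
  have neg: "t < 0 \<Longrightarrow> D t \<omega> = 0" for t
    using control_pathD(2)[of "\<lambda>t. D t \<omega>"] w by (simp add: regular_def)
  have "(\<Union>n. {-1<..- inverse (real (Suc n))}) \<in> null_sets ?\<mu>"
  proof (rule null_sets_UN)
    fix n
    have "- 1 \<le> - inverse (real (Suc n))" by (simp add: inverse_eq_divide)
    then have "emeasure ?\<mu> {-1<..- inverse (real (Suc n))} = 0"
      using emeasure_dividend_Ioc[OF w, of "-1" "- inverse (real (Suc n))"] neg by simp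
    then show "{-1<..- inverse (real (Suc n))} \<in> null_sets ?\<mu>" by auto
  qed
  also have "(\<Union>n. {-1<..- inverse (real (Suc n))}) = {-1<..<0::real}"
  proof (intro set_eqI iffI)
    fix t :: real assume t: "t \<in> {-1<..<0}"
    then obtain n where "inverse (real (Suc n)) < - t" using reals_Archimedean[of "- t"] by auto
    then show "t \<in> (\<Union>n. {-1<..- inverse (real (Suc n))})" using t by (intro UN_I[of n]) auto
  next
    fix t :: real assume "t \<in> (\<Union>n. {-1<..- inverse (real (Suc n))})"
    then obtain n where "-1 < t" "t \<le> - inverse (real (Suc n))" by auto
    moreover have "0 < inverse (real (Suc n))" by simp
    ultimately show "t \<in> {-1<..<0}" unfolding greaterThanLessThan_iff by linarith
  qed
  finally have null: "{-1<..<0::real} \<in> null_sets ?\<mu>" .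
  have "{-1<..0::real} = {0} \<union> {-1<..<0}" by auto
  then have "emeasure ?\<mu> {-1<..0} = emeasure ?\<mu> {0}"
    using emeasure_Un_null_set[OF _ null, of "{0}"] by simp
  then show ?thesis using emeasure_dividend_Ioc[OF w, of "-1" 0] neg[of "-1"] by simp
qed

text \<open>No claim occurs during some time after 0, and until then the surplus stays above its
  nonnegative starting value. Hence the initial payment falls before ruin.\<close>

lemma zero_alive: "0 \<in> alive \<omega>"
proof -
  obtain \<eta> where \<eta>: "0 < \<eta>" "\<And>s. 0 \<le> s \<Longrightarrow> s < 0 + \<eta> \<Longrightarrow> N s \<omega> = N 0 \<omega>"
    using good_path_right_const[OF good order_refl] by metis
  have "ereal \<eta> \<le> ruin_time (surplus g N Y x D \<omega>)"
    unfolding ruin_time_def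
  proof (rule Inf_greatest, clarify)
    fix s assume s: "0 \<le> s" "surplus g N Y x D \<omega> s < 0"
    show "ereal \<eta> \<le> ereal s"
    proof (rule ccontr)
      assume "\<not> ereal \<eta> \<le> ereal s"
      then have "C s \<omega> = C 0 \<omega>" using \<eta>(2)[of s] s by (simp add: claims_def)
      then have "X 0 \<omega> \<le> X s \<omega>" using path_increments(5,6)[of 0 s] s by simp
      then show False using path_start(2) x b_pos s(2) by (auto simp: X_def)
    qed
  qed
  then show ?thesis using \<eta>(1) unfolding alive_def by (auto intro: less_le_trans[of _ "ereal \<eta>"])
qed

text \<open>Reverse Fatou under the dividend measure, which is finite on
  \<open>{0<..real m}\<close>. Beyond ruin the weights are eventually 0 by \<open>ruin_grid\<close>;
  the ruin time itself escapes that argument but is null by \<open>no_atom\<close>.\<close>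

lemma limsup_total_paid:
  "limsup (\<lambda>n. ennreal (total_paid n \<omega>))
    \<le> (\<integral>\<^sup>+u. ennreal (exp (- delta * u)) * indicator (alive \<omega> \<inter> {0<..real m}) u \<partial>interval_measure (\<lambda>t. D t \<omega>))"
proof -
  let ?\<mu> = "interval_measure (\<lambda>t. D t \<omega>)" and ?\<tau> = "ruin_time (surplus g N Y x D \<omega>)"
  have "limsup (\<lambda>n. ennreal (total_paid n \<omega>)) = limsup (\<lambda>n. \<integral>\<^sup>+u. ennreal (step_weight n u \<omega>) \<partial>?\<mu>)"
    by (rule Limsup_eq, rule eventually_mono[OF eventually_gt_at_top[of "0::nat"]], rule total_paid_integral[OF w, symmetric])
  also have "\<dots> \<le> (\<integral>\<^sup>+u. limsup (\<lambda>n. ennreal (step_weight n u \<omega>)) \<partial>?\<mu>)"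
  proof (rule nn_integral_limsup[where w="indicator {0<..real m}"])
    show "AE u in ?\<mu>. ennreal (step_weight n u \<omega>) \<le> indicator {0<..real m} u" for n
      by (rule AE_I2, subst ennreal_indicator[symmetric], rule ennreal_leI, rule step_weight_le(1))
    show "(\<integral>\<^sup>+u. indicator {0<..real m} u \<partial>?\<mu>) < \<infinity>"
      using emeasure_dividend_Ioc[OF w, of 0 "real m"] by simp
  qed measurable
  also have "\<dots> \<le> (\<integral>\<^sup>+u. ennreal (exp (- delta * u)) * indicator (alive \<omega> \<inter> {0<..real m}) u \<partial>?\<mu>)"
  proof (rule nn_integral_mono_AE)
    have null: "{u. 0 < u \<and> u \<le> real m \<and> ereal u = ?\<tau>} \<in> null_sets ?\<mu>"
    proof (cases "\<exists>u. 0 < u \<and> u \<le> real m \<and> ereal u = ?\<tau>")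
      case True
      then obtain t where t: "0 < t" "t \<le> real m" "ereal t = ?\<tau>" by auto
      have "{u. 0 < u \<and> u \<le> real m \<and> ereal u = ?\<tau>} = {t}"
        unfolding t(3)[symmetric] using t(1,2) by auto
      then show ?thesis using no_atom[OF t(1,2)] by (simp only: null_setsI sets_interval_measure borel_singleton sets.empty_sets)
    next
      case False
      then have "{u. 0 < u \<and> u \<le> real m \<and> ereal u = ?\<tau>} = {}" by (intro equals0I) blast
      then show ?thesis by (simp only: null_setsI sets_interval_measure sets.empty_sets emeasure_empty)
    qed
    show "AE u in ?\<mu>. limsup (\<lambda>n. ennreal (step_weight n u \<omega>)) \<le> ennreal (exp (- delta * u)) * indicator (alive \<omega> \<inter> {0<..real m}) u"
      using AE_not_in[OF null]
    proof eventually_elim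
      fix u assume ne: "u \<notin> {u. 0 < u \<and> u \<le> real m \<and> ereal u = ?\<tau>}"
      show "limsup (\<lambda>n. ennreal (step_weight n u \<omega>)) \<le> ennreal (exp (- delta * u)) * indicator (alive \<omega> \<inter> {0<..real m}) u"
      proof (cases "u \<in> alive \<omega> \<inter> {0<..real m}")
        case True
        have "limsup (\<lambda>n. ennreal (step_weight n u \<omega>)) \<le> ennreal (exp (- delta * u))"
          by (rule Limsup_bounded, rule eventually_mono[OF eventually_gt_at_top[of "0::nat"]])
             (rule ennreal_leI[OF step_weight_le(2)])
        then show ?thesis using True by simp
      next
        case False
        have "\<forall>\<^sub>F n in sequentially. step_weight n u \<omega> = 0"
        proof (cases "u \<in> {0<..real m}")
          case u: True
          have "\<not> ereal u < ?\<tau>" using False u by (auto simp: alive_def)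
          moreover have "ereal u \<noteq> ?\<tau>" using ne u by auto
          ultimately have "?\<tau> < ereal u" by (simp add: not_less order.order_iff_strict)
          then obtain s where "0 \<le> s" "surplus g N Y x D \<omega> s < 0" "ereal s < ereal u"
            unfolding ruin_time_def by (auto simp: Inf_less_iff)
          then show ?thesis using ruin_grid[of s u] u by (simp add: X_def)
        next
          case False
          then have "step_weight n u \<omega> \<le> 0" for n using step_weight_le(1)[of n u] by (auto simp: indicator_def)
          then show ?thesis using step_weight_nonneg by (intro always_eventually allI antisym)
        qed
        then have "\<forall>\<^sub>F n in sequentially. ennreal (step_weight n u \<omega>) \<le> 0" by eventually_elim simp
        then have "limsup (\<lambda>n. ennreal (step_weight n u \<omega>)) \<le> 0" by (rule Limsup_bounded)
        then show ?thesis by simp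
      qed
    qed
  qed
  finally show ?thesis .
qed

lemma discounted_ge:
  "ennreal (max 0 (x - b)) + limsup (\<lambda>n. ennreal (total_paid n \<omega>))
    \<le> (\<integral>\<^sup>+t\<in>{t. t \<ge> 0 \<and> ereal t < ruin_time (surplus g N Y x D \<omega>)}. ennreal (exp (- delta * t)) \<partial>interval_measure (\<lambda>t. D t \<omega>))"
proof -
  let ?\<mu> = "interval_measure (\<lambda>t. D t \<omega>)"
  let ?I = "\<integral>\<^sup>+u. ennreal (exp (- delta * u)) * indicator (alive \<omega> \<inter> {0<..real m}) u \<partial>?\<mu>"
  have "ennreal (max 0 (x - b)) + limsup (\<lambda>n. ennreal (total_paid n \<omega>)) \<le> (\<integral>\<^sup>+u. indicator {0} u \<partial>?\<mu>) + ?I"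
    using limsup_total_paid start_atom path_start(1) by (simp add: add_left_mono)
  also have "\<dots> = (\<integral>\<^sup>+u. indicator {0} u + ennreal (exp (- delta * u)) * indicator (alive \<omega> \<inter> {0<..real m}) u \<partial>?\<mu>)"
    by (rule nn_integral_add[symmetric]) measurable
  also have "\<dots> \<le> (\<integral>\<^sup>+t. ennreal (exp (- delta * t)) * indicator (alive \<omega>) t \<partial>?\<mu>)"
    by (rule nn_integral_mono) (use zero_alive in \<open>auto simp: indicator_def\<close>)
  finally show ?thesis by (simp add: alive_def)
qed

lemma total_paid_le: "total_paid n \<omega> \<le> max_rate * real m"
proof (cases "n = 0")
  case False
  then have n: "0 < n" "0 < 1 / real n" "1 / real n \<le> 1" by auto
  have "total_paid n \<omega> \<le> (\<Sum>i<n * m. max_rate * (1 / real n))"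
    unfolding total_paid_def
  proof (rule sum_mono)
    fix i assume i: "i \<in> {..<n * m}"
    have gl: "real (Suc i) * (1 / real n) \<le> real m" using grid_le[OF n(1)] i by simp
    have "paid (1 / real n) i \<omega> \<le> max_rate * (1 / real n)"
      using cell_dividend_le[OF n(2) gl] max_rate_pos by (simp add: paid_def del: of_nat_Suc)
    moreover have "exp (- delta * (real (Suc i) * (1 / real n))) * paid (1 / real n) i \<omega> \<le> 1 * paid (1 / real n) i \<omega>"
      using paid_bounds(1)[OF w n(2,3) gl] delta_pos by (intro mult_right_mono) (auto simp: mult_nonneg_nonneg)
    ultimately show "exp (- delta * (real (Suc i) * (1 / real n))) * paid (1 / real n) i \<omega> \<le> max_rate * (1 / real n)" by linarith
  qed
  also have "\<dots> = max_rate * real m" using n(1) by simp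
  finally show ?thesis .
qed (use max_rate_pos in \<open>simp add: total_paid_def\<close>)

end

text \<open>Under the barrier \<open>Z\<close> stays at or below \<open>b\<close>, where the drift
  is 0, so the estimate holds with the opposite sign. The terminal term is at most
  \<open>exp (- delta * real m) * \<Phi> b\<close> and disappears as the horizon grows.\<close>

lemma lower_estimate:
  assumes e: "0 < e"
  shows "\<forall>\<^sub>F n in sequentially. \<Phi> (min x b) - exp (- delta * real m) * \<Phi> b - e \<le> expectation (total_paid n)"
proof -
  have "0 \<le> R + max_rate" using R_nonneg max_rate_pos by simp
  then obtain c where c: "1 \<le> c" "\<And>u v. 0 \<le> u \<Longrightarrow> u \<le> R + max_rate \<Longrightarrow> 0 \<le> v \<Longrightarrow> v \<le> R + max_rate \<Longrightarrow> \<bar>\<Phi> u - \<Phi> v\<bar> \<le> c * \<bar>u - v\<bar>"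
    using barrier_lipschitz by metis
  have start: "expectation (\<lambda>\<omega>. \<Phi> (Z 1 0 \<omega>)) = \<Phi> (min x b)"
  proof -
    have xR: "x \<le> R" unfolding R_def by (rule reach_ge[OF x]) simp
    have Z0: "AE \<omega> in M. \<Phi> (Z 1 0 \<omega>) = \<Phi> (min x b)"
      using AE_barrier_path
    proof eventually_elim
      fix \<omega> assume w: "regular \<omega> \<and> barrier_path D x \<omega>"
      show "\<Phi> (Z 1 0 \<omega>) = \<Phi> (min x b)"
        using path_start(2)[OF conjunct1[OF w] conjunct2[OF w]] x b_pos xR by (simp add: Z_def survive_def min_def)
    qed
    have "expectation (\<lambda>\<omega>. \<Phi> (Z 1 0 \<omega>)) = expectation (\<lambda>_. \<Phi> (min x b))"
      by (rule integral_cong_AE[OF _ _ Z0]) simp_all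
    then show ?thesis by (simp add: prob_space)
  qed
  have "\<forall>\<^sub>F n in sequentially. - 1 * (expectation (total_paid n) + exp (- delta * real m) * expectation (\<lambda>\<omega>. \<Phi> (Z (1 / real n) (n * m) \<omega>)))
     \<le> - 1 * expectation (\<lambda>\<omega>. \<Phi> (Z 1 0 \<omega>)) + e"
  proof (rule grid_sum_estimate[where K="c * (1 + max_rate) + value_bound"])
    show "0 \<le> c * (1 + max_rate) + value_bound" using c value_bound_nonneg max_rate_pos by simp
    fix h :: real and i :: nat assume h: "0 < h" "h \<le> 1" "real (Suc i) * h \<le> real m"
    show "AE \<omega> in M. - 1 * (\<Phi> (Z h (Suc i) \<omega>) + paid h i \<omega>)
        \<le> - 1 * (indicator {0..} (Z h i \<omega>) * \<Phi> (Z h i \<omega> + h * g (Z h i \<omega>) - \<Delta>C h i \<omega>))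
          + (c * (1 + max_rate) + value_bound) * (local_error h i \<omega> + hit h i \<omega> + h * claim_cell h i \<omega>)"
      using AE_barrier_path
    proof eventually_elim
      fix \<omega> assume "regular \<omega> \<and> barrier_path D x \<omega>"
      then show "- 1 * (\<Phi> (Z h (Suc i) \<omega>) + paid h i \<omega>)
        \<le> - 1 * (indicator {0..} (Z h i \<omega>) * \<Phi> (Z h i \<omega> + h * g (Z h i \<omega>) - \<Delta>C h i \<omega>))
          + (c * (1 + max_rate) + value_bound) * (local_error h i \<omega> + hit h i \<omega> + h * claim_cell h i \<omega>)"
        using lower_step[OF _ _ c h, of \<omega>] by simp
    qed
  next
    fix h :: real and i :: nat assume h: "0 < h"
    show "AE \<omega> in M. - 1 * (indicator {0..} (Z h i \<omega>) * drift (Z h i \<omega>)) \<le> 0"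
      using AE_barrier_path
    proof eventually_elim
      fix \<omega> assume w: "regular \<omega> \<and> barrier_path D x \<omega>"
      have "Z h i \<omega> \<le> b" by (rule Z_le_barrier[OF conjunct1[OF w] conjunct2[OF w]]) (use h in simp)
      then show "- 1 * (indicator {0..} (Z h i \<omega>) * drift (Z h i \<omega>)) \<le> 0"
        using drift_low[of "Z h i \<omega>"] by (simp add: indicator_def)
    qed
  qed (use e in auto)
  then show ?thesis
    using eventually_gt_at_top[of "0::nat"]
  proof eventually_elim
    fix n :: nat
    assume le: "- 1 * (expectation (total_paid n) + exp (- delta * real m) * expectation (\<lambda>\<omega>. \<Phi> (Z (1 / real n) (n * m) \<omega>)))
     \<le> - 1 * expectation (\<lambda>\<omega>. \<Phi> (Z 1 0 \<omega>)) + e"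
    have \<Phi>b: "\<bar>\<Phi> (Z (1 / real n) (n * m) \<omega>)\<bar> \<le> \<Phi> R" for \<omega> using barrier_mono[OF Z_le] barrier_nonneg by simp
    have "expectation (\<lambda>\<omega>. \<Phi> (Z (1 / real n) (n * m) \<omega>)) \<le> expectation (\<lambda>_. \<Phi> b)"
    proof (rule integral_mono_AE)
      show "integrable M (\<lambda>\<omega>. \<Phi> (Z (1 / real n) (n * m) \<omega>))" by (rule bounded_integrable[OF _ \<Phi>b]) simp
      show "AE \<omega> in M. \<Phi> (Z (1 / real n) (n * m) \<omega>) \<le> \<Phi> b"
        using AE_barrier_path by eventually_elim (rule barrier_mono, rule Z_le_barrier, erule conjunct1, erule conjunct2, simp)
    qed simp
    then have q: "exp (- delta * real m) * expectation (\<lambda>\<omega>. \<Phi> (Z (1 / real n) (n * m) \<omega>)) \<le> exp (- delta * real m) * \<Phi> b"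
      by (intro mult_left_mono) (auto simp: prob_space)
    show "\<Phi> (min x b) - exp (- delta * real m) * \<Phi> b - e \<le> expectation (total_paid n)"
    proof -
      have "- 1 * (p + q) \<le> - 1 * r + e \<Longrightarrow> q \<le> s \<Longrightarrow> r - s - e \<le> p" for p q r s :: real by simp
      from this[OF le[unfolded start] q] show ?thesis .
    qed
  qed
qed

lemma barrier_value_ge:
  "ennreal (\<Phi> x - exp (- delta * real m) * \<Phi> b) \<le> dividend_value M N Y g delta x D"
proof -
  define c where "c = max 0 (x - b)"
  define A where "A = \<Phi> (min x b) - exp (- delta * real m) * \<Phi> b"
  have \<Phi>x: "\<Phi> x = c + \<Phi> (min x b)" using barrier_high[of x] by (auto simp: c_def min_def)
  have "ennreal A \<le> limsup (\<lambda>n. \<integral>\<^sup>+\<omega>. ennreal (total_paid n \<omega>) \<partial>M)"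
  proof (rule ennreal_le_epsilon)
    fix e :: real assume e: "0 < e"
    have "ennreal (A - e) \<le> liminf (\<lambda>n. \<integral>\<^sup>+\<omega>. ennreal (total_paid n \<omega>) \<partial>M)"
    proof (rule Liminf_bounded)
      show "\<forall>\<^sub>F n in sequentially. ennreal (A - e) \<le> (\<integral>\<^sup>+\<omega>. ennreal (total_paid n \<omega>) \<partial>M)"
        using lower_estimate[OF e] eventually_gt_at_top[of "0::nat"]
        by eventually_elim (simp add: nn_integral_eq_integral[OF total_paid_integrable total_paid_nonneg] ennreal_leI A_def)
    qed
    also have "\<dots> \<le> limsup (\<lambda>n. \<integral>\<^sup>+\<omega>. ennreal (total_paid n \<omega>) \<partial>M)" by (rule Liminf_le_Limsup) simp
    finally have le: "ennreal (A - e) \<le> limsup (\<lambda>n. \<integral>\<^sup>+\<omega>. ennreal (total_paid n \<omega>) \<partial>M)" .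
    \<comment> \<open>Since \<open>ennreal\<close> cuts negative numbers off at 0, the case that
      \<open>A - e\<close> is negative has to be separated.\<close>
    have "ennreal A \<le> ennreal (A - e) + ennreal e"
      by (cases "0 \<le> A - e") (use e in \<open>auto simp: ennreal_plus[symmetric] ennreal_neg intro!: ennreal_leI simp del: ennreal_plus\<close>)
    also have "\<dots> \<le> limsup (\<lambda>n. \<integral>\<^sup>+\<omega>. ennreal (total_paid n \<omega>) \<partial>M) + ennreal e" using le by (rule add_right_mono)
    finally show "ennreal A \<le> limsup (\<lambda>n. \<integral>\<^sup>+\<omega>. ennreal (total_paid n \<omega>) \<partial>M) + ennreal e" .
  qed
  also have "\<dots> \<le> (\<integral>\<^sup>+\<omega>. limsup (\<lambda>n. ennreal (total_paid n \<omega>)) \<partial>M)"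
  proof (rule nn_integral_limsup[where w="\<lambda>_. ennreal (max_rate * real m)"])
    show "AE \<omega> in M. ennreal (total_paid n \<omega>) \<le> ennreal (max_rate * real m)" for n
      using AE_barrier_path by eventually_elim (rule ennreal_leI, rule total_paid_le, erule conjunct1, erule conjunct2)
    show "(\<integral>\<^sup>+\<omega>. ennreal (max_rate * real m) \<partial>M) < \<infinity>" by (simp add: emeasure_space_1)
  qed measurable
  finally have 1: "ennreal A \<le> (\<integral>\<^sup>+\<omega>. limsup (\<lambda>n. ennreal (total_paid n \<omega>)) \<partial>M)" .
  have "ennreal (\<Phi> x - exp (- delta * real m) * \<Phi> b) = ennreal (c + A)" unfolding \<Phi>x A_def by (simp only: add_diff_eq)
  also have "\<dots> \<le> ennreal c + ennreal A"
  proof (cases "0 \<le> A")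
    case True
    then show ?thesis by (simp add: ennreal_plus c_def)
  next
    case False
    then have "ennreal (c + A) \<le> ennreal c" by (intro ennreal_leI) simp
    then show ?thesis using False by (simp add: ennreal_neg)
  qed
  also have "\<dots> \<le> ennreal c + (\<integral>\<^sup>+\<omega>. limsup (\<lambda>n. ennreal (total_paid n \<omega>)) \<partial>M)" using 1 by (rule add_left_mono)
  also have "\<dots> = (\<integral>\<^sup>+\<omega>. ennreal c + limsup (\<lambda>n. ennreal (total_paid n \<omega>)) \<partial>M)"
    by (subst nn_integral_add) (auto simp: emeasure_space_1)
  also have "\<dots> \<le> dividend_value M N Y g delta x D"
    unfolding dividend_value_def
    unfolding c_def
    by (rule nn_integral_mono_AE, use AE_barrier_path in eventually_elim) (rule discounted_ge, erule conjunct1, erule conjunct2)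
  finally show ?thesis .
qed

end

context dividend_barrier
begin

theorem barrier_strategy_value:
  assumes D: "is_barrier_strategy M N Y g b x D" and x: "0 \<le> x"
  shows "dividend_value M N Y g delta x D = ennreal (\<Phi> x)"
proof (rule antisym)
  note adm = barrier_strategy_admissible[OF D x]
  show "dividend_value M N Y g delta x D \<le> ennreal (\<Phi> x)" by (rule dividend_value_le_barrier[OF adm x])
  interpret bs: barrier_surplus M F N Y g lam alpha delta \<psi> b D x m for m
    by unfold_locales (use D adm x in \<open>auto simp: admissible_def elim: eventually_mono\<close>)
  have "(\<lambda>m. exp (- delta * real m)) \<longlonglongrightarrow> 0"
  proof -
    have "(\<lambda>m. exp (- delta) ^ m) \<longlonglongrightarrow> 0" using delta_pos by (intro LIMSEQ_power_zero) simp
    then show ?thesis by (simp add: exp_of_nat_mult[symmetric] mult.commute)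
  qed
  then have "(\<lambda>m. \<Phi> x - exp (- delta * real m) * \<Phi> b) \<longlonglongrightarrow> \<Phi> x - 0 * \<Phi> b"
    by (intro tendsto_diff tendsto_mult tendsto_const)
  then have "(\<lambda>m. ennreal (\<Phi> x - exp (- delta * real m) * \<Phi> b)) \<longlonglongrightarrow> ennreal (\<Phi> x)"
    by (intro tendsto_ennrealI) simp
  then show "ennreal (\<Phi> x) \<le> dividend_value M N Y g delta x D"
    by (rule LIMSEQ_le_const2) (use bs.barrier_value_ge in blast)
qed

end

section \<open>Existence of a barrier strategy\<close>

context dividend_barrier
begin

text \<open>The net premium rate under the barrier. It is discontinuous at \<open>b\<close>, so the
  Picard argument does not apply to it and solutions are built from the free flow.\<close>

definition capped_rate :: "real \<Rightarrow> real" where "capped_rate z = (if z < b then rate z else 0)"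

lemma rate_eq_capped: "z \<le> b \<Longrightarrow> rate z = capped_rate z + g b * indicator {b} z"
  using rate_barrier by (auto simp: capped_rate_def)

text \<open>The free flow \<open>W\<close> is strictly increasing because the rate is positive. Its
  cap \<open>min b W\<close> follows the free flow until \<open>W\<close> reaches \<open>b\<close>
  and rests there, where the capped rate is 0.\<close>

lemma capped_flow:
  assumes y: "y \<le> b"
  obtains Z :: "real \<Rightarrow> real" where "\<forall>t\<ge>0. Z t \<le> b" "\<forall>t\<ge>0. ((\<lambda>s. capped_rate (Z s)) has_integral (Z t - y)) {0..t}"
proof -
  have "\<exists>B. \<forall>s\<in>{0..T}. \<bar>y\<bar> \<le> B" for T :: real by blast
  then obtain W where W: "flow_equation rate (\<lambda>_. y) W" using flow_exists[of "\<lambda>_. y"] by auto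
  note i = flow_equationD(1)[OF W] and W_eq = flow_equationD(2)[OF W]
  have W_cont: "continuous_on {0..t} W" if "0 \<le> t" for t
  proof -
    have "continuous_on {0..t} (\<lambda>u. y + integral {0..u} (\<lambda>s. rate (W s)))"
      by (intro continuous_intros indefinite_integral_continuous_1 i that)
    then show ?thesis by (rule continuous_on_eq) (use W_eq in simp)
  qed
  have W_less: "W s < W t" if st: "0 \<le> s" "s < t" for s t
  proof -
    have t: "0 \<le> t" using st by simp
    have "continuous_on {s..t} (\<lambda>u. rate (W u))"
      by (rule continuous_on_compose2[OF continuous_rate[of UNIV] continuous_on_subset[OF W_cont[OF t]]]) (use st in auto)
    then obtain r where r: "r \<in> {s..t}" "\<And>u. u \<in> {s..t} \<Longrightarrow> rate (W r) \<le> rate (W u)"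
      using continuous_attains_inf[of "{s..t}" "\<lambda>u. rate (W u)"] st by auto
    have "rate (W r) * (t - s) \<le> integral {s..t} (\<lambda>u. rate (W u))"
    proof (rule has_integral_le)
      show "((\<lambda>_. rate (W r)) has_integral rate (W r) * (t - s)) {s..t}"
        using has_integral_const_real[of "rate (W r)" s t] st by (simp add: mult.commute)
      show "((\<lambda>u. rate (W u)) has_integral integral {s..t} (\<lambda>u. rate (W u))) {s..t}"
        by (rule integrable_integral, rule integrable_on_interval_mono[OF i[OF t] st(1)]) simp
    qed (rule r(2))
    moreover have "0 < rate (W r) * (t - s)" using rate_pos[of "W r"] st by simp
    moreover have "integral {s..t} (\<lambda>u. rate (W u)) = W t - W s"
      using integral_diff_interval[OF i[OF t] st(1)] st W_eq[OF st(1)] W_eq[OF t] by simp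
    ultimately show ?thesis by simp
  qed
  define Z where "Z t = min b (W t)" for t
  have low: "((\<lambda>s. capped_rate (Z s)) has_integral (W t - y)) {0..t}" if t: "0 \<le> t" "W t \<le> b" for t
  proof (rule has_integral_spike_finite)
    show "finite {t}" by simp
    show "((\<lambda>s. rate (W s)) has_integral (W t - y)) {0..t}"
      using integrable_integral[OF i[OF t(1)]] W_eq[OF t(1)] by simp
    fix s assume "s \<in> {0..t} - {t}"
    then have "W s < b" using W_less[of s t] t(2) by simp
    then show "capped_rate (Z s) = rate (W s)" by (simp add: capped_rate_def Z_def min_def)
  qed
  show thesis
  proof (rule that[of Z]; intro allI impI)
    fix t :: real assume t: "0 \<le> t"
    show "((\<lambda>s. capped_rate (Z s)) has_integral (Z t - y)) {0..t}"
    proof (cases "W t \<le> b")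
      case True
      then have "Z t = W t" by (simp add: Z_def)
      then show ?thesis using low[OF t True] by simp
    next
      case False
      have "W 0 = y" using W_eq[of 0] by simp
      then obtain \<sigma> where \<sigma>: "0 \<le> \<sigma>" "\<sigma> \<le> t" "W \<sigma> = b"
        using IVT'[of W 0 b t] y False t W_cont[OF t] by auto
      have "((\<lambda>s. capped_rate (Z s)) has_integral 0) {\<sigma>..t}"
      proof (rule has_integral_is_0)
        fix s assume "s \<in> {\<sigma>..t}"
        then have "b \<le> W s" using W_less[of \<sigma> s] \<sigma> by (cases "s = \<sigma>") auto
        then show "capped_rate (Z s) = 0" by (simp add: capped_rate_def Z_def)
      qed
      from has_integral_combine[OF \<sigma>(1,2) low[OF \<sigma>(1)] this] \<sigma>(3)
      have "((\<lambda>s. capped_rate (Z s)) has_integral (b - y)) {0..t}" by simp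
      moreover have "Z t = b" using False by (simp add: Z_def)
      ultimately show ?thesis by simp
    qed
  qed (simp add: Z_def)
qed

text \<open>Induction over the claims: \<open>P k\<close> is the equation in which only the first
  \<open>k\<close> claims are deducted, and \<open>Q\<close> says that the next stage leaves the
  path unchanged while at most \<open>k\<close> claims have occurred. At time \<open>t\<close> the
  stages from \<open>N t \<omega>\<close> on agree, so the path is read off along the
  diagonal.\<close>

lemma capped_path:
  assumes good: "good_path \<omega>"
  obtains X :: "real \<Rightarrow> real" where "\<forall>t\<ge>0. X t \<le> b"
    "\<forall>t\<ge>0. ((\<lambda>s. capped_rate (X s)) has_integral (X t - min x b + C t \<omega>)) {0..t}"
proof -
  define P where "P k X \<longleftrightarrow> (\<forall>t\<ge>0. X t \<le> b \<and>
    ((\<lambda>s. capped_rate (X s)) has_integral (X t - min x b + (\<Sum>i<min (N t \<omega>) k. Y i \<omega>))) {0..t})" for k and X :: "real \<Rightarrow> real"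
  define Q where "Q k X X' \<longleftrightarrow> (\<forall>t\<ge>0. N t \<omega> \<le> k \<longrightarrow> X' t = X t)" for k and X X' :: "real \<Rightarrow> real"
  have "\<exists>X. P 0 X"
  proof -
    obtain Z :: "real \<Rightarrow> real" where "\<forall>t\<ge>0. Z t \<le> b" "\<forall>t\<ge>0. ((\<lambda>s. capped_rate (Z s)) has_integral (Z t - min x b)) {0..t}"
      using capped_flow[OF min.cobounded2[of x b]] .
    then have "P 0 Z" by (simp add: P_def)
    then show ?thesis by blast
  qed
  moreover have "\<exists>X'. P (Suc k) X' \<and> Q k X X'" if P: "P k X" for k X
  proof (cases "\<forall>t\<ge>0. N t \<omega> \<le> k")
    case True
    then have "P (Suc k) X" using P unfolding P_def by (auto simp: min_absorb1 le_SucI)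
    then show ?thesis by (intro exI[of _ X]) (simp add: Q_def)
  next
    case False
    let ?S = "{t. 0 \<le> t \<and> k < N t \<omega>}"
    \<comment> \<open>The time of the claim following the first \<open>k\<close>. If several claims
      fall on it, the next stage simply restarts at the same time.\<close>
    define T where "T = Inf ?S"
    have ne: "?S \<noteq> {}" using False by (force simp: not_le[symmetric])
    have bdd: "bdd_below ?S" by (rule bdd_belowI[of _ 0]) simp
    have T0: "0 \<le> T" unfolding T_def by (rule cInf_greatest[OF ne]) simp
    have before: "N t \<omega> \<le> k" if t: "0 \<le> t" "t < T" for t
    proof (rule ccontr)
      assume "\<not> N t \<omega> \<le> k"
      then have "T \<le> t" unfolding T_def using t by (intro cInf_lower bdd) auto
      then show False using t by simp
    qed
    have "k < N T \<omega>"
    proof -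
      obtain \<eta> where \<eta>: "0 < \<eta>" "\<And>s. T \<le> s \<Longrightarrow> s < T + \<eta> \<Longrightarrow> N s \<omega> = N T \<omega>"
        using good_path_right_const[OF good T0] by blast
      have "Inf ?S < T + \<eta>" using \<eta>(1) by (simp add: T_def)
      then obtain s where s: "s \<in> ?S" "s < T + \<eta>" using cInf_lessD[OF ne] by blast
      have "T \<le> s" unfolding T_def by (rule cInf_lower[OF s(1) bdd])
      then show ?thesis using \<eta>(2)[of s] s by simp
    qed
    then have after: "k < N t \<omega>" if "T \<le> t" for t using good_path_N_mono[OF good T0 that] by simp
    \<comment> \<open>At stage \<open>k\<close> the claim at \<open>T\<close> has not been deducted
      yet; since sizes are numbered from 0, it is \<open>Y k\<close>.\<close>
    define y where "y = X T - Y k \<omega>"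
    have y: "y \<le> b"
    proof -
      have "X T \<le> b" using P T0 by (simp add: P_def)
      moreover have "0 < Y k \<omega>" using good by (simp add: good_path_def)
      ultimately show ?thesis by (simp add: y_def)
    qed
    obtain Z :: "real \<Rightarrow> real" where "\<forall>t\<ge>0. Z t \<le> b" "\<forall>t\<ge>0. ((\<lambda>s. capped_rate (Z s)) has_integral (Z t - y)) {0..t}"
      using capped_flow[OF y] .
    then have Z: "\<And>t. 0 \<le> t \<Longrightarrow> Z t \<le> b" "\<And>t. 0 \<le> t \<Longrightarrow> ((\<lambda>s. capped_rate (Z s)) has_integral (Z t - y)) {0..t}" by auto
    define X' where "X' t = (if t < T then X t else Z (t - T))" for t
    have int: "((\<lambda>s. capped_rate (X' s)) has_integral (X t - min x b + (\<Sum>i<min (N t \<omega>) k. Y i \<omega>))) {0..t}" if t: "0 \<le> t" "t \<le> T" for t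
    proof (rule has_integral_spike_finite)
      show "finite {t}" by simp
      show "((\<lambda>s. capped_rate (X s)) has_integral (X t - min x b + (\<Sum>i<min (N t \<omega>) k. Y i \<omega>))) {0..t}"
        using P t(1) by (simp add: P_def)
      show "capped_rate (X' s) = capped_rate (X s)" if "s \<in> {0..t} - {t}" for s
        using that t(2) by (simp add: X'_def)
    qed
    have "P (Suc k) X'"
      unfolding P_def
    proof (intro allI impI conjI)
      fix t :: real assume t: "0 \<le> t"
      show "X' t \<le> b" using P t Z(1)[of "t - T"] by (auto simp: X'_def P_def)
      show "((\<lambda>s. capped_rate (X' s)) has_integral (X' t - min x b + (\<Sum>i<min (N t \<omega>) (Suc k). Y i \<omega>))) {0..t}"
      proof (cases "t < T")
        case True
        then show ?thesis using int[OF t] before[OF t True] by (simp add: X'_def min_absorb1 le_SucI)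
      next
        case False
        then have Tt: "T \<le> t" by simp
        have "(((\<lambda>s. capped_rate (Z s)) \<circ> (+) (- T)) has_integral (Z (t - T) - y)) {T..t}"
          unfolding has_integral_shift_Icc_real using Z(2)[of "t - T"] Tt by simp
        then have "((\<lambda>s. capped_rate (X' s)) has_integral (Z (t - T) - y)) {T..t}"
          by (rule has_integral_eq[rotated]) (simp add: X'_def)
        from has_integral_combine[OF T0 Tt int[OF T0 order_refl] this]
        show ?thesis using Tt after[OF Tt] after[OF order_refl] by (simp add: X'_def y_def min_absorb2 algebra_simps)
      qed
    qed
    moreover have "Q k X X'"
      unfolding Q_def
    proof (intro allI impI)
      fix t :: real assume "0 \<le> t" "N t \<omega> \<le> k"
      then have "t < T" using after[of t] by (cases "t < T") auto
      then show "X' t = X t" by (simp add: X'_def)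
    qed
    ultimately show ?thesis by blast
  qed
  ultimately obtain X where X: "\<And>k. P k (X k)" "\<And>k. Q k (X k) (X (Suc k))"
    using dependent_nat_choice[of P Q] by metis
  have stable: "X k t = X (N t \<omega>) t" if "0 \<le> t" "N t \<omega> \<le> k" for k t
    using that(2)
  proof (induction k rule: dec_induct)
    case (step k)
    then show ?case using X(2)[of k] that(1) by (simp add: Q_def)
  qed simp
  show thesis
  proof (rule that[of "\<lambda>t. X (N t \<omega>) t"]; intro allI impI)
    fix t :: real assume t: "0 \<le> t"
    show "X (N t \<omega>) t \<le> b" using X(1)[of "N t \<omega>"] t by (simp add: P_def)
    have "((\<lambda>s. capped_rate (X (N t \<omega>) s)) has_integral (X (N t \<omega>) t - min x b + C t \<omega>)) {0..t}"
      using X(1)[of "N t \<omega>", unfolded P_def, rule_format, OF t] by (simp add: claims_def)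
    then show "((\<lambda>s. capped_rate (X (N s \<omega>) s)) has_integral (X (N t \<omega>) t - min x b + C t \<omega>)) {0..t}"
    proof (rule has_integral_eq[rotated])
      fix s assume "s \<in> {0..t}"
      then show "capped_rate (X (N t \<omega>) s) = capped_rate (X (N s \<omega>) s)"
        using stable[of s "N t \<omega>"] good_path_N_mono[OF good, of s t] by simp
    qed
  qed
qed

text \<open>The capped path becomes a surplus path once \<open>g b\<close> is paid while it rests at
  \<open>b\<close>, which completes the capped rate to the full premium rate, and the initial excess
  over \<open>b\<close> is paid at time 0. Uniqueness of flows identifies it with
  \<open>surplus\<close>.\<close>

lemma barrier_path_exists:
  assumes good: "good_path \<omega>" and x: "0 \<le> x"
  shows "\<exists>d. barrier_path (\<lambda>t _. d t) x \<omega>"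
proof -
  obtain X :: "real \<Rightarrow> real" where "\<forall>t\<ge>0. X t \<le> b"
    "\<forall>t\<ge>0. ((\<lambda>s. capped_rate (X s)) has_integral (X t - min x b + C t \<omega>)) {0..t}"
    using capped_path[OF good, of x] .
  then have X_le: "\<And>t. 0 \<le> t \<Longrightarrow> X t \<le> b"
    and X_int: "\<And>t. 0 \<le> t \<Longrightarrow> ((\<lambda>s. capped_rate (X s)) has_integral (X t - min x b + C t \<omega>)) {0..t}" by auto
  define J where "J t = integral {0..max 0 t} (\<lambda>s. capped_rate (X s))" for t
  have X_eq: "X t = min x b - C t \<omega> + J t" if "0 \<le> t" for t
    using integral_unique[OF X_int[OF that]] that by (simp add: J_def)
  have J_cont: "continuous_on UNIV J"
  proof -
    have "continuous_on {0..} (\<lambda>u. integral {0..u} (\<lambda>s. capped_rate (X s)))"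
      by (rule continuous_on_halfline, rule indefinite_integral_continuous_1, rule has_integral_integrable[OF X_int])
    then show ?thesis unfolding J_def by (rule continuous_on_compose2) (auto intro!: continuous_intros)
  qed
  have X_meas: "(\<lambda>s. X (max 0 s)) \<in> borel_measurable borel"
  proof -
    have "mono (\<lambda>s. C (max 0 s) \<omega>)"
      using good_path_claims(2)[OF good] by (auto simp: mono_def monotone_on_def)
    then have "(\<lambda>s. C (max 0 s) \<omega>) \<in> borel_measurable borel" by (rule borel_measurable_mono)
    moreover have "J \<in> borel_measurable borel" by (rule borel_measurable_continuous_onI[OF J_cont])
    moreover have "(\<lambda>s. X (max 0 s)) = (\<lambda>s. min x b - C (max 0 s) \<omega> + J s)"
      using X_eq by (intro ext) (simp add: J_def)
    ultimately show ?thesis by simp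
  qed
  define p where "p s = g b * indicator {s. X (max 0 s) = b} s" for s
  have p_bd: "0 \<le> p s" "\<bar>p s\<bar> \<le> g b" for s
    using g_pos[of b] b_pos by (auto simp: p_def indicator_def)
  have p_meas: "p \<in> borel_measurable borel"
  proof -
    have "{s. X (max 0 s) = b} \<in> sets borel" using measurable_sets[OF X_meas, of "{b}"] by (simp add: vimage_def)
    then show ?thesis unfolding p_def by (intro borel_measurable_times borel_measurable_const borel_measurable_indicator)
  qed
  have p_int: "p integrable_on {s..t}" for s t
    by (rule bounded_measurable_integrable_on[OF p_meas p_bd(2)])
  define I where "I t = integral {0..max 0 t} p" for t
  have I_cont: "continuous_on UNIV I"
  proof -
    have "continuous_on {0..} (\<lambda>u. integral {0..u} p)"
      by (rule continuous_on_halfline, rule indefinite_integral_continuous_1, rule p_int)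
    then show ?thesis unfolding I_def by (rule continuous_on_compose2) (auto intro!: continuous_intros)
  qed
  have I_mono: "I s \<le> I t" if "s \<le> t" for s t
    unfolding I_def by (rule integral_subset_le) (use that p_int p_bd in auto)
  have I0: "I 0 = 0" by (simp add: I_def)
  define c where "c = max 0 (x - b)"
  define d where "d t = (if t < 0 then 0 else c + I t)" for t
  have I_lim: "(I \<longlongrightarrow> I t) (at t within S)" for t S
    by (rule tendsto_within_subset[OF _ subset_UNIV]) (use I_cont in \<open>simp add: continuous_on_def\<close>)
  have J_lim: "(J \<longlongrightarrow> J t) (at t within S)" for t S
    by (rule tendsto_within_subset[OF _ subset_UNIV]) (use J_cont in \<open>simp add: continuous_on_def\<close>)
  have d_left: "(d \<longlongrightarrow> (if t \<le> 0 then 0 else c + I t)) (at_left t)" for t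
  proof (cases "t \<le> 0")
    case True
    have "\<forall>\<^sub>F u in at_left t. u < t" by (simp add: eventually_at_filter)
    then have "\<forall>\<^sub>F u in at_left t. d u = 0" by (rule eventually_mono) (use True in \<open>simp add: d_def\<close>)
    then show ?thesis using True by (simp add: tendsto_eventually)
  next
    case False
    then have "\<forall>\<^sub>F u in at_left t. 0 < u \<and> u < t" by (intro eventually_mono[OF eventually_at_left_real[of 0 t]]) auto
    then have "\<forall>\<^sub>F u in at_left t. c + I u = d u" by (rule eventually_mono) (simp add: d_def)
    then have "(d \<longlongrightarrow> c + I t) (at_left t)"
      by (rule Lim_transform_eventually[rotated]) (intro tendsto_intros I_lim)
    then show ?thesis using False by simp
  qed
  have d_right: "(d \<longlongrightarrow> d t) (at_right t)" for t
  proof (cases "t < 0")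
    case True
    then have "\<forall>\<^sub>F u in at_right t. d u = 0"
      by (intro eventually_mono[OF eventually_at_right_real[of t 0]]) (auto simp: d_def)
    then show ?thesis using True by (simp add: d_def tendsto_eventually)
  next
    case False
    have "\<forall>\<^sub>F u in at_right t. t < u" by (simp add: eventually_at_filter)
    then have "\<forall>\<^sub>F u in at_right t. c + I u = d u" by (rule eventually_mono) (use False in \<open>simp add: d_def\<close>)
    then have "(d \<longlongrightarrow> c + I t) (at_right t)"
      by (rule Lim_transform_eventually[rotated]) (intro tendsto_intros I_lim)
    then show ?thesis using False by (simp add: d_def)
  qed
  have c0: "0 \<le> c" by (simp add: c_def)
  have "mono d"
  proof (rule monoI)
    fix s t :: real assume st: "s \<le> t"
    have "0 \<le> I t" if "0 \<le> t" using I_mono[OF that] I0 by simp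
    then show "d s \<le> d t" using I_mono[OF st] c0 st by (auto simp: d_def)
  qed
  moreover have "cadlag d"
    unfolding cadlag_def continuous_within using d_left d_right by blast
  ultimately have control: "control_path d" by (simp add: control_path_def d_def)
  define X' where "X' t = (if t < 0 then x else X (max 0 t))" for t
  have "is_surplus_path g x (\<lambda>t. C t \<omega>) d X'"
    unfolding is_surplus_path_def
  proof (intro conjI allI impI)
    fix t :: real assume t: "0 \<le> t"
    have "X' \<in> borel_measurable borel" unfolding X'_def by (intro measurable_If X_meas) measurable
    then have m: "(\<lambda>s. rate (X' s)) \<in> borel_measurable borel" by measurable
    have "\<bar>rate (X' s)\<bar> \<le> rate 0 + rate_lip * b" if "s \<in> {0..t}" for s
    proof -
      have "rate (X' s) \<le> rate 0 + rate_lip * max 0 (X s)" using rate_linear[of "X s"] that by (simp add: X'_def)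
      moreover have "rate_lip * max 0 (X s) \<le> rate_lip * b"
        using X_le[of s] that b_pos rate_lipschitz(1) by (intro mult_left_mono) auto
      ultimately show ?thesis using rate_pos[of "X' s"] by simp
    qed
    with m have si: "set_integrable lborel {0..t} (\<lambda>s. rate (X' s))" by (rule bounded_measurable_set_integrable)
    then show "set_integrable lborel {0..t} (\<lambda>s. g (max 0 (X' s)))" by (simp add: rate_def)
    have "((\<lambda>s. capped_rate (X s) + p s) has_integral (X t - min x b + C t \<omega> + I t)) {0..t}"
      using has_integral_add[OF X_int[OF t] integrable_integral[OF p_int]] t by (simp add: I_def)
    then have "((\<lambda>s. rate (X' s)) has_integral (X t - min x b + C t \<omega> + I t)) {0..t}"
    proof (rule has_integral_eq[rotated])
      fix s assume "s \<in> {0..t}"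
      then show "capped_rate (X s) + p s = rate (X' s)"
        using rate_eq_capped[OF X_le[of s]] by (simp add: p_def X'_def indicator_def)
    qed
    then have "(LBINT s:{0..t}. rate (X' s)) = X t - min x b + C t \<omega> + I t"
      using set_borel_integral_eq_integral(2)[OF si] by (simp add: integral_unique)
    then show "X' t = x + (LBINT s:{0..t}. g (max 0 (X' s))) - C t \<omega> - d t"
      using t by (simp add: rate_def X'_def d_def c_def min_def max_def)
  qed (simp add: X'_def)
  note X' = is_surplus_pathD[OF this]
  define D where "D = (\<lambda>t (_::'a). d t)"
  have "control_path (\<lambda>t. D t \<omega>)" using control by (simp add: D_def)
  note S = controlled_path[where D=D, OF good this x]
  have X'_eq: "surplus g N Y x D \<omega> = X'"
  proof
    fix t show "surplus g N Y x D \<omega> t = X' t"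
    proof (cases "t < 0")
      case True
      then show ?thesis using S(5) X'(2) by simp
    next
      case False
      then show ?thesis
        using flow_unique[OF S(1), of X' t] X'(1) by (simp add: rate_eq D_def)
    qed
  qed
  have jump_pos: "jump d t = 0" if "0 < t" for t
    using left_limit_eqI[OF d_left[of t]] that by (simp add: jump_def d_def)
  have jump_0: "jump d 0 = c"
    using left_limit_eqI[OF d_left[of 0]] I0 by (simp add: jump_def d_def)
  have "barrier_path D x \<omega>"
    unfolding barrier_path_def Let_def X'_eq
  proof (intro conjI allI impI)
    show "control_path (\<lambda>t. D t \<omega>)" by fact
    fix t :: real assume t: "0 \<le> t"
    have d_eq: "(\<lambda>t. D t \<omega>) = d" by (simp add: D_def)
    show "jump (\<lambda>t. D t \<omega>) t = (if b < left_limit X' t then left_limit X' t - b else 0)"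
    proof (cases "t = 0")
      case True
      have "\<forall>\<^sub>F u in at_left (0::real). u < 0" by (simp add: eventually_at_filter)
      then have "\<forall>\<^sub>F u in at_left 0. X' u = x" by (rule eventually_mono) (simp add: X'_def)
      then have "left_limit X' 0 = x" by (intro left_limit_eqI tendsto_eventually)
      then show ?thesis using True jump_0 unfolding d_eq by (simp add: c_def)
    next
      case False
      then have t0: "0 < t" using t by simp
      obtain s where s: "0 \<le> s" "s < t" "\<And>u. s \<le> u \<Longrightarrow> u < t \<Longrightarrow> N u \<omega> = N s \<omega>"
        using good_path_left_const[OF good t0] by blast
      have ev: "\<forall>\<^sub>F u in at_left t. s < u \<and> u < t"
        by (rule eventually_mono[OF eventually_at_left_real[OF s(2)]]) simp
      have "\<forall>\<^sub>F u in at_left t. min x b - C s \<omega> + J u = X' u"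
      proof (rule eventually_mono[OF ev])
        fix u assume u: "s < u \<and> u < t"
        then have "C u \<omega> = C s \<omega>" using s(3)[of u] by (simp add: claims_def)
        then show "min x b - C s \<omega> + J u = X' u" using u s(1) X_eq[of u] by (simp add: X'_def)
      qed
      then have lim: "(X' \<longlongrightarrow> min x b - C s \<omega> + J t) (at_left t)"
        by (rule Lim_transform_eventually[rotated]) (intro tendsto_intros J_lim)
      have "\<forall>\<^sub>F u in at_left t. X' u \<le> b"
        by (rule eventually_mono[OF ev]) (use s(1) X_le in \<open>simp add: X'_def\<close>)
      then have "min x b - C s \<omega> + J t \<le> b" by (rule tendsto_upperbound[OF lim]) simp
      then show ?thesis using jump_pos[OF t0] left_limit_eqI[OF lim] unfolding d_eq by simp
    qed
    have "(LBINT s:{0..t}. g b * indicator {s. X' s = b} s) = (LBINT s:{0..t}. p s)"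
      by (rule set_lebesgue_integral_cong) (auto simp: p_def X'_def indicator_def)
    also have "\<dots> = I t"
      using set_borel_integral_eq_integral(2)[OF bounded_measurable_set_integrable[OF p_meas p_bd(2)], of 0 t] t by (simp add: I_def)
    finally have diff: "D t \<omega> - (LBINT s:{0..t}. g b * indicator {s. X' s = b} s) = c"
      using t by (simp add: D_def d_def)
    have "(jump d has_sum c) {0}" using has_sum_finite[of "{0}" "jump d"] jump_0 by simp
    moreover have "(jump d has_sum c) {0} \<longleftrightarrow> (jump d has_sum c) {0..t}"
      by (rule has_sum_cong_neutral) (use jump_pos t in auto)
    ultimately show "(jump (\<lambda>t. D t \<omega>) has_sum D t \<omega> - (LBINT s:{0..t}. g b * indicator {s. X' s = b} s)) {0..t}"
      unfolding diff d_eq by simp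
  qed
  then show ?thesis unfolding D_def by blast
qed

theorem barrier_strategy_exists:
  assumes "0 \<le> x"
  shows "\<exists>D. is_barrier_strategy M N Y g b x D"
proof -
  \<comment> \<open>The dividends are chosen path by path; adaptedness is supplied afterwards by
    \<open>barrier_strategy_adapted\<close>.\<close>
  have "\<forall>\<omega>. \<exists>d. good_path \<omega> \<longrightarrow> barrier_path (\<lambda>t _. d t) x \<omega>"
    using barrier_path_exists[OF _ assms] by blast
  then obtain d where d: "\<And>\<omega>. good_path \<omega> \<Longrightarrow> barrier_path (\<lambda>t _. d \<omega> t) x \<omega>" by metis
  have "barrier_path (\<lambda>t \<omega>. d \<omega> t) x \<omega>" if "good_path \<omega>" for \<omega>
    using d[OF that] by (simp add: barrier_path_def surplus_def)
  then have "AE \<omega> in M. barrier_path (\<lambda>t \<omega>. d \<omega> t) x \<omega>"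
    using AE_good_path by (rule eventually_mono[rotated])
  then show ?thesis by (auto simp: is_barrier_strategy_iff)
qed

end

theorem theorem3p6:
  fixes M :: "'a measure" and F :: "real \<Rightarrow> 'a measure"
    and N :: "real \<Rightarrow> 'a \<Rightarrow> nat" and Y :: "nat \<Rightarrow> 'a \<Rightarrow> real"
    and g \<psi>\<^sub>1 :: "real \<Rightarrow> real" and lam alpha delta b :: real
  assumes model: "dividend_model M F N Y g lam alpha"
    and delta: "delta > 0"
    and finite_value: "\<And>x. x \<ge> 0 \<Longrightarrow> optimal_value M F N Y g delta x < \<infinity>"
    and psi_solution: "ide_solution g lam alpha delta \<psi>\<^sub>1"
    and psi_pos: "\<And>x. x \<ge> 0 \<Longrightarrow> \<psi>\<^sub>1 x > 0"
    and psi_mono: "strict_mono_on {0..} \<psi>\<^sub>1"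
    and b: "b > 0"
    and b_min: "\<And>x. x \<ge> 0 \<Longrightarrow> hderiv \<psi>\<^sub>1 b \<le> hderiv \<psi>\<^sub>1 x"
    and psi'_mono: "mono_on {b<..} (hderiv \<psi>\<^sub>1)"
  shows "qvi_solution g lam alpha delta (barrier_function \<psi>\<^sub>1 b) \<and>
    (\<forall>x\<ge>0.
      (\<exists>D. is_barrier_strategy M N Y g b x D) \<and>
      (\<forall>D. is_barrier_strategy M N Y g b x D \<longrightarrow>
         D \<in> admissible M F N Y g x \<and>
         optimal_value M F N Y g delta x = ennreal (barrier_function \<psi>\<^sub>1 b x) \<and>
         dividend_value M N Y g delta x D = ennreal (barrier_function \<psi>\<^sub>1 b x)))"
proof -
  interpret dividend_barrier M F N Y g lam alpha delta \<psi>\<^sub>1 b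
    by (intro dividend_barrier.intro dividend_barrier_axioms.intro)
       (rule model delta b psi_solution psi_pos psi_mono b_min psi'_mono; assumption)+
  \<comment> \<open>The upper bound holds for every admissible control, and a barrier strategy
    exists and attains it, which identifies the supremum.\<close>
  have "optimal_value M F N Y g delta x = ennreal (barrier_function \<psi>\<^sub>1 b x)" if x: "0 \<le> x" for x
  proof (rule antisym)
    show "optimal_value M F N Y g delta x \<le> ennreal (barrier_function \<psi>\<^sub>1 b x)"
      unfolding optimal_value_def by (rule SUP_least, rule dividend_value_le_barrier[OF _ x])
    obtain D where D: "is_barrier_strategy M N Y g b x D" using barrier_strategy_exists[OF x] by blast
    show "ennreal (barrier_function \<psi>\<^sub>1 b x) \<le> optimal_value M F N Y g delta x"
      unfolding optimal_value_def barrier_strategy_value[OF D x, symmetric]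
      by (rule SUP_upper, rule barrier_strategy_admissible[OF D x])
  qed
  then show ?thesis
    using barrier_qvi barrier_strategy_exists barrier_strategy_admissible barrier_strategy_value by blast
qed

end
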